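(* Let $k$ be an algebraically closed field, let $\Lambda=kQ/I$ be a representation-finite finite-dimensional basic $k$-algebra, let $i\in Q_0$ be a source point, and let $\Gamma=\Lambda[S_i]$ be the corresponding source point extension. Then there is a bijection $$\mathrm{PWT}(\Gamma)\longleftrightarrow \mathrm{PWT}(\Lambda)\coprod \mathrm{RPWT}(\Lambda,S_i).$$ Consequently, $$|\mathrm{PWT}(\Gamma)|=|\mathrm{PWT}(\Lambda)|+|\mathrm{RPWT}(\Lambda,S_i)|=|\mathrm{PWT}(\Lambda)|+|\mathrm{PWT}(\Lambda,S_i)|.$$
   Context: For a finite-dimensional $k$-algebra $A$, $\operatorname{mod}A$ is the category of finitely generated right $A$-modules, and $\operatorname{add}T$ is the full subcategory of direct summands of finite direct sums of copies of $T$. $A$ is representation-finite if there are only finitely many isomorphism classes of indecomposable modules in $\operatorname{mod}A$. A module is basic if its indecomposable direct summands in a decomposition are pairwise non-isomorphic. For $T\in\operatorname{mod}A$, $T^{\perp_A}=\{X\in\operatorname{mod}A \mid \operatorname{Ext}^i_A(T,X)=0 \text{ for all } i>0\}$. $T$ is self-orthogonal if $\operatorname{Ext}^i_A(T,T)=0$ for all $i>0$. Let $\mathcal{C}$ be a full subcategory of $\operatorname{mod}A$ closed under extensions and direct summands. An object $P\in\mathcal{C}$ is Ext-projective in $\mathcal{C}$ if $\operatorname{Ext}^1_A(P,C)=0$ for all $C\in\mathcal{C}$. $P$ is an Ext-progenerator of $\mathcal{C}$ if it is Ext-projective in $\mathcal{C}$ and for every $X\in\mathcal{C}$ there is a short exact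 sequence $0\to K\to P_0\to X\to 0$ in $\operatorname{mod}A$ with $P_0\in\operatorname{add}P$ and $K\in\mathcal{C}$. A self-orthogonal module $T$ is projectively Wakamatsu tilting (PWT) if $T$ is an Ext-progenerator of $T^{\perp_A}$. $\mathrm{PWT}(A)$ is the set of isomorphism classes of basic PWT $A$-modules. $\mathrm{PWT}(\Lambda,S_i)$ is the subset of $\mathrm{PWT}(\Lambda)$ consisting of those modules having $S_i$ as a direct summand, and $\mathrm{RPWT}(\Lambda,S_i)$ is the set of (isomorphism classes of) basic modules obtained by removing the direct summand $S_i$ from the modules in $\mathrm{PWT}(\Lambda,S_i)$. For a set, $|\cdot|$ denotes cardinality; $\coprod$ is disjoint union. Source point extension: for $\Lambda=kQ/I$ ($Q$ a finite quiver, $I$ an admissible ideal, paths composed from left to right, so that right modules are representations of $Q$ satisfying the relations), a vertex $i$ is a source point if no arrow of $Q$ ends at $i$; equivalently the simple module $S_i$ at $i$ is an injective $\Lambda$-module. The source point extension at $i$ is the one-point extension $\Gamma=\Lambda[S_i]$. Here, for $M\in\operatorname{mod}\Lambda$, $\Lambda[M]$ is the triangular matrix algebra $\begin{pmatrix}\Lambda & 0\\ M & k\end{pmatrix}$ ($M$ regarded as a $k$-$\Lambda$-bimodule), whose right modules are identified with triples $(X,V,\phi)$ with $X\in\operatorname{mod}\Lambda$, $V$ a finite-dimensional $k$-vector space and $\phi\colon V\otimes_k M\to X$ a $\Lambda$-homomorphism. *)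

theory Defs
  imports
    "HOL-Algebra.Module"
    "HOL-Algebra.QuotRing"
    "HOL-Algebra.Elementary_Groups"
    "HOL-Computational_Algebra.Polynomial"
    "Graph_Theory.Arc_Walk"
begin

(* otherwise they shadow the record fields of the same names *)
hide_const (open) Multiset.mult Polynomial.smult

section \<open>Right modules\<close>

text \<open>
  A \<open>k\<close>-algebra is a record of type \<open>('k, 'a) module\<close>: a (not necessarily commutative) ring
  together with scalar multiplication. A right module over it is a record of type
  \<open>('a, 'm) module\<close>, where \<open>a \<odot>\<^bsub>M\<^esub> x\<close> denotes the product of \<open>x\<close> with \<open>a\<close> on the right;
  hence the order of the factors in \<open>ract_assoc\<close>. The fields \<open>mult\<close> and \<open>one\<close> of such a module
  record have no meaning. The \<open>k\<close>-space structure of a module is the one induced by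
  \<open>c \<mapsto> c \<odot> \<one>\<close>, so it is not recorded separately.
\<close>

locale right_module = R?: ring R + M?: abelian_group M
  for R :: "('a, 'r) ring_scheme" (structure) and M :: "('a, 'm) module" (structure) +
  assumes ract_closed:
      "\<lbrakk>a \<in> carrier R; x \<in> carrier M\<rbrakk> \<Longrightarrow> a \<odot>\<^bsub>M\<^esub> x \<in> carrier M"
    and ract_add_ring:
      "\<lbrakk>a \<in> carrier R; b \<in> carrier R; x \<in> carrier M\<rbrakk> \<Longrightarrow>
        (a \<oplus>\<^bsub>R\<^esub> b) \<odot>\<^bsub>M\<^esub> x = a \<odot>\<^bsub>M\<^esub> x \<oplus>\<^bsub>M\<^esub> b \<odot>\<^bsub>M\<^esub> x"
    and ract_add_module:
      "\<lbrakk>a \<in> carrier R; x \<in> carrier M; y \<in> carrier M\<rbrakk> \<Longrightarrow>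
        a \<odot>\<^bsub>M\<^esub> (x \<oplus>\<^bsub>M\<^esub> y) = a \<odot>\<^bsub>M\<^esub> x \<oplus>\<^bsub>M\<^esub> a \<odot>\<^bsub>M\<^esub> y"
    and ract_assoc:
      "\<lbrakk>a \<in> carrier R; b \<in> carrier R; x \<in> carrier M\<rbrakk> \<Longrightarrow>
        (a \<otimes>\<^bsub>R\<^esub> b) \<odot>\<^bsub>M\<^esub> x = b \<odot>\<^bsub>M\<^esub> (a \<odot>\<^bsub>M\<^esub> x)"
    and ract_one:
      "x \<in> carrier M \<Longrightarrow> \<one>\<^bsub>R\<^esub> \<odot>\<^bsub>M\<^esub> x = x"

definition finitely_generated :: "('a, 'r) ring_scheme \<Rightarrow> ('a, 'm) module \<Rightarrow> bool" where
  "finitely_generated R M \<longleftrightarrow>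
    (\<exists>S. finite S \<and> S \<subseteq> carrier M \<and> (\<forall>H. submodule H R M \<and> S \<subseteq> H \<longrightarrow> H = carrier M))"

text \<open>
  The objects of \<open>mod A\<close>. Since \<open>A\<close> is finite-dimensional over \<open>k\<close>, every finitely generated module
  is finite-dimensional over \<open>k\<close> and hence isomorphic to one whose underlying set is a subset of
  \<open>nat \<Rightarrow> 'k\<close>. Fixing this type of elements thus changes \<open>mod A\<close> only up to equivalence, and
  makes its isomorphism classes form a set.
\<close>

definition fg_modules :: "('k, 'a) module \<Rightarrow> ('a, nat \<Rightarrow> 'k) module set" where
  "fg_modules A = {M. right_module A M \<and> finitely_generated A M}"

text \<open>
  Homomorphisms are extensional (\<open>undefined\<close> outside the carrier), so that equality of functions
  is equality of homomorphisms and the Hom sets are groups.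
\<close>

definition mod_hom ::
    "('a, 'r) ring_scheme \<Rightarrow> ('a, 'm) module \<Rightarrow> ('a, 'n) module \<Rightarrow> ('m \<Rightarrow> 'n) set" where
  "mod_hom R M N = {f \<in> hom (add_monoid M) (add_monoid N) \<inter> extensional (carrier M).
     \<forall>a\<in>carrier R. \<forall>x\<in>carrier M. f (a \<odot>\<^bsub>M\<^esub> x) = a \<odot>\<^bsub>N\<^esub> f x}"

definition mod_iso :: "('a, 'r) ring_scheme \<Rightarrow> ('a, 'm) module \<Rightarrow> ('a, 'n) module \<Rightarrow> bool" where
  "mod_iso R M N \<longleftrightarrow> (\<exists>f \<in> mod_hom R M N. bij_betw f (carrier M) (carrier N))"

definition iso_rel :: "('k, 'a) module \<Rightarrow> ('a, nat \<Rightarrow> 'k) module rel" where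
  "iso_rel A = {(M, N). M \<in> fg_modules A \<and> N \<in> fg_modules A \<and> mod_iso A M N}"

definition direct_sum :: "('a, 'm) module \<Rightarrow> ('a, 'n) module \<Rightarrow> ('a, 'm \<times> 'n) module" where
  "direct_sum M N =
    \<lparr>carrier = carrier M \<times> carrier N,
     mult = (\<lambda>_ _. undefined), one = undefined,
     zero = (\<zero>\<^bsub>M\<^esub>, \<zero>\<^bsub>N\<^esub>),
     add = (\<lambda>(x, y) (x', y'). (x \<oplus>\<^bsub>M\<^esub> x', y \<oplus>\<^bsub>N\<^esub> y')),
     smult = (\<lambda>a (x, y). (a \<odot>\<^bsub>M\<^esub> x, a \<odot>\<^bsub>N\<^esub> y))\<rparr>"

text \<open>Used for finite \<open>J\<close> only.\<close>

definition direct_sum_family :: "'j set \<Rightarrow> ('j \<Rightarrow> ('a, 'm) module) \<Rightarrow> ('a, 'j \<Rightarrow> 'm) module" where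
  "direct_sum_family J M =
    \<lparr>carrier = (\<Pi>\<^sub>E j\<in>J. carrier (M j)),
     mult = (\<lambda>_ _. undefined), one = undefined,
     zero = (\<lambda>j\<in>J. \<zero>\<^bsub>M j\<^esub>),
     add = (\<lambda>x y. \<lambda>j\<in>J. x j \<oplus>\<^bsub>M j\<^esub> y j),
     smult = (\<lambda>a x. \<lambda>j\<in>J. a \<odot>\<^bsub>M j\<^esub> x j)\<rparr>"

definition add_closure ::
    "('k, 'a) module \<Rightarrow> ('a, nat \<Rightarrow> 'k) module \<Rightarrow> ('a, nat \<Rightarrow> 'k) module set" where
  "add_closure A T = {X \<in> fg_modules A.
     \<exists>Y \<in> fg_modules A. \<exists>n. mod_iso A (direct_sum X Y) (direct_sum_family {..<n::nat} (\<lambda>_. T))}"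

definition indecomposable :: "('k, 'a) module \<Rightarrow> ('a, nat \<Rightarrow> 'k) module \<Rightarrow> bool" where
  "indecomposable A M \<longleftrightarrow> M \<in> fg_modules A \<and> carrier M \<noteq> {\<zero>\<^bsub>M\<^esub>} \<and>
     (\<forall>X \<in> fg_modules A. \<forall>Y \<in> fg_modules A. mod_iso A M (direct_sum X Y) \<longrightarrow>
        carrier X = {\<zero>\<^bsub>X\<^esub>} \<or> carrier Y = {\<zero>\<^bsub>Y\<^esub>})"

definition representation_finite :: "('k, 'a) module \<Rightarrow> bool" where
  "representation_finite A \<longleftrightarrow> finite (Collect (indecomposable A) // iso_rel A)"

definition basic_module :: "('k, 'a) module \<Rightarrow> ('a, nat \<Rightarrow> 'k) module \<Rightarrow> bool" where
  "basic_module A M \<longleftrightarrow> M \<in> fg_modules A \<and>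
     (\<exists>(n::nat) X. (\<forall>j<n. indecomposable A (X j)) \<and>
        mod_iso A M (direct_sum_family {..<n} X) \<and>
        (\<forall>j<n. \<forall>l<n. j \<noteq> l \<longrightarrow> \<not> mod_iso A (X j) (X l)))"

section \<open>Ext groups\<close>

definition projective_module :: "('k, 'a) module \<Rightarrow> ('a, nat \<Rightarrow> 'k) module \<Rightarrow> bool" where
  "projective_module A P \<longleftrightarrow> P \<in> fg_modules A \<and>
     (\<forall>M \<in> fg_modules A. \<forall>N \<in> fg_modules A. \<forall>g \<in> mod_hom A M N. \<forall>f \<in> mod_hom A P N.
        g ` carrier M = carrier N \<longrightarrow> (\<exists>h \<in> mod_hom A P M. compose (carrier P) g h = f))"

text \<open>\<open>\<dots> \<rightarrow> P 2 \<rightarrow> P 1 \<rightarrow> P 0 \<rightarrow> M \<rightarrow> 0\<close> with maps \<open>d n : P (n+1) \<rightarrow> P n\<close> and \<open>e : P 0 \<rightarrow> M\<close>.\<close>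

definition projective_resolution ::
    "('k, 'a) module \<Rightarrow> ('a, nat \<Rightarrow> 'k) module \<Rightarrow> (nat \<Rightarrow> ('a, nat \<Rightarrow> 'k) module) \<Rightarrow>
     (nat \<Rightarrow> (nat \<Rightarrow> 'k) \<Rightarrow> nat \<Rightarrow> 'k) \<Rightarrow> ((nat \<Rightarrow> 'k) \<Rightarrow> nat \<Rightarrow> 'k) \<Rightarrow> bool" where
  "projective_resolution A M P d e \<longleftrightarrow>
     (\<forall>n. projective_module A (P n)) \<and>
     e \<in> mod_hom A (P 0) M \<and> e ` carrier (P 0) = carrier M \<and>
     (\<forall>n. d n \<in> mod_hom A (P (Suc n)) (P n)) \<and>
     d 0 ` carrier (P 1) = a_kernel (P 0) M e \<and>
     (\<forall>n. d (Suc n) ` carrier (P (Suc (Suc n))) = a_kernel (P (Suc n)) (P n) (d n))"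

definition hom_group ::
    "('a, 'r) ring_scheme \<Rightarrow> ('a, 'm) module \<Rightarrow> ('a, 'n) module \<Rightarrow> ('m \<Rightarrow> 'n) monoid" where
  "hom_group R M N =
    \<lparr>carrier = mod_hom R M N,
     mult = (\<lambda>f g. \<lambda>x\<in>carrier M. f x \<oplus>\<^bsub>N\<^esub> g x),
     one = (\<lambda>x\<in>carrier M. \<zero>\<^bsub>N\<^esub>)\<rparr>"

definition cocycles ::
    "('k, 'a) module \<Rightarrow> (nat \<Rightarrow> ('a, nat \<Rightarrow> 'k) module) \<Rightarrow> (nat \<Rightarrow> (nat \<Rightarrow> 'k) \<Rightarrow> nat \<Rightarrow> 'k) \<Rightarrow>
     ('a, nat \<Rightarrow> 'k) module \<Rightarrow> nat \<Rightarrow> ((nat \<Rightarrow> 'k) \<Rightarrow> nat \<Rightarrow> 'k) set" where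
  "cocycles A P d N n = {f \<in> mod_hom A (P n) N.
     compose (carrier (P (Suc n))) f (d n) = \<one>\<^bsub>hom_group A (P (Suc n)) N\<^esub>}"

primrec coboundaries ::
    "('k, 'a) module \<Rightarrow> (nat \<Rightarrow> ('a, nat \<Rightarrow> 'k) module) \<Rightarrow> (nat \<Rightarrow> (nat \<Rightarrow> 'k) \<Rightarrow> nat \<Rightarrow> 'k) \<Rightarrow>
     ('a, nat \<Rightarrow> 'k) module \<Rightarrow> nat \<Rightarrow> ((nat \<Rightarrow> 'k) \<Rightarrow> nat \<Rightarrow> 'k) set" where
  "coboundaries A P d N 0 = {\<one>\<^bsub>hom_group A (P 0) N\<^esub>}"
| "coboundaries A P d N (Suc n) =
     (\<lambda>g. compose (carrier (P (Suc n))) g (d n)) ` mod_hom A (P n) N"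

text \<open>
  The cohomology of \<open>Hom(P, N)\<close> in degree \<open>n\<close>, for a chosen projective resolution \<open>P\<close> of \<open>M\<close>;
  resolutions exist because \<open>A\<close> is a finite-dimensional algebra.
\<close>

definition Ext ::
    "('k, 'a) module \<Rightarrow> nat \<Rightarrow> ('a, nat \<Rightarrow> 'k) module \<Rightarrow> ('a, nat \<Rightarrow> 'k) module \<Rightarrow>
     ((nat \<Rightarrow> 'k) \<Rightarrow> nat \<Rightarrow> 'k) set monoid" where
  "Ext A n M N =
    (let (P, d) = (SOME (P, d). \<exists>e. projective_resolution A M P d e)
     in (hom_group A (P n) N)\<lparr>carrier := cocycles A P d N n\<rparr> Mod coboundaries A P d N n)"

section \<open>Projectively Wakamatsu tilting modules\<close>

definition right_perp ::
    "('k, 'a) module \<Rightarrow> ('a, nat \<Rightarrow> 'k) module \<Rightarrow> ('a, nat \<Rightarrow> 'k) module set" where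
  "right_perp A T = {X \<in> fg_modules A. \<forall>i>0. trivial_group (Ext A i T X)}"

definition self_orthogonal :: "('k, 'a) module \<Rightarrow> ('a, nat \<Rightarrow> 'k) module \<Rightarrow> bool" where
  "self_orthogonal A T \<longleftrightarrow> (\<forall>i>0. trivial_group (Ext A i T T))"

definition Ext_projective ::
    "('k, 'a) module \<Rightarrow> ('a, nat \<Rightarrow> 'k) module set \<Rightarrow> ('a, nat \<Rightarrow> 'k) module \<Rightarrow> bool" where
  "Ext_projective A C P \<longleftrightarrow> P \<in> C \<and> (\<forall>X \<in> C. trivial_group (Ext A 1 P X))"

definition short_exact ::
    "('a, 'r) ring_scheme \<Rightarrow> ('a, 'l) module \<Rightarrow> ('l \<Rightarrow> 'm) \<Rightarrow> ('a, 'm) module \<Rightarrow> ('m \<Rightarrow> 'n) \<Rightarrow>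
     ('a, 'n) module \<Rightarrow> bool" where
  "short_exact R K f P g X \<longleftrightarrow>
     f \<in> mod_hom R K P \<and> g \<in> mod_hom R P X \<and>
     inj_on f (carrier K) \<and> f ` carrier K = a_kernel P X g \<and> g ` carrier P = carrier X"

definition Ext_progenerator ::
    "('k, 'a) module \<Rightarrow> ('a, nat \<Rightarrow> 'k) module set \<Rightarrow> ('a, nat \<Rightarrow> 'k) module \<Rightarrow> bool" where
  "Ext_progenerator A C P \<longleftrightarrow> Ext_projective A C P \<and>
     (\<forall>X \<in> C. \<exists>K \<in> C. \<exists>P0 \<in> add_closure A P. \<exists>f g. short_exact A K f P0 g X)"

definition PWT_module :: "('k, 'a) module \<Rightarrow> ('a, nat \<Rightarrow> 'k) module \<Rightarrow> bool" where
  "PWT_module A T \<longleftrightarrow> T \<in> fg_modules A \<and> self_orthogonal A T \<and>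
     Ext_progenerator A (right_perp A T) T"

definition basic_PWT_modules :: "('k, 'a) module \<Rightarrow> ('a, nat \<Rightarrow> 'k) module set" where
  "basic_PWT_modules A = {T. basic_module A T \<and> PWT_module A T}"

definition PWT :: "('k, 'a) module \<Rightarrow> ('a, nat \<Rightarrow> 'k) module set set" where
  "PWT A = basic_PWT_modules A // iso_rel A"

definition PWT_with :: "('k, 'a) module \<Rightarrow> ('a, 's) module \<Rightarrow> ('a, nat \<Rightarrow> 'k) module set set" where
  "PWT_with A S =
    {T \<in> basic_PWT_modules A. \<exists>M \<in> fg_modules A. mod_iso A T (direct_sum M S)} // iso_rel A"

definition RPWT :: "('k, 'a) module \<Rightarrow> ('a, 's) module \<Rightarrow> ('a, nat \<Rightarrow> 'k) module set set" where
  "RPWT A S =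
    {M \<in> fg_modules A. \<exists>T \<in> basic_PWT_modules A. mod_iso A T (direct_sum M S)} // iso_rel A"

section \<open>Bound quiver algebras\<close>

text \<open>
  A finite quiver is a finite directed multigraph. A path is a pair of its start vertex and the list
  of its arrows, in the order in which they are traversed; \<open>(v, [])\<close> is the trivial path at \<open>v\<close>.
\<close>

type_synonym ('v, 'e) path = "'v \<times> 'e list"

definition paths :: "('v, 'e) pre_digraph \<Rightarrow> ('v, 'e) path set" where
  "paths Q = {(u, p). \<exists>v. pre_digraph.awalk Q u p v}"

text \<open>
  An element of \<open>kQ\<close> is the finitely supported function giving its coefficients. The coefficient of
  a product at a path is the sum over all ways of cutting the path in two; the first part belongs
  to the left factor, as paths are composed from left to right.
\<close>

definition path_algebra :: "('v, 'e) pre_digraph \<Rightarrow> ('k::field, ('v, 'e) path \<Rightarrow> 'k) module" where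
  "path_algebra Q =
    \<lparr>carrier = {f. finite {w. f w \<noteq> 0} \<and> {w. f w \<noteq> 0} \<subseteq> paths Q},
     mult = (\<lambda>f g (u, p). \<Sum>j\<le>length p.
               f (u, take j p) * g (pre_digraph.awlast Q u (take j p), drop j p)),
     one = (\<lambda>(u, p). if u \<in> verts Q \<and> p = [] then 1 else 0),
     zero = (\<lambda>_. 0),
     add = (\<lambda>f g w. f w + g w),
     smult = (\<lambda>c f w. c * f w)\<rparr>"

text \<open>The \<open>m\<close>-th power of the arrow ideal, i.e. the span of the paths of length at least \<open>m\<close>.\<close>

definition arrow_ideal_power ::
    "('v, 'e) pre_digraph \<Rightarrow> nat \<Rightarrow> (('v, 'e) path \<Rightarrow> 'k::field) set" where
  "arrow_ideal_power Q m =
    {f \<in> carrier (path_algebra Q). \<forall>u p. f (u, p) \<noteq> 0 \<longrightarrow> m \<le> length p}"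

definition admissible_ideal ::
    "('v, 'e) pre_digraph \<Rightarrow> (('v, 'e) path \<Rightarrow> 'k::field) set \<Rightarrow> bool" where
  "admissible_ideal Q I \<longleftrightarrow> ideal I (path_algebra Q :: ('k, ('v, 'e) path \<Rightarrow> 'k) module) \<and>
     (\<exists>m\<ge>2. arrow_ideal_power Q m \<subseteq> I) \<and> I \<subseteq> arrow_ideal_power Q 2"

definition bound_quiver_algebra ::
    "('v, 'e) pre_digraph \<Rightarrow> (('v, 'e) path \<Rightarrow> 'k::field) set \<Rightarrow>
     ('k, (('v, 'e) path \<Rightarrow> 'k) set) module" where
  "bound_quiver_algebra Q I =
    (let kQ = path_algebra Q :: ('k, ('v, 'e) path \<Rightarrow> 'k) module
     in ring.extend (kQ Quot I)
          (module.fields (\<lambda>c X. I <+>\<^bsub>kQ\<^esub> (\<lambda>f. c \<odot>\<^bsub>kQ\<^esub> f) ` X)))"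

definition source_point :: "('v, 'e) pre_digraph \<Rightarrow> 'v \<Rightarrow> bool" where
  "source_point Q i \<longleftrightarrow> i \<in> verts Q \<and> in_arcs Q i = {}"

text \<open>
  The simple module at \<open>i\<close>: the representation with \<open>k\<close> at \<open>i\<close>, zero elsewhere. The class of \<open>f\<close>
  acts by the coefficient of \<open>f\<close> at the trivial path at \<open>i\<close>, which is constant on cosets of an
  admissible ideal.
\<close>

definition simple_at ::
    "'v \<Rightarrow> ((('v, 'e) path \<Rightarrow> 'k::field) set, 'k) module" where
  "simple_at i =
    \<lparr>carrier = UNIV,
     mult = (\<lambda>_ _. undefined), one = undefined,
     zero = 0, add = (+),
     smult = (\<lambda>X x. x * the_elem ((\<lambda>f. f (i, [])) ` X))\<rparr>"

section \<open>One-point extensions\<close>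

text \<open>
  The algebra of lower triangular matrices with rows \<open>(a, 0)\<close> and \<open>(m, c)\<close>, written as \<open>(a, m, c)\<close>.
  The field acts on the left of \<open>M\<close> through its image \<open>c \<odot> \<one>\<close> in the centre of \<open>A\<close>.
\<close>

definition one_point_extension ::
    "('k::field, 'a) module \<Rightarrow> ('a, 'm) module \<Rightarrow> ('k, 'a \<times> 'm \<times> 'k) module" where
  "one_point_extension A M =
    \<lparr>carrier = carrier A \<times> carrier M \<times> UNIV,
     mult = (\<lambda>(a, m, c) (a', m', c').
               (a \<otimes>\<^bsub>A\<^esub> a', (a' \<odot>\<^bsub>M\<^esub> m) \<oplus>\<^bsub>M\<^esub> ((c \<odot>\<^bsub>A\<^esub> \<one>\<^bsub>A\<^esub>) \<odot>\<^bsub>M\<^esub> m'), c * c')),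
     one = (\<one>\<^bsub>A\<^esub>, \<zero>\<^bsub>M\<^esub>, 1),
     zero = (\<zero>\<^bsub>A\<^esub>, \<zero>\<^bsub>M\<^esub>, 0),
     add = (\<lambda>(a, m, c) (a', m', c'). (a \<oplus>\<^bsub>A\<^esub> a', m \<oplus>\<^bsub>M\<^esub> m', c + c')),
     smult = (\<lambda>t (a, m, c). (t \<odot>\<^bsub>A\<^esub> a, (t \<odot>\<^bsub>A\<^esub> \<one>\<^bsub>A\<^esub>) \<odot>\<^bsub>M\<^esub> m, t * c))\<rparr>"

end

(*
A self-orthogonal T is PWT iff T generates every module of T^perp: the kernel of a right
add T-approximation of X in T^perp is again orthogonal to T.

Let a be the new vertex of Gamma. A nonzero map from P_a or from S_a to an indecomposable
Gamma-module Y forces Y to be isomorphic to P_a or S_a, as P_a is projective-injective and S_a is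
simple injective; all other indecomposables are Lambda-modules. On Lambda-modules Y, Ext over
Lambda and over Gamma agree, and 0 -> S_i -> P_a -> S_a -> 0 turns Hom(S_i, Y) and
Ext^n(S_i, Y) into Ext^1(S_a, Y) and Ext^(n+1)(S_a, Y). Hence the bijection sends a PWT
Lambda-module X to X + P_a, and M to M + P_a + S_a whenever M + S_i is a PWT Lambda-module. The
summands cancel because Hom(P_a, Y) and Hom(S_a, Y) vanish for Lambda-modules Y, so the
Krull-Schmidt theorem is not needed.
*)

theory Submission
  imports Defs
begin

text \<open>The obstacle is the element type. \<open>fg_modules\<close> fixes
  \<open>nat \<Rightarrow> 'k\<close>, but direct sums, the regular module, S_i and P_a are built on
  other types. Direct sums are therefore treated as a relation between three given modules
  (\<open>biprod\<close>), and what is built outside is carried back along an embedding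
  (\<open>fd_transport\<close>). Quotient modules never occur: kernels are submodules, and maps are
  factored by choosing preimages.

  \<open>Ext\<close> is a quotient group over a resolution picked by choice, but only its vanishing
  matters. Vanishing is a factorisation statement about one resolution (\<open>van\<close>), and a
  single comparison theorem yields both independence of the resolution and compatibility with sums
  and summands in the first argument.

  The new vertex of \<Gamma> is a source as well, so what is proved about S_i over an algebra with a
  source also holds for S_a. Instead of decomposing arbitrary modules into indecomposables, P_a, S_a
  and S_i are split off as injective submodules, by induction on the dimension; decompositions are
  opened only where \<open>basic_module\<close> provides them.\<close>

locale ralg = R: ring A for A :: "('k::field, 'a) module"
begin

section \<open>Right modules over a ring and their homomorphisms\<close>

abbreviation rmod :: "('a, 'm) module \<Rightarrow> bool" where "rmod M \<equiv> right_module A M"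

text \<open>Homomorphisms without the extensionality that \<open>mod_hom\<close> demands, so that
  composites and lambda terms qualify as they stand; \<open>mod_hom_iff\<close> and
  \<open>mod_hom_restrict\<close> translate.\<close>

definition lin :: "('a, 'm) module \<Rightarrow> ('a, 'n) module \<Rightarrow> ('m \<Rightarrow> 'n) \<Rightarrow> bool" where
  "lin M N f \<longleftrightarrow> (\<forall>x\<in>carrier M. f x \<in> carrier N) \<and>
     (\<forall>x\<in>carrier M. \<forall>y\<in>carrier M. f (x \<oplus>\<^bsub>M\<^esub> y) = f x \<oplus>\<^bsub>N\<^esub> f y) \<and>
     (\<forall>a\<in>carrier A. \<forall>x\<in>carrier M. f (a \<odot>\<^bsub>M\<^esub> x) = a \<odot>\<^bsub>N\<^esub> f x)"

lemma rmod_abelian: "rmod M \<Longrightarrow> abelian_group M"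
  by (simp add: right_module_def)

lemma rmod_closed [simp]:
  assumes "rmod M"
  shows "\<zero>\<^bsub>M\<^esub> \<in> carrier M"
    and "x \<in> carrier M \<Longrightarrow> y \<in> carrier M \<Longrightarrow> x \<oplus>\<^bsub>M\<^esub> y \<in> carrier M"
    and "x \<in> carrier M \<Longrightarrow> y \<in> carrier M \<Longrightarrow> x \<ominus>\<^bsub>M\<^esub> y \<in> carrier M"
    and "x \<in> carrier M \<Longrightarrow> \<ominus>\<^bsub>M\<^esub> x \<in> carrier M"
    and "a \<in> carrier A \<Longrightarrow> x \<in> carrier M \<Longrightarrow> a \<odot>\<^bsub>M\<^esub> x \<in> carrier M"
proof -
  interpret M: abelian_group M by (rule rmod_abelian) fact
  show "\<zero>\<^bsub>M\<^esub> \<in> carrier M"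
    "x \<in> carrier M \<Longrightarrow> y \<in> carrier M \<Longrightarrow> x \<oplus>\<^bsub>M\<^esub> y \<in> carrier M"
    "x \<in> carrier M \<Longrightarrow> y \<in> carrier M \<Longrightarrow> x \<ominus>\<^bsub>M\<^esub> y \<in> carrier M"
    "x \<in> carrier M \<Longrightarrow> \<ominus>\<^bsub>M\<^esub> x \<in> carrier M" by auto
  show "a \<in> carrier A \<Longrightarrow> x \<in> carrier M \<Longrightarrow> a \<odot>\<^bsub>M\<^esub> x \<in> carrier M"
    by (rule right_module.ract_closed[OF assms])
qed

lemma rmod_add_simps [simp]:
  assumes "rmod M" "x \<in> carrier M"
  shows "\<zero>\<^bsub>M\<^esub> \<oplus>\<^bsub>M\<^esub> x = x" "x \<oplus>\<^bsub>M\<^esub> \<zero>\<^bsub>M\<^esub> = x"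
    "x \<ominus>\<^bsub>M\<^esub> \<zero>\<^bsub>M\<^esub> = x" "x \<ominus>\<^bsub>M\<^esub> x = \<zero>\<^bsub>M\<^esub>"
    "\<ominus>\<^bsub>M\<^esub> x \<oplus>\<^bsub>M\<^esub> x = \<zero>\<^bsub>M\<^esub>" "x \<oplus>\<^bsub>M\<^esub> \<ominus>\<^bsub>M\<^esub> x = \<zero>\<^bsub>M\<^esub>"
proof -
  interpret M: abelian_group M by (rule rmod_abelian) fact
  show "\<zero>\<^bsub>M\<^esub> \<oplus>\<^bsub>M\<^esub> x = x" "x \<oplus>\<^bsub>M\<^esub> \<zero>\<^bsub>M\<^esub> = x"
    "x \<ominus>\<^bsub>M\<^esub> \<zero>\<^bsub>M\<^esub> = x" "x \<ominus>\<^bsub>M\<^esub> x = \<zero>\<^bsub>M\<^esub>"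
    "\<ominus>\<^bsub>M\<^esub> x \<oplus>\<^bsub>M\<^esub> x = \<zero>\<^bsub>M\<^esub>" "x \<oplus>\<^bsub>M\<^esub> \<ominus>\<^bsub>M\<^esub> x = \<zero>\<^bsub>M\<^esub>"
    using assms by (auto simp: M.minus_eq M.l_neg M.r_neg)
qed

lemma rmod_assoc: "rmod M \<Longrightarrow> x \<in> carrier M \<Longrightarrow> y \<in> carrier M \<Longrightarrow> z \<in> carrier M \<Longrightarrow>
    (x \<oplus>\<^bsub>M\<^esub> y) \<oplus>\<^bsub>M\<^esub> z = x \<oplus>\<^bsub>M\<^esub> (y \<oplus>\<^bsub>M\<^esub> z)"
  by (meson abelian_group_def abelian_monoid.a_assoc rmod_abelian)

lemma rmod_comm: "rmod M \<Longrightarrow> x \<in> carrier M \<Longrightarrow> y \<in> carrier M \<Longrightarrow>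
    x \<oplus>\<^bsub>M\<^esub> y = y \<oplus>\<^bsub>M\<^esub> x"
  by (meson abelian_group_def abelian_monoid.a_comm rmod_abelian)

lemma rmod_lcomm: "rmod M \<Longrightarrow> x \<in> carrier M \<Longrightarrow> y \<in> carrier M \<Longrightarrow> z \<in> carrier M \<Longrightarrow>
    x \<oplus>\<^bsub>M\<^esub> (y \<oplus>\<^bsub>M\<^esub> z) = y \<oplus>\<^bsub>M\<^esub> (x \<oplus>\<^bsub>M\<^esub> z)"
  by (metis rmod_assoc rmod_comm)

lemmas rmod_ac = rmod_assoc rmod_comm rmod_lcomm

lemma rmod_diff_eq_iff:
  assumes "rmod M" "x \<in> carrier M" "y \<in> carrier M"
  shows "x \<ominus>\<^bsub>M\<^esub> y = \<zero>\<^bsub>M\<^esub> \<longleftrightarrow> x = y"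
proof -
  interpret M: abelian_group M by (rule rmod_abelian) fact
  show ?thesis
  proof
    assume "x \<ominus>\<^bsub>M\<^esub> y = \<zero>\<^bsub>M\<^esub>"
    then have "(x \<ominus>\<^bsub>M\<^esub> y) \<oplus>\<^bsub>M\<^esub> y = y" using assms by simp
    then show "x = y" using assms by (simp add: M.minus_eq M.a_assoc M.l_neg)
  qed (use assms in simp)
qed

lemma rmod_diff_add:
  assumes "rmod M" "x \<in> carrier M" "y \<in> carrier M"
  shows "(x \<ominus>\<^bsub>M\<^esub> y) \<oplus>\<^bsub>M\<^esub> y = x" "(x \<oplus>\<^bsub>M\<^esub> y) \<ominus>\<^bsub>M\<^esub> y = x"
    "y \<oplus>\<^bsub>M\<^esub> (x \<ominus>\<^bsub>M\<^esub> y) = x" "(y \<oplus>\<^bsub>M\<^esub> x) \<ominus>\<^bsub>M\<^esub> y = x"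
    "x \<ominus>\<^bsub>M\<^esub> (x \<ominus>\<^bsub>M\<^esub> y) = y"
proof -
  interpret M: abelian_group M by (rule rmod_abelian) fact
  show *: "(x \<ominus>\<^bsub>M\<^esub> y) \<oplus>\<^bsub>M\<^esub> y = x" "(x \<oplus>\<^bsub>M\<^esub> y) \<ominus>\<^bsub>M\<^esub> y = x"
    using assms by (auto simp: M.minus_eq M.a_assoc M.l_neg M.r_neg)
  show "y \<oplus>\<^bsub>M\<^esub> (x \<ominus>\<^bsub>M\<^esub> y) = x" "(y \<oplus>\<^bsub>M\<^esub> x) \<ominus>\<^bsub>M\<^esub> y = x"
    using * assms by (metis M.a_comm M.minus_closed, metis M.a_comm)
  show "x \<ominus>\<^bsub>M\<^esub> (x \<ominus>\<^bsub>M\<^esub> y) = y"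
    using assms by (simp add: M.minus_eq M.minus_add M.a_assoc[symmetric] M.r_neg)
qed

lemma rmod_add_cancel:
  assumes "rmod M" "x \<in> carrier M" "y \<in> carrier M" "z \<in> carrier M"
  shows "x \<oplus>\<^bsub>M\<^esub> z = y \<oplus>\<^bsub>M\<^esub> z \<longleftrightarrow> x = y" "z \<oplus>\<^bsub>M\<^esub> x = z \<oplus>\<^bsub>M\<^esub> y \<longleftrightarrow> x = y"
proof -
  interpret M: abelian_group M by (rule rmod_abelian) fact
  show "x \<oplus>\<^bsub>M\<^esub> z = y \<oplus>\<^bsub>M\<^esub> z \<longleftrightarrow> x = y" "z \<oplus>\<^bsub>M\<^esub> x = z \<oplus>\<^bsub>M\<^esub> y \<longleftrightarrow> x = y"
    using assms by auto
qed

lemma ract_add: "rmod M \<Longrightarrow> a \<in> carrier A \<Longrightarrow> x \<in> carrier M \<Longrightarrow> y \<in> carrier M \<Longrightarrow>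
    a \<odot>\<^bsub>M\<^esub> (x \<oplus>\<^bsub>M\<^esub> y) = a \<odot>\<^bsub>M\<^esub> x \<oplus>\<^bsub>M\<^esub> a \<odot>\<^bsub>M\<^esub> y"
  by (rule right_module.ract_add_module)

lemma ract_add_left: "rmod M \<Longrightarrow> a \<in> carrier A \<Longrightarrow> b \<in> carrier A \<Longrightarrow> x \<in> carrier M \<Longrightarrow>
    (a \<oplus>\<^bsub>A\<^esub> b) \<odot>\<^bsub>M\<^esub> x = a \<odot>\<^bsub>M\<^esub> x \<oplus>\<^bsub>M\<^esub> b \<odot>\<^bsub>M\<^esub> x"
  by (rule right_module.ract_add_ring)

lemma ract_mult: "rmod M \<Longrightarrow> a \<in> carrier A \<Longrightarrow> b \<in> carrier A \<Longrightarrow> x \<in> carrier M \<Longrightarrow>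
    (a \<otimes>\<^bsub>A\<^esub> b) \<odot>\<^bsub>M\<^esub> x = b \<odot>\<^bsub>M\<^esub> (a \<odot>\<^bsub>M\<^esub> x)"
  by (rule right_module.ract_assoc)

lemma ract_one [simp]: "rmod M \<Longrightarrow> x \<in> carrier M \<Longrightarrow> \<one>\<^bsub>A\<^esub> \<odot>\<^bsub>M\<^esub> x = x"
  by (rule right_module.ract_one)

lemma ract_zero [simp]:
  assumes "rmod M" shows "a \<in> carrier A \<Longrightarrow> a \<odot>\<^bsub>M\<^esub> \<zero>\<^bsub>M\<^esub> = \<zero>\<^bsub>M\<^esub>"
    "x \<in> carrier M \<Longrightarrow> \<zero>\<^bsub>A\<^esub> \<odot>\<^bsub>M\<^esub> x = \<zero>\<^bsub>M\<^esub>"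
proof -
  show "a \<odot>\<^bsub>M\<^esub> \<zero>\<^bsub>M\<^esub> = \<zero>\<^bsub>M\<^esub>" if "a \<in> carrier A"
  proof -
    have "a \<odot>\<^bsub>M\<^esub> \<zero>\<^bsub>M\<^esub> \<oplus>\<^bsub>M\<^esub> a \<odot>\<^bsub>M\<^esub> \<zero>\<^bsub>M\<^esub> = \<zero>\<^bsub>M\<^esub> \<oplus>\<^bsub>M\<^esub> a \<odot>\<^bsub>M\<^esub> \<zero>\<^bsub>M\<^esub>"
      using assms that by (simp add: ract_add[symmetric])
    then show ?thesis using assms that by (simp only: rmod_add_cancel rmod_closed)
  qed
  show "\<zero>\<^bsub>A\<^esub> \<odot>\<^bsub>M\<^esub> x = \<zero>\<^bsub>M\<^esub>" if "x \<in> carrier M"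
  proof -
    have "\<zero>\<^bsub>A\<^esub> \<odot>\<^bsub>M\<^esub> x \<oplus>\<^bsub>M\<^esub> \<zero>\<^bsub>A\<^esub> \<odot>\<^bsub>M\<^esub> x = \<zero>\<^bsub>M\<^esub> \<oplus>\<^bsub>M\<^esub> \<zero>\<^bsub>A\<^esub> \<odot>\<^bsub>M\<^esub> x"
      using assms that by (simp add: ract_add_left[symmetric])
    then show ?thesis using assms that by (simp only: rmod_add_cancel rmod_closed R.zero_closed)
  qed
qed

lemma ract_minus:
  assumes "rmod M" "a \<in> carrier A" "x \<in> carrier M"
  shows "a \<odot>\<^bsub>M\<^esub> (\<ominus>\<^bsub>M\<^esub> x) = \<ominus>\<^bsub>M\<^esub> (a \<odot>\<^bsub>M\<^esub> x)"
    "(\<ominus>\<^bsub>A\<^esub> a) \<odot>\<^bsub>M\<^esub> x = \<ominus>\<^bsub>M\<^esub> (a \<odot>\<^bsub>M\<^esub> x)"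
proof -
  interpret M: abelian_group M by (rule rmod_abelian) fact
  show "a \<odot>\<^bsub>M\<^esub> (\<ominus>\<^bsub>M\<^esub> x) = \<ominus>\<^bsub>M\<^esub> (a \<odot>\<^bsub>M\<^esub> x)"
    by (rule M.minus_equality[symmetric]) (use assms in \<open>auto simp: ract_add[symmetric] M.l_neg\<close>)
  show "(\<ominus>\<^bsub>A\<^esub> a) \<odot>\<^bsub>M\<^esub> x = \<ominus>\<^bsub>M\<^esub> (a \<odot>\<^bsub>M\<^esub> x)"
    by (rule M.minus_equality[symmetric]) (use assms in \<open>auto simp: ract_add_left[symmetric] R.l_neg\<close>)
qed

text \<open>That the zero of the ring acts as zero takes the place of additive inverses: the inverse
  of x is the product of x with -1.\<close>

lemma rmodI:
  assumes "\<zero>\<^bsub>M\<^esub> \<in> carrier M"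
    and "\<And>x y. x \<in> carrier M \<Longrightarrow> y \<in> carrier M \<Longrightarrow> x \<oplus>\<^bsub>M\<^esub> y \<in> carrier M"
    and "\<And>x y z. x \<in> carrier M \<Longrightarrow> y \<in> carrier M \<Longrightarrow> z \<in> carrier M \<Longrightarrow>
      (x \<oplus>\<^bsub>M\<^esub> y) \<oplus>\<^bsub>M\<^esub> z = x \<oplus>\<^bsub>M\<^esub> (y \<oplus>\<^bsub>M\<^esub> z)"
    and "\<And>x y. x \<in> carrier M \<Longrightarrow> y \<in> carrier M \<Longrightarrow> x \<oplus>\<^bsub>M\<^esub> y = y \<oplus>\<^bsub>M\<^esub> x"
    and "\<And>x. x \<in> carrier M \<Longrightarrow> \<zero>\<^bsub>M\<^esub> \<oplus>\<^bsub>M\<^esub> x = x"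
    and act: "\<And>a x. a \<in> carrier A \<Longrightarrow> x \<in> carrier M \<Longrightarrow> a \<odot>\<^bsub>M\<^esub> x \<in> carrier M"
    and l: "\<And>a b x. a \<in> carrier A \<Longrightarrow> b \<in> carrier A \<Longrightarrow> x \<in> carrier M \<Longrightarrow>
      (a \<oplus>\<^bsub>A\<^esub> b) \<odot>\<^bsub>M\<^esub> x = a \<odot>\<^bsub>M\<^esub> x \<oplus>\<^bsub>M\<^esub> b \<odot>\<^bsub>M\<^esub> x"
    and "\<And>a x y. a \<in> carrier A \<Longrightarrow> x \<in> carrier M \<Longrightarrow> y \<in> carrier M \<Longrightarrow>
      a \<odot>\<^bsub>M\<^esub> (x \<oplus>\<^bsub>M\<^esub> y) = a \<odot>\<^bsub>M\<^esub> x \<oplus>\<^bsub>M\<^esub> a \<odot>\<^bsub>M\<^esub> y"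
    and "\<And>a b x. a \<in> carrier A \<Longrightarrow> b \<in> carrier A \<Longrightarrow> x \<in> carrier M \<Longrightarrow>
      (a \<otimes>\<^bsub>A\<^esub> b) \<odot>\<^bsub>M\<^esub> x = b \<odot>\<^bsub>M\<^esub> (a \<odot>\<^bsub>M\<^esub> x)"
    and one: "\<And>x. x \<in> carrier M \<Longrightarrow> \<one>\<^bsub>A\<^esub> \<odot>\<^bsub>M\<^esub> x = x"
    and zero: "\<And>x. x \<in> carrier M \<Longrightarrow> \<zero>\<^bsub>A\<^esub> \<odot>\<^bsub>M\<^esub> x = \<zero>\<^bsub>M\<^esub>"
  shows "rmod M"
proof -
  have inv: "\<exists>y\<in>carrier M. y \<oplus>\<^bsub>M\<^esub> x = \<zero>\<^bsub>M\<^esub>" if "x \<in> carrier M" for x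
  proof
    show "(\<ominus>\<^bsub>A\<^esub> \<one>\<^bsub>A\<^esub>) \<odot>\<^bsub>M\<^esub> x \<in> carrier M" using act that by simp
    show "(\<ominus>\<^bsub>A\<^esub> \<one>\<^bsub>A\<^esub>) \<odot>\<^bsub>M\<^esub> x \<oplus>\<^bsub>M\<^esub> x = \<zero>\<^bsub>M\<^esub>"
      using l[of "\<ominus>\<^bsub>A\<^esub> \<one>\<^bsub>A\<^esub>" "\<one>\<^bsub>A\<^esub>" x] that by (simp add: one zero R.l_neg)
  qed
  have "abelian_group M"
    by (rule abelian_groupI) (use assms inv in auto)
  then show ?thesis
    unfolding right_module_def right_module_axioms_def using assms R.ring_axioms by blast
qed

subsection \<open>Homomorphisms\<close>

lemma linI:
  assumes "\<And>x. x \<in> carrier M \<Longrightarrow> f x \<in> carrier N"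
    and "\<And>x y. x \<in> carrier M \<Longrightarrow> y \<in> carrier M \<Longrightarrow> f (x \<oplus>\<^bsub>M\<^esub> y) = f x \<oplus>\<^bsub>N\<^esub> f y"
    and "\<And>a x. a \<in> carrier A \<Longrightarrow> x \<in> carrier M \<Longrightarrow> f (a \<odot>\<^bsub>M\<^esub> x) = a \<odot>\<^bsub>N\<^esub> f x"
  shows "lin M N f"
  using assms by (simp add: lin_def)

lemma lin_closed: "lin M N f \<Longrightarrow> x \<in> carrier M \<Longrightarrow> f x \<in> carrier N"
  by (simp add: lin_def)

lemma lin_add: "lin M N f \<Longrightarrow> x \<in> carrier M \<Longrightarrow> y \<in> carrier M \<Longrightarrow> f (x \<oplus>\<^bsub>M\<^esub> y) = f x \<oplus>\<^bsub>N\<^esub> f y"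
  by (simp add: lin_def)

lemma lin_act: "lin M N f \<Longrightarrow> a \<in> carrier A \<Longrightarrow> x \<in> carrier M \<Longrightarrow> f (a \<odot>\<^bsub>M\<^esub> x) = a \<odot>\<^bsub>N\<^esub> f x"
  by (simp add: lin_def)

lemma lin_zero:
  assumes "lin M N f" "rmod M" "rmod N"
  shows "f \<zero>\<^bsub>M\<^esub> = \<zero>\<^bsub>N\<^esub>"
proof -
  have "f (\<zero>\<^bsub>A\<^esub> \<odot>\<^bsub>M\<^esub> \<zero>\<^bsub>M\<^esub>) = \<zero>\<^bsub>N\<^esub>" using assms by (subst lin_act[OF assms(1)]) (auto simp: lin_closed[OF assms(1)])
  then show ?thesis using assms by simp
qed

lemma lin_uminus:
  assumes "lin M N f" "rmod M" "rmod N" "x \<in> carrier M"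
  shows "f (\<ominus>\<^bsub>M\<^esub> x) = \<ominus>\<^bsub>N\<^esub> f x"
proof -
  have "f ((\<ominus>\<^bsub>A\<^esub> \<one>\<^bsub>A\<^esub>) \<odot>\<^bsub>M\<^esub> x) = (\<ominus>\<^bsub>A\<^esub> \<one>\<^bsub>A\<^esub>) \<odot>\<^bsub>N\<^esub> f x"
    using assms by (subst lin_act[OF assms(1)]) auto
  then show ?thesis using assms by (simp add: ract_minus lin_closed[OF assms(1)])
qed

lemma lin_diff:
  assumes "lin M N f" "rmod M" "rmod N" "x \<in> carrier M" "y \<in> carrier M"
  shows "f (x \<ominus>\<^bsub>M\<^esub> y) = f x \<ominus>\<^bsub>N\<^esub> f y"
  using assms by (simp add: a_minus_def lin_add lin_uminus)

lemmas lins = lin_closed lin_add lin_act lin_zero lin_uminus lin_diff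

lemma lin_comp: "lin M N f \<Longrightarrow> lin N L g \<Longrightarrow> lin M L (\<lambda>x. g (f x))"
  by (simp add: lin_def)

lemma lin_cong: "lin M N f \<Longrightarrow> rmod M \<Longrightarrow> (\<And>x. x \<in> carrier M \<Longrightarrow> g x = f x) \<Longrightarrow> lin M N g"
  by (simp add: lin_def)

lemma lin_id: "lin M M (\<lambda>x. x)"
  by (simp add: lin_def)

lemma lin_const_zero: "rmod N \<Longrightarrow> lin M N (\<lambda>x. \<zero>\<^bsub>N\<^esub>)"
  by (simp add: lin_def)

lemma lin_sum: "lin M N f \<Longrightarrow> lin M N g \<Longrightarrow> rmod M \<Longrightarrow> rmod N \<Longrightarrow> lin M N (\<lambda>x. f x \<oplus>\<^bsub>N\<^esub> g x)"
  by (intro linI) (auto simp: lin_closed lin_add lin_act ract_add rmod_ac)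

lemma lin_neg: "lin M N f \<Longrightarrow> rmod M \<Longrightarrow> rmod N \<Longrightarrow> lin M N (\<lambda>x. \<ominus>\<^bsub>N\<^esub> f x)"
  by (intro linI) (auto simp: lin_closed lin_add lin_act ract_minus abelian_group.minus_add[OF rmod_abelian])

lemma lin_sub: "lin M N f \<Longrightarrow> lin M N g \<Longrightarrow> rmod M \<Longrightarrow> rmod N \<Longrightarrow> lin M N (\<lambda>x. f x \<ominus>\<^bsub>N\<^esub> g x)"
  unfolding a_minus_def by (intro lin_sum lin_neg)

lemma mod_hom_iff: "f \<in> mod_hom A M N \<longleftrightarrow> lin M N f \<and> f \<in> extensional (carrier M)"
  by (auto simp: mod_hom_def lin_def hom_def)

lemma mod_hom_restrict: "lin M N f \<Longrightarrow> rmod M \<Longrightarrow> restrict f (carrier M) \<in> mod_hom A M N"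
  by (auto simp: mod_hom_iff intro: lin_cong)

lemma mod_isoI:
  assumes "rmod M" "lin M N f" "lin N M g"
    and "\<And>x. x \<in> carrier M \<Longrightarrow> g (f x) = x" and "\<And>y. y \<in> carrier N \<Longrightarrow> f (g y) = y"
  shows "mod_iso A M N"
  unfolding mod_iso_def
proof
  show "restrict f (carrier M) \<in> mod_hom A M N" using assms by (intro mod_hom_restrict)
  show "bij_betw (restrict f (carrier M)) (carrier M) (carrier N)"
    by (rule bij_betw_byWitness[where f' = g])
      (use assms in \<open>auto simp: lin_closed[OF assms(2)] lin_closed[OF assms(3)]\<close>)
qed

lemma lin_inv_into:
  assumes "rmod M" "lin M N f" "bij_betw f (carrier M) (carrier N)"
  shows "lin N M (inv_into (carrier M) f)"
proof (rule linI)
  let ?g = "inv_into (carrier M) f"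
  have 1: "?g y \<in> carrier M" "f (?g y) = y" if "y \<in> carrier N" for y
    using assms(3) that by (auto simp: bij_betw_def inv_into_into f_inv_into_f)
  have 2: "?g (f x) = x" if "x \<in> carrier M" for x
    using assms(3) that by (auto simp: bij_betw_def)
  show "?g y \<in> carrier M" if "y \<in> carrier N" for y using 1 that by auto
  show "?g (x \<oplus>\<^bsub>N\<^esub> y) = ?g x \<oplus>\<^bsub>M\<^esub> ?g y" if "x \<in> carrier N" "y \<in> carrier N" for x y
    using 2[of "?g x \<oplus>\<^bsub>M\<^esub> ?g y"] assms 1 that by (simp add: lin_add)
  show "?g (a \<odot>\<^bsub>N\<^esub> x) = a \<odot>\<^bsub>M\<^esub> ?g x" if "x \<in> carrier N" "a \<in> carrier A" for x a
    using 2[of "a \<odot>\<^bsub>M\<^esub> ?g x"] assms 1 that by (simp add: lin_act)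
qed

lemma mod_isoE:
  assumes "mod_iso A M N" "rmod M"
  obtains f g where "lin M N f" "lin N M g"
    "\<And>x. x \<in> carrier M \<Longrightarrow> g (f x) = x" "\<And>y. y \<in> carrier N \<Longrightarrow> f (g y) = y"
proof -
  obtain f where f: "lin M N f" "bij_betw f (carrier M) (carrier N)"
    using assms by (auto simp: mod_iso_def mod_hom_iff)
  show thesis
    by (rule that[OF f(1) lin_inv_into[OF assms(2) f]])
      (use f(2) in \<open>auto simp: bij_betw_def f_inv_into_f\<close>)
qed

lemma mod_iso_refl: "rmod M \<Longrightarrow> mod_iso A M M"
  by (rule mod_isoI) (auto intro: lin_id)

lemma mod_iso_sym: "mod_iso A M N \<Longrightarrow> rmod M \<Longrightarrow> rmod N \<Longrightarrow> mod_iso A N M"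
  by (erule mod_isoE, assumption) (rule mod_isoI)

lemma mod_iso_trans:
  assumes "mod_iso A M N" "mod_iso A N L" "rmod M" "rmod N"
  shows "mod_iso A M L"
proof -
  obtain f g where 1: "lin M N f" "lin N M g"
    "\<And>x. x \<in> carrier M \<Longrightarrow> g (f x) = x" "\<And>y. y \<in> carrier N \<Longrightarrow> f (g y) = y"
    using mod_isoE assms by meson
  obtain f' g' where 2: "lin N L f'" "lin L N g'"
    "\<And>x. x \<in> carrier N \<Longrightarrow> g' (f' x) = x" "\<And>y. y \<in> carrier L \<Longrightarrow> f' (g' y) = y"
    using mod_isoE assms by meson
  show ?thesis
    by (rule mod_isoI[OF assms(3) lin_comp[OF 1(1) 2(1)] lin_comp[OF 2(2) 1(2)]])
      (use 1 2 in \<open>auto simp: lin_closed[OF 1(1)] lin_closed[OF 2(2)]\<close>)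
qed

subsection \<open>Submodules, kernels\<close>

text \<open>Closure under negation is automatic, since negation is multiplication by -1.\<close>

lemma submodule_iff:
  assumes "rmod M"
  shows "submodule H A M \<longleftrightarrow> H \<subseteq> carrier M \<and> \<zero>\<^bsub>M\<^esub> \<in> H \<and>
    (\<forall>x\<in>H. \<forall>y\<in>H. x \<oplus>\<^bsub>M\<^esub> y \<in> H) \<and> (\<forall>a\<in>carrier A. \<forall>x\<in>H. a \<odot>\<^bsub>M\<^esub> x \<in> H)"
proof (intro iffI conjI)
  assume "submodule H A M"
  then interpret H: submodule H A M .
  show "H \<subseteq> carrier M" "\<zero>\<^bsub>M\<^esub> \<in> H" "(\<forall>x\<in>H. \<forall>y\<in>H. x \<oplus>\<^bsub>M\<^esub> y \<in> H)"
    "(\<forall>a\<in>carrier A. \<forall>x\<in>H. a \<odot>\<^bsub>M\<^esub> x \<in> H)"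
    using H.subset H.one_closed H.m_closed H.smult_closed by auto
next
  assume *: "H \<subseteq> carrier M \<and> \<zero>\<^bsub>M\<^esub> \<in> H \<and>
    (\<forall>x\<in>H. \<forall>y\<in>H. x \<oplus>\<^bsub>M\<^esub> y \<in> H) \<and> (\<forall>a\<in>carrier A. \<forall>x\<in>H. a \<odot>\<^bsub>M\<^esub> x \<in> H)"
  have "\<ominus>\<^bsub>M\<^esub> x \<in> H" if "x \<in> H" for x
  proof -
    have "(\<ominus>\<^bsub>A\<^esub> \<one>\<^bsub>A\<^esub>) \<odot>\<^bsub>M\<^esub> x \<in> H" using * that by simp
    moreover have "x \<in> carrier M" using * that by auto
    ultimately show ?thesis using assms by (simp add: ract_minus)
  qed
  then have "\<forall>x\<in>H. inv\<^bsub>add_monoid M\<^esub> x \<in> H" by (simp add: a_inv_def)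
  then show "submodule H A M"
    using * by (auto intro!: submodule.intro subgroup.intro simp: submodule_axioms_def)
qed

lemma submoduleD:
  assumes "submodule H A M" "rmod M"
  shows "x \<in> H \<Longrightarrow> x \<in> carrier M" "\<zero>\<^bsub>M\<^esub> \<in> H" "x \<in> H \<Longrightarrow> y \<in> H \<Longrightarrow> x \<oplus>\<^bsub>M\<^esub> y \<in> H"
    "a \<in> carrier A \<Longrightarrow> x \<in> H \<Longrightarrow> a \<odot>\<^bsub>M\<^esub> x \<in> H"
  using assms by (auto simp: submodule_iff)

lemma rmod_sub:
  assumes "rmod M" "submodule H A M"
  shows "rmod (M\<lparr>carrier := H\<rparr>)"
  using assms
  by (intro rmodI) (auto simp: submodule_iff rmod_assoc ract_add ract_add_left ract_mult subset_iff
      intro: rmod_comm)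

lemma lin_incl: "rmod M \<Longrightarrow> submodule H A M \<Longrightarrow> lin (M\<lparr>carrier := H\<rparr>) M (\<lambda>x. x)"
  by (intro linI) (auto dest: submoduleD)

lemma lin_into_sub:
  "lin N M f \<Longrightarrow> (\<And>x. x \<in> carrier N \<Longrightarrow> f x \<in> H) \<Longrightarrow> lin N (M\<lparr>carrier := H\<rparr>) f"
  by (auto simp: lin_def)

lemma submodule_ker:
  assumes "rmod M" "rmod N" "lin M N f"
  shows "submodule {x \<in> carrier M. f x = \<zero>\<^bsub>N\<^esub>} A M"
  using assms by (auto simp: submodule_iff lins[OF assms(3)])

lemma submodule_image:
  assumes "rmod M" "rmod N" "lin M N f" "submodule H A M"
  shows "submodule (f ` H) A N"
proof -
  have H: "H \<subseteq> carrier M" using assms by (simp add: submodule_iff)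
  show ?thesis
    unfolding submodule_iff[OF assms(2)]
  proof (intro conjI ballI)
    show "f ` H \<subseteq> carrier N" using H lin_closed[OF assms(3)] by auto
    show "\<zero>\<^bsub>N\<^esub> \<in> f ` H" using assms submoduleD(2) by (metis image_eqI lin_zero)
    show "x \<oplus>\<^bsub>N\<^esub> y \<in> f ` H" if "x \<in> f ` H" "y \<in> f ` H" for x y
      using that H assms submoduleD(3)[OF assms(4,1)]
      by (clarsimp simp: lin_add[OF assms(3), symmetric] subset_iff)
    show "a \<odot>\<^bsub>N\<^esub> x \<in> f ` H" if "x \<in> f ` H" "a \<in> carrier A" for x a
      using that H assms submoduleD(4)[OF assms(4,1)]
      by (clarsimp simp: lin_act[OF assms(3), symmetric] subset_iff)
  qed
qed

lemma submodule_carrier: "rmod M \<Longrightarrow> submodule (carrier M) A M"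
  by (auto simp: submodule_iff)

lemma submodule_vimage:
  assumes "rmod M" "rmod N" "lin M N f" "submodule H A N"
  shows "submodule {x \<in> carrier M. f x \<in> H} A M"
  using assms by (auto simp: submodule_iff lins[OF assms(3)])

lemma lin_inj_iff:
  assumes "rmod M" "rmod N" "lin M N f"
  shows "inj_on f (carrier M) \<longleftrightarrow> (\<forall>x\<in>carrier M. f x = \<zero>\<^bsub>N\<^esub> \<longrightarrow> x = \<zero>\<^bsub>M\<^esub>)"
proof
  assume "inj_on f (carrier M)"
  then show "\<forall>x\<in>carrier M. f x = \<zero>\<^bsub>N\<^esub> \<longrightarrow> x = \<zero>\<^bsub>M\<^esub>"
    using assms by (metis inj_onD lin_zero rmod_closed(1))
next
  assume *: "\<forall>x\<in>carrier M. f x = \<zero>\<^bsub>N\<^esub> \<longrightarrow> x = \<zero>\<^bsub>M\<^esub>"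
  show "inj_on f (carrier M)"
  proof (rule inj_onI)
    fix x y assume xy: "x \<in> carrier M" "y \<in> carrier M" "f x = f y"
    then have "f (x \<ominus>\<^bsub>M\<^esub> y) = \<zero>\<^bsub>N\<^esub>" using assms by (simp add: lins[OF assms(3)])
    then show "x = y" using * xy assms by (metis rmod_closed(3) rmod_diff_eq_iff)
  qed
qed

text \<open>As \<open>f\<close> is constant on the fibres of \<open>e\<close>, composing it with any
  set-theoretic section of \<open>e\<close> gives a linear map. This is the universal property of a
  quotient without the quotient module.\<close>

lemma lin_factor:
  assumes "rmod P" "rmod M" "rmod N" "lin P M e" "carrier M \<subseteq> e ` carrier P" "lin P N f"
    "\<And>x. x \<in> carrier P \<Longrightarrow> e x = \<zero>\<^bsub>M\<^esub> \<Longrightarrow> f x = \<zero>\<^bsub>N\<^esub>"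
  obtains u where "lin M N u" "\<And>x. x \<in> carrier P \<Longrightarrow> u (e x) = f x"
proof -
  note e = assms(4) and f = assms(6)
  have ker: "f x = f y" if xy: "x \<in> carrier P" "y \<in> carrier P" "e x = e y" for x y
  proof -
    have "e (x \<ominus>\<^bsub>P\<^esub> y) = \<zero>\<^bsub>M\<^esub>" using xy assms(1,2) lin_closed[OF e] by (simp add: lin_diff[OF e])
    then have "f (x \<ominus>\<^bsub>P\<^esub> y) = \<zero>\<^bsub>N\<^esub>" using assms(1,7) xy by simp
    then have "f x \<ominus>\<^bsub>N\<^esub> f y = \<zero>\<^bsub>N\<^esub>" using lin_diff[OF f assms(1,3) xy(1,2)] by simp
    then show ?thesis using rmod_diff_eq_iff[OF assms(3)] lin_closed[OF f] xy by simp
  qed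
  have "\<forall>t\<in>carrier M. \<exists>p. p \<in> carrier P \<and> e p = t" using assms(5) by auto
  then obtain s where s: "\<And>t. t \<in> carrier M \<Longrightarrow> s t \<in> carrier P \<and> e (s t) = t" by (metis (no_types))
  have se: "f (s (e x)) = f x" if "x \<in> carrier P" for x
    using ker s[OF lin_closed[OF e that]] that by blast
  have "lin M N (\<lambda>t. f (s t))"
  proof (rule linI)
    show "f (s x) \<in> carrier N" if "x \<in> carrier M" for x using s[OF that] lin_closed[OF f] by simp
    show "f (s (x \<oplus>\<^bsub>M\<^esub> y)) = f (s x) \<oplus>\<^bsub>N\<^esub> f (s y)" if xy: "x \<in> carrier M" "y \<in> carrier M" for x y
      using se[of "s x \<oplus>\<^bsub>P\<^esub> s y"] s[OF xy(1)] s[OF xy(2)] assms(1)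
        lin_add[OF e, of "s x" "s y"] lin_add[OF f, of "s x" "s y"] by simp
    show "f (s (a \<odot>\<^bsub>M\<^esub> x)) = a \<odot>\<^bsub>N\<^esub> f (s x)" if ax: "a \<in> carrier A" "x \<in> carrier M" for a x
      using se[of "a \<odot>\<^bsub>P\<^esub> s x"] s[OF ax(2)] ax assms(1) lin_act[OF e ax(1), of "s x"]
        lin_act[OF f ax(1), of "s x"] by simp
  qed
  then show thesis using that se by blast
qed

subsection \<open>Biproducts\<close>

text \<open>A relation between modules of arbitrary element types. \<open>direct_sum\<close> changes
  the type and so leaves \<open>fg_modules\<close>, whereas here \<open>D\<close> can be chosen
  inside it.\<close>

definition bip where
  "bip D M N i1 i2 p1 p2 \<longleftrightarrow> lin M D i1 \<and> lin N D i2 \<and> lin D M p1 \<and> lin D N p2 \<and>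
     (\<forall>x\<in>carrier M. p1 (i1 x) = x \<and> p2 (i1 x) = \<zero>\<^bsub>N\<^esub>) \<and>
     (\<forall>y\<in>carrier N. p2 (i2 y) = y \<and> p1 (i2 y) = \<zero>\<^bsub>M\<^esub>) \<and>
     (\<forall>d\<in>carrier D. i1 (p1 d) \<oplus>\<^bsub>D\<^esub> i2 (p2 d) = d)"

definition biprod where "biprod D M N \<longleftrightarrow> (\<exists>i1 i2 p1 p2. bip D M N i1 i2 p1 p2)"

lemma bipD:
  assumes "bip D M N i1 i2 p1 p2"
  shows "lin M D i1" "lin N D i2" "lin D M p1" "lin D N p2"
    "x \<in> carrier M \<Longrightarrow> p1 (i1 x) = x" "x \<in> carrier M \<Longrightarrow> p2 (i1 x) = \<zero>\<^bsub>N\<^esub>"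
    "y \<in> carrier N \<Longrightarrow> p2 (i2 y) = y" "y \<in> carrier N \<Longrightarrow> p1 (i2 y) = \<zero>\<^bsub>M\<^esub>"
    "d \<in> carrier D \<Longrightarrow> i1 (p1 d) \<oplus>\<^bsub>D\<^esub> i2 (p2 d) = d"
  using assms by (auto simp: bip_def)

lemma rmod_direct_sum:
  assumes "rmod M" "rmod N" shows "rmod (direct_sum M N)"
  using assms by (intro rmodI)
    (auto simp: direct_sum_def rmod_assoc ract_add ract_add_left ract_mult intro: rmod_comm)

lemma bip_direct_sum:
  assumes "rmod M" "rmod N"
  shows "bip (direct_sum M N) M N (\<lambda>x. (x, \<zero>\<^bsub>N\<^esub>)) (\<lambda>y. (\<zero>\<^bsub>M\<^esub>, y)) fst snd"
  using assms by (auto simp: bip_def lin_def direct_sum_def)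

lemma biprod_direct_sum: "rmod M \<Longrightarrow> rmod N \<Longrightarrow> biprod (direct_sum M N) M N"
  using bip_direct_sum unfolding biprod_def by blast

lemma bip_iso:
  assumes "bip D M N i1 i2 p1 p2" "lin D D' f" "lin D' D g" "rmod D"
    "\<And>x. x \<in> carrier D \<Longrightarrow> g (f x) = x" "\<And>y. y \<in> carrier D' \<Longrightarrow> f (g y) = y"
  shows "bip D' M N (\<lambda>x. f (i1 x)) (\<lambda>x. f (i2 x)) (\<lambda>x. p1 (g x)) (\<lambda>x. p2 (g x))"
proof -
  note bd = bipD[OF assms(1)]
  note cl = lin_closed[OF bd(1)] lin_closed[OF bd(2)] lin_closed[OF bd(3)] lin_closed[OF bd(4)]
    lin_closed[OF assms(2)] lin_closed[OF assms(3)]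
  show ?thesis
    unfolding bip_def
  proof (intro conjI ballI)
    show "lin M D' (\<lambda>x. f (i1 x))" "lin N D' (\<lambda>x. f (i2 x))"
      "lin D' M (\<lambda>x. p1 (g x))" "lin D' N (\<lambda>x. p2 (g x))"
      by (rule lin_comp[OF bd(1) assms(2)] lin_comp[OF bd(2) assms(2)]
          lin_comp[OF assms(3) bd(3)] lin_comp[OF assms(3) bd(4)])+
  qed (simp_all add: assms(5,6) bd(5-9) cl lin_add[OF assms(2), symmetric])
qed

lemma biprod_iso: "biprod D M N \<Longrightarrow> mod_iso A D D' \<Longrightarrow> rmod D \<Longrightarrow> biprod D' M N"
  by (erule mod_isoE, assumption) (unfold biprod_def, blast dest: bip_iso)

lemma biprod_unique:
  assumes "biprod D M N" "biprod D' M' N'" "mod_iso A M M'" "mod_iso A N N'"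
    and rm: "rmod D" "rmod D'" "rmod M" "rmod N" "rmod M'" "rmod N'"
  shows "mod_iso A D D'"
proof -
  obtain i1 i2 p1 p2 where b: "bip D M N i1 i2 p1 p2" using assms biprod_def by blast
  obtain j1 j2 q1 q2 where c: "bip D' M' N' j1 j2 q1 q2" using assms biprod_def by blast
  obtain f f' where f: "lin M M' f" "lin M' M f'"
    "\<And>x. x \<in> carrier M \<Longrightarrow> f' (f x) = x" "\<And>y. y \<in> carrier M' \<Longrightarrow> f (f' y) = y"
    using mod_isoE[OF assms(3) rm(3)] by metis
  obtain g g' where g: "lin N N' g" "lin N' N g'"
    "\<And>x. x \<in> carrier N \<Longrightarrow> g' (g x) = x" "\<And>y. y \<in> carrier N' \<Longrightarrow> g (g' y) = y"
    using mod_isoE[OF assms(4) rm(4)] by metis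
  note bd = bipD[OF b] and cd = bipD[OF c]
  show ?thesis
  proof (rule mod_isoI[OF rm(1)])
    show "lin D D' (\<lambda>x. j1 (f (p1 x)) \<oplus>\<^bsub>D'\<^esub> j2 (g (p2 x)))"
      by (intro lin_sum lin_comp[OF _ cd(1)] lin_comp[OF _ cd(2)] lin_comp[OF _ f(1)]
          lin_comp[OF _ g(1)] bd rm)
    show "lin D' D (\<lambda>x. i1 (f' (q1 x)) \<oplus>\<^bsub>D\<^esub> i2 (g' (q2 x)))"
      by (intro lin_sum lin_comp[OF _ bd(1)] lin_comp[OF _ bd(2)] lin_comp[OF _ f(2)]
          lin_comp[OF _ g(2)] cd rm)
  qed (use f g bd(5-9) cd(5-9) rm in \<open>simp_all add: lin_closed[OF f(1)] lin_closed[OF f(2)] lin_closed[OF g(1)] lin_closed[OF g(2)]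
     lin_zero[OF f(1)] lin_zero[OF f(2)] lin_zero[OF g(1)] lin_zero[OF g(2)] lin_add[OF f(1)] lin_add[OF f(2)] lin_add[OF g(1)] lin_add[OF g(2)] lin_add[OF cd(3)] lin_add[OF cd(4)]
      lin_add[OF bd(3)] lin_add[OF bd(4)] lin_closed[OF bd(1)] lin_closed[OF bd(2)] lin_closed[OF bd(3)] lin_closed[OF bd(4)]
    lin_closed[OF cd(1)] lin_closed[OF cd(2)] lin_closed[OF cd(3)] lin_closed[OF cd(4)]\<close>)
qed

lemma biprod_iff:
  assumes "rmod D" "rmod M" "rmod N"
  shows "biprod D M N \<longleftrightarrow> mod_iso A D (direct_sum M N)"
proof
  show "mod_iso A D (direct_sum M N)" if "biprod D M N"
    by (rule biprod_unique[OF that biprod_direct_sum]) (use assms in \<open>auto simp: mod_iso_refl rmod_direct_sum\<close>)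
  show "biprod D M N" if "mod_iso A D (direct_sum M N)"
    using biprod_iso[OF biprod_direct_sum] that assms by (meson mod_iso_sym rmod_direct_sum)
qed

lemma biprod_cong:
  assumes "biprod D M N" "mod_iso A M M'" "mod_iso A N N'" "rmod D" "rmod M" "rmod N" "rmod M'" "rmod N'"
  shows "biprod D M' N'"
  using biprod_unique[OF assms(1) biprod_direct_sum[OF assms(7,8)] assms(2,3,4)] assms(4-)
  by (simp add: biprod_iff rmod_direct_sum)

text \<open>Regroups (M + P) + N as M + (P + N), where the inner sum is a module \<open>U\<close>
  given in advance.\<close>

lemma biprod_assoc:
  assumes "biprod T D N" "biprod D M P" "biprod U P N"
    and rm: "rmod T" "rmod D" "rmod N" "rmod M" "rmod P" "rmod U"
  shows "biprod T M U"
proof -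
  obtain i1 i2 p1 p2 where b: "bip T D N i1 i2 p1 p2" using assms biprod_def by blast
  obtain j1 j2 q1 q2 where c: "bip D M P j1 j2 q1 q2" using assms biprod_def by blast
  obtain k1 k2 r1 r2 where d: "bip U P N k1 k2 r1 r2" using assms biprod_def by blast
  note bd = bipD[OF b] and cd = bipD[OF c] and dd = bipD[OF d]
  note cl = lin_closed[OF bd(1)] lin_closed[OF bd(2)] lin_closed[OF bd(3)] lin_closed[OF bd(4)]
    lin_closed[OF cd(1)] lin_closed[OF cd(2)] lin_closed[OF cd(3)] lin_closed[OF cd(4)]
    lin_closed[OF dd(1)] lin_closed[OF dd(2)] lin_closed[OF dd(3)] lin_closed[OF dd(4)]
  note ad = lin_add[OF bd(1)] lin_add[OF bd(2)] lin_add[OF bd(3)] lin_add[OF bd(4)]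
    lin_add[OF cd(1)] lin_add[OF cd(2)] lin_add[OF cd(3)] lin_add[OF cd(4)]
    lin_add[OF dd(1)] lin_add[OF dd(2)] lin_add[OF dd(3)] lin_add[OF dd(4)]
  note ze = lin_zero[OF bd(1)] lin_zero[OF bd(2)] lin_zero[OF bd(3)] lin_zero[OF bd(4)]
    lin_zero[OF cd(1)] lin_zero[OF cd(2)] lin_zero[OF cd(3)] lin_zero[OF cd(4)]
    lin_zero[OF dd(1)] lin_zero[OF dd(2)] lin_zero[OF dd(3)] lin_zero[OF dd(4)]
  have "bip T M U (\<lambda>x. i1 (j1 x)) (\<lambda>u. i1 (j2 (r1 u)) \<oplus>\<^bsub>T\<^esub> i2 (r2 u)) (\<lambda>t. q1 (p1 t))
    (\<lambda>t. k1 (q2 (p1 t)) \<oplus>\<^bsub>U\<^esub> k2 (p2 t))"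
    unfolding bip_def
  proof (intro conjI ballI)
    show "lin M T (\<lambda>x. i1 (j1 x))" by (rule lin_comp[OF cd(1) bd(1)])
    show "lin U T (\<lambda>u. i1 (j2 (r1 u)) \<oplus>\<^bsub>T\<^esub> i2 (r2 u))"
      by (intro lin_sum rm lin_comp[OF dd(4) bd(2)] lin_comp[OF lin_comp[OF dd(3) cd(2)] bd(1)])
    show "lin T M (\<lambda>t. q1 (p1 t))" by (rule lin_comp[OF bd(3) cd(3)])
    show "lin T U (\<lambda>t. k1 (q2 (p1 t)) \<oplus>\<^bsub>U\<^esub> k2 (p2 t))"
      by (intro lin_sum rm lin_comp[OF bd(4) dd(2)] lin_comp[OF lin_comp[OF bd(3) cd(4)] dd(1)])
    fix t assume t: "t \<in> carrier T"
    have "i1 (j1 (q1 (p1 t))) \<oplus>\<^bsub>T\<^esub> (i1 (j2 (q2 (p1 t))) \<oplus>\<^bsub>T\<^esub> i2 (p2 t)) =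
        i1 (j1 (q1 (p1 t)) \<oplus>\<^bsub>D\<^esub> j2 (q2 (p1 t))) \<oplus>\<^bsub>T\<^esub> i2 (p2 t)"
      using t rm by (simp add: cl ad rmod_assoc)
    also have "\<dots> = t" using t cl by (simp add: cd(9) bd(9))
    finally show "i1 (j1 (q1 (p1 t))) \<oplus>\<^bsub>T\<^esub> (i1 (j2 (r1 (k1 (q2 (p1 t)) \<oplus>\<^bsub>U\<^esub> k2 (p2 t)))) \<oplus>\<^bsub>T\<^esub>
        i2 (r2 (k1 (q2 (p1 t)) \<oplus>\<^bsub>U\<^esub> k2 (p2 t)))) = t"
      using t rm by (simp add: cl ad ze dd)
  qed (use rm in \<open>simp_all add: cl ad ze bd(5-9) cd(5-9) dd(5-9)\<close>)
  then show ?thesis unfolding biprod_def by blast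
qed

lemma bip_swap:
  assumes "bip D M N i1 i2 p1 p2" "rmod D" shows "bip D N M i2 i1 p2 p1"
proof -
  note bd = bipD[OF assms(1)]
  show ?thesis
    using bd assms(2) unfolding bip_def
    by (auto simp: rmod_comm[OF assms(2), of "i2 _"] lin_closed[OF bd(1)] lin_closed[OF bd(2)]
        lin_closed[OF bd(3)] lin_closed[OF bd(4)])
qed

lemma biprod_swap: "biprod D M N \<Longrightarrow> rmod D \<Longrightarrow> biprod D N M"
  unfolding biprod_def using bip_swap by blast

text \<open>The complement of the image of \<open>i\<close> is the kernel of the retraction
  \<open>r\<close>, and x - i (r x) projects onto it.\<close>

lemma bip_split:
  assumes "rmod D" "rmod N" "lin N D i" "lin D N r" "\<And>y. y \<in> carrier N \<Longrightarrow> r (i y) = y"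
  shows "bip D (D\<lparr>carrier := {x \<in> carrier D. r x = \<zero>\<^bsub>N\<^esub>}\<rparr>) N (\<lambda>x. x) i (\<lambda>x. x \<ominus>\<^bsub>D\<^esub> i (r x)) r"
proof -
  have "lin D D (\<lambda>x. x \<ominus>\<^bsub>D\<^esub> i (r x))"
    using assms by (intro lin_sub lin_id lin_comp[OF assms(4,3)])
  then have "lin D (D\<lparr>carrier := {x \<in> carrier D. r x = \<zero>\<^bsub>N\<^esub>}\<rparr>) (\<lambda>x. x \<ominus>\<^bsub>D\<^esub> i (r x))"
    by (rule lin_into_sub)
      (use assms in \<open>auto simp: lin_diff[OF assms(4)] lin_closed[OF assms(3)] lin_closed[OF assms(4)]\<close>)
  then show ?thesis
    unfolding bip_def using assms lin_incl[OF assms(1) submodule_ker[OF assms(1,2,4)]]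
    by (auto simp: rmod_diff_add lins[OF assms(3)] lins[OF assms(4)])
qed

text \<open>Write \<open>h\<close> and its inverse \<open>k\<close> as 2x2 block matrices. By
  \<open>z\<close> an off-diagonal block vanishes in each, in the same position, so the diagonal
  blocks between \<open>X\<close> and \<open>X'\<close> are inverse to each other.\<close>

lemma bip_cancel:
  assumes b: "bip D X U i1 i2 p1 p2" and c: "bip D' X' U' j1 j2 q1 q2"
    and h: "lin D D' h" "lin D' D k"
      "\<And>x. x \<in> carrier D \<Longrightarrow> k (h x) = x" "\<And>y. y \<in> carrier D' \<Longrightarrow> h (k y) = y"
    and z: "\<And>u. u \<in> carrier U \<Longrightarrow> q1 (h (i2 u)) = \<zero>\<^bsub>X'\<^esub>" "\<And>u. u \<in> carrier U' \<Longrightarrow> p1 (k (j2 u)) = \<zero>\<^bsub>X\<^esub>"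
    and rm: "rmod D" "rmod D'" "rmod X" "rmod X'" "rmod U" "rmod U'"
  shows "mod_iso A X X'"
proof -
  note bd = bipD[OF b] and cd = bipD[OF c]
  note cl = lin_closed[OF bd(1)] lin_closed[OF bd(2)] lin_closed[OF bd(3)] lin_closed[OF bd(4)]
    lin_closed[OF cd(1)] lin_closed[OF cd(2)] lin_closed[OF cd(3)] lin_closed[OF cd(4)]
    lin_closed[OF h(1)] lin_closed[OF h(2)]
  show ?thesis
  proof (rule mod_isoI[OF rm(3)])
    show "lin X X' (\<lambda>x. q1 (h (i1 x)))" "lin X' X (\<lambda>x. p1 (k (j1 x)))"
      using lin_comp[OF lin_comp[OF bd(1) h(1)] cd(3)] lin_comp[OF lin_comp[OF cd(1) h(2)] bd(3)] by auto
    fix x assume x: "x \<in> carrier X"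
    have "p1 (k (j1 (q1 (h (i1 x))) \<oplus>\<^bsub>D'\<^esub> j2 (q2 (h (i1 x))))) = x"
      using x by (simp add: cd(9) cl h(3) bd)
    then show "p1 (k (j1 (q1 (h (i1 x))))) = x"
      using x rm by (simp add: cl z lin_add[OF h(2)] lin_add[OF bd(3)])
  next
    fix x assume x: "x \<in> carrier X'"
    have "q1 (h (i1 (p1 (k (j1 x))) \<oplus>\<^bsub>D\<^esub> i2 (p2 (k (j1 x))))) = x"
      using x by (simp add: bd(9) cl h(4) cd)
    then show "q1 (h (i1 (p1 (k (j1 x))))) = x"
      using x rm by (simp add: cl z lin_add[OF h(1)] lin_add[OF cd(3)])
  qed
qed

end

section \<open>Finite-dimensional algebras over a field\<close>

locale fd_algebra = ralg A for A :: "('k::field, 'a) module" +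
  assumes smult_eq: "a \<in> carrier A \<Longrightarrow> c \<odot>\<^bsub>A\<^esub> a = (c \<odot>\<^bsub>A\<^esub> \<one>\<^bsub>A\<^esub>) \<otimes>\<^bsub>A\<^esub> a"
    and scalar_closed: "c \<odot>\<^bsub>A\<^esub> \<one>\<^bsub>A\<^esub> \<in> carrier A"
    and scalar_central: "a \<in> carrier A \<Longrightarrow> (c \<odot>\<^bsub>A\<^esub> \<one>\<^bsub>A\<^esub>) \<otimes>\<^bsub>A\<^esub> a = a \<otimes>\<^bsub>A\<^esub> (c \<odot>\<^bsub>A\<^esub> \<one>\<^bsub>A\<^esub>)"
    and scalar_add: "(c + d) \<odot>\<^bsub>A\<^esub> \<one>\<^bsub>A\<^esub> = c \<odot>\<^bsub>A\<^esub> \<one>\<^bsub>A\<^esub> \<oplus>\<^bsub>A\<^esub> d \<odot>\<^bsub>A\<^esub> \<one>\<^bsub>A\<^esub>"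
    and scalar_mult: "(c * d) \<odot>\<^bsub>A\<^esub> \<one>\<^bsub>A\<^esub> = (c \<odot>\<^bsub>A\<^esub> \<one>\<^bsub>A\<^esub>) \<otimes>\<^bsub>A\<^esub> (d \<odot>\<^bsub>A\<^esub> \<one>\<^bsub>A\<^esub>)"
    and scalar_one: "1 \<odot>\<^bsub>A\<^esub> \<one>\<^bsub>A\<^esub> = \<one>\<^bsub>A\<^esub>"
    and finite_dim: "\<exists>B. finite B \<and> B \<subseteq> carrier A \<and>
      (\<forall>H. H \<subseteq> carrier A \<and> \<zero>\<^bsub>A\<^esub> \<in> H \<and> (\<forall>x\<in>H. \<forall>y\<in>H. x \<oplus>\<^bsub>A\<^esub> y \<in> H) \<and>
         (\<forall>c. \<forall>x\<in>H. c \<odot>\<^bsub>A\<^esub> x \<in> H) \<and> B \<subseteq> H \<longrightarrow> H = carrier A)"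
begin

text \<open>The image of a scalar in the centre of \<open>A\<close>. Every module is a vector space
  through the action of these elements, so module homomorphisms are linear over the field.\<close>

definition sc where "sc c = c \<odot>\<^bsub>A\<^esub> \<one>\<^bsub>A\<^esub>"

lemma sc_simps [simp]: "sc c \<in> carrier A" "sc 1 = \<one>\<^bsub>A\<^esub>" "sc 0 = \<zero>\<^bsub>A\<^esub>"
proof -
  show *: "sc c \<in> carrier A" "sc 1 = \<one>\<^bsub>A\<^esub>" for c
    by (auto simp: sc_def scalar_closed scalar_one)
  have "sc 0 \<oplus>\<^bsub>A\<^esub> sc 0 = sc 0" using scalar_add[of 0 0] by (simp add: sc_def)
  then show "sc 0 = \<zero>\<^bsub>A\<^esub>" using * R.add.l_cancel_one by blast
qed

lemma sc_act_simps:
  assumes "rmod M" "x \<in> carrier M"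
  shows "sc (c + d) \<odot>\<^bsub>M\<^esub> x = sc c \<odot>\<^bsub>M\<^esub> x \<oplus>\<^bsub>M\<^esub> sc d \<odot>\<^bsub>M\<^esub> x"
    "sc c \<odot>\<^bsub>M\<^esub> (sc d \<odot>\<^bsub>M\<^esub> x) = sc (c * d) \<odot>\<^bsub>M\<^esub> x"
    "a \<in> carrier A \<Longrightarrow> a \<odot>\<^bsub>M\<^esub> (sc c \<odot>\<^bsub>M\<^esub> x) = sc c \<odot>\<^bsub>M\<^esub> (a \<odot>\<^bsub>M\<^esub> x)"
proof -
  show "sc (c + d) \<odot>\<^bsub>M\<^esub> x = sc c \<odot>\<^bsub>M\<^esub> x \<oplus>\<^bsub>M\<^esub> sc d \<odot>\<^bsub>M\<^esub> x"
    using ract_add_left[OF assms(1) scalar_closed scalar_closed assms(2)] by (simp add: sc_def scalar_add)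
  show "a \<odot>\<^bsub>M\<^esub> (sc c \<odot>\<^bsub>M\<^esub> x) = sc c \<odot>\<^bsub>M\<^esub> (a \<odot>\<^bsub>M\<^esub> x)" if "a \<in> carrier A" for a
    using ract_mult[OF assms(1) _ _ assms(2)] scalar_closed scalar_central[OF that] that
    by (metis sc_def)
  show "sc c \<odot>\<^bsub>M\<^esub> (sc d \<odot>\<^bsub>M\<^esub> x) = sc (c * d) \<odot>\<^bsub>M\<^esub> x"
    using ract_mult[OF assms(1) scalar_closed scalar_closed assms(2)] scalar_mult[of d c]
    by (simp add: sc_def mult.commute)
qed

lemma sc_uminus: "rmod M \<Longrightarrow> x \<in> carrier M \<Longrightarrow> sc (- c) \<odot>\<^bsub>M\<^esub> x = \<ominus>\<^bsub>M\<^esub> (sc c \<odot>\<^bsub>M\<^esub> x)"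
  using sc_act_simps(1)[of M x "- c" c]
  by (metis abelian_group.minus_equality add.left_inverse ract_zero(2) rmod_abelian rmod_closed(5) sc_simps(1) sc_simps(3))

lemma sc_lin: "rmod M \<Longrightarrow> lin M M (\<lambda>x. sc c \<odot>\<^bsub>M\<^esub> x)"
  by (intro linI) (auto simp: ract_add sc_act_simps(3))

subsection \<open>Linear algebra over the ground field\<close>

definition ksub where
  "ksub M H \<longleftrightarrow> H \<subseteq> carrier M \<and> \<zero>\<^bsub>M\<^esub> \<in> H \<and> (\<forall>x\<in>H. \<forall>y\<in>H. x \<oplus>\<^bsub>M\<^esub> y \<in> H) \<and>
     (\<forall>c. \<forall>x\<in>H. sc c \<odot>\<^bsub>M\<^esub> x \<in> H)"

text \<open>Built by adding one scaled generator at a time, without reference to the carrier; hence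
  a submodule record has the same spans as the module (\<open>kspan_carrier_update\<close>).\<close>

inductive_set kspan :: "('a, 'm) module \<Rightarrow> 'm set \<Rightarrow> 'm set" for M S where
  kspan_zero: "\<zero>\<^bsub>M\<^esub> \<in> kspan M S"
| kspan_step: "x \<in> S \<Longrightarrow> h \<in> kspan M S \<Longrightarrow> sc c \<odot>\<^bsub>M\<^esub> x \<oplus>\<^bsub>M\<^esub> h \<in> kspan M S"

lemma ksub_submodule: "rmod M \<Longrightarrow> submodule H A M \<Longrightarrow> ksub M H"
  by (simp add: ksub_def submodule_iff)

lemma ksubD:
  assumes "ksub M H"
  shows "x \<in> H \<Longrightarrow> x \<in> carrier M" "\<zero>\<^bsub>M\<^esub> \<in> H" "x \<in> H \<Longrightarrow> y \<in> H \<Longrightarrow> x \<oplus>\<^bsub>M\<^esub> y \<in> H"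
    "x \<in> H \<Longrightarrow> sc c \<odot>\<^bsub>M\<^esub> x \<in> H"
  using assms by (auto simp: ksub_def)

lemma ksub_diff: "rmod M \<Longrightarrow> ksub M H \<Longrightarrow> x \<in> H \<Longrightarrow> y \<in> H \<Longrightarrow> x \<ominus>\<^bsub>M\<^esub> y \<in> H"
  using ksubD[of M H] sc_uminus[of M y 1] by (metis a_minus_def sc_simps(2) ract_one)

lemma kspan_carrier: "rmod M \<Longrightarrow> S \<subseteq> carrier M \<Longrightarrow> x \<in> kspan M S \<Longrightarrow> x \<in> carrier M"
  by (rotate_tac 2, induction rule: kspan.induct) auto

lemma kspan_least: "ksub M H \<Longrightarrow> S \<subseteq> H \<Longrightarrow> kspan M S \<subseteq> H"
proof
  fix x assume "x \<in> kspan M S" "ksub M H" "S \<subseteq> H"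
  then show "x \<in> H" by (induction rule: kspan.induct) (auto simp: ksub_def)
qed

lemma kspan_ksub:
  assumes "rmod M" "S \<subseteq> carrier M" shows "ksub M (kspan M S)"
proof -
  note c = kspan_carrier[OF assms]
  have add: "x \<oplus>\<^bsub>M\<^esub> y \<in> kspan M S" if "x \<in> kspan M S" "y \<in> kspan M S" for x y
    using that
  proof (induction rule: kspan.induct)
    case kspan_zero then show ?case using assms c by simp
  next
    case (kspan_step x h c')
    have "(sc c' \<odot>\<^bsub>M\<^esub> x \<oplus>\<^bsub>M\<^esub> h) \<oplus>\<^bsub>M\<^esub> y = sc c' \<odot>\<^bsub>M\<^esub> x \<oplus>\<^bsub>M\<^esub> (h \<oplus>\<^bsub>M\<^esub> y)"
      using kspan_step assms c by (intro rmod_assoc) auto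
    then show ?case using kspan_step by (simp add: kspan.kspan_step)
  qed
  have sm: "sc c' \<odot>\<^bsub>M\<^esub> x \<in> kspan M S" if "x \<in> kspan M S" for x c'
    using that
  proof (induction rule: kspan.induct)
    case kspan_zero then show ?case using assms by (simp add: kspan.kspan_zero)
  next
    case (kspan_step x h d)
    have "sc c' \<odot>\<^bsub>M\<^esub> (sc d \<odot>\<^bsub>M\<^esub> x \<oplus>\<^bsub>M\<^esub> h) = sc (c' * d) \<odot>\<^bsub>M\<^esub> x \<oplus>\<^bsub>M\<^esub> sc c' \<odot>\<^bsub>M\<^esub> h"
      using kspan_step assms c by (subst ract_add) (auto simp: sc_act_simps(2) subsetD[OF assms(2)])
    then show ?case using kspan_step by (simp add: kspan.kspan_step)
  qed
  show ?thesis unfolding ksub_def using add sm c kspan_zero by auto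
qed

lemma kspan_base: "rmod M \<Longrightarrow> S \<subseteq> carrier M \<Longrightarrow> S \<subseteq> kspan M S"
proof
  fix x assume *: "rmod M" "S \<subseteq> carrier M" "x \<in> S"
  then show "x \<in> kspan M S" using kspan_step[OF *(3) kspan_zero[of M S], of 1] by (auto simp: subset_iff)
qed

lemma kspan_mono: "S \<subseteq> T \<Longrightarrow> kspan M S \<subseteq> kspan M T"
proof
  fix x assume "x \<in> kspan M S" "S \<subseteq> T"
  then show "x \<in> kspan M T" by (induction rule: kspan.induct) (auto intro: kspan.intros)
qed

lemma kspan_empty: "kspan M {} = {\<zero>\<^bsub>M\<^esub>}"
  by (auto intro: kspan_zero elim: kspan.cases)

lemma kspan_carrier_update [simp]: "kspan (M\<lparr>carrier := H\<rparr>) S = kspan M S"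
proof (intro equalityI subsetI)
  show "x \<in> kspan M S" if "x \<in> kspan (M\<lparr>carrier := H\<rparr>) S" for x
    using that by (induction rule: kspan.induct) (auto intro: kspan.intros)
  show "x \<in> kspan (M\<lparr>carrier := H\<rparr>) S" if "x \<in> kspan M S" for x
    using that by (induction rule: kspan.induct)
      (use kspan.intros[where M = "M\<lparr>carrier := H\<rparr>" and S = S] in auto)
qed

lemma kspan_insert:
  assumes "rmod M" "insert v S \<subseteq> carrier M" "x \<in> kspan M (insert v S)"
  obtains c h where "h \<in> kspan M S" "x = sc c \<odot>\<^bsub>M\<^esub> v \<oplus>\<^bsub>M\<^esub> h"
proof -
  have S: "S \<subseteq> carrier M" "v \<in> carrier M" using assms by auto
  note cl = kspan_carrier[OF assms(1) S(1)]
  have "\<exists>c h. h \<in> kspan M S \<and> x = sc c \<odot>\<^bsub>M\<^esub> v \<oplus>\<^bsub>M\<^esub> h" using assms(3)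
  proof (induction rule: kspan.induct)
    case kspan_zero
    then show ?case using assms S by (intro exI[of _ 0] exI[of _ "\<zero>\<^bsub>M\<^esub>"]) (auto intro: kspan.kspan_zero)
  next
    case (kspan_step y h c)
    then obtain d g where g: "g \<in> kspan M S" "h = sc d \<odot>\<^bsub>M\<^esub> v \<oplus>\<^bsub>M\<^esub> g" by auto
    show ?case
    proof (cases "y = v")
      case True
      have "sc c \<odot>\<^bsub>M\<^esub> y \<oplus>\<^bsub>M\<^esub> h = sc (c + d) \<odot>\<^bsub>M\<^esub> v \<oplus>\<^bsub>M\<^esub> g"
        using True g S assms cl by (simp add: sc_act_simps(1) rmod_assoc)
      then show ?thesis using g by blast
    next
      case False
      then have y: "y \<in> S" using kspan_step by auto
      have "sc c \<odot>\<^bsub>M\<^esub> y \<oplus>\<^bsub>M\<^esub> h = sc d \<odot>\<^bsub>M\<^esub> v \<oplus>\<^bsub>M\<^esub> (sc c \<odot>\<^bsub>M\<^esub> y \<oplus>\<^bsub>M\<^esub> g)"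
        unfolding g(2) using g S y assms cl by (intro rmod_lcomm) auto
      then show ?thesis using kspan.kspan_step[OF y g(1), of c] by blast
    qed
  qed
  then show thesis using that by blast
qed

lemma kspan_insert_ksub:
  assumes "rmod M" "ksub M W" "v \<in> carrier M"
  shows "ksub M {sc c \<odot>\<^bsub>M\<^esub> v \<oplus>\<^bsub>M\<^esub> h |c h. h \<in> W}"
  unfolding ksub_def
proof (intro conjI ballI allI)
  let ?U = "{sc c \<odot>\<^bsub>M\<^esub> v \<oplus>\<^bsub>M\<^esub> h |c h. h \<in> W}"
  note W = ksubD[OF assms(2)]
  show "?U \<subseteq> carrier M" using assms W by auto
  show "\<zero>\<^bsub>M\<^esub> \<in> ?U" using assms W(2) by (auto intro!: exI[of _ 0] exI[of _ "\<zero>\<^bsub>M\<^esub>"])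
  show "x \<oplus>\<^bsub>M\<^esub> y \<in> ?U" if xy: "x \<in> ?U" "y \<in> ?U" for x y
  proof -
    obtain c h where 1: "x = sc c \<odot>\<^bsub>M\<^esub> v \<oplus>\<^bsub>M\<^esub> h" "h \<in> W" using xy(1) by blast
    obtain d g where 2: "y = sc d \<odot>\<^bsub>M\<^esub> v \<oplus>\<^bsub>M\<^esub> g" "g \<in> W" using xy(2) by blast
    note * = 1 2
    have "x \<oplus>\<^bsub>M\<^esub> y = sc (c + d) \<odot>\<^bsub>M\<^esub> v \<oplus>\<^bsub>M\<^esub> (h \<oplus>\<^bsub>M\<^esub> g)"
      using * assms W(1) by (simp add: sc_act_simps(1) rmod_ac)
    then show ?thesis using * W(3) by blast
  qed
  show "sc e \<odot>\<^bsub>M\<^esub> x \<in> ?U" if xy: "x \<in> ?U" for x e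
  proof -
    obtain c h where *: "x = sc c \<odot>\<^bsub>M\<^esub> v \<oplus>\<^bsub>M\<^esub> h" "h \<in> W" using xy by blast
    have "sc e \<odot>\<^bsub>M\<^esub> x = sc (e * c) \<odot>\<^bsub>M\<^esub> v \<oplus>\<^bsub>M\<^esub> sc e \<odot>\<^bsub>M\<^esub> h"
      using * assms W(1) by (simp add: sc_act_simps(2) ract_add)
    then show ?thesis using * W(4) by blast
  qed
qed

text \<open>Induction on the spanning set. If some \<open>w\<close> in \<open>W\<close> has a
  nonzero coefficient at the new generator \<open>v\<close>, then subtracting multiples of
  \<open>w\<close> moves every element of \<open>W\<close> into the part of \<open>W\<close> spanned
  by \<open>S\<close>, to which the induction hypothesis applies.\<close>

lemma ksub_finite_span:
  assumes "rmod M" "finite S" "S \<subseteq> carrier M" "ksub M W" "W \<subseteq> kspan M S"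
  shows "\<exists>T. finite T \<and> T \<subseteq> W \<and> W \<subseteq> kspan M T"
  using assms(2-5)
proof (induction S arbitrary: W)
  case empty
  then show ?case by (intro exI[of _ "{}"]) auto
next
  case (insert v S)
  have S: "S \<subseteq> carrier M" "v \<in> carrier M" using insert by auto
  note W = ksubD[OF insert(5)]
  have kS: "ksub M (kspan M S)" using kspan_ksub assms(1) S by blast
  have "ksub M (W \<inter> kspan M S)" using insert(5) kS by (auto simp: ksub_def)
  then obtain T where T: "finite T" "T \<subseteq> W \<inter> kspan M S" "W \<inter> kspan M S \<subseteq> kspan M T"
    using insert.IH[of "W \<inter> kspan M S"] S by auto
  show ?case
  proof (cases "W \<subseteq> kspan M S")
    case True then show ?thesis using T by auto
  next
    case False
    then obtain w where w: "w \<in> W" "w \<notin> kspan M S" by auto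
    obtain c h where h: "h \<in> kspan M S" "w = sc c \<odot>\<^bsub>M\<^esub> v \<oplus>\<^bsub>M\<^esub> h"
      by (rule kspan_insert[OF assms(1) insert(4), of w]) (use w insert(6) in auto)
    have hc: "h \<in> carrier M" using ksubD(1)[OF kS] h by auto
    have c: "c \<noteq> 0"
    proof
      assume "c = 0" then have "w = h" using h(2) hc S assms by simp
      then show False using h w by simp
    qed
    have TM: "insert w T \<subseteq> carrier M" using T w W by auto
    have "x \<in> kspan M (insert w T)" if x: "x \<in> W" for x
    proof -
      obtain d g where g: "g \<in> kspan M S" "x = sc d \<odot>\<^bsub>M\<^esub> v \<oplus>\<^bsub>M\<^esub> g"
        by (rule kspan_insert[OF assms(1) insert(4), of x]) (use x insert(6) in auto)
      have gc: "g \<in> carrier M" using ksubD(1)[OF kS] g by auto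
      \<comment> \<open>The multiple of \<open>w\<close> that clears the
        \<open>v\<close>-coefficient of \<open>x\<close>.\<close>
      let ?q = "d / c"
      have "sc ?q \<odot>\<^bsub>M\<^esub> w = sc d \<odot>\<^bsub>M\<^esub> v \<oplus>\<^bsub>M\<^esub> sc ?q \<odot>\<^bsub>M\<^esub> h"
        using h(2) hc S assms(1) c by (simp add: ract_add sc_act_simps(2))
      then have "x \<ominus>\<^bsub>M\<^esub> sc ?q \<odot>\<^bsub>M\<^esub> w = g \<ominus>\<^bsub>M\<^esub> sc ?q \<odot>\<^bsub>M\<^esub> h"
        using g(2) gc hc S assms(1)
        by (simp add: a_minus_def abelian_group.minus_add[OF rmod_abelian] rmod_ac)
          (simp add: rmod_assoc[symmetric])
      moreover have "g \<ominus>\<^bsub>M\<^esub> sc ?q \<odot>\<^bsub>M\<^esub> h \<in> kspan M S"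
        using ksub_diff[OF assms(1) kS] g h ksubD(4)[OF kS] by blast
      moreover have "x \<ominus>\<^bsub>M\<^esub> sc ?q \<odot>\<^bsub>M\<^esub> w \<in> W"
        using ksub_diff[OF assms(1) insert(5)] x w W(4) by blast
      ultimately have "x \<ominus>\<^bsub>M\<^esub> sc ?q \<odot>\<^bsub>M\<^esub> w \<in> kspan M T" using T by auto
      then have "x \<ominus>\<^bsub>M\<^esub> sc ?q \<odot>\<^bsub>M\<^esub> w \<in> kspan M (insert w T)" using kspan_mono[of T "insert w T"] by auto
      then have "sc ?q \<odot>\<^bsub>M\<^esub> w \<oplus>\<^bsub>M\<^esub> (x \<ominus>\<^bsub>M\<^esub> sc ?q \<odot>\<^bsub>M\<^esub> w) \<in> kspan M (insert w T)"
        by (intro kspan_step) auto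
      then show ?thesis using rmod_diff_add(3)[OF assms(1)] W(1) x w by (simp add: assms(1))
    qed
    then show ?thesis using T w by (intro exI[of _ "insert w T"]) auto
  qed
qed

text \<open>Steinitz exchange: strip generators off an expression of \<open>w\<close> until one has
  a nonzero coefficient, and solve for that one. The purpose is \<open>kdim_less\<close>.\<close>

lemma kspan_exchange:
  assumes "rmod M" "finite S" "S \<subseteq> carrier M" "w \<in> kspan M S" "w \<noteq> \<zero>\<^bsub>M\<^esub>"
  shows "\<exists>s\<in>S. \<exists>c h. h \<in> kspan M (S - {s}) \<and> s = sc c \<odot>\<^bsub>M\<^esub> w \<oplus>\<^bsub>M\<^esub> h"
  using assms(2-4)
proof (induction S)
  case empty
  then show ?case using assms(5) by (simp add: kspan_empty)
next
  case (insert v S)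
  have S: "S \<subseteq> carrier M" "v \<in> carrier M" using insert by auto
  have kS: "ksub M (kspan M S)" using kspan_ksub assms(1) S by blast
  obtain c h where h: "h \<in> kspan M S" "w = sc c \<odot>\<^bsub>M\<^esub> v \<oplus>\<^bsub>M\<^esub> h"
    by (rule kspan_insert[OF assms(1) insert(4,5)])
  have hc: "h \<in> carrier M" using ksubD(1)[OF kS] h by auto
  show ?case
  proof (cases "c = 0")
    case True
    then have "w = h" using h(2) hc S assms by simp
    then obtain s d g where s: "s \<in> S" "g \<in> kspan M (S - {s})" "s = sc d \<odot>\<^bsub>M\<^esub> w \<oplus>\<^bsub>M\<^esub> g"
      using insert.IH h S by blast
    then have "g \<in> kspan M (insert v S - {s})" using kspan_mono[of "S - {s}" "insert v S - {s}"] by auto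
    then show ?thesis using s by blast
  next
    case False
    let ?i = "inverse c"
    have "sc ?i \<odot>\<^bsub>M\<^esub> w = v \<oplus>\<^bsub>M\<^esub> sc ?i \<odot>\<^bsub>M\<^esub> h"
      using h(2) hc S assms(1) False by (simp add: ract_add sc_act_simps(2))
    then have "v = sc ?i \<odot>\<^bsub>M\<^esub> w \<oplus>\<^bsub>M\<^esub> sc (- ?i) \<odot>\<^bsub>M\<^esub> h"
      using S hc assms(1) by (simp add: sc_uminus rmod_assoc)
    moreover have "sc (- ?i) \<odot>\<^bsub>M\<^esub> h \<in> kspan M (insert v S - {v})"
      using insert(2) ksubD(4)[OF kS] h by simp
    ultimately show ?thesis by blast
  qed
qed

lemma kspan_image:
  assumes "rmod M" "rmod N" "lin M N f" "S \<subseteq> carrier M"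
  shows "f ` kspan M S \<subseteq> kspan N (f ` S)"
proof
  fix y assume "y \<in> f ` kspan M S"
  then obtain x where x: "x \<in> kspan M S" "y = f x" by auto
  have "f x \<in> kspan N (f ` S)" using x(1)
  proof (induction rule: kspan.induct)
    case kspan_zero
    then show ?case using assms by (simp add: lin_zero[OF assms(3)] kspan.kspan_zero)
  next
    case (kspan_step x h c)
    have "f (sc c \<odot>\<^bsub>M\<^esub> x \<oplus>\<^bsub>M\<^esub> h) = sc c \<odot>\<^bsub>N\<^esub> f x \<oplus>\<^bsub>N\<^esub> f h"
      using kspan_step assms kspan_carrier[OF assms(1,4)] by (auto simp: lins[OF assms(3)] subset_iff)
    then show ?case using kspan_step by (auto intro!: kspan.kspan_step)
  qed
  then show "y \<in> kspan N (f ` S)" using x by simp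
qed

text \<open>No basis is required: whatever coefficients are chosen for a vector, they determine it,
  so listing them is injective. This brings a finite-dimensional module into the element type of
  \<open>fg_modules\<close>.\<close>

lemma kspan_embed:
  assumes "rmod M" "finite S" "S \<subseteq> carrier M"
  shows "\<exists>\<epsilon> :: _ \<Rightarrow> nat \<Rightarrow> 'k. inj_on \<epsilon> (kspan M S)"
  using assms(2,3)
proof (induction S)
  case empty
  then show ?case by (simp add: kspan_empty)
next
  case (insert v S)
  then obtain \<epsilon> :: "_ \<Rightarrow> nat \<Rightarrow> 'k" where e: "inj_on \<epsilon> (kspan M S)" by auto
  have "\<forall>x. \<exists>c h. x \<in> kspan M (insert v S) \<longrightarrow> h \<in> kspan M S \<and> x = sc c \<odot>\<^bsub>M\<^esub> v \<oplus>\<^bsub>M\<^esub> h"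
    using kspan_insert[OF assms(1) insert(4)] by metis
  then obtain c h where ch: "\<And>x. x \<in> kspan M (insert v S) \<Longrightarrow> h x \<in> kspan M S \<and>
      x = sc (c x) \<odot>\<^bsub>M\<^esub> v \<oplus>\<^bsub>M\<^esub> h x" by metis
  \<comment> \<open>The new coefficient goes in front and the previous coordinates are shifted by
    one.\<close>
  have "inj_on (\<lambda>x. case_nat (c x) (\<epsilon> (h x))) (kspan M (insert v S))"
  proof (rule inj_onI)
    fix x y assume *: "x \<in> kspan M (insert v S)" "y \<in> kspan M (insert v S)"
      "case_nat (c x) (\<epsilon> (h x)) = case_nat (c y) (\<epsilon> (h y))"
    have "c x = c y" using fun_cong[OF *(3), of 0] by simp
    moreover have "\<epsilon> (h x) = \<epsilon> (h y)"
    proof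
      show "\<epsilon> (h x) n = \<epsilon> (h y) n" for n using fun_cong[OF *(3), of "Suc n"] by simp
    qed
    then have "h x = h y" using e ch * by (meson inj_onD)
    ultimately show "x = y" using ch * by metis
  qed
  then show ?case by blast
qed

definition klin where
  "klin M H l \<longleftrightarrow> (\<forall>x\<in>H. \<forall>y\<in>H. l (x \<oplus>\<^bsub>M\<^esub> y) = l x + l y) \<and> (\<forall>c. \<forall>x\<in>H. l (sc c \<odot>\<^bsub>M\<^esub> x) = c * l x)"

text \<open>One generator \<open>v\<close> at a time, with value 0 at \<open>v\<close>. If
  \<open>v\<close> lies outside \<open>W\<close>, the component in \<open>W\<close> of an element of
  k v + W is well defined (\<open>uniq\<close>), and the functional is applied to that
  component.\<close>

lemma klin_extend:
  assumes "rmod M" "finite S" "S \<subseteq> carrier M" "ksub M U" "klin M U (l :: _ \<Rightarrow> 'k)"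
  shows "\<exists>W l'. ksub M W \<and> U \<subseteq> W \<and> S \<subseteq> W \<and> klin M W (l' :: _ \<Rightarrow> 'k) \<and> (\<forall>x\<in>U. l' x = l x)"
  using assms(2,3)
proof (induction S)
  case empty
  then show ?case using assms by (intro exI[of _ U] exI[of _ l]) auto
next
  case (insert v S)
  then obtain W l' where W: "ksub M W" "U \<subseteq> W" "S \<subseteq> W" "klin M W l'" "\<forall>x\<in>U. l' x = l x"
    by auto
  note Wd = ksubD[OF W(1)]
  have v: "v \<in> carrier M" using insert by auto
  show ?case
  proof (cases "v \<in> W")
    case True
    then show ?thesis using W by (intro exI[of _ W] exI[of _ l']) auto
  next
    case False
    have uniq: "h = h'" if *: "sc c \<odot>\<^bsub>M\<^esub> v \<oplus>\<^bsub>M\<^esub> h = sc c' \<odot>\<^bsub>M\<^esub> v \<oplus>\<^bsub>M\<^esub> h'" "h \<in> W" "h' \<in> W" for c c' h h'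
    proof -
      have hc: "h \<in> carrier M" "h' \<in> carrier M" using that Wd by auto
      interpret M: abelian_group M by (rule rmod_abelian) fact
      have "sc (c - c') \<odot>\<^bsub>M\<^esub> v = sc c \<odot>\<^bsub>M\<^esub> v \<ominus>\<^bsub>M\<^esub> sc c' \<odot>\<^bsub>M\<^esub> v"
        using sc_act_simps(1)[OF assms(1) v, of c "- c'"] v assms(1) by (simp add: sc_uminus a_minus_def)
      also have "\<dots> = ((sc c \<odot>\<^bsub>M\<^esub> v \<oplus>\<^bsub>M\<^esub> h) \<ominus>\<^bsub>M\<^esub> h) \<ominus>\<^bsub>M\<^esub> sc c' \<odot>\<^bsub>M\<^esub> v"
        using v hc assms(1) by (simp add: rmod_diff_add)
      also have "\<dots> = h' \<ominus>\<^bsub>M\<^esub> h"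
        unfolding *(1) using v hc assms(1) by (simp add: M.minus_eq M.a_ac)
      finally have eq: "sc (c - c') \<odot>\<^bsub>M\<^esub> v = h' \<ominus>\<^bsub>M\<^esub> h" .
      \<comment> \<open>Otherwise c - c' is invertible, and \<open>eq\<close> would place
        \<open>v\<close> in \<open>W\<close>.\<close>
      have "c = c'"
      proof (rule ccontr)
        assume "c \<noteq> c'"
        then have "v = sc (inverse (c - c')) \<odot>\<^bsub>M\<^esub> (h' \<ominus>\<^bsub>M\<^esub> h)"
          using v assms(1) by (simp add: eq[symmetric] sc_act_simps(2))
        then show False using False ksub_diff[OF assms(1) W(1) that(3,2)] Wd(4) by metis
      qed
      then show "h = h'" using * hc v assms(1) by (simp add: rmod_add_cancel)
    qed
    let ?U = "{sc c \<odot>\<^bsub>M\<^esub> v \<oplus>\<^bsub>M\<^esub> h |c h. h \<in> W}"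
    define f where "f x = (THE h. h \<in> W \<and> (\<exists>c. x = sc c \<odot>\<^bsub>M\<^esub> v \<oplus>\<^bsub>M\<^esub> h))" for x
    have f: "f (sc c \<odot>\<^bsub>M\<^esub> v \<oplus>\<^bsub>M\<^esub> h) = h" if "h \<in> W" for c h
      unfolding f_def using that uniq by (intro the_equality) blast+
    have kU: "ksub M ?U" by (rule kspan_insert_ksub[OF assms(1) W(1) v])
    have sub: "W \<subseteq> ?U" "v \<in> ?U"
    proof -
      show "W \<subseteq> ?U"
      proof
        fix h assume "h \<in> W"
        then show "h \<in> ?U" using Wd(1) v assms(1) by (intro CollectI exI[of _ 0] exI[of _ h]) auto
      qed
      show "v \<in> ?U" using v assms(1) Wd(2) by (intro CollectI exI[of _ 1] exI[of _ "\<zero>\<^bsub>M\<^esub>"]) auto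
    qed
    have fW: "f h = h" if "h \<in> W" for h using f[OF that, of 0] Wd(1)[OF that] v assms(1) by simp
    have "klin M ?U (\<lambda>x. l' (f x))"
      unfolding klin_def
    proof (intro conjI ballI allI)
      show "l' (f (x \<oplus>\<^bsub>M\<^esub> y)) = l' (f x) + l' (f y)" if xy: "x \<in> ?U" "y \<in> ?U" for x y
      proof -
        obtain c h where 1: "x = sc c \<odot>\<^bsub>M\<^esub> v \<oplus>\<^bsub>M\<^esub> h" "h \<in> W" using xy(1) by blast
        obtain d g where 2: "y = sc d \<odot>\<^bsub>M\<^esub> v \<oplus>\<^bsub>M\<^esub> g" "g \<in> W" using xy(2) by blast
        note * = 1 2
        have "x \<oplus>\<^bsub>M\<^esub> y = sc (c + d) \<odot>\<^bsub>M\<^esub> v \<oplus>\<^bsub>M\<^esub> (h \<oplus>\<^bsub>M\<^esub> g)"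
          using * assms(1) v Wd(1) by (simp add: sc_act_simps(1) rmod_ac)
        then have "f (x \<oplus>\<^bsub>M\<^esub> y) = h \<oplus>\<^bsub>M\<^esub> g" "f x = h" "f y = g" using f * Wd(3) by auto
        then show ?thesis using W(4) * by (simp add: klin_def)
      qed
      show "l' (f (sc e \<odot>\<^bsub>M\<^esub> x)) = e * l' (f x)" if xy: "x \<in> ?U" for x e
      proof -
        obtain c h where *: "x = sc c \<odot>\<^bsub>M\<^esub> v \<oplus>\<^bsub>M\<^esub> h" "h \<in> W" using xy by blast
        have "sc e \<odot>\<^bsub>M\<^esub> x = sc (e * c) \<odot>\<^bsub>M\<^esub> v \<oplus>\<^bsub>M\<^esub> sc e \<odot>\<^bsub>M\<^esub> h"
          using * assms(1) v Wd(1) by (simp add: sc_act_simps(2) ract_add)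
        then have "f (sc e \<odot>\<^bsub>M\<^esub> x) = sc e \<odot>\<^bsub>M\<^esub> h" "f x = h" using f * Wd(4) by auto
        then show ?thesis using W(4) * by (simp add: klin_def)
      qed
    qed
    moreover have "\<forall>x\<in>U. l' (f x) = l x" using W fW by auto
    ultimately show ?thesis using kU sub W(2,3)
      by (intro exI[of _ ?U] exI[of _ "\<lambda>x. l' (f x)"]) auto
  qed
qed

subsection \<open>Finite-dimensional modules\<close>

text \<open>A finite spanning set over the field, for any type of elements;
  \<open>fd_finitely_generated\<close> compares it with generation over \<open>A\<close>.\<close>

definition fd where "fd M \<longleftrightarrow> rmod M \<and> (\<exists>S. finite S \<and> S \<subseteq> carrier M \<and> carrier M \<subseteq> kspan M S)"

lemma fdE:
  assumes "fd M"
  obtains S where "finite S" "S \<subseteq> carrier M" "carrier M \<subseteq> kspan M S"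
  using assms by (auto simp: fd_def)

lemma fd_rmod [simp, intro]: "fd M \<Longrightarrow> rmod M" by (simp add: fd_def)

lemma fd_klin_extend:
  assumes "fd M" "ksub M U" "klin M U (l :: _ \<Rightarrow> 'k)"
  shows "\<exists>l' :: _ \<Rightarrow> 'k. klin M (carrier M) l' \<and> (\<forall>x\<in>U. l' x = l x)"
proof -
  obtain S where S: "finite S" "S \<subseteq> carrier M" "carrier M \<subseteq> kspan M S" using fdE[OF assms(1)] by metis
  obtain W l' where W: "ksub M W" "S \<subseteq> W" "klin M W (l' :: _ \<Rightarrow> 'k)" "\<forall>x\<in>U. l' x = l x"
    using klin_extend[OF fd_rmod[OF assms(1)] S(1,2) assms(2,3)] by blast
  have "carrier M = W" using W kspan_least[OF W(1,2)] S ksubD(1)[OF W(1)] by blast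
  then show ?thesis using W by blast
qed

lemma fd_sub: "fd M \<Longrightarrow> submodule H A M \<Longrightarrow> fd (M\<lparr>carrier := H\<rparr>)"
proof -
  assume *: "fd M" "submodule H A M"
  obtain S where S: "finite S" "S \<subseteq> carrier M" "carrier M \<subseteq> kspan M S" using fdE[OF *(1)] by metis
  have "H \<subseteq> carrier M" using * by (simp add: submodule_iff)
  then have "H \<subseteq> kspan M S" using S(3) by (rule order_trans)
  then obtain T where "finite T" "T \<subseteq> H" "H \<subseteq> kspan M T"
    using ksub_finite_span[OF fd_rmod S(1,2) ksub_submodule] * by (metis fd_rmod)
  then show "fd (M\<lparr>carrier := H\<rparr>)" unfolding fd_def using * by (auto simp: rmod_sub)
qed

lemma fd_image:
  assumes "fd M" "rmod N" "lin M N f" "carrier N \<subseteq> f ` carrier M" shows "fd N"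
proof -
  obtain S where S: "finite S" "S \<subseteq> carrier M" "carrier M \<subseteq> kspan M S" using fdE[of M] assms by metis
  have "carrier N \<subseteq> f ` kspan M S" using assms(4) image_mono[OF S(3)] by (rule order_trans)
  then have "carrier N \<subseteq> kspan N (f ` S)"
    using kspan_image[OF fd_rmod[OF assms(1)] assms(2,3) S(2)] by (rule order_trans)
  moreover have "f ` S \<subseteq> carrier N" using S lin_closed[OF assms(3)] by auto
  ultimately show ?thesis using assms S unfolding fd_def by blast
qed

lemma fd_iso: "fd M \<Longrightarrow> mod_iso A M N \<Longrightarrow> rmod N \<Longrightarrow> fd N"
proof (erule mod_isoE, simp)
  fix f g
  assume *: "fd M" "rmod N" "lin M N f" "lin N M g" "\<And>y. y \<in> carrier N \<Longrightarrow> f (g y) = y"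
  have "carrier N \<subseteq> f ` carrier M" using *(5) lin_closed[OF *(4)] by (metis image_eqI subsetI)
  then show "fd N" using fd_image * by blast
qed

lemma fd_biprod:
  assumes "rmod D" "fd M" "fd N" "biprod D M N" shows "fd D"
proof -
  obtain i1 i2 p1 p2 where b: "bip D M N i1 i2 p1 p2" using assms biprod_def by blast
  obtain S where S: "finite S" "S \<subseteq> carrier M" "carrier M \<subseteq> kspan M S" using fdE[of M] assms by metis
  obtain T where T: "finite T" "T \<subseteq> carrier N" "carrier N \<subseteq> kspan N T" using fdE[of N] assms by metis
  note bd = bipD[OF b]
  let ?U = "i1 ` S \<union> i2 ` T"
  have U: "?U \<subseteq> carrier D" using S T lin_closed[OF bd(1)] lin_closed[OF bd(2)] by auto
  have "i1 x \<in> kspan D ?U" if "x \<in> carrier M" for x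
    using kspan_image[OF fd_rmod[OF assms(2)] assms(1) bd(1) S(2)] that S kspan_mono[of "i1 ` S" ?U D] by blast
  moreover have "i2 x \<in> kspan D ?U" if "x \<in> carrier N" for x
    using kspan_image[OF fd_rmod[OF assms(3)] assms(1) bd(2) T(2)] that T kspan_mono[of "i2 ` T" ?U D] by blast
  ultimately have "i1 (p1 d) \<oplus>\<^bsub>D\<^esub> i2 (p2 d) \<in> kspan D ?U" if "d \<in> carrier D" for d
    using ksubD(3)[OF kspan_ksub[OF assms(1) U]] that lin_closed[OF bd(3)] lin_closed[OF bd(4)] by blast
  then have "carrier D \<subseteq> kspan D ?U" using bd(9) by (metis subsetI)
  then show ?thesis unfolding fd_def using assms U S T by (intro conjI exI[of _ ?U]) auto
qed

lemma fd_direct_sum: "fd M \<Longrightarrow> fd N \<Longrightarrow> fd (direct_sum M N)"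
  using fd_biprod biprod_direct_sum rmod_direct_sum by (metis fd_rmod)

definition regular where
  "regular = \<lparr>carrier = carrier A, mult = (\<lambda>_ _. undefined), one = undefined,
     zero = \<zero>\<^bsub>A\<^esub>, add = (\<lambda>x y. x \<oplus>\<^bsub>A\<^esub> y), smult = (\<lambda>a x. x \<otimes>\<^bsub>A\<^esub> a)\<rparr>"

lemma rmod_regular: "rmod regular"
  by (rule rmodI) (auto simp: regular_def R.a_ac R.l_distr R.r_distr R.m_assoc)

lemma fd_regular: "fd regular"
proof -
  obtain B where B: "finite B" "B \<subseteq> carrier A"
    "\<And>H. H \<subseteq> carrier A \<Longrightarrow> \<zero>\<^bsub>A\<^esub> \<in> H \<Longrightarrow> (\<And>x y. x\<in>H \<Longrightarrow> y\<in>H \<Longrightarrow> x \<oplus>\<^bsub>A\<^esub> y \<in> H) \<Longrightarrow>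
         (\<And>c x. x\<in>H \<Longrightarrow> c \<odot>\<^bsub>A\<^esub> x \<in> H) \<Longrightarrow> B \<subseteq> H \<Longrightarrow> H = carrier A" using finite_dim by metis
  have Bs: "B \<subseteq> carrier regular" using B by (simp add: regular_def)
  note k = kspan_ksub[OF rmod_regular Bs]
  have "kspan regular B = carrier A"
  proof (rule B(3))
    show "kspan regular B \<subseteq> carrier A" using ksubD(1)[OF k] by (auto simp: regular_def)
    show "\<zero>\<^bsub>A\<^esub> \<in> kspan regular B" using ksubD(2)[OF k] by (auto simp: regular_def)
    show "x \<oplus>\<^bsub>A\<^esub> y \<in> kspan regular B" if "x \<in> kspan regular B" "y \<in> kspan regular B" for x y
      using ksubD(3)[OF k] that by (auto simp: regular_def)
    show "c \<odot>\<^bsub>A\<^esub> x \<in> kspan regular B" if "x \<in> kspan regular B" for x c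
    proof -
      have "x \<in> carrier A" using ksubD(1)[OF k] that by (auto simp: regular_def)
      then have "c \<odot>\<^bsub>A\<^esub> x = x \<otimes>\<^bsub>A\<^esub> sc c" using smult_eq[of x c] scalar_central[of x c] by (simp add: sc_def)
      then show ?thesis using ksubD(4)[OF k that, of c] by (simp add: regular_def)
    qed
    show "B \<subseteq> kspan regular B" by (rule kspan_base[OF rmod_regular Bs])
  qed
  then show ?thesis unfolding fd_def using rmod_regular B(1) Bs by (auto simp: regular_def)
qed

text \<open>From right to left: if \<open>B\<close> spans \<open>A\<close> over the field and
  \<open>S\<close> generates \<open>M\<close>, the products of elements of \<open>S\<close> with
  elements of \<open>B\<close> span \<open>M\<close>, because their span is stable under
  \<open>A\<close> and contains \<open>S\<close>.\<close>

lemma fd_finitely_generated: "fd M \<longleftrightarrow> rmod M \<and> finitely_generated A M"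
proof (intro iffI conjI)
  assume M: "fd M"
  then show "rmod M" by simp
  obtain S where S: "finite S" "S \<subseteq> carrier M" "carrier M \<subseteq> kspan M S" using fdE[of M] M by metis
  show "finitely_generated A M"
    unfolding finitely_generated_def
  proof (intro exI conjI allI impI)
    fix H assume H: "submodule H A M \<and> S \<subseteq> H"
    then have "kspan M S \<subseteq> H" using kspan_least ksub_submodule M fd_rmod by metis
    moreover have "H \<subseteq> carrier M" using H M by (simp add: submodule_iff)
    ultimately show "H = carrier M" using S(3) by simp
  qed (use S in auto)
next
  assume *: "rmod M \<and> finitely_generated A M"
  then have M: "rmod M" by simp
  obtain S where S: "finite S" "S \<subseteq> carrier M"
    "\<And>H. submodule H A M \<Longrightarrow> S \<subseteq> H \<Longrightarrow> H = carrier M" using * finitely_generated_def by (metis (no_types, lifting))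
  obtain B where B: "finite B" "B \<subseteq> carrier A" "carrier A \<subseteq> kspan regular B"
    using fd_regular unfolding fd_def by (auto simp: regular_def)
  let ?T = "(\<lambda>(b, s). b \<odot>\<^bsub>M\<^esub> s) ` (B \<times> S)"
  have T: "?T \<subseteq> carrier M" using S(2) B(2) M by (auto simp: subset_iff)
  note k = kspan_ksub[OF M T]
  have bs: "a \<odot>\<^bsub>M\<^esub> s \<in> kspan M ?T" if a: "a \<in> carrier A" and s: "s \<in> S" for a s
  proof -
    have sM: "s \<in> carrier M" using s S by auto
    have l: "lin regular M (\<lambda>a. a \<odot>\<^bsub>M\<^esub> s)"
      using sM M by (intro linI) (auto simp: regular_def ract_add_left ract_mult)
    have "a \<odot>\<^bsub>M\<^esub> s \<in> kspan M ((\<lambda>a. a \<odot>\<^bsub>M\<^esub> s) ` B)"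
      using kspan_image[OF rmod_regular M l, of B] a B by (auto simp: regular_def)
    moreover have "(\<lambda>a. a \<odot>\<^bsub>M\<^esub> s) ` B \<subseteq> ?T" using s by auto
    ultimately show ?thesis using kspan_mono by blast
  qed
  have "submodule (kspan M ?T) A M"
    unfolding submodule_iff[OF M]
  proof (intro conjI ballI)
    show "a \<odot>\<^bsub>M\<^esub> x \<in> kspan M ?T" if "x \<in> kspan M ?T" and a: "a \<in> carrier A" for a x
      using that(1)
    proof (induction rule: kspan.induct)
      case kspan_zero
      then show ?case using a M by (simp add: kspan.kspan_zero)
    next
      case (kspan_step x h c)
      then obtain b s where x: "x = b \<odot>\<^bsub>M\<^esub> s" "b \<in> B" "s \<in> S" by auto
      have c: "h \<in> carrier M" "b \<in> carrier A" "s \<in> carrier M" using ksubD(1)[OF k] kspan_step x S B by auto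
      have "a \<odot>\<^bsub>M\<^esub> (sc c \<odot>\<^bsub>M\<^esub> x \<oplus>\<^bsub>M\<^esub> h) = sc c \<odot>\<^bsub>M\<^esub> ((b \<otimes>\<^bsub>A\<^esub> a) \<odot>\<^bsub>M\<^esub> s) \<oplus>\<^bsub>M\<^esub> a \<odot>\<^bsub>M\<^esub> h"
        using c x a M by (simp add: ract_add sc_act_simps(3) ract_mult)
      then show ?case using kspan_step bs[of "b \<otimes>\<^bsub>A\<^esub> a" s] c x a ksubD[OF k] by auto
    qed
  qed (use ksubD[OF k] in auto)
  moreover have "S \<subseteq> kspan M ?T"
  proof
    fix s assume "s \<in> S"
    then show "s \<in> kspan M ?T" using bs[of "\<one>\<^bsub>A\<^esub>" s] S M by auto
  qed
  ultimately have "kspan M ?T = carrier M" using S by blast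
  then show "fd M" unfolding fd_def using M T S B by (intro conjI exI[of _ ?T]) auto
qed

lemma fg_modules_iff: "M \<in> fg_modules A \<longleftrightarrow> fd M"
  by (simp add: fg_modules_def fd_finitely_generated)

text \<open>Transport of structure along an injection of the carrier into
  \<open>nat \<Rightarrow> 'k\<close>. Every construction that changes the element type returns to
  \<open>fg_modules\<close> in this way.\<close>

lemma fd_transport:
  assumes "fd M" obtains N where "N \<in> fg_modules A" "mod_iso A M N"
proof -
  obtain S where S: "finite S" "S \<subseteq> carrier M" "carrier M \<subseteq> kspan M S" using fdE[of M] assms by metis
  then obtain \<epsilon> :: "_ \<Rightarrow> nat \<Rightarrow> 'k" where "inj_on \<epsilon> (kspan M S)" using kspan_embed[of M S] assms by blast
  then have e: "inj_on \<epsilon> (carrier M)" using S inj_on_subset by blast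
  define \<delta> where "\<delta> = inv_into (carrier M) \<epsilon>"
  have d [simp]: "\<delta> (\<epsilon> x) = x" if "x \<in> carrier M" for x using e that by (simp add: \<delta>_def)
  define N :: "('a, nat \<Rightarrow> 'k) module" where "N = \<lparr>carrier = \<epsilon> ` carrier M, mult = (\<lambda>_ _. undefined), one = undefined,
     zero = \<epsilon> \<zero>\<^bsub>M\<^esub>, add = (\<lambda>x y. \<epsilon> (\<delta> x \<oplus>\<^bsub>M\<^esub> \<delta> y)), smult = (\<lambda>a x. \<epsilon> (a \<odot>\<^bsub>M\<^esub> \<delta> x))\<rparr>"
  have M: "rmod M" using assms by simp
  have N: "rmod N"
    by (rule rmodI) (use M in \<open>auto simp: N_def rmod_assoc ract_add ract_add_left ract_mult rmod_ac\<close>)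
  have iso: "mod_iso A M N"
    by (rule mod_isoI[OF M, of N \<epsilon> \<delta>]) (use M in \<open>auto simp: N_def lin_def\<close>)
  show thesis by (rule that[OF _ iso]) (use fd_iso[OF assms iso N] fg_modules_iff in blast)
qed

text \<open>Serves as an induction measure: splitting off a nonzero summand lowers it
  (\<open>kdim_biprod\<close>).\<close>

definition kdim where "kdim M = (LEAST n. \<exists>S. finite S \<and> S \<subseteq> carrier M \<and> carrier M \<subseteq> kspan M S \<and> card S = n)"

text \<open>In a smallest spanning set of \<open>M\<close> some \<open>s\<close> can be exchanged
  for \<open>w\<close>. As \<open>p\<close> kills \<open>w\<close>, the images of the remaining
  elements already span \<open>N\<close>.\<close>

lemma kdim_less:
  assumes "fd M" "rmod N" "lin M N p" "carrier N \<subseteq> p ` carrier M"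
    "w \<in> carrier M" "w \<noteq> \<zero>\<^bsub>M\<^esub>" "p w = \<zero>\<^bsub>N\<^esub>"
  shows "kdim N < kdim M"
proof -
  have M: "rmod M" using assms by simp
  have "\<exists>n S. finite S \<and> S \<subseteq> carrier M \<and> carrier M \<subseteq> kspan M S \<and> card S = n" using assms(1) fd_def by auto
  from LeastI_ex[OF this] obtain S where S: "finite S" "S \<subseteq> carrier M" "carrier M \<subseteq> kspan M S" "card S = kdim M"
    unfolding kdim_def by blast
  obtain s c h where s: "s \<in> S" "h \<in> kspan M (S - {s})" "s = sc c \<odot>\<^bsub>M\<^esub> w \<oplus>\<^bsub>M\<^esub> h"
    using kspan_exchange[OF M S(1,2)] assms S by blast
  let ?T = "p ` (S - {s})"
  have Sc: "S - {s} \<subseteq> carrier M" using S by auto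
  have T: "?T \<subseteq> carrier N" using Sc lin_closed[OF assms(3)] by auto
  have hc: "h \<in> carrier M" using kspan_carrier[OF M Sc] s by simp
  have "p s = p h" unfolding s(3) using hc assms(2,5,7) M by (simp add: lins[OF assms(3)])
  then have "p s \<in> kspan N ?T" using kspan_image[OF M assms(2,3) Sc] s by auto
  then have "p ` S \<subseteq> kspan N ?T" using kspan_base[OF assms(2) T] by auto
  then have "kspan N (p ` S) \<subseteq> kspan N ?T" using kspan_least[OF kspan_ksub[OF assms(2) T]] by blast
  then have "p ` kspan M S \<subseteq> kspan N ?T" using kspan_image[OF M assms(2,3) S(2)] by (rule order_trans[rotated])
  then have "carrier N \<subseteq> kspan N ?T" using assms(4) image_mono[OF S(3), of p] by (meson order_trans)
  then have "kdim N \<le> card ?T" unfolding kdim_def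
    by (intro Least_le exI[of _ ?T] conjI T finite_imageI finite_Diff S(1) refl)
  also have "\<dots> \<le> card (S - {s})" using S by (simp add: card_image_le)
  also have "\<dots> < kdim M" using S s by (metis card_Diff1_less)
  finally show ?thesis .
qed

lemma kdim_biprod:
  assumes "fd D" "rmod M" "rmod N" "biprod D M N" "carrier N \<noteq> {\<zero>\<^bsub>N\<^esub>}"
  shows "kdim M < kdim D"
proof -
  obtain i1 i2 p1 p2 where b: "bip D M N i1 i2 p1 p2" using assms biprod_def by blast
  note bd = bipD[OF b]
  obtain y where y: "y \<in> carrier N" "y \<noteq> \<zero>\<^bsub>N\<^esub>" using assms(3,5) rmod_closed(1) by blast
  show ?thesis
  proof (rule kdim_less[OF assms(1,2) bd(3)])
    show "carrier M \<subseteq> p1 ` carrier D" using bd(5) lin_closed[OF bd(1)] by (metis image_eqI subsetI)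
    show "i2 y \<in> carrier D" using y lin_closed[OF bd(2)] by auto
    show "i2 y \<noteq> \<zero>\<^bsub>D\<^esub>" using y bd(7) lin_zero[OF bd(4)] assms by force
    show "p1 (i2 y) = \<zero>\<^bsub>M\<^esub>" using y bd by auto
  qed
qed

subsection \<open>Projective modules and resolutions\<close>

text \<open>Projectivity without membership in \<open>fg_modules\<close>, hence also meaningful for
  modules of another element type such as \<open>regular\<close>.\<close>

definition lifts where
  "lifts P \<longleftrightarrow> (\<forall>M\<in>fg_modules A. \<forall>N\<in>fg_modules A. \<forall>g f. lin M N g \<longrightarrow> lin P N f \<longrightarrow>
     carrier N \<subseteq> g ` carrier M \<longrightarrow> (\<exists>h. lin P M h \<and> (\<forall>x\<in>carrier P. g (h x) = f x)))"

lemma liftsD: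
  assumes "lifts P" "M \<in> fg_modules A" "N \<in> fg_modules A" "lin M N g" "lin P N f"
    "carrier N \<subseteq> g ` carrier M"
  obtains h where "lin P M h" "\<And>x. x \<in> carrier P \<Longrightarrow> g (h x) = f x"
  using assms unfolding lifts_def by blast

lemma fg_fd [simp]: "M \<in> fg_modules A \<Longrightarrow> fd M" by (simp add: fg_modules_iff)

lemma fg_rmod [simp]: "M \<in> fg_modules A \<Longrightarrow> rmod M" by (simp add: fg_modules_iff)

lemma compose_eq_iff:
  assumes "f \<in> extensional S"
  shows "compose S g h = f \<longleftrightarrow> (\<forall>x\<in>S. g (h x) = f x)"
proof
  assume *: "\<forall>x\<in>S. g (h x) = f x"
  show "compose S g h = f"
  proof
    fix x show "compose S g h x = f x"
      using * extensional_arb[OF assms, of x] by (cases "x \<in> S") (simp_all add: compose_def)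
  qed
next
  assume "compose S g h = f"
  then show "\<forall>x\<in>S. g (h x) = f x" by (metis compose_eq)
qed

lemma projective_iff: "projective_module A P \<longleftrightarrow> P \<in> fg_modules A \<and> lifts P"
proof (intro iffI conjI)
  assume P: "projective_module A P"
  then show fgP: "P \<in> fg_modules A" by (simp add: projective_module_def)
  show "lifts P"
    unfolding lifts_def
  proof (intro ballI allI impI)
    fix M N g f
    assume MN: "M \<in> fg_modules A" "N \<in> fg_modules A" and g: "lin M N g" and f: "lin P N f"
      and surj: "carrier N \<subseteq> g ` carrier M"
    let ?g = "restrict g (carrier M)" and ?f = "restrict f (carrier P)"
    have "?g \<in> mod_hom A M N" "?f \<in> mod_hom A P N" using MN fgP g f by (auto intro!: mod_hom_restrict)
    moreover have "?g ` carrier M = carrier N" using surj lin_closed[OF g] by auto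
    ultimately obtain h where h: "h \<in> mod_hom A P M" "compose (carrier P) ?g h = ?f"
      using P MN unfolding projective_module_def by meson
    then have "lin P M h" by (simp add: mod_hom_iff)
    moreover have "\<forall>x\<in>carrier P. g (h x) = f x"
      using h(2) lin_closed[OF \<open>lin P M h\<close>] by (simp add: compose_eq_iff)
    ultimately show "\<exists>h. lin P M h \<and> (\<forall>x\<in>carrier P. g (h x) = f x)" by blast
  qed
next
  assume P: "P \<in> fg_modules A \<and> lifts P"
  show "projective_module A P"
    unfolding projective_module_def
  proof (intro conjI ballI impI)
    show "P \<in> fg_modules A" using P by simp
    fix M N g f
    assume *: "M \<in> fg_modules A" "N \<in> fg_modules A" "g \<in> mod_hom A M N" "f \<in> mod_hom A P N"
      "g ` carrier M = carrier N"
    obtain h where h: "lin P M h" "\<And>x. x \<in> carrier P \<Longrightarrow> g (h x) = f x"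
      using liftsD[of P M N g f] P * by (auto simp: mod_hom_iff)
    show "\<exists>h \<in> mod_hom A P M. compose (carrier P) g h = f"
    proof
      show "restrict h (carrier P) \<in> mod_hom A P M" using h P by (auto intro!: mod_hom_restrict)
      show "compose (carrier P) g (restrict h (carrier P)) = f"
        using * h by (subst compose_eq_iff) (auto simp: mod_hom_iff)
    qed
  qed
qed

lemma projective_fg [simp]: "projective_module A P \<Longrightarrow> P \<in> fg_modules A"
  by (simp add: projective_iff)

lemma projective_rmod [simp]: "projective_module A P \<Longrightarrow> rmod P"
  by (simp add: projective_iff)

lemma fg_sub: "M \<in> fg_modules A \<Longrightarrow> submodule H A M \<Longrightarrow> M\<lparr>carrier := H\<rparr> \<in> fg_modules A"
  by (simp add: fg_modules_iff fd_sub)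

text \<open>Replacing the target by the image of \<open>g\<close> makes \<open>g\<close> surjective.
  In this form projectivity applies to the differentials of a resolution.\<close>

lemma projective_lift:
  assumes "projective_module A P" "M \<in> fg_modules A" "N \<in> fg_modules A" "lin M N g" "lin P N f"
    "f ` carrier P \<subseteq> g ` carrier M"
  obtains h where "lin P M h" "\<And>x. x \<in> carrier P \<Longrightarrow> g (h x) = f x"
proof -
  let ?N = "N\<lparr>carrier := g ` carrier M\<rparr>"
  have N: "?N \<in> fg_modules A"
    using assms by (intro fg_sub submodule_image[OF _ _ assms(4)] submodule_carrier) auto
  show thesis
    by (rule liftsD[of P M ?N g f])
      (use assms N that in \<open>auto simp: projective_iff intro!: lin_into_sub\<close>)
qed

lemma lifts_zero: assumes "rmod P" "carrier P = {\<zero>\<^bsub>P\<^esub>}" shows "lifts P"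
  unfolding lifts_def
proof (intro ballI allI impI)
  fix M N g f assume *: "M \<in> fg_modules A" "N \<in> fg_modules A" "lin M N g" "lin P N f"
  show "\<exists>h. lin P M h \<and> (\<forall>x\<in>carrier P. g (h x) = f x)"
    using * assms lin_zero[OF *(3)] lin_zero[OF *(4)]
    by (intro exI[of _ "\<lambda>x. \<zero>\<^bsub>M\<^esub>"]) (auto intro: lin_const_zero)
qed

lemma lifts_regular: "lifts regular"
  unfolding lifts_def
proof (intro ballI allI impI)
  fix M N :: "('a, nat \<Rightarrow> 'k) module" and g and f :: "'a \<Rightarrow> nat \<Rightarrow> 'k"
  assume *: "M \<in> fg_modules A" "N \<in> fg_modules A" "lin M N g" "lin regular N f"
    "carrier N \<subseteq> g ` carrier M"
  have "f \<one>\<^bsub>A\<^esub> \<in> carrier N" using lin_closed[OF *(4), of "\<one>\<^bsub>A\<^esub>"] by (simp add: regular_def)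
  then obtain m where m: "m \<in> carrier M" "g m = f \<one>\<^bsub>A\<^esub>" using *(5) by force
  have "lin regular M (\<lambda>a. a \<odot>\<^bsub>M\<^esub> m)"
    using m * by (intro linI) (auto simp: regular_def ract_add_left ract_mult)
  moreover have "g (a \<odot>\<^bsub>M\<^esub> m) = f a" if "a \<in> carrier A" for a
    using lin_act[OF *(4) that, of "\<one>\<^bsub>A\<^esub>"] that m by (simp add: lin_act[OF *(3)] regular_def)
  ultimately show "\<exists>h. lin regular M h \<and> (\<forall>x\<in>carrier regular. g (h x) = f x)"
    by (intro exI[of _ "\<lambda>a. a \<odot>\<^bsub>M\<^esub> m"]) (auto simp: regular_def)
qed

lemma lifts_biprod:
  assumes "rmod D" "rmod P" "rmod P'" "lifts P" "lifts P'" "biprod D P P'"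
  shows "lifts D"
  unfolding lifts_def
proof (intro ballI allI impI)
  obtain i1 i2 p1 p2 where b: "bip D P P' i1 i2 p1 p2" using assms biprod_def by blast
  note bd = bipD[OF b]
  fix M N g f
  assume *: "M \<in> fg_modules A" "N \<in> fg_modules A" "lin M N g" "lin D N f" "carrier N \<subseteq> g ` carrier M"
  obtain h1 where h1: "lin P M h1" "\<And>x. x \<in> carrier P \<Longrightarrow> g (h1 x) = f (i1 x)"
    using liftsD[OF assms(4) *(1-3) lin_comp[OF bd(1) *(4)] *(5)] by metis
  obtain h2 where h2: "lin P' M h2" "\<And>x. x \<in> carrier P' \<Longrightarrow> g (h2 x) = f (i2 x)"
    using liftsD[OF assms(5) *(1-3) lin_comp[OF bd(2) *(4)] *(5)] by metis
  show "\<exists>h. lin D M h \<and> (\<forall>x\<in>carrier D. g (h x) = f x)"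
  proof (intro exI conjI ballI)
    show "lin D M (\<lambda>x. h1 (p1 x) \<oplus>\<^bsub>M\<^esub> h2 (p2 x))"
      using * assms by (intro lin_sum lin_comp[OF bd(3) h1(1)] lin_comp[OF bd(4) h2(1)]) auto
    fix x assume x: "x \<in> carrier D"
    have c: "p1 x \<in> carrier P" "p2 x \<in> carrier P'" using x lin_closed[OF bd(3)] lin_closed[OF bd(4)] by auto
    have "g (h1 (p1 x) \<oplus>\<^bsub>M\<^esub> h2 (p2 x)) = f (i1 (p1 x)) \<oplus>\<^bsub>N\<^esub> f (i2 (p2 x))"
      using c by (simp add: lin_add[OF *(3)] lin_closed[OF h1(1)] lin_closed[OF h2(1)] h1 h2)
    also have "\<dots> = f x"
      using c x lin_add[OF *(4), symmetric] lin_closed[OF bd(1)] lin_closed[OF bd(2)] bd(9) by simp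
    finally show "g (h1 (p1 x) \<oplus>\<^bsub>M\<^esub> h2 (p2 x)) = f x" .
  qed
qed

lemma lifts_iso:
  assumes "lifts P" "mod_iso A P P'" "rmod P" "rmod P'" shows "lifts P'"
  unfolding lifts_def
proof (intro ballI allI impI)
  obtain i j where ij: "lin P P' i" "lin P' P j" "\<And>y. y \<in> carrier P' \<Longrightarrow> i (j y) = y"
    using mod_isoE[OF assms(2,3)] by metis
  fix M N g f
  assume *: "M \<in> fg_modules A" "N \<in> fg_modules A" "lin M N g" "lin P' N f" "carrier N \<subseteq> g ` carrier M"
  obtain h where h: "lin P M h" "\<And>x. x \<in> carrier P \<Longrightarrow> g (h x) = f (i x)"
    using liftsD[OF assms(1) *(1-3) lin_comp[OF ij(1) *(4)] *(5)] by metis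
  show "\<exists>h. lin P' M h \<and> (\<forall>x\<in>carrier P'. g (h x) = f x)"
    by (intro exI[of _ "\<lambda>x. h (j x)"] conjI lin_comp[OF ij(2) h(1)])
      (use h ij lin_closed[OF ij(2)] in auto)
qed

text \<open>A surjection from some projective module, without minimality: one copy of
  \<open>regular\<close> for each element of a spanning set, the sum being moved into
  \<open>fg_modules\<close> at each step. The zero submodule of \<open>M\<close> starts the
  induction.\<close>

lemma projective_cover:
  assumes "M \<in> fg_modules A"
  obtains P e where "projective_module A P" "lin P M e" "carrier M \<subseteq> e ` carrier P"
proof -
  obtain S where S: "finite S" "S \<subseteq> carrier M" "carrier M \<subseteq> kspan M S"
    using fdE[of M] assms by (metis fg_fd)
  have M: "rmod M" using assms by simp
  have "\<exists>P e. projective_module A P \<and> lin P M e \<and> T \<subseteq> e ` carrier P" if "finite T" "T \<subseteq> carrier M" for T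
    using that
  proof (induction T)
    case empty
    let ?Z = "M\<lparr>carrier := {\<zero>\<^bsub>M\<^esub>}\<rparr>"
    have s: "submodule {\<zero>\<^bsub>M\<^esub>} A M" using M by (auto simp: submodule_iff)
    have "projective_module A ?Z"
      using fg_sub[OF assms s] by (auto simp: projective_iff intro!: lifts_zero)
    then show ?case using lin_incl[OF M s] by blast
  next
    case (insert v T)
    then obtain P e where P: "projective_module A P" "lin P M e" "T \<subseteq> e ` carrier P" by auto
    have v: "v \<in> carrier M" using insert by simp
    have "fd (direct_sum P regular)" using P by (intro fd_direct_sum fd_regular) auto
    then obtain Q where Q: "Q \<in> fg_modules A" "mod_iso A (direct_sum P regular) Q"
      using fd_transport by blast
    have rP: "rmod P" using P by simp
    have bi: "biprod Q P regular"
      using biprod_iso[OF biprod_direct_sum Q(2)] rP by (simp add: rmod_direct_sum rmod_regular)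
    then obtain i1 i2 p1 p2 where b: "bip Q P regular i1 i2 p1 p2" using biprod_def by blast
    note bd = bipD[OF b]
    have "projective_module A Q"
      using lifts_biprod[OF _ rP rmod_regular _ lifts_regular bi] P Q by (auto simp: projective_iff)
    have l: "lin regular M (\<lambda>a. a \<odot>\<^bsub>M\<^esub> v)"
      using v M by (intro linI) (auto simp: regular_def ract_add_left ract_mult)
    let ?e = "\<lambda>x. e (p1 x) \<oplus>\<^bsub>M\<^esub> p2 x \<odot>\<^bsub>M\<^esub> v"
    have e: "lin Q M ?e"
      using Q M by (intro lin_sum lin_comp[OF bd(3) P(2)] lin_comp[OF bd(4) l]) auto
    have one: "\<one>\<^bsub>A\<^esub> \<in> carrier regular" by (simp add: regular_def)
    have zero: "\<zero>\<^bsub>regular\<^esub> = \<zero>\<^bsub>A\<^esub>" by (simp add: regular_def)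
    have "v = ?e (i2 \<one>\<^bsub>A\<^esub>)"
      unfolding bd(7)[OF one] bd(8)[OF one] using v M rP by (simp add: lin_zero[OF P(2)])
    moreover have "i2 \<one>\<^bsub>A\<^esub> \<in> carrier Q" by (rule lin_closed[OF bd(2) one])
    moreover have "t \<in> ?e ` carrier Q" if t: "t \<in> T" for t
    proof -
      obtain x where x: "x \<in> carrier P" "t = e x" using P(3) t by auto
      have "?e (i1 x) = t" using x bd v M zero by (simp add: lin_closed[OF P(2)])
      then show ?thesis using x lin_closed[OF bd(1)] by force
    qed
    ultimately have "insert v T \<subseteq> ?e ` carrier Q" by blast
    then show ?case using \<open>projective_module A Q\<close> e by blast
  qed
  from this[OF S(1,2)] obtain P e where P: "projective_module A P" "lin P M e" "S \<subseteq> e ` carrier P" by blast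
  have "submodule (e ` carrier P) A M"
    using P M by (intro submodule_image[OF _ _ P(2)] submodule_carrier) auto
  then have "kspan M S \<subseteq> e ` carrier P" using kspan_least ksub_submodule M P by blast
  then have "carrier M \<subseteq> e ` carrier P" using S(3) by simp
  then show thesis using that P by blast
qed

text \<open>\<open>projective_resolution\<close> with \<open>lin\<close> in place of
  \<open>mod_hom\<close> and with exactness stated pointwise.\<close>

definition res where
  "res M P d e \<longleftrightarrow> (\<forall>n. projective_module A (P n)) \<and> lin (P 0) M e \<and> carrier M \<subseteq> e ` carrier (P 0) \<and>
     (\<forall>n. lin (P (Suc n)) (P n) (d n)) \<and>
     (\<forall>x\<in>carrier (P 0). e x = \<zero>\<^bsub>M\<^esub> \<longleftrightarrow> x \<in> d 0 ` carrier (P (Suc 0))) \<and>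
     (\<forall>n. \<forall>x\<in>carrier (P (Suc n)). d n x = \<zero>\<^bsub>P n\<^esub> \<longleftrightarrow> x \<in> d (Suc n) ` carrier (P (Suc (Suc n))))"

lemma resD:
  assumes "res M P d e"
  shows "projective_module A (P n)" "lin (P 0) M e" "carrier M \<subseteq> e ` carrier (P 0)"
    "lin (P (Suc n)) (P n) (d n)"
    "x \<in> carrier (P 0) \<Longrightarrow> e x = \<zero>\<^bsub>M\<^esub> \<longleftrightarrow> x \<in> d 0 ` carrier (P (Suc 0))"
    "x \<in> carrier (P (Suc n)) \<Longrightarrow> d n x = \<zero>\<^bsub>P n\<^esub> \<longleftrightarrow> x \<in> d (Suc n) ` carrier (P (Suc (Suc n)))"
    "P n \<in> fg_modules A" "rmod (P n)"
    "y \<in> carrier (P (Suc 0)) \<Longrightarrow> e (d 0 y) = \<zero>\<^bsub>M\<^esub>"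
    "y \<in> carrier (P (Suc (Suc n))) \<Longrightarrow> d n (d (Suc n) y) = \<zero>\<^bsub>P n\<^esub>"
proof -
  show *: "projective_module A (P n)" "lin (P 0) M e" "carrier M \<subseteq> e ` carrier (P 0)"
    "lin (P (Suc n)) (P n) (d n)"
    "x \<in> carrier (P 0) \<Longrightarrow> e x = \<zero>\<^bsub>M\<^esub> \<longleftrightarrow> x \<in> d 0 ` carrier (P (Suc 0))"
    "x \<in> carrier (P (Suc n)) \<Longrightarrow> d n x = \<zero>\<^bsub>P n\<^esub> \<longleftrightarrow> x \<in> d (Suc n) ` carrier (P (Suc (Suc n)))" for n x
    using assms unfolding res_def by blast+
  show "P n \<in> fg_modules A" "rmod (P n)" using *(1) by auto
  show "y \<in> carrier (P (Suc 0)) \<Longrightarrow> e (d 0 y) = \<zero>\<^bsub>M\<^esub>"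
    using *(5)[of "d 0 y"] lin_closed[OF *(4)] by blast
  show "y \<in> carrier (P (Suc (Suc n))) \<Longrightarrow> d n (d (Suc n) y) = \<zero>\<^bsub>P n\<^esub>"
    using *(6)[of "d (Suc n) y" n] lin_closed[OF *(4)[of "Suc n"]] by blast
qed

lemma projective_resolution_iff:
  assumes "M \<in> fg_modules A"
  shows "projective_resolution A M P d e \<longleftrightarrow> res M P d e \<and> e \<in> extensional (carrier (P 0)) \<and>
    (\<forall>n. d n \<in> extensional (carrier (P (Suc n))))"
proof -
  have 1: "f ` carrier X = carrier Y \<longleftrightarrow> carrier Y \<subseteq> f ` carrier X" if "lin X Y f"
    for f :: "(nat \<Rightarrow> 'k) \<Rightarrow> nat \<Rightarrow> 'k" and X Y :: "('a, nat \<Rightarrow> 'k) module"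
    using lin_closed[OF that] by auto
  have 2: "f ` carrier X = a_kernel Y Z g \<longleftrightarrow> (\<forall>y\<in>carrier Y. g y = \<zero>\<^bsub>Z\<^esub> \<longleftrightarrow> y \<in> f ` carrier X)"
    if "lin X Y f" for f g :: "(nat \<Rightarrow> 'k) \<Rightarrow> nat \<Rightarrow> 'k" and X Y Z :: "('a, nat \<Rightarrow> 'k) module"
    using lin_closed[OF that] by (auto simp: a_kernel_def kernel_def)
  show ?thesis (is "?L \<longleftrightarrow> ?R")
  proof
    assume L: ?L
    then have l: "lin (P 0) M e" "lin (P (Suc n)) (P n) (d n)" for n
      by (auto simp: projective_resolution_def mod_hom_iff)
    show ?R
      using L unfolding projective_resolution_def res_def mod_hom_iff 2[OF l(2)] 1[OF l(1)] One_nat_def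
      by (simp add: all_conj_distrib)
  next
    assume R: ?R
    then have l: "lin (P 0) M e" "lin (P (Suc n)) (P n) (d n)" for n
      by (auto simp: res_def)
    show ?L
      using R unfolding projective_resolution_def res_def mod_hom_iff 2[OF l(2)] 1[OF l(1)] One_nat_def
      by (simp add: all_conj_distrib)
  qed
qed

text \<open>Iterated syzygies. The n-th differential is the surjection of P (n + 1) onto the next
  syzygy, read as a map into P n; the elements need no conversion, because a syzygy is the record of
  P n with a smaller carrier.\<close>

lemma res_exists:
  assumes "M \<in> fg_modules A" obtains P d e where "res M P d e"
proof -
  define cov where "cov M = (SOME q. projective_module A (fst q) \<and> lin (fst q) M (snd q) \<and>
    carrier M \<subseteq> snd q ` carrier (fst q))" for M :: "('a, nat \<Rightarrow> 'k) module"
  have cov: "projective_module A (fst (cov M)) \<and> lin (fst (cov M)) M (snd (cov M)) \<and>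
    carrier M \<subseteq> snd (cov M) ` carrier (fst (cov M))" if "M \<in> fg_modules A" for M
    unfolding cov_def
  proof (rule someI_ex)
    show "\<exists>q. projective_module A (fst q) \<and> lin (fst q) M (snd q) \<and> carrier M \<subseteq> snd q ` carrier (fst q)"
      using projective_cover[OF that] by (metis fst_conv snd_conv)
  qed
  define syz where "syz M = (fst (cov M))\<lparr>carrier := {x \<in> carrier (fst (cov M)). snd (cov M) x = \<zero>\<^bsub>M\<^esub>}\<rparr>" for M
  have syz: "syz M \<in> fg_modules A" if "M \<in> fg_modules A" for M
    using cov[OF that] that unfolding syz_def by (intro fg_sub submodule_ker[of _ M]) auto
  define Z where "Z n = (syz ^^ n) M" for n
  have Z: "Z n \<in> fg_modules A" for n by (induction n) (auto simp: Z_def assms syz)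
  define P where "P n = fst (cov (Z n))" for n
  define e where "e n = snd (cov (Z n))" for n
  have ZS: "Z (Suc n) = (P n)\<lparr>carrier := {x \<in> carrier (P n). e n x = \<zero>\<^bsub>Z n\<^esub>}\<rparr>" for n
    by (simp add: Z_def syz_def P_def e_def)
  have c: "projective_module A (P n)" "lin (P n) (Z n) (e n)" "carrier (Z n) \<subseteq> e n ` carrier (P n)" for n
    using cov[OF Z[of n]] by (auto simp: P_def e_def)
  have l: "lin (P (Suc n)) (P n) (e (Suc n))" for n
    using c(2)[of "Suc n"] unfolding ZS by (auto simp: lin_def)
  have ex: "e n x = \<zero>\<^bsub>Z n\<^esub> \<longleftrightarrow> x \<in> e (Suc n) ` carrier (P (Suc n))" if "x \<in> carrier (P n)" for x n
    using c(3)[of "Suc n"] lin_closed[OF c(2)[of "Suc n"]] that unfolding ZS by auto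
  have Z0: "Z 0 = M" by (simp add: Z_def)
  have zero: "\<zero>\<^bsub>Z (Suc n)\<^esub> = \<zero>\<^bsub>P n\<^esub>" for n unfolding ZS by simp
  have "res M P (\<lambda>n. e (Suc n)) (e 0)"
    unfolding res_def using c(1) l ex[of _ 0] ex[of _ "Suc _"] c(2,3)[of 0] by (simp add: Z0 zero)
  then show thesis by (rule that)
qed

text \<open>Exactness of \<open>Hom(P, N)\<close> in degree \<open>n + 1\<close>, that is, \<open>Ext\<^sup>n\<^sup>+\<^sup>1(M, N) = 0\<close> when \<open>P\<close> is a projective
  resolution of \<open>M\<close>.\<close>

definition van where
  "van P d N n \<longleftrightarrow> (\<forall>f. lin (P (Suc n)) N f \<longrightarrow>
     (\<forall>x\<in>carrier (P (Suc (Suc n))). f (d (Suc n) x) = \<zero>\<^bsub>N\<^esub>) \<longrightarrow>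
     (\<exists>g. lin (P n) N g \<and> (\<forall>x\<in>carrier (P (Suc n)). f x = g (d n x))))"

lemma vanD:
  assumes "van P d N n" "lin (P (Suc n)) N f"
    "\<And>x. x \<in> carrier (P (Suc (Suc n))) \<Longrightarrow> f (d (Suc n) x) = \<zero>\<^bsub>N\<^esub>"
  obtains g where "lin (P n) N g" "\<And>x. x \<in> carrier (P (Suc n)) \<Longrightarrow> f x = g (d n x)"
  using assms unfolding van_def by blast

lemma chain_map:
  assumes "M \<in> fg_modules A" and r: "res M P d e" "res M' P' d' e'" and "lin M' M \<phi>"
  obtains \<Phi> where "\<And>n. lin (P' n) (P n) (\<Phi> n)" "\<And>x. x \<in> carrier (P' 0) \<Longrightarrow> e (\<Phi> 0 x) = \<phi> (e' x)"
    "\<And>n x. x \<in> carrier (P' (Suc n)) \<Longrightarrow> d n (\<Phi> (Suc n) x) = \<Phi> n (d' n x)"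
proof -
  note r1 = resD[OF r(1)] and r2 = resD[OF r(2)]
  \<comment> \<open>The clause on boundaries keeps the recursion going:
    \<open>projective_lift\<close> can produce the next map only if the map to be lifted lands in
    the image of \<open>d\<close>.\<close>
  define K where "K n F \<longleftrightarrow> lin (P' n) (P n) F \<and>
    (\<forall>x\<in>carrier (P' (Suc n)). F (d' n x) \<in> d n ` carrier (P (Suc n))) \<and>
    (n = 0 \<longrightarrow> (\<forall>x\<in>carrier (P' 0). e (F x) = \<phi> (e' x)))" for n F
  have "\<exists>\<Phi>. \<forall>n. K n (\<Phi> n) \<and> (\<forall>x\<in>carrier (P' (Suc n)). d n (\<Phi> (Suc n) x) = \<Phi> n (d' n x))"
  proof (rule dependent_nat_choice)
    have l: "lin (P' 0) M (\<lambda>x. \<phi> (e' x))" by (rule lin_comp[OF r2(2) assms(4)])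
    have "(\<lambda>x. \<phi> (e' x)) ` carrier (P' 0) \<subseteq> e ` carrier (P 0)"
      using r1(3) lin_closed[OF l] by auto
    then obtain F where F: "lin (P' 0) (P 0) F" "\<And>x. x \<in> carrier (P' 0) \<Longrightarrow> e (F x) = \<phi> (e' x)"
      using projective_lift[OF r2(1) r1(7) assms(1) r1(2) l] by metis
    have "F (d' 0 x) \<in> d 0 ` carrier (P (Suc 0))" if x: "x \<in> carrier (P' (Suc 0))" for x
    proof -
      have dx: "d' 0 x \<in> carrier (P' 0)" using x lin_closed[OF r2(4)] by simp
      have z: "e (F \<zero>\<^bsub>P' 0\<^esub>) = \<zero>\<^bsub>M\<^esub>"
        using lin_zero[OF F(1)] lin_zero[OF r1(2)] r1(8) r2(8) assms(1) by simp
      have "e' \<zero>\<^bsub>P' 0\<^esub> = \<zero>\<^bsub>M'\<^esub>" using r2(9)[of "\<zero>\<^bsub>P' (Suc 0)\<^esub>"] lin_zero[OF r2(4)] r2(8) by simp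
      then have "\<phi> \<zero>\<^bsub>M'\<^esub> = \<zero>\<^bsub>M\<^esub>" using z F(2)[of "\<zero>\<^bsub>P' 0\<^esub>"] r2(8) by simp
      then have "e (F (d' 0 x)) = \<zero>\<^bsub>M\<^esub>" using F(2)[OF dx] r2(9)[OF x] by simp
      then show ?thesis using r1(5) lin_closed[OF F(1) dx] by blast
    qed
    then show "\<exists>F. K 0 F" unfolding K_def using F by blast
  next
    fix F n assume "K n F"
    then have F: "lin (P' n) (P n) F"
      "\<And>x. x \<in> carrier (P' (Suc n)) \<Longrightarrow> F (d' n x) \<in> d n ` carrier (P (Suc n))" unfolding K_def by auto
    have l: "lin (P' (Suc n)) (P n) (\<lambda>x. F (d' n x))" by (rule lin_comp[OF r2(4) F(1)])
    obtain G where G: "lin (P' (Suc n)) (P (Suc n)) G" "\<And>x. x \<in> carrier (P' (Suc n)) \<Longrightarrow> d n (G x) = F (d' n x)"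
      by (rule projective_lift[OF r2(1) r1(7) r1(7) r1(4) l]) (use F(2) in auto)
    have "G (d' (Suc n) x) \<in> d (Suc n) ` carrier (P (Suc (Suc n)))" if x: "x \<in> carrier (P' (Suc (Suc n)))" for x
    proof -
      have dx: "d' (Suc n) x \<in> carrier (P' (Suc n))" using x lin_closed[OF r2(4)] by simp
      have "d n (G (d' (Suc n) x)) = \<zero>\<^bsub>P n\<^esub>"
        using G(2)[OF dx] r2(10)[OF x] lin_zero[OF F(1)] r1(8) r2(8) by simp
      then show ?thesis using r1(6) lin_closed[OF G(1) dx] by blast
    qed
    then show "\<exists>G. K (Suc n) G \<and> (\<forall>x\<in>carrier (P' (Suc n)). d n (G x) = F (d' n x))"
      unfolding K_def using G by auto
  qed
  then obtain \<Phi> where \<Phi>: "\<And>n. K n (\<Phi> n)"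
    "\<And>n x. x \<in> carrier (P' (Suc n)) \<Longrightarrow> d n (\<Phi> (Suc n) x) = \<Phi> n (d' n x)"
    by blast
  show thesis
  proof (rule that[of \<Phi>])
    show "lin (P' n) (P n) (\<Phi> n)" for n using \<Phi>(1)[of n] by (simp add: K_def)
    show "e (\<Phi> 0 x) = \<phi> (e' x)" if "x \<in> carrier (P' 0)" for x
      using \<Phi>(1)[of 0] that by (simp add: K_def)
    show "d n (\<Phi> (Suc n) x) = \<Phi> n (d' n x)" if "x \<in> carrier (P' (Suc n))" for n x
      using \<Phi>(2) that by simp
  qed
qed

text \<open>\<open>X\<close> lifts the zero map of \<open>M\<close>, hence is null-homotopic. Degree
  n + 1 alone is recorded, because that is where \<open>van\<close> lives, so the two homotopy maps
  may be chosen anew for each n.\<close>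

lemma null_homotopy:
  assumes "M \<in> fg_modules A" and r: "res M P d e"
    and X: "\<And>n. lin (P n) (P n) (X n)" "\<And>x. x \<in> carrier (P 0) \<Longrightarrow> e (X 0 x) = \<zero>\<^bsub>M\<^esub>"
      "\<And>n x. x \<in> carrier (P (Suc n)) \<Longrightarrow> d n (X (Suc n) x) = X n (d n x)"
  shows "\<exists>s t. lin (P (Suc n)) (P (Suc (Suc n))) s \<and> lin (P n) (P (Suc n)) t \<and>
    (\<forall>x\<in>carrier (P (Suc n)). X (Suc n) x = d (Suc n) (s x) \<oplus>\<^bsub>P (Suc n)\<^esub> t (d n x))"
proof -
  note r1 = resD[OF r]
  \<comment> \<open>What is asked of \<open>t\<close> concerns boundaries only. In degree 0 it comes
    from lifting \<open>X 0\<close>; later, \<open>t\<close> is the previous \<open>s\<close>, for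
    which it holds because the other term of the homotopy vanishes on boundaries.\<close>
  have step: "\<exists>s. lin (P (Suc n)) (P (Suc (Suc n))) s \<and>
    (\<forall>x\<in>carrier (P (Suc n)). X (Suc n) x = d (Suc n) (s x) \<oplus>\<^bsub>P (Suc n)\<^esub> t (d n x))"
    if t: "lin (P n) (P (Suc n)) t" "\<And>x. x \<in> carrier (P (Suc n)) \<Longrightarrow> d n (t (d n x)) = X n (d n x)" for n t
  proof -
    let ?f = "\<lambda>x. X (Suc n) x \<ominus>\<^bsub>P (Suc n)\<^esub> t (d n x)"
    have l: "lin (P (Suc n)) (P (Suc n)) ?f"
      using r1(8) by (intro lin_sub X lin_comp[OF r1(4) t(1)])
    have "?f x \<in> d (Suc n) ` carrier (P (Suc (Suc n)))" if x: "x \<in> carrier (P (Suc n))" for x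
    proof -
      have dx: "d n x \<in> carrier (P n)" using x lin_closed[OF r1(4)] by simp
      have "d n (?f x) = d n (X (Suc n) x) \<ominus>\<^bsub>P n\<^esub> d n (t (d n x))"
        using x dx r1(8) lin_closed[OF X(1)] lin_closed[OF t(1)] by (intro lin_diff[OF r1(4)]) auto
      also have "\<dots> = \<zero>\<^bsub>P n\<^esub>" using x dx t(2)[OF x] X(3)[OF x] lin_closed[OF X(1)] r1(8) by simp
      finally show ?thesis using r1(6) lin_closed[OF l x] by blast
    qed
    then have im: "?f ` carrier (P (Suc n)) \<subseteq> d (Suc n) ` carrier (P (Suc (Suc n)))" by blast
    obtain s where s: "lin (P (Suc n)) (P (Suc (Suc n))) s"
      "\<And>x. x \<in> carrier (P (Suc n)) \<Longrightarrow> d (Suc n) (s x) = ?f x"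
      by (rule projective_lift[OF r1(1) r1(7) r1(7) r1(4) l im], rule that)
    have "X (Suc n) x = d (Suc n) (s x) \<oplus>\<^bsub>P (Suc n)\<^esub> t (d n x)" if x: "x \<in> carrier (P (Suc n))" for x
    proof -
      have dx: "d n x \<in> carrier (P n)" using x lin_closed[OF r1(4)] by simp
      show ?thesis unfolding s(2)[OF x] using x dx r1(8) lin_closed[OF X(1)] lin_closed[OF t(1)]
        by (simp add: rmod_diff_add)
    qed
    then show ?thesis using s by blast
  qed
  show ?thesis
  proof (induction n)
    case 0
    have "X 0 ` carrier (P 0) \<subseteq> d 0 ` carrier (P (Suc 0))"
      using X(2) r1(5) lin_closed[OF X(1)] by blast
    then obtain t where t: "lin (P 0) (P (Suc 0)) t" "\<And>x. x \<in> carrier (P 0) \<Longrightarrow> d 0 (t x) = X 0 x"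
      using projective_lift[OF r1(1) r1(7) r1(7) r1(4) X(1)] by metis
    show ?case using step[OF t(1)] t lin_closed[OF r1(4)] by blast
  next
    case (Suc n)
    then obtain s t where st: "lin (P (Suc n)) (P (Suc (Suc n))) s" "lin (P n) (P (Suc n)) t"
      "\<And>x. x \<in> carrier (P (Suc n)) \<Longrightarrow> X (Suc n) x = d (Suc n) (s x) \<oplus>\<^bsub>P (Suc n)\<^esub> t (d n x)" by blast
    have "d (Suc n) (s (d (Suc n) x)) = X (Suc n) (d (Suc n) x)" if x: "x \<in> carrier (P (Suc (Suc n)))" for x
    proof -
      have dx: "d (Suc n) x \<in> carrier (P (Suc n))" using x lin_closed[OF r1(4)] by simp
      show ?thesis using st(3)[OF dx] r1(10)[OF x] lin_zero[OF st(2)] r1(8)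
        lin_closed[OF r1(4) lin_closed[OF st(1) dx]] by simp
    qed
    then show ?case using step[OF st(1)] st(1) by blast
  qed
qed

text \<open>The comparison theorem. For \<open>M\<^sub>1 = M\<^sub>2\<close> and \<open>j\<^sub>2 = 0\<close> it covers retracts,
  in particular the independence of the resolution.\<close>

lemma van_comparison:
  assumes fg: "M \<in> fg_modules A" "M1 \<in> fg_modules A" "M2 \<in> fg_modules A" "N \<in> fg_modules A"
    and r: "res M P d e" "res M1 P1 d1 e1" "res M2 P2 d2 e2"
    and j: "lin M1 M j1" "lin M2 M j2" "lin M M1 q1" "lin M M2 q2"
      "\<And>x. x \<in> carrier M \<Longrightarrow> j1 (q1 x) \<oplus>\<^bsub>M\<^esub> j2 (q2 x) = x"
    and v: "van P1 d1 N n" "van P2 d2 N n"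
  shows "van P d N n"
  unfolding van_def
proof (intro allI impI)
  fix f assume f: "lin (P (Suc n)) N f" "\<forall>x\<in>carrier (P (Suc (Suc n))). f (d (Suc n) x) = \<zero>\<^bsub>N\<^esub>"
  note r0 = resD[OF r(1)] and r1 = resD[OF r(2)] and r2 = resD[OF r(3)]
  obtain F1 where F1: "\<And>n. lin (P1 n) (P n) (F1 n)" "\<And>x. x \<in> carrier (P1 0) \<Longrightarrow> e (F1 0 x) = j1 (e1 x)"
    "\<And>n x. x \<in> carrier (P1 (Suc n)) \<Longrightarrow> d n (F1 (Suc n) x) = F1 n (d1 n x)"
    using chain_map[OF fg(1) r(1,2) j(1)] by metis
  obtain F2 where F2: "\<And>n. lin (P2 n) (P n) (F2 n)" "\<And>x. x \<in> carrier (P2 0) \<Longrightarrow> e (F2 0 x) = j2 (e2 x)"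
    "\<And>n x. x \<in> carrier (P2 (Suc n)) \<Longrightarrow> d n (F2 (Suc n) x) = F2 n (d2 n x)"
    using chain_map[OF fg(1) r(1,3) j(2)] by metis
  obtain G1 where G1: "\<And>n. lin (P n) (P1 n) (G1 n)" "\<And>x. x \<in> carrier (P 0) \<Longrightarrow> e1 (G1 0 x) = q1 (e x)"
    "\<And>n x. x \<in> carrier (P (Suc n)) \<Longrightarrow> d1 n (G1 (Suc n) x) = G1 n (d n x)"
    using chain_map[OF fg(2) r(2,1) j(3)] by metis
  obtain G2 where G2: "\<And>n. lin (P n) (P2 n) (G2 n)" "\<And>x. x \<in> carrier (P 0) \<Longrightarrow> e2 (G2 0 x) = q2 (e x)"
    "\<And>n x. x \<in> carrier (P (Suc n)) \<Longrightarrow> d2 n (G2 (Suc n) x) = G2 n (d n x)"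
    using chain_map[OF fg(3) r(3,1) j(4)] by metis
  note FG = lin_comp[OF G1(1) F1(1)] lin_comp[OF G2(1) F2(1)]
  note cl = lin_closed[OF F1(1)] lin_closed[OF F2(1)] lin_closed[OF G1(1)] lin_closed[OF G2(1)]
    lin_closed[OF r0(4)] lin_closed[OF r0(2)] lin_closed[OF r1(4)] lin_closed[OF r2(4)] lin_closed[OF f(1)]
  have rm: "rmod M" "rmod N" "\<And>n. rmod (P n)" using fg r0(8) by auto
  \<comment> \<open>The sum of the two round trips through \<open>M1\<close> and \<open>M2\<close>
    lifts the identity of \<open>M\<close>, so its difference \<open>X\<close> from the identity
    lifts zero and is null-homotopic.\<close>
  define Y where "Y n x = F1 n (G1 n x) \<oplus>\<^bsub>P n\<^esub> F2 n (G2 n x)" for n x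
  define X where "X n x = x \<ominus>\<^bsub>P n\<^esub> Y n x" for n x
  have Yl: "lin (P n) (P n) (Y n)" for n
    unfolding Y_def by (intro lin_sum FG rm)
  have Yd: "d n (Y (Suc n) x) = Y n (d n x)" if x: "x \<in> carrier (P (Suc n))" for n x
    unfolding Y_def using x by (simp add: lin_add[OF r0(4)] cl F1 F2 G1 G2)
  have Ye: "e (Y 0 x) = e x" if x: "x \<in> carrier (P 0)" for x
    unfolding Y_def using x by (simp add: lin_add[OF r0(2)] cl F1 F2 G1 G2 j(5))
  have "\<exists>s t. lin (P (Suc n)) (P (Suc (Suc n))) s \<and> lin (P n) (P (Suc n)) t \<and>
    (\<forall>x\<in>carrier (P (Suc n)). X (Suc n) x = d (Suc n) (s x) \<oplus>\<^bsub>P (Suc n)\<^esub> t (d n x))"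
  proof (rule null_homotopy[OF fg(1) r(1)])
    show "lin (P n) (P n) (X n)" for n unfolding X_def by (intro lin_sub lin_id Yl rm)
    show "e (X 0 x) = \<zero>\<^bsub>M\<^esub>" if "x \<in> carrier (P 0)" for x
      unfolding X_def using that rm by (simp add: lin_diff[OF r0(2)] Ye lin_closed[OF Yl] cl)
    show "d n (X (Suc n) x) = X n (d n x)" if "x \<in> carrier (P (Suc n))" for n x
      unfolding X_def using that rm by (simp add: lin_diff[OF r0(4)] Yd lin_closed[OF Yl] cl)
  qed
  then obtain s t where st: "lin (P (Suc n)) (P (Suc (Suc n))) s" "lin (P n) (P (Suc n)) t"
    "\<And>x. x \<in> carrier (P (Suc n)) \<Longrightarrow> X (Suc n) x = d (Suc n) (s x) \<oplus>\<^bsub>P (Suc n)\<^esub> t (d n x)" by blast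
  obtain h1 where h1: "lin (P1 n) N h1" "\<And>x. x \<in> carrier (P1 (Suc n)) \<Longrightarrow> f (F1 (Suc n) x) = h1 (d1 n x)"
    by (rule vanD[OF v(1) lin_comp[OF F1(1) f(1)]]) (use F1 f(2) cl in \<open>auto simp flip: F1(3)\<close>)
  obtain h2 where h2: "lin (P2 n) N h2" "\<And>x. x \<in> carrier (P2 (Suc n)) \<Longrightarrow> f (F2 (Suc n) x) = h2 (d2 n x)"
    by (rule vanD[OF v(2) lin_comp[OF F2(1) f(1)]]) (use F2 f(2) cl in \<open>auto simp flip: F2(3)\<close>)
  \<comment> \<open>On x = X x + Y x, the part f (X x) reduces to f (t (d x)) since \<open>f\<close>
    kills boundaries, and f (Y x) is a coboundary because \<open>f\<close> restricted along
    \<open>F1\<close> and \<open>F2\<close> is one.\<close>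
  let ?g = "\<lambda>x. f (t x) \<oplus>\<^bsub>N\<^esub> (h1 (G1 n x) \<oplus>\<^bsub>N\<^esub> h2 (G2 n x))"
  have "lin (P n) N ?g"
    by (intro lin_sum rm lin_comp[OF st(2) f(1)] lin_comp[OF G1(1) h1(1)] lin_comp[OF G2(1) h2(1)])
  moreover have "f x = ?g (d n x)" if x: "x \<in> carrier (P (Suc n))" for x
  proof -
    have c: "s x \<in> carrier (P (Suc (Suc n)))" "t (d n x) \<in> carrier (P (Suc n))" "Y (Suc n) x \<in> carrier (P (Suc n))"
      using x lin_closed[OF st(1)] lin_closed[OF st(2)] lin_closed[OF Yl] cl by auto
    have "x = X (Suc n) x \<oplus>\<^bsub>P (Suc n)\<^esub> Y (Suc n) x"
      unfolding X_def using x c rm by (simp add: rmod_diff_add)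
    then have "f x = f (X (Suc n) x) \<oplus>\<^bsub>N\<^esub> f (Y (Suc n) x)"
      using x c rm cl lin_add[OF f(1), of "X (Suc n) x" "Y (Suc n) x"] unfolding X_def by simp
    also have "f (X (Suc n) x) = f (t (d n x))"
      unfolding st(3)[OF x] using x c rm f(2) cl by (simp add: lin_add[OF f(1)])
    also have "f (Y (Suc n) x) = h1 (G1 n (d n x)) \<oplus>\<^bsub>N\<^esub> h2 (G2 n (d n x))"
      unfolding Y_def using x cl h1 h2 G1 G2 by (simp add: lin_add[OF f(1)])
    finally show ?thesis .
  qed
  ultimately show "\<exists>g. lin (P n) N g \<and> (\<forall>x\<in>carrier (P (Suc n)). f x = g (d n x))" by blast
qed

subsection \<open>Vanishing of Ext\<close>

lemma cocycles_iff: "f \<in> cocycles A P d N n \<longleftrightarrow> lin (P n) N f \<and> f \<in> extensional (carrier (P n)) \<and>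
    (\<forall>x\<in>carrier (P (Suc n)). f (d n x) = \<zero>\<^bsub>N\<^esub>)"
proof -
  have "compose (carrier (P (Suc n))) f (d n) = \<one>\<^bsub>hom_group A (P (Suc n)) N\<^esub> \<longleftrightarrow>
    (\<forall>x\<in>carrier (P (Suc n)). f (d n x) = \<zero>\<^bsub>N\<^esub>)"
    by (subst compose_eq_iff) (auto simp: hom_group_def)
  then show ?thesis by (auto simp: cocycles_def mod_hom_iff)
qed

lemma lin_restrict: "rmod M \<Longrightarrow> lin M N (restrict f (carrier M)) \<longleftrightarrow> lin M N f"
  by (auto intro: lin_cong)

lemma coboundaries_iff:
  assumes "rmod (P n)" "lin (P (Suc n)) (P n) (d n)"
  shows "f \<in> coboundaries A P d N (Suc n) \<longleftrightarrow> f \<in> extensional (carrier (P (Suc n))) \<and>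
    (\<exists>g. lin (P n) N g \<and> (\<forall>x\<in>carrier (P (Suc n)). f x = g (d n x)))"
proof
  assume "f \<in> coboundaries A P d N (Suc n)"
  then obtain g where "g \<in> mod_hom A (P n) N" "f = compose (carrier (P (Suc n))) g (d n)" by auto
  then show "f \<in> extensional (carrier (P (Suc n))) \<and>
    (\<exists>g. lin (P n) N g \<and> (\<forall>x\<in>carrier (P (Suc n)). f x = g (d n x)))"
    by (auto simp: mod_hom_iff compose_def)
next
  assume "f \<in> extensional (carrier (P (Suc n))) \<and>
    (\<exists>g. lin (P n) N g \<and> (\<forall>x\<in>carrier (P (Suc n)). f x = g (d n x)))"
  then obtain g where g: "f \<in> extensional (carrier (P (Suc n)))" "lin (P n) N g"
    "\<And>x. x \<in> carrier (P (Suc n)) \<Longrightarrow> f x = g (d n x)" by auto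
  have "compose (carrier (P (Suc n))) (restrict g (carrier (P n))) (d n) = f"
    using g lin_closed[OF assms(2)] by (subst compose_eq_iff) auto
  moreover have "restrict g (carrier (P n)) \<in> mod_hom A (P n) N" using assms g by (intro mod_hom_restrict)
  ultimately show "f \<in> coboundaries A P d N (Suc n)" by (auto simp: image_iff)
qed

lemma cocycle_group:
  fixes N :: "('a, nat \<Rightarrow> 'k) module"
  assumes "rmod (P n)" "rmod (P (Suc n))" "rmod N" "lin (P (Suc n)) (P n) (d n)"
  shows "comm_group ((hom_group A (P n) N)\<lparr>carrier := cocycles A P d N n\<rparr>)" (is "comm_group ?G")
proof (rule comm_groupI)
  note dc = lin_closed[OF assms(4)]
  have rl: "f \<in> extensional (carrier (P n)) \<Longrightarrow> (\<And>x. x \<in> carrier (P n) \<Longrightarrow> g x = f x) \<Longrightarrow> restrict g (carrier (P n)) = f" for f g :: "(nat \<Rightarrow> 'k) \<Rightarrow> nat \<Rightarrow> 'k"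
    by (auto simp: restrict_def extensional_def fun_eq_iff)
  show "x \<otimes>\<^bsub>?G\<^esub> y \<in> carrier ?G" if "x \<in> carrier ?G" "y \<in> carrier ?G" for x y
    using that assms dc by (auto simp: hom_group_def cocycles_iff lin_restrict intro: lin_sum)
  show "\<one>\<^bsub>?G\<^esub> \<in> carrier ?G"
    using assms dc by (auto simp: hom_group_def cocycles_iff lin_restrict intro: lin_const_zero)
  show "x \<otimes>\<^bsub>?G\<^esub> y \<otimes>\<^bsub>?G\<^esub> z = x \<otimes>\<^bsub>?G\<^esub> (y \<otimes>\<^bsub>?G\<^esub> z)"
    if "x \<in> carrier ?G" "y \<in> carrier ?G" "z \<in> carrier ?G" for x y z
    using that assms by (auto simp: hom_group_def cocycles_iff lin_closed rmod_assoc intro!: restrict_ext)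
  show "x \<otimes>\<^bsub>?G\<^esub> y = y \<otimes>\<^bsub>?G\<^esub> x" if "x \<in> carrier ?G" "y \<in> carrier ?G" for x y
    using that assms by (auto simp: hom_group_def cocycles_iff lin_closed intro!: restrict_ext rmod_comm)
  show "\<one>\<^bsub>?G\<^esub> \<otimes>\<^bsub>?G\<^esub> x = x" if "x \<in> carrier ?G" for x
    using that assms by (auto simp: hom_group_def cocycles_iff lin_closed intro!: rl)
  show "\<exists>y\<in>carrier ?G. y \<otimes>\<^bsub>?G\<^esub> x = \<one>\<^bsub>?G\<^esub>" if "x \<in> carrier ?G" for x
  proof
    show "(\<lambda>v\<in>carrier (P n). \<ominus>\<^bsub>N\<^esub> x v) \<in> carrier ?G"
      using that assms dc
      by (auto simp: cocycles_iff lin_restrict intro!: lin_neg)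
        (metis rmod_add_simps(1) rmod_add_simps(6) rmod_closed(1) rmod_closed(4))
    show "(\<lambda>v\<in>carrier (P n). \<ominus>\<^bsub>N\<^esub> x v) \<otimes>\<^bsub>?G\<^esub> x = \<one>\<^bsub>?G\<^esub>"
      using that assms by (auto simp: hom_group_def cocycles_iff lin_closed intro!: restrict_ext)
  qed
qed

text \<open>\<open>Ext\<close> refers to a resolution chosen by \<open>SOME\<close>, so this is
  first proved for that resolution; \<open>van_unique\<close> then allows any other. The Ext group
  is trivial exactly when every cocycle is a coboundary.\<close>

lemma Ext_trivial_van:
  assumes "M \<in> fg_modules A" "N \<in> fg_modules A"
  shows "\<exists>P d e. res M P d e \<and> (\<forall>n. trivial_group (Ext A (Suc n) M N) \<longleftrightarrow> van P d N n)"
proof -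
  let ?q = "SOME q. (case q of (P, d) \<Rightarrow> \<exists>e. projective_resolution A M P d e)"
  have "\<exists>q. case q of (P, d) \<Rightarrow> \<exists>e. projective_resolution A M P d e"
  proof -
    obtain P d e where r: "res M P d e" using res_exists assms by metis
    note r1 = resD[OF r]
    have "res M P (\<lambda>n. restrict (d n) (carrier (P (Suc n)))) (restrict e (carrier (P 0)))"
      using r r1(8) lin_closed[OF r1(4)] unfolding res_def by (simp add: lin_restrict)
    then have "projective_resolution A M P (\<lambda>n. restrict (d n) (carrier (P (Suc n)))) (restrict e (carrier (P 0)))"
      using projective_resolution_iff[OF assms(1)] by simp
    then show ?thesis by blast
  qed
  from someI_ex[OF this] obtain P d e where q: "?q = (P, d)" and pr: "projective_resolution A M P d e"
    by (cases ?q) auto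
  then have r: "res M P d e" using projective_resolution_iff[OF assms(1)] by simp
  note r1 = resD[OF r]
  have "trivial_group (Ext A (Suc n) M N) \<longleftrightarrow> van P d N n" for n
  proof -
    let ?G = "(hom_group A (P (Suc n)) N)\<lparr>carrier := cocycles A P d N (Suc n)\<rparr>"
    let ?H = "coboundaries A P d N (Suc n)"
    have E: "Ext A (Suc n) M N = ?G Mod ?H" unfolding Ext_def q by simp
    have N: "rmod N" using assms by simp
    interpret G: comm_group ?G using cocycle_group[where P = P and d = d and N = N and n = "Suc n"] r1(4,8) N by simp
    have Hsub: "?H \<subseteq> carrier ?G"
    proof
      fix f assume "f \<in> ?H"
      then obtain g where g: "f \<in> extensional (carrier (P (Suc n)))" "lin (P n) N g"
        "\<And>x. x \<in> carrier (P (Suc n)) \<Longrightarrow> f x = g (d n x)"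
        using coboundaries_iff[where P = P and d = d and n = n, OF r1(8) r1(4)] by blast
      have "lin (P (Suc n)) N f" using lin_cong[OF lin_comp[OF r1(4) g(2)] r1(8)] g(3) by blast
      moreover have "f (d (Suc n) x) = \<zero>\<^bsub>N\<^esub>" if x: "x \<in> carrier (P (Suc (Suc n)))" for x
        using g(3)[OF lin_closed[OF r1(4) x]] r1(10)[OF x] lin_zero[OF g(2)] r1(8) N by simp
      ultimately show "f \<in> carrier ?G" using g by (simp add: cocycles_iff)
    qed
    have cob: "f \<in> ?H \<longleftrightarrow> (\<exists>g. lin (P n) N g \<and> (\<forall>x\<in>carrier (P (Suc n)). f x = g (d n x)))"
      if "f \<in> extensional (carrier (P (Suc n)))" for f
      using coboundaries_iff[where P = P and d = d and n = n, OF r1(8) r1(4)] that by blast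
    have one: "\<one>\<^bsub>?G\<^esub> \<in> ?H"
    proof -
      have "\<one>\<^bsub>?G\<^esub> \<in> extensional (carrier (P (Suc n)))" by (simp add: hom_group_def)
      moreover have "\<exists>g. lin (P n) N g \<and> (\<forall>x\<in>carrier (P (Suc n)). \<one>\<^bsub>?G\<^esub> x = g (d n x))"
        using N by (intro exI[of _ "\<lambda>x. \<zero>\<^bsub>N\<^esub>"]) (simp add: hom_group_def lin_const_zero)
      ultimately show ?thesis using cob by blast
    qed
    have "trivial_group (?G Mod ?H) \<longleftrightarrow> carrier ?G \<subseteq> ?H"
    proof
      assume "trivial_group (?G Mod ?H)"
      then have *: "(\<lambda>x. ?H #>\<^bsub>?G\<^esub> x) ` carrier ?G = {?H}"
        unfolding trivial_group_def carrier_FactGroup one_FactGroup by simp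
      show "carrier ?G \<subseteq> ?H"
      proof
        fix f assume f: "f \<in> carrier ?G"
        then have "?H #>\<^bsub>?G\<^esub> f = ?H" using * by blast
        moreover have "\<one>\<^bsub>?G\<^esub> \<otimes>\<^bsub>?G\<^esub> f \<in> ?H #>\<^bsub>?G\<^esub> f" unfolding r_coset_def using one by blast
        ultimately have "\<one>\<^bsub>?G\<^esub> \<otimes>\<^bsub>?G\<^esub> f \<in> ?H" by (simp only:)
        then show "f \<in> ?H" by (simp only: G.l_one[OF f])
      qed
    next
      assume "carrier ?G \<subseteq> ?H"
      then have eq: "?H = carrier ?G" using Hsub by auto
      have "carrier ?G \<lhd> ?G" by (simp only: G.normal_iff_subgroup G.subgroup_self)
      then have "group (?G Mod ?H)" unfolding eq by (rule normal.factorgroup_is_group)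
      moreover have "(\<lambda>x. ?H #>\<^bsub>?G\<^esub> x) ` carrier ?G = {?H}"
      proof -
        have "carrier ?G #>\<^bsub>?G\<^esub> x = carrier ?G" if "x \<in> carrier ?G" for x
          by (rule G.coset_join2[OF that G.subgroup_self that])
        then have "(\<lambda>x. carrier ?G #>\<^bsub>?G\<^esub> x) ` carrier ?G = {carrier ?G}" using G.one_closed by blast
        then show ?thesis unfolding eq by simp
      qed
      ultimately show "trivial_group (?G Mod ?H)"
        unfolding trivial_group_def carrier_FactGroup one_FactGroup by simp
    qed
    also have "\<dots> \<longleftrightarrow> van P d N n"
    proof
      assume *: "carrier ?G \<subseteq> ?H"
      show "van P d N n" unfolding van_def
      proof (intro allI impI)
        fix f assume f: "lin (P (Suc n)) N f" "\<forall>x\<in>carrier (P (Suc (Suc n))). f (d (Suc n) x) = \<zero>\<^bsub>N\<^esub>"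
        let ?f = "restrict f (carrier (P (Suc n)))"
        have "?f \<in> carrier ?G"
          using f r1(8) lin_closed[OF r1(4)] by (simp add: cocycles_iff lin_restrict)
        then have "?f \<in> ?H" using * by blast
        then show "\<exists>g. lin (P n) N g \<and> (\<forall>x\<in>carrier (P (Suc n)). f x = g (d n x))" by (subst (asm) cob) auto
      qed
    next
      assume v: "van P d N n"
      show "carrier ?G \<subseteq> ?H"
      proof
        fix f assume f: "f \<in> carrier ?G"
        then have "lin (P (Suc n)) N f" "f \<in> extensional (carrier (P (Suc n)))"
          "\<And>x. x \<in> carrier (P (Suc (Suc n))) \<Longrightarrow> f (d (Suc n) x) = \<zero>\<^bsub>N\<^esub>"
          by (auto simp: cocycles_iff)
        then show "f \<in> ?H" using cob vanD[OF v] by metis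
      qed
    qed
    finally show ?thesis unfolding E .
  qed
  then show ?thesis using r by blast
qed

lemma van_unique:
  assumes "M \<in> fg_modules A" "N \<in> fg_modules A" "res M P d e" "res M P' d' e'" "van P d N n"
  shows "van P' d' N n"
  by (rule van_comparison[OF assms(1,1,1,2) assms(4,3,3) lin_id lin_const_zero lin_id lin_id _ assms(5,5)])
    (use assms in simp_all)

lemma Ext_trivial_iff:
  assumes "M \<in> fg_modules A" "N \<in> fg_modules A" "res M P d e"
  shows "trivial_group (Ext A (Suc n) M N) \<longleftrightarrow> van P d N n"
  using Ext_trivial_van[OF assms(1,2)] van_unique[OF assms(1,2)] assms(3) by metis

text \<open>Vanishing of all Ext^i with i > 0, written with \<open>Suc n\<close> to match the
  degrees of \<open>van\<close>.\<close>

definition orth where "orth M N \<longleftrightarrow> (\<forall>n. trivial_group (Ext A (Suc n) M N))"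

lemma orth_res:
  assumes "M \<in> fg_modules A" "N \<in> fg_modules A" "res M P d e"
  shows "orth M N \<longleftrightarrow> (\<forall>n. van P d N n)"
  unfolding orth_def using Ext_trivial_iff[OF assms] by simp

lemma right_perp_iff: "right_perp A T = {X \<in> fg_modules A. orth T X}"
  unfolding right_perp_def orth_def using gr0_conv_Suc by auto

lemma self_orthogonal_iff: "self_orthogonal A T \<longleftrightarrow> orth T T"
  unfolding self_orthogonal_def orth_def using gr0_conv_Suc by auto

text \<open>The single identity j1 q1 + j2 q2 = id makes \<open>M\<close> a retract of M1 + M2, so
  that direct sums, summands and isomorphic copies are all instances.\<close>

lemma orth_sum1:
  assumes fg: "M \<in> fg_modules A" "M1 \<in> fg_modules A" "M2 \<in> fg_modules A" "N \<in> fg_modules A"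
    and j: "lin M1 M j1" "lin M2 M j2" "lin M M1 q1" "lin M M2 q2"
      "\<And>x. x \<in> carrier M \<Longrightarrow> j1 (q1 x) \<oplus>\<^bsub>M\<^esub> j2 (q2 x) = x"
    and o: "orth M1 N" "orth M2 N"
  shows "orth M N"
proof -
  obtain P d e where r: "res M P d e" using res_exists fg by metis
  obtain P1 d1 e1 where r1: "res M1 P1 d1 e1" using res_exists fg by metis
  obtain P2 d2 e2 where r2: "res M2 P2 d2 e2" using res_exists fg by metis
  show ?thesis
    using van_comparison[OF fg r r1 r2 j] o
    by (simp add: orth_res[OF fg(1,4) r] orth_res[OF fg(2,4) r1] orth_res[OF fg(3,4) r2])
qed

lemma orth_retract1:
  assumes "M \<in> fg_modules A" "M1 \<in> fg_modules A" "N \<in> fg_modules A" "lin M1 M j" "lin M M1 q"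
    "\<And>x. x \<in> carrier M \<Longrightarrow> j (q x) = x" "orth M1 N"
  shows "orth M N"
  by (rule orth_sum1[OF assms(1,2,2,3) assms(4) lin_const_zero assms(5,5) _ assms(7,7)]) (use assms in simp_all)

lemma orth_biprod1:
  assumes "D \<in> fg_modules A" "M \<in> fg_modules A" "M' \<in> fg_modules A" "N \<in> fg_modules A" "biprod D M M'"
  shows "orth D N \<longleftrightarrow> orth M N \<and> orth M' N"
proof -
  obtain i1 i2 p1 p2 where b: "bip D M M' i1 i2 p1 p2" using assms biprod_def by blast
  note bd = bipD[OF b]
  show ?thesis
    using orth_sum1[OF assms(1-4) bd(1-4) bd(9)] orth_retract1[OF assms(2,1,4) bd(3,1) bd(5)]
      orth_retract1[OF assms(3,1,4) bd(4,2) bd(7)] by blast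
qed

text \<open>With the resolution of \<open>M\<close> fixed, compose a cocycle with q1 and q2, solve
  in \<open>N1\<close> and \<open>N2\<close>, and recombine the solutions by j1 and j2.\<close>

lemma orth_sum2:
  assumes fg: "M \<in> fg_modules A" "N \<in> fg_modules A" "N1 \<in> fg_modules A" "N2 \<in> fg_modules A"
    and j: "lin N1 N j1" "lin N2 N j2" "lin N N1 q1" "lin N N2 q2"
      "\<And>x. x \<in> carrier N \<Longrightarrow> j1 (q1 x) \<oplus>\<^bsub>N\<^esub> j2 (q2 x) = x"
    and o: "orth M N1" "orth M N2"
  shows "orth M N"
proof -
  obtain P d e where r: "res M P d e" using res_exists fg by metis
  note r1 = resD[OF r]
  have "van P d N n" if v: "van P d N1 n" "van P d N2 n" for n
    unfolding van_def
  proof (intro allI impI)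
    fix f assume f: "lin (P (Suc n)) N f" "\<forall>x\<in>carrier (P (Suc (Suc n))). f (d (Suc n) x) = \<zero>\<^bsub>N\<^esub>"
    have z: "q1 \<zero>\<^bsub>N\<^esub> = \<zero>\<^bsub>N1\<^esub>" "q2 \<zero>\<^bsub>N\<^esub> = \<zero>\<^bsub>N2\<^esub>" using lin_zero[OF j(3)] lin_zero[OF j(4)] fg by auto
    obtain g1 where g1: "lin (P n) N1 g1" "\<And>x. x \<in> carrier (P (Suc n)) \<Longrightarrow> q1 (f x) = g1 (d n x)"
      using vanD[OF v(1) lin_comp[OF f(1) j(3)]] f(2) z by metis
    obtain g2 where g2: "lin (P n) N2 g2" "\<And>x. x \<in> carrier (P (Suc n)) \<Longrightarrow> q2 (f x) = g2 (d n x)"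
      using vanD[OF v(2) lin_comp[OF f(1) j(4)]] f(2) z by metis
    have "lin (P n) N (\<lambda>x. j1 (g1 x) \<oplus>\<^bsub>N\<^esub> j2 (g2 x))"
      using fg r1(8) by (intro lin_sum lin_comp[OF g1(1) j(1)] lin_comp[OF g2(1) j(2)]) auto
    moreover have "f x = j1 (g1 (d n x)) \<oplus>\<^bsub>N\<^esub> j2 (g2 (d n x))" if "x \<in> carrier (P (Suc n))" for x
      using j(5)[OF lin_closed[OF f(1) that]] that by (simp add: g1(2) g2(2))
    ultimately show "\<exists>g. lin (P n) N g \<and> (\<forall>x\<in>carrier (P (Suc n)). f x = g (d n x))" by blast
  qed
  then show ?thesis using o by (simp add: orth_res[OF fg(1,2) r] orth_res[OF fg(1,3) r] orth_res[OF fg(1,4) r])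
qed

lemma orth_retract2:
  assumes "M \<in> fg_modules A" "N \<in> fg_modules A" "N1 \<in> fg_modules A" "lin N1 N j" "lin N N1 q"
    "\<And>x. x \<in> carrier N \<Longrightarrow> j (q x) = x" "orth M N1"
  shows "orth M N"
  by (rule orth_sum2[OF assms(1,2,3,3) assms(4) lin_const_zero assms(5,5) _ assms(7,7)]) (use assms in simp_all)

lemma orth_biprod2:
  assumes "M \<in> fg_modules A" "D \<in> fg_modules A" "N \<in> fg_modules A" "N' \<in> fg_modules A" "biprod D N N'"
  shows "orth M D \<longleftrightarrow> orth M N \<and> orth M N'"
proof -
  obtain i1 i2 p1 p2 where b: "bip D N N' i1 i2 p1 p2" using assms biprod_def by blast
  note bd = bipD[OF b]
  show ?thesis
    using orth_sum2[OF assms(1-4) bd(1-4) bd(9)] orth_retract2[OF assms(1,3,2) bd(3,1) bd(5)]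
      orth_retract2[OF assms(1,4,2) bd(4,2) bd(7)] by blast
qed

lemma orth_iso1:
  assumes "mod_iso A M M'" "M \<in> fg_modules A" "M' \<in> fg_modules A" "N \<in> fg_modules A"
  shows "orth M N \<longleftrightarrow> orth M' N"
  using assms orth_retract1 by (elim mod_isoE) (simp, metis)

lemma orth_iso2:
  assumes "mod_iso A N N'" "M \<in> fg_modules A" "N \<in> fg_modules A" "N' \<in> fg_modules A"
  shows "orth M N \<longleftrightarrow> orth M N'"
  using assms orth_retract2 by (elim mod_isoE) (simp, metis)

lemma submodule_zero: "rmod M \<Longrightarrow> submodule {\<zero>\<^bsub>M\<^esub>} A M"
  by (auto simp: submodule_iff)

text \<open>\<open>M\<close> in degree 0 followed by zero modules is a resolution. Its zero module
  is a submodule record of \<open>M\<close>, so the identity of \<open>M\<close> and constant zero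
  maps serve as structure maps.\<close>

lemma orth_projective:
  assumes "projective_module A M" "N \<in> fg_modules A" shows "orth M N"
proof -
  let ?Z = "M\<lparr>carrier := {\<zero>\<^bsub>M\<^esub>}\<rparr>"
  have M: "M \<in> fg_modules A" "rmod M" using assms by auto
  have Z: "rmod ?Z" "?Z \<in> fg_modules A"
    using fg_sub[OF M(1) submodule_zero[OF M(2)]] by auto
  then have "projective_module A ?Z" by (auto simp: projective_iff intro!: lifts_zero)
  then have r: "res M (case_nat M (\<lambda>_. ?Z)) (\<lambda>_ _. \<zero>\<^bsub>M\<^esub>) (\<lambda>x. x)"
    unfolding res_def using assms M lin_const_zero[OF M(2)] lin_const_zero[OF Z(1)]
    by (auto simp: lin_id split: nat.split)
  have "van (case_nat M (\<lambda>_. ?Z)) (\<lambda>_ _. \<zero>\<^bsub>M\<^esub>) N n" for n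
    unfolding van_def
  proof (intro allI impI)
    fix f assume "lin (case_nat M (\<lambda>_. ?Z) (Suc n)) N f"
    then have f: "lin ?Z N f" by simp
    have N: "rmod N" using assms by simp
    have "f \<zero>\<^bsub>M\<^esub> = \<zero>\<^bsub>N\<^esub>" using lin_zero[OF f Z(1) N] by simp
    then show "\<exists>g. lin (case_nat M (\<lambda>_. ?Z) n) N g \<and>
      (\<forall>x\<in>carrier (case_nat M (\<lambda>_. ?Z) (Suc n)). f x = g \<zero>\<^bsub>M\<^esub>)"
      by (intro exI[of _ "\<lambda>_. \<zero>\<^bsub>N\<^esub>"]) (simp add: lin_const_zero[OF N])
  qed
  then show ?thesis using orth_res[OF M(1) assms(2) r] by blast
qed

text \<open>Injectivity for a \<open>g\<close> that may have a kernel, on which \<open>f\<close>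
  must then vanish. It can thus be applied to the differentials of a resolution directly.\<close>

definition inj_mod where
  "inj_mod N \<longleftrightarrow> (\<forall>K\<in>fg_modules A. \<forall>L\<in>fg_modules A. \<forall>g f. lin K L g \<longrightarrow> lin K N f \<longrightarrow>
     (\<forall>x\<in>carrier K. g x = \<zero>\<^bsub>L\<^esub> \<longrightarrow> f x = \<zero>\<^bsub>N\<^esub>) \<longrightarrow> (\<exists>h. lin L N h \<and> (\<forall>x\<in>carrier K. h (g x) = f x)))"

lemma inj_modD:
  assumes "inj_mod N" "K \<in> fg_modules A" "L \<in> fg_modules A" "lin K L g" "lin K N f"
    "\<And>x. x \<in> carrier K \<Longrightarrow> g x = \<zero>\<^bsub>L\<^esub> \<Longrightarrow> f x = \<zero>\<^bsub>N\<^esub>"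
  obtains h where "lin L N h" "\<And>x. x \<in> carrier K \<Longrightarrow> h (g x) = f x"
  using assms unfolding inj_mod_def by blast

lemma inj_mod_iso:
  assumes "inj_mod N" "mod_iso A N N'" "rmod N" "rmod N'" shows "inj_mod N'"
  unfolding inj_mod_def
proof (intro ballI allI impI)
  obtain i j where ij: "lin N N' i" "lin N' N j" "\<And>y. y \<in> carrier N' \<Longrightarrow> i (j y) = y"
    using mod_isoE[OF assms(2,3)] by metis
  fix K L g f
  assume *: "K \<in> fg_modules A" "L \<in> fg_modules A" "lin K L g" "lin K N' f"
    "\<forall>x\<in>carrier K. g x = \<zero>\<^bsub>L\<^esub> \<longrightarrow> f x = \<zero>\<^bsub>N'\<^esub>"
  have "j (f x) = \<zero>\<^bsub>N\<^esub>" if "x \<in> carrier K" "g x = \<zero>\<^bsub>L\<^esub>" for x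
    using * that lin_zero[OF ij(2)] assms by simp
  then obtain h where h: "lin L N h" "\<And>x. x \<in> carrier K \<Longrightarrow> h (g x) = j (f x)"
    using inj_modD[OF assms(1) *(1-3) lin_comp[OF *(4) ij(2)]] by metis
  show "\<exists>h. lin L N' h \<and> (\<forall>x\<in>carrier K. h (g x) = f x)"
    by (intro exI[of _ "\<lambda>x. i (h x)"] conjI lin_comp[OF h(1) ij(1)])
      (use h ij lin_closed[OF *(4)] in auto)
qed

text \<open>A cocycle vanishes on the boundaries, which are the kernel of the preceding
  differential, and so extends along that differential.\<close>

lemma orth_injective:
  assumes "M \<in> fg_modules A" "N \<in> fg_modules A" "inj_mod N" shows "orth M N"
proof -
  obtain P d e where r: "res M P d e" using res_exists assms by metis
  note r1 = resD[OF r]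
  have "van P d N n" for n
    unfolding van_def
  proof (intro allI impI)
    fix f assume f: "lin (P (Suc n)) N f" "\<forall>x\<in>carrier (P (Suc (Suc n))). f (d (Suc n) x) = \<zero>\<^bsub>N\<^esub>"
    have "f x = \<zero>\<^bsub>N\<^esub>" if "x \<in> carrier (P (Suc n))" "d n x = \<zero>\<^bsub>P n\<^esub>" for x
      using r1(6)[OF that(1)] that f(2) by auto
    then obtain h where "lin (P n) N h" "\<And>x. x \<in> carrier (P (Suc n)) \<Longrightarrow> h (d n x) = f x"
      using inj_modD[OF assms(3) r1(7) r1(7) r1(4) f(1)] by metis
    then show "\<exists>g. lin (P n) N g \<and> (\<forall>x\<in>carrier (P (Suc n)). f x = g (d n x))" by force
  qed
  then show ?thesis using orth_res[OF assms(1,2) r] by blast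
qed

subsection \<open>Finite direct sums\<close>

abbreviation fam where "fam J X \<equiv> direct_sum_family J X"

lemma rmod_fam:
  assumes "\<And>j. j \<in> J \<Longrightarrow> rmod (X j)" shows "rmod (fam J X)"
  using assms
  by (intro rmodI)
    (auto simp: direct_sum_family_def PiE_iff rmod_assoc ract_add ract_add_left ract_mult
      fun_eq_iff extensional_def restrict_def intro: rmod_comm)

lemma biprod_fam_insert:
  assumes "\<And>j. j \<in> insert i J \<Longrightarrow> rmod (X j)" "i \<notin> J"
  shows "biprod (fam (insert i J) X) (X i) (fam J X)"
proof -
  have ne: "j \<noteq> i" if "j \<in> J" for j using that assms by auto
  have "bip (fam (insert i J) X) (X i) (fam J X) (\<lambda>x. \<lambda>j\<in>insert i J. if j = i then x else \<zero>\<^bsub>X j\<^esub>)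
    (\<lambda>y. \<lambda>j\<in>insert i J. if j = i then \<zero>\<^bsub>X i\<^esub> else y j) (\<lambda>v. v i) (\<lambda>v. restrict v J)"
    unfolding bip_def lin_def
    using assms ne by (auto simp: direct_sum_family_def PiE_iff fun_eq_iff extensional_def restrict_def)
  then show ?thesis unfolding biprod_def by blast
qed

lemma biprod_fam_remove:
  assumes "\<And>j. j \<in> J \<Longrightarrow> rmod (X j)" "i \<in> J"
  shows "biprod (fam J X) (X i) (fam (J - {i}) X)"
proof -
  have ins: "J = insert i (J - {i})" using assms by auto
  show ?thesis by (subst ins, rule biprod_fam_insert) (use assms in auto)
qed

lemma fam_empty: "carrier (fam {} X) = {\<zero>\<^bsub>fam {} X\<^esub>}"
  by (auto simp: direct_sum_family_def)

lemma fd_zero: "rmod M \<Longrightarrow> carrier M = {\<zero>\<^bsub>M\<^esub>} \<Longrightarrow> fd M"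
  unfolding fd_def by (auto intro!: exI[of _ "{}"] kspan_zero)

lemma fd_fam:
  assumes "finite J" "\<And>j. j \<in> J \<Longrightarrow> fd (X j)" shows "fd (fam J X)"
  using assms
proof (induction J)
  case empty
  show ?case by (rule fd_zero[OF rmod_fam fam_empty]) auto
next
  case (insert i J)
  have "fd (fam J X)" using insert by auto
  then show ?case
    by (rule fd_biprod[OF rmod_fam, rotated 2, OF _ biprod_fam_insert]) (use insert in auto)
qed

lemma biprod_zero:
  assumes "rmod M" "rmod Z" "carrier Z = {\<zero>\<^bsub>Z\<^esub>}" shows "biprod M M Z"
  unfolding biprod_def bip_def using assms
  by (intro exI[of _ "\<lambda>x. x"] exI[of _ "\<lambda>_. \<zero>\<^bsub>M\<^esub>"] exI[of _ "\<lambda>_. \<zero>\<^bsub>Z\<^esub>"])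
    (auto simp: lin_id lin_const_zero)

lemma biprod_zero_iso:
  assumes "biprod D M N" "rmod D" "rmod M" "rmod N" "carrier M = {\<zero>\<^bsub>M\<^esub>}"
  shows "mod_iso A D N"
  by (rule biprod_unique[OF biprod_swap[OF assms(1,2)] biprod_zero[OF assms(4,3,5)] mod_iso_refl mod_iso_refl])
    (use assms in simp_all)

lemma biprod_exists:
  assumes "fd M" "fd N" obtains D where "D \<in> fg_modules A" "biprod D M N"
proof -
  obtain D where D: "D \<in> fg_modules A" "mod_iso A (direct_sum M N) D"
    using fd_transport[OF fd_direct_sum[OF assms]] by blast
  then show thesis
    using that biprod_iso[OF biprod_direct_sum D(2)] assms by (simp add: rmod_direct_sum)
qed

subsection \<open>Generation\<close>

text \<open>The trace of \<open>T\<close> in \<open>X\<close> is all of \<open>X\<close>. Speaking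
  of submodules that contain every image of \<open>T\<close> avoids finite sums of maps.\<close>

definition gen where
  "gen T X \<longleftrightarrow> (\<forall>H. submodule H A X \<longrightarrow> (\<forall>f. lin T X f \<longrightarrow> f ` carrier T \<subseteq> H) \<longrightarrow> H = carrier X)"

text \<open>For each map f from \<open>T\<close> to \<open>X\<close>, the preimage of
  \<open>H\<close> is a submodule of \<open>T\<close> that contains all images of \<open>T'\<close>,
  hence is all of \<open>T\<close>.\<close>

lemma gen_trans:
  assumes "rmod T'" "rmod T" "rmod X" "gen T' T" "gen T X" shows "gen T' X"
  unfolding gen_def
proof (intro allI impI)
  fix H assume H: "submodule H A X" "\<forall>f. lin T' X f \<longrightarrow> f ` carrier T' \<subseteq> H"
  have "f ` carrier T \<subseteq> H" if f: "lin T X f" for f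
  proof -
    have "{x \<in> carrier T. f x \<in> H} = carrier T"
    proof (rule assms(4)[unfolded gen_def, rule_format])
      show "submodule {x \<in> carrier T. f x \<in> H} A T" using submodule_vimage[OF assms(2,3) f H(1)] .
      show "g ` carrier T' \<subseteq> {x \<in> carrier T. f x \<in> H}" if g: "lin T' T g" for g
        using H(2) lin_comp[OF g f] lin_closed[OF g] by auto
    qed
    then show ?thesis by auto
  qed
  then show "H = carrier X" using assms(5) H(1) unfolding gen_def by blast
qed

lemma gen_surj:
  assumes "rmod X" "lin T X f" "carrier X \<subseteq> f ` carrier T" shows "gen T X"
  unfolding gen_def
proof (intro allI impI)
  fix H assume "submodule H A X" "\<forall>f. lin T X f \<longrightarrow> f ` carrier T \<subseteq> H"
  then have "H \<subseteq> carrier X" "f ` carrier T \<subseteq> H" using assms by (simp_all add: submodule_iff)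
  then show "H = carrier X" using assms(3) by simp
qed

lemma gen_self: "rmod T \<Longrightarrow> gen T T"
  by (rule gen_surj[OF _ lin_id]) auto

lemma gen_zero: "rmod X \<Longrightarrow> carrier X = {\<zero>\<^bsub>X\<^esub>} \<Longrightarrow> gen T X"
  unfolding gen_def by (auto dest: submoduleD)

lemma gen_biprod:
  assumes "rmod D" "rmod M" "rmod N" "biprod D M N" "gen T M" "gen T N" shows "gen T D"
  unfolding gen_def
proof (intro allI impI)
  obtain i1 i2 p1 p2 where b: "bip D M N i1 i2 p1 p2" using assms biprod_def by blast
  note bd = bipD[OF b]
  fix H assume H: "submodule H A D" "\<forall>f. lin T D f \<longrightarrow> f ` carrier T \<subseteq> H"
  have 1: "{x \<in> carrier M. i1 x \<in> H} = carrier M"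
  proof (rule assms(5)[unfolded gen_def, rule_format])
    show "submodule {x \<in> carrier M. i1 x \<in> H} A M" using submodule_vimage[OF assms(2,1) bd(1) H(1)] .
    show "g ` carrier T \<subseteq> {x \<in> carrier M. i1 x \<in> H}" if g: "lin T M g" for g
      using H(2) lin_comp[OF g bd(1)] lin_closed[OF g] by auto
  qed
  have 2: "{x \<in> carrier N. i2 x \<in> H} = carrier N"
  proof (rule assms(6)[unfolded gen_def, rule_format])
    show "submodule {x \<in> carrier N. i2 x \<in> H} A N" using submodule_vimage[OF assms(3,1) bd(2) H(1)] .
    show "g ` carrier T \<subseteq> {x \<in> carrier N. i2 x \<in> H}" if g: "lin T N g" for g
      using H(2) lin_comp[OF g bd(2)] lin_closed[OF g] by auto
  qed
  have "d \<in> H" if d: "d \<in> carrier D" for d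
  proof -
    have "i1 (p1 d) \<in> H" "i2 (p2 d) \<in> H" using 1 2 d lin_closed[OF bd(3) d] lin_closed[OF bd(4) d] by blast+
    then show ?thesis using submoduleD(3)[OF H(1) assms(1)] bd(9)[OF d] by metis
  qed
  then show "H = carrier D" using H(1) assms(1) by (auto simp: submodule_iff)
qed

lemma gen_summand:
  assumes "rmod D" "rmod M" "rmod N" "biprod D M N" shows "gen D M" "gen D N"
proof -
  obtain i1 i2 p1 p2 where b: "bip D M N i1 i2 p1 p2" using assms biprod_def by blast
  note bd = bipD[OF b]
  show "gen D M"
    by (rule gen_surj[OF assms(2) bd(3)]) (use bd(5) lin_closed[OF bd(1)] in \<open>metis image_eqI subsetI\<close>)
  show "gen D N"
    by (rule gen_surj[OF assms(3) bd(4)]) (use bd(7) lin_closed[OF bd(2)] in \<open>metis image_eqI subsetI\<close>)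
qed

lemma gen_iso:
  assumes "mod_iso A M N" "rmod M" "rmod N" shows "gen M N"
proof -
  obtain f g where fg: "lin M N f" "lin N M g" "\<And>y. y \<in> carrier N \<Longrightarrow> f (g y) = y"
    using mod_isoE[OF assms(1,2)] by metis
  show ?thesis by (rule gen_surj[OF assms(3) fg(1)]) (use fg(3) lin_closed[OF fg(2)] in \<open>metis image_eqI subsetI\<close>)
qed

text \<open>Since Hom(N, X) = 0, a map from \<open>D\<close> to \<open>X\<close> has the same image
  as its restriction to \<open>M\<close>.\<close>

lemma gen_drop_summand:
  assumes "rmod D" "rmod M" "rmod N" "rmod X" "biprod D M N" "gen D X"
    "\<And>f x. lin N X f \<Longrightarrow> x \<in> carrier N \<Longrightarrow> f x = \<zero>\<^bsub>X\<^esub>"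
  shows "gen M X"
  unfolding gen_def
proof (intro allI impI)
  obtain i1 i2 p1 p2 where b: "bip D M N i1 i2 p1 p2" using assms biprod_def by blast
  note bd = bipD[OF b]
  fix H assume H: "submodule H A X" "\<forall>f. lin M X f \<longrightarrow> f ` carrier M \<subseteq> H"
  have "f ` carrier D \<subseteq> H" if f: "lin D X f" for f
  proof
    fix y assume "y \<in> f ` carrier D"
    then obtain x where x: "x \<in> carrier D" "y = f x" by auto
    have c: "p1 x \<in> carrier M" "p2 x \<in> carrier N" using x lin_closed[OF bd(3)] lin_closed[OF bd(4)] by auto
    have "f x = f (i1 (p1 x)) \<oplus>\<^bsub>X\<^esub> f (i2 (p2 x))"
      using lin_add[OF f, of "i1 (p1 x)" "i2 (p2 x)"] c lin_closed[OF bd(1)] lin_closed[OF bd(2)] bd(9)[OF x(1)] by simp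
    also have "\<dots> = f (i1 (p1 x))"
      using assms(7)[OF lin_comp[OF bd(2) f] c(2)] assms(4) lin_closed[OF f lin_closed[OF bd(1) c(1)]] by simp
    also have "\<dots> \<in> H" using H(2) lin_comp[OF bd(1) f] c by blast
    finally show "y \<in> H" using x by simp
  qed
  then show "H = carrier X" using assms(6) H(1) unfolding gen_def by blast
qed

section \<open>Vanishing of Hom and cancellation of direct summands\<close>

definition no_hom where "no_hom U Y \<longleftrightarrow> (\<forall>f. lin U Y f \<longrightarrow> (\<forall>x\<in>carrier U. f x = \<zero>\<^bsub>Y\<^esub>))"

lemma no_homD: "no_hom U Y \<Longrightarrow> lin U Y f \<Longrightarrow> x \<in> carrier U \<Longrightarrow> f x = \<zero>\<^bsub>Y\<^esub>"
  by (simp add: no_hom_def)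

lemma no_hom_sub:
  assumes "no_hom U Y" "lin Z Y i" "inj_on i (carrier Z)" "rmod Y" "rmod Z" shows "no_hom U Z"
  unfolding no_hom_def
proof (intro allI impI ballI)
  fix f x assume f: "lin U Z f" and x: "x \<in> carrier U"
  have "i (f x) = \<zero>\<^bsub>Y\<^esub>" using no_homD[OF assms(1) lin_comp[OF f assms(2)] x] .
  then show "f x = \<zero>\<^bsub>Z\<^esub>" using lin_inj_iff[OF assms(5,4,2)] assms(3) lin_closed[OF f x] by blast
qed

lemma no_hom_iso1:
  assumes "no_hom U Y" "mod_iso A U V" "rmod U" shows "no_hom V Y"
  unfolding no_hom_def
proof (intro allI impI ballI)
  obtain i j where ij: "lin U V i" "lin V U j" "\<And>y. y \<in> carrier V \<Longrightarrow> i (j y) = y"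
    using mod_isoE[OF assms(2,3)] by metis
  fix f x assume f: "lin V Y f" and x: "x \<in> carrier V"
  show "f x = \<zero>\<^bsub>Y\<^esub>"
    using no_homD[OF assms(1) lin_comp[OF ij(1) f] lin_closed[OF ij(2) x]] ij(3)[OF x] by simp
qed

lemma no_hom_biprod1:
  assumes "biprod D M N" "no_hom M Y" "no_hom N Y" "rmod Y" shows "no_hom D Y"
  unfolding no_hom_def
proof (intro allI impI ballI)
  obtain i1 i2 p1 p2 where b: "bip D M N i1 i2 p1 p2" using assms biprod_def by blast
  note bd = bipD[OF b]
  fix f x assume f: "lin D Y f" and x: "x \<in> carrier D"
  have c: "p1 x \<in> carrier M" "p2 x \<in> carrier N" using lin_closed[OF bd(3) x] lin_closed[OF bd(4) x] by auto
  have "f x = f (i1 (p1 x)) \<oplus>\<^bsub>Y\<^esub> f (i2 (p2 x))"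
    using lin_add[OF f lin_closed[OF bd(1) c(1)] lin_closed[OF bd(2) c(2)]] bd(9)[OF x] by simp
  then show "f x = \<zero>\<^bsub>Y\<^esub>"
    using no_homD[OF assms(2) lin_comp[OF bd(1) f] c(1)] no_homD[OF assms(3) lin_comp[OF bd(2) f] c(2)] assms(4) by simp
qed

lemma no_hom_biprod2:
  assumes "biprod D M N" "no_hom U M" "no_hom U N" "rmod D" "rmod M" "rmod N" shows "no_hom U D"
  unfolding no_hom_def
proof (intro allI impI ballI)
  obtain i1 i2 p1 p2 where b: "bip D M N i1 i2 p1 p2" using assms biprod_def by blast
  note bd = bipD[OF b]
  fix f x assume f: "lin U D f" and x: "x \<in> carrier U"
  show "f x = \<zero>\<^bsub>D\<^esub>"
    using bd(9)[OF lin_closed[OF f x]] no_homD[OF assms(2) lin_comp[OF f bd(3)] x]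
      no_homD[OF assms(3) lin_comp[OF f bd(4)] x] lin_zero[OF bd(1)] lin_zero[OF bd(2)] assms by simp
qed

lemma no_hom_iso2:
  assumes "no_hom U Y" "mod_iso A Y Z" "rmod Y" "rmod Z" shows "no_hom U Z"
proof -
  obtain i j where ij: "lin Y Z i" "lin Z Y j" "\<And>y. y \<in> carrier Z \<Longrightarrow> i (j y) = y"
    using mod_isoE[OF assms(2,3)] by metis
  have "inj_on j (carrier Z)" using ij(3) by (metis inj_onI)
  then show ?thesis using no_hom_sub[OF assms(1) ij(2)] assms by blast
qed

lemma no_hom_summand:
  assumes "biprod D M N" "no_hom U D" "rmod D" "rmod M" "rmod N" shows "no_hom U M" "no_hom U N"
proof -
  obtain i1 i2 p1 p2 where b: "bip D M N i1 i2 p1 p2" using assms biprod_def by blast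
  note bd = bipD[OF b]
  have "inj_on i1 (carrier M)" "inj_on i2 (carrier N)" using bd(5,7) by (metis inj_onI)+
  then show "no_hom U M" "no_hom U N"
    using no_hom_sub[OF assms(2) bd(1)] no_hom_sub[OF assms(2) bd(2)] assms by blast+
qed

lemma no_hom_fam:
  assumes "\<And>j. j \<in> J \<Longrightarrow> no_hom U (X j)" shows "no_hom U (fam J X)"
  unfolding no_hom_def
proof (intro allI impI ballI)
  fix f x assume f: "lin U (fam J X) f" and x: "x \<in> carrier U"
  have "f x j = \<zero>\<^bsub>X j\<^esub>" if j: "j \<in> J" for j
  proof -
    have "lin (fam J X) (X j) (\<lambda>v. v j)"
      by (rule linI) (use j in \<open>auto simp: direct_sum_family_def PiE_iff\<close>)
    then show ?thesis using no_homD[OF assms[OF j] lin_comp[OF f] x] by blast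
  qed
  moreover have "f x \<in> extensional J" using lin_closed[OF f x] by (simp add: direct_sum_family_def PiE_def)
  ultimately show "f x = \<zero>\<^bsub>fam J X\<^esub>"
    by (auto simp: direct_sum_family_def fun_eq_iff extensional_def)
qed

text \<open>The two Hom conditions kill the off-diagonal blocks that \<open>bip_cancel\<close>
  requires to vanish.\<close>

lemma biprod_cancel:
  assumes "biprod D X U" "biprod D' X' U'" "mod_iso A D D'" "no_hom U X'" "no_hom U' X"
    and rm: "rmod D" "rmod D'" "rmod X" "rmod X'" "rmod U" "rmod U'"
  shows "mod_iso A X X'"
proof -
  obtain i1 i2 p1 p2 where b: "bip D X U i1 i2 p1 p2" using assms biprod_def by blast
  obtain j1 j2 q1 q2 where c: "bip D' X' U' j1 j2 q1 q2" using assms biprod_def by blast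
  obtain h k where h: "lin D D' h" "lin D' D k"
      "\<And>x. x \<in> carrier D \<Longrightarrow> k (h x) = x" "\<And>y. y \<in> carrier D' \<Longrightarrow> h (k y) = y"
    using mod_isoE[OF assms(3) rm(1)] by metis
  note bd = bipD[OF b] and cd = bipD[OF c]
  show ?thesis
    by (rule bip_cancel[OF b c h(1,2) _ _ _ _ rm])
      (use h(3,4) no_homD[OF assms(4) lin_comp[OF lin_comp[OF bd(2) h(1)] cd(3)]]
        no_homD[OF assms(5) lin_comp[OF lin_comp[OF cd(2) h(2)] bd(3)]] in auto)
qed

section \<open>Approximations by add T and the generation criterion for PWT modules\<close>

lemma gen_fam:
  assumes "rmod T" "finite J" shows "gen T (fam J (\<lambda>_. T))"
  using assms(2)
proof (induction J)
  case empty
  show ?case by (rule gen_zero[OF rmod_fam fam_empty]) auto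
next
  case (insert i J)
  show ?case
    by (rule gen_biprod[OF rmod_fam _ rmod_fam biprod_fam_insert gen_self insert.IH])
      (use assms insert in auto)
qed

lemma gen_add_closure:
  assumes "T \<in> fg_modules A" "X \<in> add_closure A T" shows "gen T X"
proof -
  obtain Y and n :: nat where *: "X \<in> fg_modules A" "Y \<in> fg_modules A"
    "mod_iso A (direct_sum X Y) (fam {..<n} (\<lambda>_. T))"
    using assms(2) unfolding add_closure_def by auto
  have rF: "rmod (fam {..<n} (\<lambda>_. T))" using assms by (intro rmod_fam) simp
  have rD: "rmod (direct_sum X Y)" using * by (simp add: rmod_direct_sum)
  have "gen (fam {..<n} (\<lambda>_. T)) (direct_sum X Y)"
    using gen_iso[OF mod_iso_sym[OF *(3) rD rF] rF rD] .
  then have "gen T (direct_sum X Y)"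
    using gen_trans[OF _ rF rD gen_fam] assms by simp
  moreover have "gen (direct_sum X Y) X" using gen_summand(1)[OF rD _ _ biprod_direct_sum] * by simp
  ultimately show ?thesis
    by (rule gen_trans[OF _ rD, rotated 2]) (use assms * in simp_all)
qed

text \<open>\<open>Hom(T, X)\<close> embeds into a finite power of \<open>X\<close> by evaluation at a spanning set of \<open>T\<close>.\<close>

lemma hom_finite:
  assumes "fd T" "fd X"
  obtains F where "finite F" "\<And>f. f \<in> F \<Longrightarrow> lin T X f"
    "\<And>f P g. rmod P \<Longrightarrow> lin P X g \<Longrightarrow>
      (\<And>h. h \<in> F \<Longrightarrow> \<exists>u. lin T P u \<and> (\<forall>t\<in>carrier T. g (u t) = h t)) \<Longrightarrow> lin T X f \<Longrightarrow>
      \<exists>u. lin T P u \<and> (\<forall>t\<in>carrier T. g (u t) = f t)"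
proof -
  have T: "rmod T" and X: "rmod X" using assms by auto
  obtain S where S: "finite S" "S \<subseteq> carrier T" "carrier T \<subseteq> kspan T S" using fdE[OF assms(1)] by metis
  let ?E = "fam S (\<lambda>_. X)"
  have fE: "fd ?E" using fd_fam[OF S(1), of "\<lambda>_. X"] assms by simp
  have rE: "rmod ?E" using fE by simp
  define ev where "ev f = restrict f S" for f :: "'b \<Rightarrow> 'c"
  let ?W = "ev ` {f. lin T X f}"
  have ev0: "ev (\<lambda>_. \<zero>\<^bsub>X\<^esub>) = \<zero>\<^bsub>?E\<^esub>" by (simp add: ev_def direct_sum_family_def)
  have eva: "ev f \<oplus>\<^bsub>?E\<^esub> ev g = ev (\<lambda>x. f x \<oplus>\<^bsub>X\<^esub> g x)" for f g
    by (auto simp: ev_def direct_sum_family_def)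
  have evs: "a \<odot>\<^bsub>?E\<^esub> ev f = ev (\<lambda>x. a \<odot>\<^bsub>X\<^esub> f x)" for f a
    by (auto simp: ev_def direct_sum_family_def)
  have evc: "ev f \<in> carrier ?E" if "lin T X f" for f
    using lin_closed[OF that] S(2) by (auto simp: ev_def direct_sum_family_def)
  have lsc: "lin T X (\<lambda>x. sc c \<odot>\<^bsub>X\<^esub> f x)" if "lin T X f" for f c
    using lin_comp[OF that sc_lin[OF X]] .
  have kW: "ksub ?E ?W"
    unfolding ksub_def
  proof (intro conjI ballI allI)
    show "\<zero>\<^bsub>?E\<^esub> \<in> ?W" using ev0 lin_const_zero[OF X] by (metis imageI mem_Collect_eq)
    show "x \<oplus>\<^bsub>?E\<^esub> y \<in> ?W" if "x \<in> ?W" "y \<in> ?W" for x y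
      using that lin_sum[OF _ _ T X] by (auto simp: eva)
    show "sc c \<odot>\<^bsub>?E\<^esub> x \<in> ?W" if "x \<in> ?W" for x c
      using that lsc by (auto simp: evs)
  qed (use evc in auto)
  obtain S' where S': "finite S'" "S' \<subseteq> carrier ?E" "carrier ?E \<subseteq> kspan ?E S'"
    using fdE[OF fE] by metis
  have "?W \<subseteq> kspan ?E S'" using S'(3) ksubD(1)[OF kW] by auto
  \<comment> \<open>The evaluations form a subspace of the finite-dimensional X^S, so finitely many
    of them span it; \<open>F\<close> consists of homomorphisms with these evaluations.\<close>
  then obtain V where V: "finite V" "V \<subseteq> ?W" "?W \<subseteq> kspan ?E V"
    using ksub_finite_span[OF rE S'(1,2) kW] by auto
  obtain F where F: "finite F" "F \<subseteq> {f. lin T X f}" "V = ev ` F"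
    using finite_subset_image[OF V(1,2)] by auto
  show thesis
  proof (rule that[OF F(1)])
    show "lin T X f" if "f \<in> F" for f using that F by auto
    fix f P g
    assume P: "rmod P" and g: "lin P X g" and f: "lin T X f"
      and fac: "\<And>h. h \<in> F \<Longrightarrow> \<exists>u. lin T P u \<and> (\<forall>t\<in>carrier T. g (u t) = h t)"
    \<comment> \<open>Maps that factor through \<open>g\<close> are closed under linear
      combinations, so factorisation spreads from \<open>F\<close> to its span.\<close>
    have "\<exists>u. lin T P u \<and> ev (\<lambda>t. g (u t)) = w" if "w \<in> kspan ?E V" for w
      using that
    proof (induction rule: kspan.induct)
      case kspan_zero
      show ?case using lin_const_zero[OF P] lin_zero[OF g P X] ev0 by (intro exI[of _ "\<lambda>_. \<zero>\<^bsub>P\<^esub>"]) auto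
    next
      case (kspan_step x w c)
      then obtain h where h: "h \<in> F" "x = ev h" using F by auto
      obtain u1 where u1: "lin T P u1" "\<forall>t\<in>carrier T. g (u1 t) = h t" using fac[OF h(1)] by auto
      obtain u2 where u2: "lin T P u2" "ev (\<lambda>t. g (u2 t)) = w" using kspan_step by auto
      have "ev h = ev (\<lambda>t. g (u1 t))" unfolding ev_def using u1(2) S(2) by (intro restrict_ext) auto
      then have "sc c \<odot>\<^bsub>?E\<^esub> x \<oplus>\<^bsub>?E\<^esub> w = ev (\<lambda>t. sc c \<odot>\<^bsub>X\<^esub> g (u1 t) \<oplus>\<^bsub>X\<^esub> g (u2 t))"
        unfolding h(2) u2(2)[symmetric] by (simp only: evs eva)
      also have "\<dots> = ev (\<lambda>t. g (sc c \<odot>\<^bsub>P\<^esub> u1 t \<oplus>\<^bsub>P\<^esub> u2 t))"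
        unfolding ev_def using S(2) P lin_closed[OF u1(1)] lin_closed[OF u2(1)]
        by (intro restrict_ext) (simp add: lin_add[OF g] lin_act[OF g] subset_iff)
      finally show ?case
        using lin_sum[OF lin_comp[OF u1(1) sc_lin[OF P]] u2(1) T P, of c] by metis
    qed
    moreover have "ev f \<in> kspan ?E V" using V(3) f by auto
    ultimately obtain u where u: "lin T P u" "ev (\<lambda>t. g (u t)) = ev f" by blast
    have gu: "lin T X (\<lambda>t. g (u t))" by (rule lin_comp[OF u(1) g])
    \<comment> \<open>\<open>g u\<close> and \<open>f\<close> agree on the spanning set
      \<open>S\<close> only; the kernel of their difference is a submodule containing
      \<open>S\<close>, hence everything.\<close>
    have "submodule {t \<in> carrier T. g (u t) \<ominus>\<^bsub>X\<^esub> f t = \<zero>\<^bsub>X\<^esub>} A T"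
      by (rule submodule_ker[OF T X lin_sub[OF gu f T X]])
    moreover have "S \<subseteq> {t \<in> carrier T. g (u t) \<ominus>\<^bsub>X\<^esub> f t = \<zero>\<^bsub>X\<^esub>}"
    proof
      fix s assume s: "s \<in> S"
      then have "g (u s) = f s" using fun_cong[OF u(2), of s] by (simp add: ev_def)
      then show "s \<in> {t \<in> carrier T. g (u t) \<ominus>\<^bsub>X\<^esub> f t = \<zero>\<^bsub>X\<^esub>}" using s S(2) lin_closed[OF f] X by auto
    qed
    ultimately have "kspan T S \<subseteq> {t \<in> carrier T. g (u t) \<ominus>\<^bsub>X\<^esub> f t = \<zero>\<^bsub>X\<^esub>}"
      using kspan_least ksub_submodule T by blast
    then have "g (u t) = f t" if "t \<in> carrier T" for t
      using that S(3) rmod_diff_eq_iff[OF X] lin_closed[OF gu] lin_closed[OF f] by blast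
    then show "\<exists>u. lin T P u \<and> (\<forall>t\<in>carrier T. g (u t) = f t)" using u by blast
  qed
qed

text \<open>\<open>P\<close> is a power of \<open>T\<close> with one copy for each map in the finite
  set from \<open>hom_finite\<close>, and \<open>g\<close> is the sum of these maps. Each of them
  factors through \<open>g\<close> by a coordinate inclusion, and hence so does every map from
  \<open>T\<close> to \<open>X\<close>.\<close>

lemma add_approximation:
  assumes "T \<in> fg_modules A" "X \<in> fg_modules A" "orth T T"
  obtains P g where "P \<in> add_closure A T" "P \<in> fg_modules A" "orth T P" "lin P X g"
    "\<And>f. lin T X f \<Longrightarrow> \<exists>u. lin T P u \<and> (\<forall>t\<in>carrier T. g (u t) = f t)"
proof -
  have T: "rmod T" and X: "rmod X" using assms by auto
  obtain F where F: "finite F" "\<And>f. f \<in> F \<Longrightarrow> lin T X f"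
    "\<And>f (P :: ('a, nat \<Rightarrow> 'k) module) g. rmod P \<Longrightarrow> lin P X g \<Longrightarrow>
      (\<And>h. h \<in> F \<Longrightarrow> \<exists>u. lin T P u \<and> (\<forall>t\<in>carrier T. g (u t) = h t)) \<Longrightarrow> lin T X f \<Longrightarrow>
      \<exists>u. lin T P u \<and> (\<forall>t\<in>carrier T. g (u t) = f t)"
    using hom_finite[OF fg_fd[OF assms(1)] fg_fd[OF assms(2)]] by blast
  let ?Z = "T\<lparr>carrier := {\<zero>\<^bsub>T\<^esub>}\<rparr>"
  have Z: "?Z \<in> fg_modules A" by (rule fg_sub[OF assms(1) submodule_zero[OF T]])
  then have rZ: "rmod ?Z" by simp
  have "\<exists>P g (n::nat). P \<in> fg_modules A \<and> mod_iso A P (fam {..<n} (\<lambda>_. T)) \<and> orth T P \<and> lin P X g \<and>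
    (\<forall>h\<in>G. \<exists>u. lin T P u \<and> (\<forall>t\<in>carrier T. g (u t) = h t))"
    if "finite G" "G \<subseteq> F" for G
    using that
  proof (induction G)
    case empty
    have rE: "rmod (fam ({} :: nat set) (\<lambda>_. T))" by (rule rmod_fam) simp
    have 1: "mod_iso A ?Z (fam {..<0::nat} (\<lambda>_. T))"
      by (rule mod_isoI[OF rZ, of _ "\<lambda>_. \<zero>\<^bsub>fam {..<0::nat} (\<lambda>_. T)\<^esub>" "\<lambda>_. \<zero>\<^bsub>?Z\<^esub>"])
        (use lin_const_zero[OF rZ] lin_const_zero[OF rE] in \<open>simp_all add: fam_empty\<close>)
    have 2: "orth T ?Z"
      by (rule orth_retract2[OF assms(1) Z assms(1) lin_const_zero[OF rZ] lin_incl[OF T submodule_zero[OF T]] _ assms(3)]) simp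
    show ?case using Z 1 2 lin_const_zero[OF X] by blast
  next
    case (insert h G)
    then obtain P g and n :: nat where P: "P \<in> fg_modules A" "mod_iso A P (fam {..<n} (\<lambda>_. T))" "orth T P"
      "lin P X g" "\<And>h. h \<in> G \<Longrightarrow> \<exists>u. lin T P u \<and> (\<forall>t\<in>carrier T. g (u t) = h t)" by auto
    have h: "lin T X h" using F insert by auto
    have rP: "rmod P" using P by simp
    obtain D where D: "D \<in> fg_modules A" "biprod D T P" using biprod_exists assms P by (meson fg_fd)
    then obtain i1 i2 p1 p2 where b: "bip D T P i1 i2 p1 p2" using biprod_def by blast
    note bd = bipD[OF b]
    have rD: "rmod D" using D by simp
    have ins: "{..<Suc n} = insert n {..<n}" by auto
    have "mod_iso A D (fam {..<Suc n} (\<lambda>_. T))"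
      unfolding ins
      by (rule biprod_unique[OF D(2) biprod_fam_insert mod_iso_refl[OF T] P(2)])
        (use T rP rD in \<open>auto intro!: rmod_fam\<close>)
    moreover have "orth T D" using orth_biprod2[OF assms(1) D(1) assms(1) P(1) D(2)] assms P by simp
    moreover have "lin D X (\<lambda>x. h (p1 x) \<oplus>\<^bsub>X\<^esub> g (p2 x))"
      by (intro lin_sum lin_comp[OF bd(3) h] lin_comp[OF bd(4) P(4)] rD X)
    moreover have "\<exists>u. lin T D u \<and> (\<forall>t\<in>carrier T. h (p1 (u t)) \<oplus>\<^bsub>X\<^esub> g (p2 (u t)) = k t)"
      if k: "k \<in> insert h G" for k
    proof (cases "k = h")
      case True
      then show ?thesis using bd(1,5,6) lin_zero[OF P(4) rP X] X lin_closed[OF h]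
        by (intro exI[of _ i1]) auto
    next
      case False
      then obtain u where u: "lin T P u" "\<forall>t\<in>carrier T. g (u t) = k t" using P(5) k by auto
      then show ?thesis using lin_comp[OF u(1) bd(2)] bd(7,8) lin_zero[OF h T X] X lin_closed[OF P(4)] lin_closed[OF u(1)]
        by (intro exI[of _ "\<lambda>t. i2 (u t)"]) (auto, metis rmod_add_simps(1))
    qed
    ultimately show ?case using D(1) by blast
  qed
  from this[OF F(1)] obtain P g and n :: nat where P: "P \<in> fg_modules A" "mod_iso A P (fam {..<n} (\<lambda>_. T))"
    "orth T P" "lin P X g" "\<And>h. h \<in> F \<Longrightarrow> \<exists>u. lin T P u \<and> (\<forall>t\<in>carrier T. g (u t) = h t)" by auto
  have rP: "rmod P" using P by simp
  have cZ: "carrier ?Z = {\<zero>\<^bsub>?Z\<^esub>}" by simp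
  \<comment> \<open>\<open>add_closure\<close> asks for a complement of \<open>P\<close> in a power
    of \<open>T\<close>; as \<open>P\<close> is itself such a power, the zero module serves.\<close>
  have "biprod P P ?Z" by (rule biprod_zero[OF rP rZ cZ])
  then have "mod_iso A P (direct_sum P ?Z)" using biprod_iff[OF rP rP rZ] by simp
  then have "mod_iso A (direct_sum P ?Z) (fam {..<n} (\<lambda>_. T))"
    by (intro mod_iso_trans[OF mod_iso_sym P(2)] rmod_direct_sum rP rZ)
  then have "P \<in> add_closure A T" unfolding add_closure_def using P(1) Z by blast
  then show thesis
  proof (rule that[OF _ P(1,3,4)])
    show "\<exists>u. lin T P u \<and> (\<forall>t\<in>carrier T. g (u t) = f t)" if "lin T X f" for f
      by (rule F(3)[OF rP P(4) _ that]) (rule P(5))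
  qed
qed

text \<open>The part of the long exact \<open>Ext\<close>-sequence needed for kernels of approximations.\<close>

lemma orth_kernel:
  assumes fg: "T \<in> fg_modules A" "P0 \<in> fg_modules A" "X \<in> fg_modules A"
    and o: "orth T P0" "orth T X" and g: "lin P0 X g" "carrier X \<subseteq> g ` carrier P0"
    and ap: "\<And>f. lin T X f \<Longrightarrow> \<exists>u. lin T P0 u \<and> (\<forall>t\<in>carrier T. g (u t) = f t)"
  shows "orth T (P0\<lparr>carrier := {x \<in> carrier P0. g x = \<zero>\<^bsub>X\<^esub>}\<rparr>)" (is "orth T ?K")
proof -
  have rT: "rmod T" and rP0: "rmod P0" and X: "rmod X" using fg by auto
  have sK: "submodule {x \<in> carrier P0. g x = \<zero>\<^bsub>X\<^esub>} A P0" by (rule submodule_ker[OF rP0 X g(1)])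
  have K: "?K \<in> fg_modules A" by (rule fg_sub[OF fg(2) sK])
  obtain P d e where r: "res T P d e" using res_exists fg by metis
  note r1 = resD[OF r]
  have vP: "van P d P0 n" "van P d X n" for n
    using o orth_res[OF fg(1,2) r] orth_res[OF fg(1,3) r] by auto
  \<comment> \<open>Over \<open>P0\<close> the cocycle \<open>f\<close> is a coboundary h d, but
    \<open>h\<close> need not land in the kernel. Subtracting a \<open>w\<close> with g w = g h
    corrects this, and w d = 0 keeps the coboundary unchanged.\<close>
  have key: "\<exists>k. lin (P n) ?K k \<and> (\<forall>x\<in>carrier (P (Suc n)). f x = k (d n x))"
    if f: "lin (P (Suc n)) ?K f" and h: "lin (P n) P0 h" "\<And>x. x \<in> carrier (P (Suc n)) \<Longrightarrow> f x = h (d n x)"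
      and w: "lin (P n) P0 w" "\<And>x. x \<in> carrier (P n) \<Longrightarrow> g (w x) = g (h x)"
        "\<And>x. x \<in> carrier (P (Suc n)) \<Longrightarrow> w (d n x) = \<zero>\<^bsub>P0\<^esub>" for n f h w
  proof (intro exI conjI ballI)
    show "lin (P n) ?K (\<lambda>x. h x \<ominus>\<^bsub>P0\<^esub> w x)"
      using h w rP0 X by (intro lin_into_sub lin_sub r1)
        (auto simp: lin_closed[OF h(1)] lin_closed[OF w(1)] lin_diff[OF g(1)] lin_closed[OF g(1)])
    show "f x = h (d n x) \<ominus>\<^bsub>P0\<^esub> w (d n x)" if "x \<in> carrier (P (Suc n))" for x
      using that rP0 by (simp add: h(2) w(3) lin_closed[OF h(1)] lin_closed[OF r1(4)])
  qed
  have "van P d ?K n" for n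
    unfolding van_def
  proof (intro allI impI)
    fix f assume f: "lin (P (Suc n)) ?K f" "\<forall>x\<in>carrier (P (Suc (Suc n))). f (d (Suc n) x) = \<zero>\<^bsub>?K\<^esub>"
    have f': "lin (P (Suc n)) P0 f" using lin_comp[OF f(1) lin_incl[OF rP0 sK]] .
    obtain h where h: "lin (P n) P0 h" "\<And>x. x \<in> carrier (P (Suc n)) \<Longrightarrow> f x = h (d n x)"
      using vanD[OF vP(1) f'] f(2) by auto
    have gh: "lin (P n) X (\<lambda>x. g (h x))" by (rule lin_comp[OF h(1) g(1)])
    have gh0: "g (h (d n x)) = \<zero>\<^bsub>X\<^esub>" if x: "x \<in> carrier (P (Suc n))" for x
      using h(2)[OF x] lin_closed[OF f(1) x] by simp
    show "\<exists>k. lin (P n) ?K k \<and> (\<forall>x\<in>carrier (P (Suc n)). f x = k (d n x))"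
    \<comment> \<open>To find \<open>w\<close>: for n = 0, g h vanishes on boundaries and so comes
      from a map T \<rightarrow> X, which factors through the approximation. For larger n, g h is a
      cocycle, hence equal to h' d, and h' lifts along the surjection \<open>g\<close> by
      projectivity.\<close>
    proof (cases n)
      case 0
      have e: "lin (P 0) T e" by (rule r1(2))
      have gh': "lin (P 0) X (\<lambda>x. g (h x))" using gh 0 by simp
      obtain v where v: "lin T X v" "\<And>x. x \<in> carrier (P 0) \<Longrightarrow> v (e x) = g (h x)"
        by (rule lin_factor[OF r1(8) rT X e r1(3) gh']) (use r1(5) gh0 0 in auto)
      obtain u where u: "lin T P0 u" "\<forall>t\<in>carrier T. g (u t) = v t" using ap[OF v(1)] by blast
      show ?thesis
        by (rule key[OF f(1) h, of "\<lambda>x. u (e x)"])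
          (use 0 u v lin_closed[OF e] lin_comp[OF e u(1)] r1(9) lin_zero[OF u(1) rT rP0] in auto)
    next
      case (Suc m)
      obtain h' where h': "lin (P m) X h'" "\<And>x. x \<in> carrier (P n) \<Longrightarrow> g (h x) = h' (d m x)"
        using vanD[OF vP(2)[of m], of "\<lambda>x. g (h x)"] gh gh0 unfolding Suc by auto
      have "h' ` carrier (P m) \<subseteq> g ` carrier P0" using lin_closed[OF h'(1)] g(2) by blast
      then obtain h2 where h2: "lin (P m) P0 h2" "\<And>x. x \<in> carrier (P m) \<Longrightarrow> g (h2 x) = h' x"
        using projective_lift[OF r1(1) fg(2,3) g(1) h'(1)] by metis
      show ?thesis
        by (rule key[OF f(1) h, of "\<lambda>x. h2 (d m x)"])
          (use Suc h' h2 lin_closed[OF r1(4)] lin_comp[OF r1(4) h2(1)] r1(10) lin_zero[OF h2(1) r1(8) rP0] in auto)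
    qed
  qed
  then show ?thesis using orth_res[OF fg(1) K r] by blast
qed

text \<open>The short exact sequences of the definition give way to generation, which passes along
  direct sums, summands and isomorphisms.\<close>

theorem PWT_module_iff:
  "PWT_module A T \<longleftrightarrow> T \<in> fg_modules A \<and> orth T T \<and> (\<forall>X\<in>fg_modules A. orth T X \<longrightarrow> gen T X)"
proof
  assume P: "PWT_module A T"
  then have T: "T \<in> fg_modules A" "orth T T" by (auto simp: PWT_module_def self_orthogonal_iff)
  have "gen T X" if X: "X \<in> fg_modules A" "orth T X" for X
  proof -
    have "X \<in> right_perp A T" using X by (simp add: right_perp_iff)
    then obtain K P0 f g where P0: "P0 \<in> add_closure A T" "short_exact A K f P0 g X"
      and "K \<in> right_perp A T"
      using P unfolding PWT_module_def Ext_progenerator_def by blast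
    have "P0 \<in> fg_modules A" using P0(1) unfolding add_closure_def by blast
    moreover have "lin P0 X g" "carrier X \<subseteq> g ` carrier P0"
      using P0(2) by (auto simp: short_exact_def mod_hom_iff)
    ultimately show ?thesis using gen_trans[OF _ _ _ gen_add_closure gen_surj] T X P0(1) by (meson fg_rmod)
  qed
  then show "T \<in> fg_modules A \<and> orth T T \<and> (\<forall>X\<in>fg_modules A. orth T X \<longrightarrow> gen T X)" using T by blast
next
  assume *: "T \<in> fg_modules A \<and> orth T T \<and> (\<forall>X\<in>fg_modules A. orth T X \<longrightarrow> gen T X)"
  then have T: "T \<in> fg_modules A" "orth T T" by auto
  have pr: "Ext_projective A (right_perp A T) T"
    using T unfolding Ext_projective_def right_perp_iff orth_def by (auto simp: One_nat_def)
  have "\<exists>K\<in>right_perp A T. \<exists>P0\<in>add_closure A T. \<exists>f g. short_exact A K f P0 g X"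
    if "X \<in> right_perp A T" for X
  proof -
    have X: "X \<in> fg_modules A" "orth T X" "gen T X" using that * by (auto simp: right_perp_iff)
    obtain P0 g where P0: "P0 \<in> add_closure A T" "P0 \<in> fg_modules A" "orth T P0" "lin P0 X g"
      "\<And>f. lin T X f \<Longrightarrow> \<exists>u. lin T P0 u \<and> (\<forall>t\<in>carrier T. g (u t) = f t)"
      using add_approximation[OF T(1) X(1) T(2)] by blast
    have r: "rmod P0" "rmod X" using P0 X by auto
    \<comment> \<open>Every map from \<open>T\<close> factors through \<open>g\<close>, so the image
      of \<open>g\<close> contains the trace of \<open>T\<close> in \<open>X\<close>.\<close>
    have "g ` carrier P0 = carrier X"
    proof (rule X(3)[unfolded gen_def, rule_format])
      show "submodule (g ` carrier P0) A X"
        by (rule submodule_image[OF r P0(4) submodule_carrier[OF r(1)]])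
      show "f ` carrier T \<subseteq> g ` carrier P0" if "lin T X f" for f
        using P0(5)[OF that] lin_closed by (metis image_eqI image_subsetI)
    qed
    let ?H = "{x \<in> carrier P0. g x = \<zero>\<^bsub>X\<^esub>}"
    let ?K = "P0\<lparr>carrier := ?H\<rparr>"
    have sK: "submodule ?H A P0" by (rule submodule_ker[OF r P0(4)])
    have K: "?K \<in> fg_modules A" by (rule fg_sub[OF P0(2) sK])
    have "orth T ?K"
      using orth_kernel[OF T(1) P0(2) X(1) P0(3) X(2) P0(4) _ P0(5)] \<open>g ` carrier P0 = carrier X\<close> by blast
    then have "?K \<in> right_perp A T" using K by (simp add: right_perp_iff)
    moreover have "short_exact A ?K (restrict (\<lambda>x. x) ?H) P0 (restrict g (carrier P0)) X"
      unfolding short_exact_def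
    proof (intro conjI)
      show "restrict (\<lambda>x. x) ?H \<in> mod_hom A ?K P0"
        using mod_hom_restrict[OF lin_incl[OF r(1) sK]] K by simp
      show "restrict g (carrier P0) \<in> mod_hom A P0 X" using mod_hom_restrict[OF P0(4) r(1)] .
      show "inj_on (restrict (\<lambda>x. x) ?H) (carrier ?K)" by (auto simp: inj_on_def)
      show "restrict (\<lambda>x. x) ?H ` carrier ?K = a_kernel P0 X (restrict g (carrier P0))"
        by (auto simp: a_kernel_def kernel_def)
      show "restrict g (carrier P0) ` carrier P0 = carrier X"
        using \<open>g ` carrier P0 = carrier X\<close> by simp
    qed
    ultimately show ?thesis using P0(1) by blast
  qed
  then show "PWT_module A T"
    unfolding PWT_module_def Ext_progenerator_def self_orthogonal_iff using T pr by blast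
qed

lemma PWT_module_iso:
  assumes "PWT_module A T" "mod_iso A T T'" "T' \<in> fg_modules A" shows "PWT_module A T'"
proof -
  have T: "T \<in> fg_modules A" "orth T T" "\<And>X. X \<in> fg_modules A \<Longrightarrow> orth T X \<Longrightarrow> gen T X"
    using assms(1) by (auto simp: PWT_module_iff)
  have i: "mod_iso A T' T" using mod_iso_sym[OF assms(2)] T assms by simp
  have "orth T' T'" using orth_iso1[OF assms(2) T(1) assms(3)] orth_iso2[OF assms(2) _ T(1) assms(3)] T assms by blast
  moreover have "gen T' X" if "X \<in> fg_modules A" "orth T' X" for X
    using gen_trans[OF _ _ _ gen_iso[OF i] T(3)] orth_iso1[OF assms(2) T(1) assms(3)] that T assms by (meson fg_rmod)
  ultimately show ?thesis using assms(3) by (simp add: PWT_module_iff)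
qed

subsection \<open>Indecomposable and basic modules\<close>

lemma mod_iso_fam:
  assumes h: "bij_betw h J' J" and iso: "\<And>j. j \<in> J' \<Longrightarrow> mod_iso A (X (h j)) (Y j)"
    and rm: "\<And>j. j \<in> J \<Longrightarrow> rmod (X j)" "\<And>j. j \<in> J' \<Longrightarrow> rmod (Y j)"
  shows "mod_iso A (fam J X) (fam J' Y)"
proof -
  let ?k = "inv_into J' h"
  have hk: "h j \<in> J" "?k (h j) = j" if "j \<in> J'" for j
    using h that by (auto simp: bij_betw_def)
  have kh: "?k j \<in> J'" "h (?k j) = j" if "j \<in> J" for j
    using h that by (auto simp: bij_betw_def inv_into_into f_inv_into_f)
  have "\<forall>j\<in>J'. \<exists>f g. lin (X (h j)) (Y j) f \<and> lin (Y j) (X (h j)) g \<and>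
    (\<forall>x\<in>carrier (X (h j)). g (f x) = x) \<and> (\<forall>y\<in>carrier (Y j). f (g y) = y)"
  proof
    fix j assume "j \<in> J'"
    then show "\<exists>f g. lin (X (h j)) (Y j) f \<and> lin (Y j) (X (h j)) g \<and>
      (\<forall>x\<in>carrier (X (h j)). g (f x) = x) \<and> (\<forall>y\<in>carrier (Y j). f (g y) = y)"
      using mod_isoE[OF iso rm(1)[OF hk(1)]] by metis
  qed
  then obtain f g where fg: "\<And>j. j \<in> J' \<Longrightarrow> lin (X (h j)) (Y j) (f j)" "\<And>j. j \<in> J' \<Longrightarrow> lin (Y j) (X (h j)) (g j)"
    "\<And>j x. j \<in> J' \<Longrightarrow> x \<in> carrier (X (h j)) \<Longrightarrow> g j (f j x) = x"
    "\<And>j y. j \<in> J' \<Longrightarrow> y \<in> carrier (Y j) \<Longrightarrow> f j (g j y) = y" by metis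
  have g': "lin (Y (?k j)) (X j) (g (?k j))" if "j \<in> J" for j using fg(2)[OF kh(1)[OF that]] kh[OF that] by simp
  note cl = lin_closed[OF fg(1)] lin_closed[OF g']
  show ?thesis
  proof (rule mod_isoI)
    show "rmod (fam J X)" by (rule rmod_fam[OF rm(1)])
    show "lin (fam J X) (fam J' Y) (\<lambda>v. \<lambda>j\<in>J'. f j (v (h j)))"
      by (rule linI) (auto simp: direct_sum_family_def PiE_iff hk cl lin_add[OF fg(1)] lin_act[OF fg(1)] intro!: restrict_ext)
    show "lin (fam J' Y) (fam J X) (\<lambda>v. \<lambda>j\<in>J. g (?k j) (v (?k j)))"
      by (rule linI) (auto simp: direct_sum_family_def PiE_iff kh cl lin_add[OF g'] lin_act[OF g'] intro!: restrict_ext)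
    show "(\<lambda>j\<in>J. g (?k j) ((\<lambda>j\<in>J'. f j (x (h j))) (?k j))) = x" if "x \<in> carrier (fam J X)" for x
      using that by (auto simp: direct_sum_family_def PiE_iff kh fg(3) fun_eq_iff restrict_def extensional_def)
    show "(\<lambda>j\<in>J'. f j ((\<lambda>j\<in>J. g (?k j) (y (?k j))) (h j))) = y" if "y \<in> carrier (fam J' Y)" for y
      using that by (auto simp: direct_sum_family_def PiE_iff hk fg(4) fun_eq_iff restrict_def extensional_def)
  qed
qed

lemma nonzeroE:
  assumes "rmod M" "carrier M \<noteq> {\<zero>\<^bsub>M\<^esub>}"
  obtains x where "x \<in> carrier M" "x \<noteq> \<zero>\<^bsub>M\<^esub>"
  using assms rmod_closed(1)[OF assms(1)] by blast

lemma fam_cong: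
  assumes "\<And>j. j \<in> J \<Longrightarrow> X j = Y j" shows "fam J X = fam J Y"
proof -
  have "(\<Pi>\<^sub>E j\<in>J. carrier (X j)) = (\<Pi>\<^sub>E j\<in>J. carrier (Y j))"
    by (rule PiE_cong) (simp add: assms)
  moreover have "(\<lambda>j\<in>J. \<zero>\<^bsub>X j\<^esub>) = (\<lambda>j\<in>J. \<zero>\<^bsub>Y j\<^esub>)"
    "(\<lambda>x y. \<lambda>j\<in>J. x j \<oplus>\<^bsub>X j\<^esub> y j) = (\<lambda>x y. \<lambda>j\<in>J. x j \<oplus>\<^bsub>Y j\<^esub> y j)"
    "(\<lambda>a x. \<lambda>j\<in>J. a \<odot>\<^bsub>X j\<^esub> x j) = (\<lambda>a x. \<lambda>j\<in>J. a \<odot>\<^bsub>Y j\<^esub> x j)"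
    by (intro ext; simp add: assms restrict_def)+
  ultimately show ?thesis by (simp add: direct_sum_family_def)
qed

lemma ind_fg [simp]: "indecomposable A M \<Longrightarrow> M \<in> fg_modules A"
  by (simp add: indecomposable_def)

lemma ind_nonzero: "indecomposable A M \<Longrightarrow> carrier M \<noteq> {\<zero>\<^bsub>M\<^esub>}"
  unfolding indecomposable_def by blast

text \<open>\<open>indecomposable\<close> tests only decompositions inside
  \<open>fg_modules\<close>; summands of other element types, such as \<open>fam J X\<close>, are
  first transported there.\<close>

lemma ind_biprod:
  assumes "indecomposable A M" "fd X" "fd Y" "biprod M X Y"
  shows "carrier X = {\<zero>\<^bsub>X\<^esub>} \<or> carrier Y = {\<zero>\<^bsub>Y\<^esub>}"
proof -
  obtain X' where X': "X' \<in> fg_modules A" "mod_iso A X X'" using fd_transport[OF assms(2)] by blast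
  obtain Y' where Y': "Y' \<in> fg_modules A" "mod_iso A Y Y'" using fd_transport[OF assms(3)] by blast
  have "mod_iso A M (direct_sum X' Y')"
    by (rule biprod_unique[OF assms(4) biprod_direct_sum X'(2) Y'(2)])
      (use assms X' Y' in \<open>auto simp: rmod_direct_sum\<close>)
  then have *: "carrier X' = {\<zero>\<^bsub>X'\<^esub>} \<or> carrier Y' = {\<zero>\<^bsub>Y'\<^esub>}"
    using assms(1) X' Y' unfolding indecomposable_def by blast
  have "carrier U = {\<zero>\<^bsub>U\<^esub>}" if U: "mod_iso A U U'" "rmod U" "rmod U'" "carrier U' = {\<zero>\<^bsub>U'\<^esub>}"
    for U :: "('a, 'd) module" and U' :: "('a, nat \<Rightarrow> 'k) module"
  proof -
    obtain f g where fg: "lin U U' f" "lin U' U g" "\<And>x. x \<in> carrier U \<Longrightarrow> g (f x) = x"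
      using mod_isoE[OF U(1,2)] by metis
    have "x = \<zero>\<^bsub>U\<^esub>" if x: "x \<in> carrier U" for x
    proof -
      have "f x = \<zero>\<^bsub>U'\<^esub>" using lin_closed[OF fg(1) x] U(4) by simp
      then show ?thesis using fg(3)[OF x] lin_zero[OF fg(2) U(3,2)] by simp
    qed
    then show ?thesis using U(2) by auto
  qed
  then show ?thesis using * X' Y' assms by (metis fd_rmod fg_rmod)
qed

text \<open>A decomposition gives an idempotent endomorphism i1 p1, here a scalar c with c^2 = c. So
  c is 0 or 1, and the first or the second summand vanishes.\<close>

lemma ind_brick:
  assumes "U \<in> fg_modules A" "carrier U \<noteq> {\<zero>\<^bsub>U\<^esub>}"
    "\<And>f. lin U U f \<Longrightarrow> \<exists>c. \<forall>x\<in>carrier U. f x = sc c \<odot>\<^bsub>U\<^esub> x"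
  shows "indecomposable A U"
  unfolding indecomposable_def
proof (intro conjI ballI impI)
  fix X Y assume XY: "X \<in> fg_modules A" "Y \<in> fg_modules A" "mod_iso A U (direct_sum X Y)"
  have rm: "rmod U" "rmod X" "rmod Y" using assms XY by auto
  then have "biprod U X Y" using XY by (simp add: biprod_iff)
  then obtain i1 i2 p1 p2 where b: "bip U X Y i1 i2 p1 p2" using biprod_def by blast
  note bd = bipD[OF b]
  obtain c where c: "\<And>x. x \<in> carrier U \<Longrightarrow> i1 (p1 x) = sc c \<odot>\<^bsub>U\<^esub> x"
    using assms(3)[OF lin_comp[OF bd(3,1)]] by blast
  obtain x where x: "x \<in> carrier U" "x \<noteq> \<zero>\<^bsub>U\<^esub>" using nonzeroE[OF rm(1) assms(2)] by metis
  have e: "sc c \<odot>\<^bsub>U\<^esub> x = sc (c * c) \<odot>\<^bsub>U\<^esub> x"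
    using c[OF x(1)] c[of "sc c \<odot>\<^bsub>U\<^esub> x"] x rm bd(5)[OF lin_closed[OF bd(3) x(1)]] by (simp add: sc_act_simps(2))
  have "c * c - c = 0"
  proof (rule ccontr)
    assume nz: "c * c - c \<noteq> 0"
    have "sc (c * c - c) \<odot>\<^bsub>U\<^esub> x = \<zero>\<^bsub>U\<^esub>"
      using sc_act_simps(1)[OF rm(1) x(1), of "c * c" "- c"] sc_uminus[OF rm(1) x(1), of c] rm x e by simp
    then have "sc (inverse (c * c - c) * (c * c - c)) \<odot>\<^bsub>U\<^esub> x = \<zero>\<^bsub>U\<^esub>"
      using sc_act_simps(2)[OF rm(1) x(1)] rm by (metis ract_zero(1) sc_simps(1))
    then show False using x rm nz by simp
  qed
  then have "c = 0 \<or> c = 1" by (simp add: algebra_simps)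
  then show "carrier X = {\<zero>\<^bsub>X\<^esub>} \<or> carrier Y = {\<zero>\<^bsub>Y\<^esub>}"
  proof
    assume "c = 0"
    have "u = \<zero>\<^bsub>X\<^esub>" if u: "u \<in> carrier X" for u
      using c[OF lin_closed[OF bd(1) u]] bd(5)[OF u] lin_closed[OF bd(1) u] lin_zero[OF bd(3)] rm \<open>c = 0\<close> by simp
    then show ?thesis using rm by auto
  next
    assume "c = 1"
    have "u = \<zero>\<^bsub>Y\<^esub>" if u: "u \<in> carrier Y" for u
      using c[OF lin_closed[OF bd(2) u]] bd(7)[OF u] bd(8)[OF u] lin_closed[OF bd(2) u] lin_zero[OF bd(1)]
        lin_zero[OF bd(4)] rm \<open>c = 1\<close> by simp
    then show ?thesis using rm by auto
  qed
qed (use assms in auto)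

lemma ind_brick_iso:
  assumes "U \<in> fg_modules A" "mod_iso A V U" "rmod V" "carrier V \<noteq> {\<zero>\<^bsub>V\<^esub>}"
    "\<And>f. lin V V f \<Longrightarrow> \<exists>c. \<forall>x\<in>carrier V. f x = sc c \<odot>\<^bsub>V\<^esub> x"
  shows "indecomposable A U"
proof (rule ind_brick[OF assms(1)])
  have U: "rmod U" using assms by simp
  obtain i j where ij: "lin V U i" "lin U V j" "\<And>x. x \<in> carrier V \<Longrightarrow> j (i x) = x"
    "\<And>y. y \<in> carrier U \<Longrightarrow> i (j y) = y"
    using mod_isoE[OF assms(2,3)] by metis
  obtain x where x: "x \<in> carrier V" "x \<noteq> \<zero>\<^bsub>V\<^esub>" using nonzeroE[OF assms(3,4)] by metis
  have "i x \<noteq> \<zero>\<^bsub>U\<^esub>" using ij(3)[OF x(1)] lin_zero[OF ij(2) U assms(3)] x(2) by auto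
  then show "carrier U \<noteq> {\<zero>\<^bsub>U\<^esub>}" using lin_closed[OF ij(1) x(1)] by auto
  fix f assume f: "lin U U f"
  obtain c where c: "\<And>x. x \<in> carrier V \<Longrightarrow> j (f (i x)) = sc c \<odot>\<^bsub>V\<^esub> x"
    using assms(5)[OF lin_comp[OF lin_comp[OF ij(1) f] ij(2)]] by blast
  have "f y = sc c \<odot>\<^bsub>U\<^esub> y" if y: "y \<in> carrier U" for y
  proof -
    have "i (j (f (i (j y)))) = i (sc c \<odot>\<^bsub>V\<^esub> j y)" by (simp only: c[OF lin_closed[OF ij(2) y]])
    then show ?thesis
      by (simp only: ij(4)[OF y] ij(4)[OF lin_closed[OF f y]] lin_act[OF ij(1) sc_simps(1) lin_closed[OF ij(2) y]])
  qed
  then show "\<exists>c. \<forall>x\<in>carrier U. f x = sc c \<odot>\<^bsub>U\<^esub> x" by blast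
qed

lemma ind_iso:
  assumes "indecomposable A M" "mod_iso A M N" "N \<in> fg_modules A" shows "indecomposable A N"
  unfolding indecomposable_def
proof (intro conjI ballI impI)
  have M: "rmod M" "rmod N" using assms by auto
  obtain f g where fg: "lin M N f" "lin N M g" "\<And>x. x \<in> carrier M \<Longrightarrow> g (f x) = x"
    using mod_isoE[OF assms(2) M(1)] by metis
  obtain x where x: "x \<in> carrier M" "x \<noteq> \<zero>\<^bsub>M\<^esub>"
    using assms(1) nonzeroE[OF M(1)] unfolding indecomposable_def by metis
  show "carrier N \<noteq> {\<zero>\<^bsub>N\<^esub>}"
    using fg(3)[OF x(1)] x(2) lin_zero[OF fg(2) M(2,1)] lin_closed[OF fg(1) x(1)] by auto
  fix X Y assume XY: "X \<in> fg_modules A" "Y \<in> fg_modules A" "mod_iso A N (direct_sum X Y)"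
  then show "carrier X = {\<zero>\<^bsub>X\<^esub>} \<or> carrier Y = {\<zero>\<^bsub>Y\<^esub>}"
    using assms(1) mod_iso_trans[OF assms(2) XY(3)] M unfolding indecomposable_def by blast
qed (use assms in auto)

lemma not_no_hom_self: "indecomposable A U \<Longrightarrow> \<not> no_hom U U"
  using no_homD[OF _ lin_id, of U] nonzeroE[of U] unfolding indecomposable_def by (metis fg_rmod)

text \<open>Any finite index set is allowed, for instance one with a summand removed; the summands
  are renumbered by a bijection.\<close>

lemma basic_moduleI:
  assumes "finite J" "M \<in> fg_modules A" "\<And>j. j \<in> J \<Longrightarrow> indecomposable A (X j)" "mod_iso A M (fam J X)"
    "\<And>j l. j \<in> J \<Longrightarrow> l \<in> J \<Longrightarrow> j \<noteq> l \<Longrightarrow> \<not> mod_iso A (X j) (X l)"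
  shows "basic_module A M"
proof -
  obtain h where h: "bij_betw h {..<card J} J"
    using ex_bij_betw_nat_finite[OF assms(1)] atLeast0LessThan by metis
  then have hJ: "h j \<in> J" if "j < card J" for j using that by (auto simp: bij_betw_def)
  have "mod_iso A (fam J X) (fam {..<card J} (\<lambda>j. X (h j)))"
    by (rule mod_iso_fam[OF h]) (use assms(3) hJ in \<open>auto intro!: mod_iso_refl\<close>)
  then have "mod_iso A M (fam {..<card J} (\<lambda>j. X (h j)))"
    by (rule mod_iso_trans[OF assms(4)]) (use assms in \<open>auto intro!: rmod_fam\<close>)
  moreover have "\<not> mod_iso A (X (h j)) (X (h l))" if "j < card J" "l < card J" "j \<noteq> l" for j l
    using assms(5)[OF hJ hJ] that h by (auto simp: bij_betw_def inj_on_def)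
  ultimately show ?thesis unfolding basic_module_def using assms(2,3) hJ
    by (intro conjI exI[of _ "card J"] exI[of _ "\<lambda>j. X (h j)"]) auto
qed

lemma basic_moduleE:
  assumes "basic_module A M"
  obtains n :: nat and X where "\<And>j. j < n \<Longrightarrow> indecomposable A (X j)" "mod_iso A M (fam {..<n} X)"
    "\<And>j l. j < n \<Longrightarrow> l < n \<Longrightarrow> j \<noteq> l \<Longrightarrow> \<not> mod_iso A (X j) (X l)"
  using assms unfolding basic_module_def by blast

lemma basic_fg [simp]: "basic_module A M \<Longrightarrow> M \<in> fg_modules A"
  by (simp add: basic_module_def)

lemma basic_iso:
  assumes "basic_module A M" "mod_iso A M N" "N \<in> fg_modules A" shows "basic_module A N"
proof -
  obtain n :: nat and X where X: "\<And>j. j < n \<Longrightarrow> indecomposable A (X j)" "mod_iso A M (fam {..<n} X)"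
    "\<And>j l. j < n \<Longrightarrow> l < n \<Longrightarrow> j \<noteq> l \<Longrightarrow> \<not> mod_iso A (X j) (X l)"
    using basic_moduleE[OF assms(1)] by metis
  have "mod_iso A N (fam {..<n} X)"
    by (rule mod_iso_trans[OF mod_iso_sym[OF assms(2)] X(2)]) (use assms in auto)
  then show ?thesis using X assms(3) by (intro basic_moduleI[of "{..<n}"]) auto
qed

text \<open>If \<open>U\<close> were isomorphic to one of the summands of \<open>M\<close>, the
  inclusion of that summand would be a nonzero map from \<open>U\<close> to
  \<open>M\<close>.\<close>

lemma basic_add:
  assumes "basic_module A M" "indecomposable A U" "D \<in> fg_modules A" "biprod D M U"
    "no_hom U M"
  shows "basic_module A D"
proof -
  obtain n :: nat and X where X: "\<And>j. j < n \<Longrightarrow> indecomposable A (X j)" "mod_iso A M (fam {..<n} X)"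
    "\<And>j l. j < n \<Longrightarrow> l < n \<Longrightarrow> j \<noteq> l \<Longrightarrow> \<not> mod_iso A (X j) (X l)"
    using basic_moduleE[OF assms(1)] by metis
  have rX: "rmod (X j)" if "j < n" for j using X(1) that by auto
  have rm: "rmod M" "rmod U" "rmod D" using assms by auto
  have no: "\<not> mod_iso A (X j) U" if j: "j < n" for j
  proof -
    have "biprod (fam {..<n} X) (X j) (fam ({..<n} - {j}) X)"
      by (rule biprod_fam_remove) (use rX j in auto)
    moreover have "rmod (fam {..<n} X)" "rmod (fam ({..<n} - {j}) X)" using rX by (auto intro!: rmod_fam)
    ultimately have "biprod M (X j) (fam ({..<n} - {j}) X)"
      using biprod_iso[OF _ mod_iso_sym[OF X(2)]] rm by blast
    then have "no_hom U (X j)"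
      using no_hom_summand(1)[OF _ assms(5)] rm rX[OF j] \<open>rmod (fam ({..<n} - {j}) X)\<close> by blast
    then show ?thesis using no_hom_iso2 not_no_hom_self[OF assms(2)] rm rX[OF j] by blast
  qed
  let ?X = "X(n := U)"
  have ins: "{..<Suc n} = insert n {..<n}" by auto
  have "biprod (fam (insert n {..<n}) ?X) (?X n) (fam {..<n} ?X)"
    by (rule biprod_fam_insert) (use rX rm in auto)
  moreover have "fam {..<n} ?X = fam {..<n} X" by (rule fam_cong) auto
  ultimately have bX: "biprod (fam {..<Suc n} ?X) U (fam {..<n} X)" by (simp add: ins)
  have "mod_iso A D (fam {..<Suc n} ?X)"
    by (rule biprod_unique[OF biprod_swap[OF assms(4) rm(3)] bX mod_iso_refl[OF rm(2)] X(2) rm(3) _ rm(2,1,2)])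
      (use rX rm in \<open>auto intro!: rmod_fam\<close>)
  moreover have "\<not> mod_iso A (?X j) (?X l)" if "j \<in> {..<Suc n}" "l \<in> {..<Suc n}" "j \<noteq> l" for j l
    using that X(3)[of j l] no[of j] no[of l] mod_iso_sym[of U "X l"] rm rX[of l] by (auto simp: less_Suc_eq)
  ultimately show ?thesis using X(1) assms(2,3)
    by (intro basic_moduleI[of "{..<Suc n}" D ?X]) (auto simp: less_Suc_eq)
qed

section \<open>Isomorphism classes and the finiteness of the set of basic modules\<close>

lemma iso_rel_class_eq:
  assumes "M \<in> fg_modules A" "N \<in> fg_modules A"
  shows "iso_rel A `` {M} = iso_rel A `` {N} \<longleftrightarrow> mod_iso A M N"
proof
  assume "iso_rel A `` {M} = iso_rel A `` {N}"
  moreover have "N \<in> iso_rel A `` {N}" using assms by (simp add: iso_rel_def mod_iso_refl)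
  ultimately show "mod_iso A M N" by (auto simp: iso_rel_def)
next
  assume *: "mod_iso A M N"
  then have "mod_iso A N M" using assms by (simp add: mod_iso_sym)
  then show "iso_rel A `` {M} = iso_rel A `` {N}"
    using * assms mod_iso_trans[of M N] mod_iso_trans[of N M] by (auto simp: iso_rel_def)
qed

text \<open>Fix one decomposition for each basic module. The set \<phi> of the classes of its
  summands determines the module up to isomorphism, and it is a subset of the finite set of classes
  of indecomposables.\<close>

lemma finite_basic:
  assumes "representation_finite A" shows "finite ({T. basic_module A T} // iso_rel A)"
proof -
  let ?I = "Collect (indecomposable A) // iso_rel A"
  define K where "K T n X \<longleftrightarrow> (\<forall>j<n. indecomposable A (X j)) \<and> mod_iso A T (fam {..<n} X) \<and>
    (\<forall>j<n. \<forall>l<n. j \<noteq> l \<longrightarrow> \<not> mod_iso A (X j) (X l))" for T :: "('a, nat \<Rightarrow> 'k) module" and X and n :: nat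
  have "\<forall>T. \<exists>n X. basic_module A T \<longrightarrow> K T n X" unfolding K_def basic_module_def by blast
  then obtain n X where nX: "\<And>T. basic_module A T \<Longrightarrow> K T (n T) (X T)" by metis
  define \<phi> where "\<phi> T = (\<lambda>j. iso_rel A `` {X T j}) ` {..<n T}" for T
  have sub: "\<phi> T \<subseteq> ?I" if "basic_module A T" for T
    using nX[OF that] by (auto simp: \<phi>_def K_def intro!: quotientI)
  have inj: "mod_iso A T T'" if T: "basic_module A T" "basic_module A T'" "\<phi> T = \<phi> T'" for T T'
  proof -
    note a = nX[OF T(1), unfolded K_def] and b = nX[OF T(2), unfolded K_def]
    have "\<exists>l. l < n T \<and> mod_iso A (X T l) (X T' j)" if "j < n T'" for j
    proof -
      have "iso_rel A `` {X T' j} \<in> \<phi> T" using that T(3) by (auto simp: \<phi>_def)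
      then obtain l where "l < n T" "iso_rel A `` {X T' j} = iso_rel A `` {X T l}" by (auto simp: \<phi>_def)
      then show ?thesis using a b that iso_rel_class_eq[of "X T l" "X T' j"] by auto
    qed
    then obtain h where h: "\<And>j. j < n T' \<Longrightarrow> h j < n T \<and> mod_iso A (X T (h j)) (X T' j)" by metis
    have fgX: "X T j \<in> fg_modules A" if "j < n T" for j using a that by simp
    have fgX': "X T' j \<in> fg_modules A" if "j < n T'" for j using b that by simp
    \<comment> \<open>Each summand of \<open>T'\<close> is matched with an isomorphic summand of
      \<open>T\<close>. Pairwise non-isomorphism makes the matching injective, and equality of the
      two sets of classes makes it surjective.\<close>
    have "bij_betw h {..<n T'} {..<n T}"
      unfolding bij_betw_def
    proof (intro conjI inj_onI equalityI subsetI)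
      fix j l assume jl: "j \<in> {..<n T'}" "l \<in> {..<n T'}" "h j = h l"
      have "mod_iso A (X T' j) (X T' l)"
        using mod_iso_trans[OF mod_iso_sym[of "X T (h j)" "X T' j"]] h jl fgX fgX'
        by (metis fg_rmod lessThan_iff)
      then show "j = l" using b jl by blast
    next
      fix l assume l: "l \<in> {..<n T}"
      have "iso_rel A `` {X T l} \<in> \<phi> T'" using l T(3) by (auto simp: \<phi>_def)
      then obtain j where j: "j < n T'" "iso_rel A `` {X T l} = iso_rel A `` {X T' j}" by (auto simp: \<phi>_def)
      have "mod_iso A (X T l) (X T' j)" using j l iso_rel_class_eq fgX fgX' by blast
      then have "mod_iso A (X T l) (X T (h j))"
        using mod_iso_trans mod_iso_sym h[OF j(1)] j l fgX fgX' by (metis fg_rmod lessThan_iff)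
      then have "l = h j" using a l h[OF j(1)] by blast
      then show "l \<in> h ` {..<n T'}" using j by auto
    qed (use h in auto)
    then have "mod_iso A (fam {..<n T} (X T)) (fam {..<n T'} (X T'))"
      by (rule mod_iso_fam) (use h fgX fgX' in auto)
    moreover have "rmod (fam {..<n T} (X T))" "rmod (fam {..<n T'} (X T'))" using fgX fgX' by (auto intro!: rmod_fam)
    ultimately show ?thesis using mod_iso_trans mod_iso_sym a b T by (metis basic_fg fg_rmod)
  qed
  have "finite (\<phi> ` {T. basic_module A T})"
    by (rule finite_subset[of _ "Pow ?I"]) (use sub assms in \<open>auto simp: representation_finite_def\<close>)
  moreover have "{T. basic_module A T} // iso_rel A \<subseteq>
    (\<lambda>s. iso_rel A `` {SOME T. basic_module A T \<and> \<phi> T = s}) ` \<phi> ` {T. basic_module A T}"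
  proof
    fix c assume "c \<in> {T. basic_module A T} // iso_rel A"
    then obtain T where T: "basic_module A T" "c = iso_rel A `` {T}" by (auto simp: quotient_def)
    let ?T = "SOME T'. basic_module A T' \<and> \<phi> T' = \<phi> T"
    have "basic_module A ?T \<and> \<phi> ?T = \<phi> T" by (rule someI[of _ T]) (use T in simp)
    then have "c = iso_rel A `` {?T}" unfolding T(2) using iso_rel_class_eq[of T ?T] inj[of T ?T] T by simp
    then show "c \<in> (\<lambda>s. iso_rel A `` {SOME T. basic_module A T \<and> \<phi> T = s}) ` \<phi> ` {T. basic_module A T}"
      using T by blast
  qed
  ultimately show ?thesis using finite_subset by blast
qed

lemma finite_PWT: "representation_finite A \<Longrightarrow> finite (PWT A)"
proof (rule finite_subset[OF _ finite_basic])
  show "PWT A \<subseteq> {T. basic_module A T} // iso_rel A"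
    unfolding PWT_def basic_PWT_modules_def quotient_def by auto
qed

text \<open>Dual to \<open>lin_factor\<close>: the functional descends to the image of
  \<open>g\<close> and then extends to \<open>L\<close>. The injectivity of S_i, S_a and P_a rests
  on it.\<close>

lemma klin_factor:
  assumes "rmod K" "fd L" "lin K L g" "klin K (carrier K) (\<phi> :: _ \<Rightarrow> 'k)"
    "\<And>x. x \<in> carrier K \<Longrightarrow> g x = \<zero>\<^bsub>L\<^esub> \<Longrightarrow> \<phi> x = 0"
  obtains l :: "_ \<Rightarrow> 'k" where "klin L (carrier L) l" "\<And>x. x \<in> carrier K \<Longrightarrow> l (g x) = \<phi> x"
proof -
  have L: "rmod L" using assms by simp
  note g = assms(3)
  have \<phi>: "\<phi> (x \<oplus>\<^bsub>K\<^esub> y) = \<phi> x + \<phi> y" "\<phi> (sc c \<odot>\<^bsub>K\<^esub> x) = c * \<phi> x"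
    if "x \<in> carrier K" "y \<in> carrier K" for x y c using assms(4) that unfolding klin_def by auto
  note \<phi>(2)[OF _ rmod_closed(1)[OF assms(1)]]
  note \<phi> = \<phi>(1) this
  have ker: "\<phi> x = \<phi> y" if xy: "x \<in> carrier K" "y \<in> carrier K" "g x = g y" for x y
  proof -
    have "g (x \<ominus>\<^bsub>K\<^esub> y) = \<zero>\<^bsub>L\<^esub>" using xy assms(1) L lin_closed[OF g] by (simp add: lin_diff[OF g])
    then have "\<phi> (x \<ominus>\<^bsub>K\<^esub> y) = 0" using assms(1,5) xy by simp
    then show ?thesis using \<phi>(1)[of "x \<ominus>\<^bsub>K\<^esub> y" y] xy assms(1) by (simp add: rmod_diff_add)
  qed
  have "\<forall>t\<in>g ` carrier K. \<exists>p. p \<in> carrier K \<and> g p = t" by auto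
  then obtain s where s: "\<And>t. t \<in> g ` carrier K \<Longrightarrow> s t \<in> carrier K \<and> g (s t) = t" by (metis (no_types))
  have se: "\<phi> (s (g x)) = \<phi> x" if "x \<in> carrier K" for x using ker s[of "g x"] that by blast
  have "ksub L (g ` carrier K)"
    by (rule ksub_submodule[OF L submodule_image[OF assms(1) L g submodule_carrier[OF assms(1)]]])
  moreover have "klin L (g ` carrier K) (\<lambda>t. \<phi> (s t))"
    unfolding klin_def
  proof (intro conjI ballI allI)
    fix t u assume t: "t \<in> g ` carrier K" and u: "u \<in> g ` carrier K"
    show "\<phi> (s (t \<oplus>\<^bsub>L\<^esub> u)) = \<phi> (s t) + \<phi> (s u)"
      using se[of "s t \<oplus>\<^bsub>K\<^esub> s u"] s[OF t] s[OF u] assms(1) lin_add[OF g, of "s t" "s u"] \<phi> by simp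
  next
    fix c t assume t: "t \<in> g ` carrier K"
    show "\<phi> (s (sc c \<odot>\<^bsub>L\<^esub> t)) = c * \<phi> (s t)"
      using se[of "sc c \<odot>\<^bsub>K\<^esub> s t"] s[OF t] assms(1) lin_act[OF g, of "sc c" "s t"] \<phi> by simp
  qed
  ultimately obtain l :: "_ \<Rightarrow> 'k" where l: "klin L (carrier L) l" "\<forall>t\<in>g ` carrier K. l t = \<phi> (s t)"
    using fd_klin_extend[OF assms(2)] by blast
  then show thesis using that se by auto
qed

text \<open>Extending the identity of \<open>J\<close> along \<open>i\<close> gives a retraction,
  whose kernel is the complement.\<close>

lemma inj_split:
  assumes "inj_mod J" "J \<in> fg_modules A" "Y \<in> fg_modules A" "lin J Y i" "inj_on i (carrier J)"
  obtains Y' where "Y' \<in> fg_modules A" "biprod Y Y' J"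
proof -
  have rm: "rmod J" "rmod Y" using assms by auto
  obtain r where r: "lin Y J r" "\<And>x. x \<in> carrier J \<Longrightarrow> r (i x) = x"
    using inj_modD[OF assms(1,2,3,4) lin_id] assms(5) lin_inj_iff[OF rm assms(4)] by metis
  have "biprod Y (Y\<lparr>carrier := {x \<in> carrier Y. r x = \<zero>\<^bsub>J\<^esub>}\<rparr>) J"
    unfolding biprod_def using bip_split[OF rm(2,1) assms(4) r(1)] r(2) by blast
  then show thesis using that fg_sub[OF assms(3) submodule_ker[OF rm(2,1) r(1)]] by blast
qed

lemma biprod_nonzero_less:
  assumes "Y \<in> fg_modules A" "biprod Y Y' J" "rmod Y'" "rmod J" "x \<in> carrier J" "x \<noteq> \<zero>\<^bsub>J\<^esub>"
  shows "kdim Y' < kdim Y"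
  using kdim_biprod[of Y Y' J] assms by auto

end

subsection \<open>Simple modules at sources\<close>

text \<open>A source point \<open>i\<close> enters only through its idempotent \<open>e\<close> and the character \<open>\<chi>\<close> that reads
  off the coefficient of the trivial path at \<open>i\<close>: no other path ends at \<open>i\<close>, so \<open>a e = \<chi>(a) e\<close>.\<close>

locale source_algebra = fd_algebra A for A :: "('k::field, 'a) module" +
  fixes e :: 'a and \<chi> :: "'a \<Rightarrow> 'k"
  assumes e_closed [simp]: "e \<in> carrier A"
    and chi_add: "a \<in> carrier A \<Longrightarrow> b \<in> carrier A \<Longrightarrow> \<chi> (a \<oplus>\<^bsub>A\<^esub> b) = \<chi> a + \<chi> b"
    and chi_mult: "a \<in> carrier A \<Longrightarrow> b \<in> carrier A \<Longrightarrow> \<chi> (a \<otimes>\<^bsub>A\<^esub> b) = \<chi> a * \<chi> b"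
    and chi_scalar: "\<chi> (c \<odot>\<^bsub>A\<^esub> \<one>\<^bsub>A\<^esub>) = c"
    and chi_e [simp]: "\<chi> e = 1"
    and mult_e: "a \<in> carrier A \<Longrightarrow> a \<otimes>\<^bsub>A\<^esub> e = (\<chi> a \<odot>\<^bsub>A\<^esub> \<one>\<^bsub>A\<^esub>) \<otimes>\<^bsub>A\<^esub> e"
begin

lemma chi_simps [simp]: "\<chi> (sc c) = c" "\<chi> \<one>\<^bsub>A\<^esub> = 1" "\<chi> \<zero>\<^bsub>A\<^esub> = 0"
  using chi_scalar sc_simps(2,3) by (metis sc_def)+

text \<open>For a bound quiver algebra this is \<open>simple_at i\<close> itself, whence the element
  type \<open>'k\<close>; for the one-point extension it is S_a.\<close>

definition charmod :: "('a, 'k) module" where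
  "charmod = \<lparr>carrier = UNIV, mult = (\<lambda>_ _. undefined), one = undefined,
     zero = 0, add = (+), smult = (\<lambda>a x. x * \<chi> a)\<rparr>"

lemma charmod_simps [simp]: "carrier charmod = UNIV" "\<zero>\<^bsub>charmod\<^esub> = 0" "x \<oplus>\<^bsub>charmod\<^esub> y = x + y"
  "a \<odot>\<^bsub>charmod\<^esub> x = x * \<chi> a"
  by (auto simp: charmod_def)

lemma rmod_charmod [simp]: "rmod charmod"
  by (rule rmodI) (auto simp: chi_add chi_mult algebra_simps)

lemma fd_charmod [simp]: "fd charmod"
proof -
  have "x \<in> kspan charmod {1}" for x
    using kspan_step[of 1 "{1}" "\<zero>\<^bsub>charmod\<^esub>" charmod x] kspan_zero[of charmod] by simp
  then show ?thesis unfolding fd_def by (auto intro!: exI[of _ "{1}"])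
qed

text \<open>In right-module notation: x a e = \<chi>(a) x e.\<close>

lemma e_act:
  assumes "rmod M" "x \<in> carrier M" "a \<in> carrier A"
  shows "e \<odot>\<^bsub>M\<^esub> (a \<odot>\<^bsub>M\<^esub> x) = sc (\<chi> a) \<odot>\<^bsub>M\<^esub> (e \<odot>\<^bsub>M\<^esub> x)"
proof -
  have "e \<odot>\<^bsub>M\<^esub> (a \<odot>\<^bsub>M\<^esub> x) = (a \<otimes>\<^bsub>A\<^esub> e) \<odot>\<^bsub>M\<^esub> x" using assms by (simp add: ract_mult)
  also have "\<dots> = e \<odot>\<^bsub>M\<^esub> (sc (\<chi> a) \<odot>\<^bsub>M\<^esub> x)"
    using assms mult_e[OF assms(3)] by (simp add: sc_def[symmetric] ract_mult)
  finally show ?thesis using assms by (simp add: sc_act_simps(3))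
qed

lemma charmod_hom:
  assumes "rmod Y" "y \<in> carrier Y" "\<And>a. a \<in> carrier A \<Longrightarrow> a \<odot>\<^bsub>Y\<^esub> y = sc (\<chi> a) \<odot>\<^bsub>Y\<^esub> y"
  shows "lin charmod Y (\<lambda>c. sc c \<odot>\<^bsub>Y\<^esub> y)"
proof (rule linI)
  fix a c assume a: "a \<in> carrier A"
  have "a \<odot>\<^bsub>Y\<^esub> (sc c \<odot>\<^bsub>Y\<^esub> y) = sc c \<odot>\<^bsub>Y\<^esub> (a \<odot>\<^bsub>Y\<^esub> y)"
    using assms(1,2) a by (simp add: sc_act_simps(3))
  then show "sc (a \<odot>\<^bsub>charmod\<^esub> c) \<odot>\<^bsub>Y\<^esub> y = a \<odot>\<^bsub>Y\<^esub> (sc c \<odot>\<^bsub>Y\<^esub> y)"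
    unfolding assms(3)[OF a] using assms(1,2) by (simp add: sc_act_simps(2))
qed (use assms(1,2) in \<open>simp_all add: sc_act_simps(1)\<close>)

lemma charmod_homD:
  assumes "lin charmod Y f" "a \<in> carrier A"
  shows "f c = sc c \<odot>\<^bsub>Y\<^esub> f 1" "a \<odot>\<^bsub>Y\<^esub> f c = f (c * \<chi> a)"
proof -
  show "f c = sc c \<odot>\<^bsub>Y\<^esub> f 1" using lin_act[OF assms(1), of "sc c" 1] by simp
  show "a \<odot>\<^bsub>Y\<^esub> f c = f (c * \<chi> a)" using lin_act[OF assms(1,2), of c] by simp
qed

lemma charmod_hom_inj:
  assumes "rmod Y" "lin charmod Y f" "f c \<noteq> \<zero>\<^bsub>Y\<^esub>" shows "inj_on f (carrier charmod)"
proof -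
  have "d = 0" if "f d = \<zero>\<^bsub>Y\<^esub>" for d
  proof (rule ccontr)
    assume "d \<noteq> 0"
    then have "f c = sc (c / d) \<odot>\<^bsub>Y\<^esub> f d" using lin_act[OF assms(2), of "sc (c / d)" d] by simp
    then show False using that assms by simp
  qed
  then show ?thesis using lin_inj_iff[OF rmod_charmod assms(1,2)] by simp
qed

text \<open>Extend \<open>f\<close> to a linear functional l on \<open>L\<close>, then make it a
  homomorphism by taking y to l(y e), which is compatible with the action because y a e = \<chi>(a)
  y e. On the image of \<open>K\<close> nothing changes, since \<chi>(e) = 1.\<close>

lemma inj_charmod: "inj_mod charmod"
  unfolding inj_mod_def
proof (intro ballI allI impI)
  fix K L :: "('a, nat \<Rightarrow> 'k) module" and g f
  assume *: "K \<in> fg_modules A" "L \<in> fg_modules A" "lin K L g" "lin K charmod f"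
    "\<forall>x\<in>carrier K. g x = \<zero>\<^bsub>L\<^esub> \<longrightarrow> f x = \<zero>\<^bsub>charmod\<^esub>"
  have rm: "rmod K" "rmod L" using * by auto
  have "klin K (carrier K) f"
    unfolding klin_def using lin_add[OF *(4)] lin_act[OF *(4), of "sc _"] by (simp add: mult.commute)
  then obtain l :: "_ \<Rightarrow> 'k" where l: "klin L (carrier L) l" "\<And>x. x \<in> carrier K \<Longrightarrow> l (g x) = f x"
    using klin_factor[OF rm(1) fg_fd[OF *(2)] *(3)] *(5) by auto
  have "lin L charmod (\<lambda>y. l (e \<odot>\<^bsub>L\<^esub> y))"
    using l(1) rm unfolding klin_def by (intro linI) (auto simp: ract_add e_act mult.commute)
  moreover have "l (e \<odot>\<^bsub>L\<^esub> g x) = f x" if "x \<in> carrier K" for x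
    using l(2)[of "e \<odot>\<^bsub>K\<^esub> x"] lin_act[OF *(3) e_closed that] lin_act[OF *(4) e_closed that] that rm by simp
  ultimately show "\<exists>h. lin L charmod h \<and> (\<forall>x\<in>carrier K. h (g x) = f x)" by blast
qed

lemma charmod_brick:
  assumes "U \<in> fg_modules A" "mod_iso A charmod U" shows "indecomposable A U"
proof (rule ind_brick_iso[OF assms rmod_charmod])
  show "carrier charmod \<noteq> {\<zero>\<^bsub>charmod\<^esub>}" using zero_neq_one by (metis UNIV_I charmod_simps(1,2) singletonD)
  fix f assume f: "lin charmod charmod f"
  show "\<exists>c. \<forall>x\<in>carrier charmod. f x = sc c \<odot>\<^bsub>charmod\<^esub> x"
    using charmod_homD(1)[OF f e_closed] by (intro exI[of _ "f 1"]) (metis charmod_simps(4) chi_simps(1) mult.commute)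
qed

text \<open>A copy of \<open>charmod\<close> inside \<open>fg_modules\<close>, where Ext is
  defined.\<close>

definition Sm where "Sm = (SOME N. N \<in> fg_modules A \<and> mod_iso A charmod N)"

lemma Sm: "Sm \<in> fg_modules A" "mod_iso A charmod Sm"
proof -
  have "\<exists>N. N \<in> fg_modules A \<and> mod_iso A charmod N" using fd_transport[OF fd_charmod] by blast
  from someI_ex[OF this] show "Sm \<in> fg_modules A" "mod_iso A charmod Sm" by (auto simp: Sm_def)
qed

lemma Sm_rmod [simp]: "rmod Sm" using Sm(1) by simp

lemma Sm_inj: "inj_mod Sm" by (rule inj_mod_iso[OF inj_charmod Sm(2)]) simp_all

lemma Sm_ind: "indecomposable A Sm" by (rule charmod_brick[OF Sm])

lemma Sm_nonzero: obtains x where "x \<in> carrier Sm" "x \<noteq> \<zero>\<^bsub>Sm\<^esub>"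
  using Sm_ind nonzeroE[OF Sm_rmod] unfolding indecomposable_def by metis

text \<open>A nonzero map from a one-dimensional module is injective, and its image splits off
  because \<open>Sm\<close> is injective.\<close>

lemma Sm_split:
  assumes "Y \<in> fg_modules A" "\<not> no_hom Sm Y"
  obtains Y' where "Y' \<in> fg_modules A" "biprod Y Y' Sm"
proof -
  have Y: "rmod Y" using assms by simp
  obtain f x where f: "lin Sm Y f" "x \<in> carrier Sm" "f x \<noteq> \<zero>\<^bsub>Y\<^esub>" using assms unfolding no_hom_def by blast
  obtain i j where ij: "lin charmod Sm i" "lin Sm charmod j" "\<And>x. x \<in> carrier charmod \<Longrightarrow> j (i x) = x"
    "\<And>y. y \<in> carrier Sm \<Longrightarrow> i (j y) = y"
    using mod_isoE[OF Sm(2) rmod_charmod] by metis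
  have inj: "inj_on (\<lambda>c. f (i c)) (carrier charmod)"
    by (rule charmod_hom_inj[OF Y lin_comp[OF ij(1) f(1)], of "j x"]) (use f ij in simp)
  have "inj_on f (carrier Sm)"
  proof (rule inj_onI)
    fix u v assume uv: "u \<in> carrier Sm" "v \<in> carrier Sm" "f u = f v"
    then have "f (i (j u)) = f (i (j v))" using ij(4) by simp
    then have "j u = j v" using inj by (simp add: inj_on_def)
    then show "u = v" using ij(4) uv by metis
  qed
  then show thesis using inj_split[OF Sm_inj Sm(1) assms(1) f(1)] that by blast
qed

subsection \<open>One-point extensions\<close>

definition ext_alg :: "('k, 'a \<times> 'k \<times> 'k) module" where
  "ext_alg = one_point_extension A charmod"

lemma ext_alg_simps [simp]:
  "x \<in> carrier ext_alg \<longleftrightarrow> fst x \<in> carrier A"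
  "(a, m, c) \<otimes>\<^bsub>ext_alg\<^esub> (a', m', c') = (a \<otimes>\<^bsub>A\<^esub> a', m * \<chi> a' + m' * c, c * c')"
  "\<one>\<^bsub>ext_alg\<^esub> = (\<one>\<^bsub>A\<^esub>, 0, 1)" "\<zero>\<^bsub>ext_alg\<^esub> = (\<zero>\<^bsub>A\<^esub>, 0, 0)"
  "(a, m, c) \<oplus>\<^bsub>ext_alg\<^esub> (a', m', c') = (a \<oplus>\<^bsub>A\<^esub> a', m + m', c + c')"
  "t \<odot>\<^bsub>ext_alg\<^esub> (a, m, c) = (t \<odot>\<^bsub>A\<^esub> a, m * t, t * c)"
  by (cases x; simp add: ext_alg_def one_point_extension_def chi_scalar)
    (simp_all add: ext_alg_def one_point_extension_def chi_scalar)

lemma smult_closed: "a \<in> carrier A \<Longrightarrow> t \<odot>\<^bsub>A\<^esub> a \<in> carrier A"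
  by (subst smult_eq) (simp_all add: scalar_closed)

lemma smult_zero: "t \<odot>\<^bsub>A\<^esub> \<zero>\<^bsub>A\<^esub> = \<zero>\<^bsub>A\<^esub>"
  by (subst smult_eq) (simp_all add: scalar_closed)

lemma scalar_norm:
  "a \<in> carrier A \<Longrightarrow> (t \<odot>\<^bsub>A\<^esub> \<one>\<^bsub>A\<^esub>) \<otimes>\<^bsub>A\<^esub> a = t \<odot>\<^bsub>A\<^esub> a"
  "a \<in> carrier A \<Longrightarrow> a \<otimes>\<^bsub>A\<^esub> (t \<odot>\<^bsub>A\<^esub> \<one>\<^bsub>A\<^esub>) = t \<odot>\<^bsub>A\<^esub> a"
  "t \<odot>\<^bsub>A\<^esub> (s \<odot>\<^bsub>A\<^esub> \<one>\<^bsub>A\<^esub>) = (t * s) \<odot>\<^bsub>A\<^esub> \<one>\<^bsub>A\<^esub>"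
proof -
  show 1: "(t \<odot>\<^bsub>A\<^esub> \<one>\<^bsub>A\<^esub>) \<otimes>\<^bsub>A\<^esub> a = t \<odot>\<^bsub>A\<^esub> a" if "a \<in> carrier A" for a
    by (rule smult_eq[OF that, symmetric])
  show "a \<otimes>\<^bsub>A\<^esub> (t \<odot>\<^bsub>A\<^esub> \<one>\<^bsub>A\<^esub>) = t \<odot>\<^bsub>A\<^esub> a" if "a \<in> carrier A"
    unfolding scalar_central[OF that, symmetric] by (rule 1[OF that])
  show "t \<odot>\<^bsub>A\<^esub> (s \<odot>\<^bsub>A\<^esub> \<one>\<^bsub>A\<^esub>) = (t * s) \<odot>\<^bsub>A\<^esub> \<one>\<^bsub>A\<^esub>"
    unfolding scalar_mult by (rule 1[OF scalar_closed, symmetric])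
qed

lemma ring_ext_alg: "ring ext_alg"
proof (rule ringI)
  show "abelian_group ext_alg"
  proof (rule abelian_groupI)
    show "\<exists>y\<in>carrier ext_alg. y \<oplus>\<^bsub>ext_alg\<^esub> x = \<zero>\<^bsub>ext_alg\<^esub>" if "x \<in> carrier ext_alg" for x
      using that by (cases x) (auto intro!: bexI[of _ "(\<ominus>\<^bsub>A\<^esub> fst x, - fst (snd x), - snd (snd x))"] simp: R.l_neg)
  qed (auto simp: R.a_ac)
  show "monoid ext_alg"
    by (rule monoidI) (auto simp: R.m_assoc chi_mult algebra_simps)
qed (auto simp: R.l_distr R.r_distr chi_add algebra_simps)

text \<open>The idempotent of the new vertex is the matrix unit in the lower right corner, and the
  product (b, m, c) (0, 0, 1) is (0, 0, c), so the character reads off c.\<close>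

lemma source_algebra_ext_alg:
  "source_algebra ext_alg (\<zero>\<^bsub>A\<^esub>, 0, 1) (\<lambda>(a, m, c). c)"
proof (intro source_algebra.intro fd_algebra.intro ralg.intro ring_ext_alg fd_algebra_axioms.intro
    source_algebra_axioms.intro)
  show "\<exists>B. finite B \<and> B \<subseteq> carrier ext_alg \<and>
      (\<forall>H. H \<subseteq> carrier ext_alg \<and> \<zero>\<^bsub>ext_alg\<^esub> \<in> H \<and> (\<forall>x\<in>H. \<forall>y\<in>H. x \<oplus>\<^bsub>ext_alg\<^esub> y \<in> H) \<and>
         (\<forall>c. \<forall>x\<in>H. c \<odot>\<^bsub>ext_alg\<^esub> x \<in> H) \<and> B \<subseteq> H \<longrightarrow> H = carrier ext_alg)"
  proof -
    obtain B where B: "finite B" "B \<subseteq> carrier A"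
      "\<And>H. H \<subseteq> carrier A \<and> \<zero>\<^bsub>A\<^esub> \<in> H \<and> (\<forall>x\<in>H. \<forall>y\<in>H. x \<oplus>\<^bsub>A\<^esub> y \<in> H) \<and>
           (\<forall>c. \<forall>x\<in>H. c \<odot>\<^bsub>A\<^esub> x \<in> H) \<and> B \<subseteq> H \<Longrightarrow> H = carrier A" using finite_dim by metis
    \<comment> \<open>A spanning set of \<open>A\<close> together with the two matrix units of the
      bottom row.\<close>
    let ?B = "(\<lambda>b. (b, 0, 0)) ` B \<union> {(\<zero>\<^bsub>A\<^esub>, 1, 0), (\<zero>\<^bsub>A\<^esub>, 0, 1)}"
    have span: "H = carrier ext_alg" if H: "H \<subseteq> carrier ext_alg" "\<zero>\<^bsub>ext_alg\<^esub> \<in> H"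
      "\<And>x y. x \<in> H \<Longrightarrow> y \<in> H \<Longrightarrow> x \<oplus>\<^bsub>ext_alg\<^esub> y \<in> H"
      "\<And>c x. x \<in> H \<Longrightarrow> c \<odot>\<^bsub>ext_alg\<^esub> x \<in> H" "?B \<subseteq> H" for H
    proof -
      have "{a. (a, 0, 0) \<in> H} = carrier A"
      proof (rule B(3), intro conjI allI ballI)
        show "{a. (a, 0, 0) \<in> H} \<subseteq> carrier A" using H(1) by (auto dest: subsetD)
        show "x \<oplus>\<^bsub>A\<^esub> y \<in> {a. (a, 0, 0) \<in> H}" if "x \<in> {a. (a, 0, 0) \<in> H}" "y \<in> {a. (a, 0, 0) \<in> H}" for x y
          using H(3)[of "(x, 0, 0)" "(y, 0, 0)"] that by simp
        show "c \<odot>\<^bsub>A\<^esub> x \<in> {a. (a, 0, 0) \<in> H}" if "x \<in> {a. (a, 0, 0) \<in> H}" for x c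
          using H(4)[of "(x, 0, 0)" c] that by simp
      qed (use H(2,5) in auto)
      then have a: "(a, 0, 0) \<in> H" if "a \<in> carrier A" for a using that by blast
      have m: "(\<zero>\<^bsub>A\<^esub>, m, 0) \<in> H" for m using H(4)[of "(\<zero>\<^bsub>A\<^esub>, 1, 0)" m] H(5) by (simp add: smult_zero)
      have c: "(\<zero>\<^bsub>A\<^esub>, 0, c) \<in> H" for c using H(4)[of "(\<zero>\<^bsub>A\<^esub>, 0, 1)" c] H(5) by (simp add: smult_zero)
      have "(a, m, c) \<in> H" if "a \<in> carrier A" for a m c
        using H(3)[OF H(3)[OF a[OF that] m[of m]] c[of c]] that by simp
      then show ?thesis using H(1) by auto
    qed
    have "finite ?B" "?B \<subseteq> carrier ext_alg" using B by auto
    moreover have "H = carrier ext_alg" if *: "H \<subseteq> carrier ext_alg \<and> \<zero>\<^bsub>ext_alg\<^esub> \<in> H \<and>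
      (\<forall>x\<in>H. \<forall>y\<in>H. x \<oplus>\<^bsub>ext_alg\<^esub> y \<in> H) \<and> (\<forall>c. \<forall>x\<in>H. c \<odot>\<^bsub>ext_alg\<^esub> x \<in> H) \<and> ?B \<subseteq> H" for H
    proof -
      note c = *[THEN conjunct1] *[THEN conjunct2, THEN conjunct1]
        *[THEN conjunct2, THEN conjunct2, THEN conjunct1]
        *[THEN conjunct2, THEN conjunct2, THEN conjunct2, THEN conjunct1]
        *[THEN conjunct2, THEN conjunct2, THEN conjunct2, THEN conjunct2]
      show ?thesis by (rule span[OF c(1,2) _ _ c(5)]) (rule c(3,4)[rule_format], assumption+)+
    qed
    ultimately show ?thesis by (intro exI[of _ ?B] conjI allI impI)
  qed
next
  fix c a assume "a \<in> carrier ext_alg"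
  then show "c \<odot>\<^bsub>ext_alg\<^esub> a = (c \<odot>\<^bsub>ext_alg\<^esub> \<one>\<^bsub>ext_alg\<^esub>) \<otimes>\<^bsub>ext_alg\<^esub> a"
    "(c \<odot>\<^bsub>ext_alg\<^esub> \<one>\<^bsub>ext_alg\<^esub>) \<otimes>\<^bsub>ext_alg\<^esub> a = a \<otimes>\<^bsub>ext_alg\<^esub> (c \<odot>\<^bsub>ext_alg\<^esub> \<one>\<^bsub>ext_alg\<^esub>)"
    by (cases a; simp add: scalar_norm chi_scalar)+
next
  fix c d :: 'k
  show "(c + d) \<odot>\<^bsub>ext_alg\<^esub> \<one>\<^bsub>ext_alg\<^esub> = c \<odot>\<^bsub>ext_alg\<^esub> \<one>\<^bsub>ext_alg\<^esub> \<oplus>\<^bsub>ext_alg\<^esub> d \<odot>\<^bsub>ext_alg\<^esub> \<one>\<^bsub>ext_alg\<^esub>"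
    by (simp add: scalar_add)
  show "(c * d) \<odot>\<^bsub>ext_alg\<^esub> \<one>\<^bsub>ext_alg\<^esub> = (c \<odot>\<^bsub>ext_alg\<^esub> \<one>\<^bsub>ext_alg\<^esub>) \<otimes>\<^bsub>ext_alg\<^esub> (d \<odot>\<^bsub>ext_alg\<^esub> \<one>\<^bsub>ext_alg\<^esub>)"
    by (simp add: scalar_mult)
next
  fix a b :: "'a \<times> 'k \<times> 'k" assume "a \<in> carrier ext_alg" "b \<in> carrier ext_alg"
  then show "(case a \<oplus>\<^bsub>ext_alg\<^esub> b of (a, m, c) \<Rightarrow> c) = (case a of (a, m, c) \<Rightarrow> c) + (case b of (a, m, c) \<Rightarrow> c)"
    "(case a \<otimes>\<^bsub>ext_alg\<^esub> b of (a, m, c) \<Rightarrow> c) = (case a of (a, m, c) \<Rightarrow> c) * (case b of (a, m, c) \<Rightarrow> c)"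
    by (cases a; cases b; simp)+
next
  fix a :: "'a \<times> 'k \<times> 'k" assume "a \<in> carrier ext_alg"
  then show "a \<otimes>\<^bsub>ext_alg\<^esub> (\<zero>\<^bsub>A\<^esub>, 0, 1) =
    ((case a of (a, m, c) \<Rightarrow> c) \<odot>\<^bsub>ext_alg\<^esub> \<one>\<^bsub>ext_alg\<^esub>) \<otimes>\<^bsub>ext_alg\<^esub> (\<zero>\<^bsub>A\<^esub>, 0, 1)"
    by (cases a) (simp add: scalar_closed)
qed (simp_all add: scalar_closed scalar_one)

end

text \<open>A one-point extension at a source is again an algebra with a source: the new vertex \<open>a\<close>. Below,
  \<open>ea\<close> is the idempotent at \<open>a\<close>, \<open>ex\<close> the arrow from \<open>a\<close> to \<open>i\<close>, and \<open>ep\<close> the unit of \<open>\<Lambda>\<close>.\<close>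

locale one_point = source_algebra A e \<chi> for A :: "('k::field, 'a) module" and e \<chi>
begin

sublocale G: source_algebra ext_alg "(\<zero>\<^bsub>A\<^esub>, 0, 1)" "\<lambda>(a, m, c). c"
  by (rule source_algebra_ext_alg)

abbreviation "ea \<equiv> (\<zero>\<^bsub>A\<^esub>, 0, 1) :: 'a \<times> 'k \<times> 'k"
abbreviation "ex \<equiv> (\<zero>\<^bsub>A\<^esub>, 1, 0) :: 'a \<times> 'k \<times> 'k"
abbreviation "ep \<equiv> (\<one>\<^bsub>A\<^esub>, 0, 0) :: 'a \<times> 'k \<times> 'k"

section \<open>Passage between modules over \<Lambda> and modules over \<Gamma>\<close>

lemma G_sc: "G.sc c = (sc c, 0, c)"
  by (simp add: G.sc_def sc_def)

lemma fst_G_sc [simp]: "fst (G.sc c) = sc c"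
  by (simp add: G_sc)

text \<open>The embedding of \<open>mod \<Lambda>\<close> into \<open>mod \<Gamma>\<close> and its right adjoint.\<close>

definition infl :: "('a, 'm) module \<Rightarrow> ('a \<times> 'k \<times> 'k, 'm) module" where
  "infl M = \<lparr>carrier = carrier M, mult = (\<lambda>_ _. undefined), one = undefined, zero = \<zero>\<^bsub>M\<^esub>,
     add = (\<lambda>x y. x \<oplus>\<^bsub>M\<^esub> y), smult = (\<lambda>(a, m, c) x. a \<odot>\<^bsub>M\<^esub> x)\<rparr>"

definition restr :: "('a \<times> 'k \<times> 'k, 'm) module \<Rightarrow> ('a, 'm) module" where
  "restr N = \<lparr>carrier = {y \<in> carrier N. ep \<odot>\<^bsub>N\<^esub> y = y}, mult = (\<lambda>_ _. undefined), one = undefined,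
     zero = \<zero>\<^bsub>N\<^esub>, add = (\<lambda>x y. x \<oplus>\<^bsub>N\<^esub> y), smult = (\<lambda>a x. (a, 0, 0) \<odot>\<^bsub>N\<^esub> x)\<rparr>"

lemma infl_simps [simp]: "carrier (infl M) = carrier M" "\<zero>\<^bsub>infl M\<^esub> = \<zero>\<^bsub>M\<^esub>"
  "x \<oplus>\<^bsub>infl M\<^esub> y = x \<oplus>\<^bsub>M\<^esub> y" "(a, m, c) \<odot>\<^bsub>infl M\<^esub> x = a \<odot>\<^bsub>M\<^esub> x"
  by (auto simp: infl_def)

lemma restr_simps: "carrier (restr N) = {y \<in> carrier N. ep \<odot>\<^bsub>N\<^esub> y = y}" "\<zero>\<^bsub>restr N\<^esub> = \<zero>\<^bsub>N\<^esub>"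
  "x \<oplus>\<^bsub>restr N\<^esub> y = x \<oplus>\<^bsub>N\<^esub> y" "a \<odot>\<^bsub>restr N\<^esub> x = (a, 0, 0) \<odot>\<^bsub>N\<^esub> x"
  by (auto simp: restr_def)

lemma G_mult: "G.rmod N \<Longrightarrow> a \<in> carrier A \<Longrightarrow> a' \<in> carrier A \<Longrightarrow> y \<in> carrier N \<Longrightarrow>
    (a', m', c') \<odot>\<^bsub>N\<^esub> ((a, m, c) \<odot>\<^bsub>N\<^esub> y) = (a \<otimes>\<^bsub>A\<^esub> a', m * \<chi> a' + m' * c, c * c') \<odot>\<^bsub>N\<^esub> y"
  using G.ract_mult[of N "(a, m, c)" "(a', m', c')" y] by simp

lemma G_add: "G.rmod N \<Longrightarrow> a \<in> carrier A \<Longrightarrow> a' \<in> carrier A \<Longrightarrow> y \<in> carrier N \<Longrightarrow>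
    (a \<oplus>\<^bsub>A\<^esub> a', m + m', c + c') \<odot>\<^bsub>N\<^esub> y = (a, m, c) \<odot>\<^bsub>N\<^esub> y \<oplus>\<^bsub>N\<^esub> (a', m', c') \<odot>\<^bsub>N\<^esub> y"
  using G.ract_add_left[of N "(a, m, c)" "(a', m', c')" y] by simp

lemma G_one: "G.rmod N \<Longrightarrow> y \<in> carrier N \<Longrightarrow> (\<one>\<^bsub>A\<^esub>, 0, 1) \<odot>\<^bsub>N\<^esub> y = y"
  using G.ract_one[of N y] by simp

lemma G_zero: "G.rmod N \<Longrightarrow> y \<in> carrier N \<Longrightarrow> (\<zero>\<^bsub>A\<^esub>, 0, 0) \<odot>\<^bsub>N\<^esub> y = \<zero>\<^bsub>N\<^esub>"
  using G.ract_zero(2)[of N y] by simp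

lemma G_rmod_infl: "rmod M \<Longrightarrow> G.rmod (infl M)"
  by (rule G.rmodI) (auto simp: rmod_ac ract_add ract_add_left ract_mult)

text \<open>In \<Gamma> the product of \<open>ep\<close> with (a, m, c) is (a, 0, 0), and y is fixed
  by \<open>ep\<close>.\<close>

lemma restr_act:
  assumes "G.rmod N" "y \<in> carrier (restr N)" "a \<in> carrier A"
  shows "(a, m, c) \<odot>\<^bsub>N\<^esub> y = (a, 0, 0) \<odot>\<^bsub>N\<^esub> y"
proof -
  have y: "y \<in> carrier N" "ep \<odot>\<^bsub>N\<^esub> y = y" using assms by (auto simp: restr_simps)
  have "(a, m, c) \<odot>\<^bsub>N\<^esub> (ep \<odot>\<^bsub>N\<^esub> y) = (a, 0, 0) \<odot>\<^bsub>N\<^esub> y"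
    using G_mult[OF assms(1) R.one_closed assms(3) y(1), of m c 0 0] assms(3) by simp
  then show ?thesis using y by simp
qed

lemma rmod_restr:
  assumes "G.rmod N" shows "rmod (restr N)"
proof (rule rmodI)
  show "a \<odot>\<^bsub>restr N\<^esub> x \<in> carrier (restr N)" if "a \<in> carrier A" "x \<in> carrier (restr N)" for a x
    using that assms by (auto simp: restr_simps G_mult)
  show "(a \<oplus>\<^bsub>A\<^esub> b) \<odot>\<^bsub>restr N\<^esub> x = a \<odot>\<^bsub>restr N\<^esub> x \<oplus>\<^bsub>restr N\<^esub> b \<odot>\<^bsub>restr N\<^esub> x"
    if "a \<in> carrier A" "b \<in> carrier A" "x \<in> carrier (restr N)" for a b x
    using that assms G_add[of N a b x 0 0 0 0] by (auto simp: restr_simps)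
qed (use assms in \<open>auto simp: restr_simps G.rmod_ac G.ract_add G_mult G_zero\<close>)

lemma G_lin_infl: "G.lin (infl M) (infl N) f \<longleftrightarrow> lin M N f"
proof
  assume f: "G.lin (infl M) (infl N) f"
  show "lin M N f"
  proof (rule linI)
    show "f (a \<odot>\<^bsub>M\<^esub> x) = a \<odot>\<^bsub>N\<^esub> f x" if "a \<in> carrier A" "x \<in> carrier M" for a x
      using G.lin_act[OF f, of "(a, 0, 0)" x] that by simp
  qed (use G.lin_closed[OF f] G.lin_add[OF f] in auto)
next
  assume f: "lin M N f"
  show "G.lin (infl M) (infl N) f"
  proof (rule G.linI)
    show "f (a \<odot>\<^bsub>infl M\<^esub> x) = a \<odot>\<^bsub>infl N\<^esub> f x" if "a \<in> carrier ext_alg" "x \<in> carrier (infl M)" for a x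
      using lin_act[OF f, of "fst a" x] that by (cases a) simp
  qed (use lin_closed[OF f] lin_add[OF f] in auto)
qed

lemma lin_infl_into:
  assumes "rmod M" "G.rmod N" "G.lin (infl M) N f" shows "lin M (restr N) f"
proof (rule linI)
  show "f x \<in> carrier (restr N)" if "x \<in> carrier M" for x
    using G.lin_closed[OF assms(3), of x] G.lin_act[OF assms(3), of ep x] that assms(1) by (simp add: restr_simps)
qed (use assms(1) G.lin_add[OF assms(3)] G.lin_act[OF assms(3), of "(_, 0, 0)"] in \<open>auto simp: restr_simps\<close>)

lemma lin_restr:
  assumes "G.rmod N" "G.rmod N'" "G.lin N N' g" shows "lin (restr N) (restr N') g"
proof (rule linI)
  show "g x \<in> carrier (restr N')" if "x \<in> carrier (restr N)" for x
    using G.lin_closed[OF assms(3), of x] G.lin_act[OF assms(3), of ep x] that by (simp add: restr_simps)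
qed (use G.lin_add[OF assms(3)] G.lin_act[OF assms(3), of "(_, 0, 0)"] in \<open>auto simp: restr_simps\<close>)

lemma lin_from_restr:
  assumes "rmod M" "G.rmod N" "lin M (restr N) f" shows "G.lin (infl M) N f"
proof (rule G.linI)
  fix a x assume a: "a \<in> carrier ext_alg" and x: "x \<in> carrier (infl M)"
  obtain b m c where [simp]: "a = (b, m, c)" by (cases a)
  have "b \<in> carrier A" using a by simp
  then show "f (a \<odot>\<^bsub>infl M\<^esub> x) = a \<odot>\<^bsub>N\<^esub> f x"
    using lin_act[OF assms(3), of b x] lin_closed[OF assms(3), of x] restr_act[OF assms(2), of "f x" b m c] x
    by (simp add: restr_simps)
qed (use assms lin_add[OF assms(3)] lin_closed[OF assms(3)] in \<open>auto simp: restr_simps\<close>)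

lemma G_kspan_infl: "rmod M \<Longrightarrow> S \<subseteq> carrier M \<Longrightarrow> G.kspan (infl M) S = kspan M S"
proof (intro equalityI subsetI)
  show "x \<in> kspan M S" if "x \<in> G.kspan (infl M) S" for x
    using that by (induction rule: G.kspan.induct) (auto simp: G_sc intro: kspan.intros)
  show "x \<in> G.kspan (infl M) S" if "x \<in> kspan M S" for x
    using that
  proof (induction rule: kspan.induct)
    case kspan_zero show ?case using G.kspan_zero[of "infl M" S] by simp
  next
    case (kspan_step x h c)
    show ?case using G.kspan_step[OF kspan_step(1,3), of c] by (simp add: G_sc)
  qed
qed

lemma G_fd_infl:
  assumes "fd M" shows "G.fd (infl M)"
proof -
  obtain S where S: "finite S" "S \<subseteq> carrier M" "carrier M \<subseteq> kspan M S" using fdE[OF assms] by metis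
  have M: "rmod M" using assms by simp
  show ?thesis unfolding G.fd_def using G_rmod_infl[OF M] S G_kspan_infl[OF M S(2)]
    by (intro conjI exI[of _ S]) simp_all
qed

lemma infl_fg [simp]: "M \<in> fg_modules A \<Longrightarrow> infl M \<in> fg_modules ext_alg"
  by (simp add: G.fg_modules_iff G_fd_infl)

text \<open>The part fixed by \<open>ep\<close> is a submodule already over \<Gamma>; it inherits
  finite dimension there, before \<open>restr_fg\<close> reads it over \<Lambda>.\<close>

lemma submodule_restr:
  assumes "G.rmod N" shows "submodule (carrier (restr N)) ext_alg N"
  unfolding G.submodule_iff[OF assms]
proof (intro conjI ballI)
  fix a x assume a: "a \<in> carrier ext_alg" and x: "x \<in> carrier (restr N)"
  obtain b m c where b: "a = (b, m, c)" "b \<in> carrier A" using a by (cases a) auto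
  have "a \<odot>\<^bsub>N\<^esub> x = (b, 0, 0) \<odot>\<^bsub>N\<^esub> x" using restr_act[OF assms x b(2)] b(1) by simp
  then show "a \<odot>\<^bsub>N\<^esub> x \<in> carrier (restr N)"
    using rmod_closed(5)[OF rmod_restr[OF assms] b(2) x] by (simp add: restr_simps)
qed (use assms in \<open>auto simp: restr_simps G.ract_add\<close>)

lemma restr_fg:
  assumes "N \<in> fg_modules ext_alg" shows "restr N \<in> fg_modules A"
proof -
  have N: "G.rmod N" using assms by simp
  let ?H = "carrier (restr N)"
  have "G.fd (N\<lparr>carrier := ?H\<rparr>)" by (rule G.fd_sub[OF G.fg_fd[OF assms] submodule_restr[OF N]])
  then obtain S where S: "finite S" "S \<subseteq> ?H" "?H \<subseteq> G.kspan N S"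
    using G.fdE[of "N\<lparr>carrier := ?H\<rparr>"] by auto
  have "x \<in> kspan (restr N) S" if "x \<in> G.kspan N S" for x
    using that
  proof (induction rule: G.kspan.induct)
    case kspan_zero show ?case using kspan.kspan_zero[of "restr N" S] by (simp add: restr_simps)
  next
    case (kspan_step x h c)
    have "G.sc c \<odot>\<^bsub>N\<^esub> x = (sc c, 0, 0) \<odot>\<^bsub>N\<^esub> x"
      using restr_act[OF N, of x "sc c" 0 c] kspan_step(1) S(2) by (auto simp: G_sc)
    then show ?case using kspan.kspan_step[OF kspan_step(1,3), of c] by (simp add: restr_simps)
  qed
  then have "fd (restr N)" unfolding fd_def using S rmod_restr[OF N] by blast
  then show ?thesis by (simp add: fg_modules_iff)
qed

lemma G_ep_ea:
  assumes "G.rmod N" "y \<in> carrier N"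
  shows "ep \<odot>\<^bsub>N\<^esub> y \<oplus>\<^bsub>N\<^esub> ea \<odot>\<^bsub>N\<^esub> y = y"
  using G_add[OF assms(1) R.one_closed R.zero_closed assms(2), of 0 0 0 1] G_one[OF assms] by simp

text \<open>Vanishing at the new vertex a. Up to isomorphism these are the modules of the form
  \<open>infl X\<close>; see \<open>lambda_mod_iso\<close>.\<close>

definition lambda_mod where "lambda_mod N \<longleftrightarrow> (\<forall>y\<in>carrier N. ea \<odot>\<^bsub>N\<^esub> y = \<zero>\<^bsub>N\<^esub>)"

lemma lambda_mod_infl: "rmod M \<Longrightarrow> lambda_mod (infl M)"
  by (auto simp: lambda_mod_def)

lemma lambda_mod_restr:
  assumes "G.rmod N" "lambda_mod N" shows "carrier (restr N) = carrier N"
  using G_ep_ea[OF assms(1)] assms by (auto simp: restr_simps lambda_mod_def)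

lemma lambda_mod_iso:
  assumes "G.rmod N" "lambda_mod N" shows "mod_iso ext_alg N (infl (restr N))"
proof (rule G.mod_isoI[OF assms(1)])
  have c: "carrier (restr N) = carrier N" by (rule lambda_mod_restr[OF assms])
  have act: "a \<odot>\<^bsub>infl (restr N)\<^esub> x = a \<odot>\<^bsub>N\<^esub> x" if "a \<in> carrier ext_alg" "x \<in> carrier N" for a x
  proof -
    obtain b m d where a: "a = (b, m, d)" "b \<in> carrier A" using \<open>a \<in> carrier ext_alg\<close> by (cases a) auto
    have "(b, m, d) \<odot>\<^bsub>N\<^esub> x = (b, 0, 0) \<odot>\<^bsub>N\<^esub> x"
      by (rule restr_act[OF assms(1) _ a(2)]) (use that c in simp)
    then show ?thesis unfolding a(1) by (simp add: restr_simps)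
  qed
  show "G.lin N (infl (restr N)) (\<lambda>x. x)" "G.lin (infl (restr N)) N (\<lambda>x. x)"
    using act c by (auto simp: G.lin_def restr_simps(3))
qed auto

lemma infl_iso: "rmod M \<Longrightarrow> mod_iso A M N \<longleftrightarrow> mod_iso ext_alg (infl M) (infl N)"
proof
  assume M: "rmod M"
  show "mod_iso ext_alg (infl M) (infl N)" if "mod_iso A M N"
    using mod_isoE[OF that M] G.mod_isoI[OF G_rmod_infl[OF M], of "infl N"] by (metis G_lin_infl infl_simps(1))
  show "mod_iso A M N" if "mod_iso ext_alg (infl M) (infl N)"
    using G.mod_isoE[OF that G_rmod_infl[OF M]] mod_isoI[OF M, of N] by (metis G_lin_infl infl_simps(1))
qed

lemma infl_biprod: "G.biprod (infl D) (infl M) (infl N) \<longleftrightarrow> biprod D M N"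
  by (simp add: G.biprod_def biprod_def G.bip_def bip_def G_lin_infl)

text \<open>Maps out of \<open>infl P\<close> land in \<open>restr\<close>, so it is enough that
  \<open>restr\<close> preserves surjections: if y = g x is fixed by \<open>ep\<close>, then y is
  also the image of x \<open>ep\<close>.\<close>

lemma infl_projective:
  assumes "projective_module A P" shows "projective_module ext_alg (infl P)"
  unfolding G.projective_iff G.lifts_def
proof (intro conjI ballI allI impI)
  have P: "P \<in> fg_modules A" "rmod P" using assms by auto
  show "infl P \<in> fg_modules ext_alg" using P by simp
  fix M N g f
  assume *: "M \<in> fg_modules ext_alg" "N \<in> fg_modules ext_alg" "G.lin M N g" "G.lin (infl P) N f"
    "carrier N \<subseteq> g ` carrier M"
  have rm: "G.rmod M" "G.rmod N" using * by auto
  have "carrier (restr N) \<subseteq> g ` carrier (restr M)"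
  proof
    fix y assume "y \<in> carrier (restr N)"
    then have y: "y \<in> carrier N" "ep \<odot>\<^bsub>N\<^esub> y = y" by (auto simp: restr_simps)
    then obtain x where x: "x \<in> carrier M" "y = g x" using *(5) by auto
    have "g (ep \<odot>\<^bsub>M\<^esub> x) = y" using G.lin_act[OF *(3), of ep x] x y by simp
    moreover have "ep \<odot>\<^bsub>M\<^esub> x \<in> carrier (restr M)"
      using x rm(1) by (auto simp: restr_simps G_mult)
    ultimately show "y \<in> g ` carrier (restr M)" by force
  qed
  then obtain h where h: "lin P (restr M) h" "\<And>x. x \<in> carrier P \<Longrightarrow> g (h x) = f x"
    using liftsD[of P "restr M" "restr N" g f] assms restr_fg * lin_restr[OF rm *(3)]
      lin_infl_into[OF P(2) rm(2) *(4)] unfolding projective_iff by metis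
  show "\<exists>h. G.lin (infl P) M h \<and> (\<forall>x\<in>carrier (infl P). g (h x) = f x)"
    using h lin_from_restr[OF P(2) rm(1) h(1)] by (intro exI[of _ h]) simp
qed

lemma infl_res:
  assumes "res M P d \<epsilon>" shows "G.res (infl M) (\<lambda>n. infl (P n)) d \<epsilon>"
  using assms unfolding res_def G.res_def by (simp add: G_lin_infl infl_projective)

lemma infl_van: "G.van (\<lambda>n. infl (P n)) d (infl N) n \<longleftrightarrow> van P d N n"
  unfolding van_def G.van_def by (simp add: G_lin_infl)

text \<open>\<open>infl\<close> leaves homomorphisms and elements unchanged and preserves
  projectives, so a resolution and its Hom complex carry over verbatim.\<close>

lemma infl_orth:
  assumes "M \<in> fg_modules A" "N \<in> fg_modules A"
  shows "G.orth (infl M) (infl N) \<longleftrightarrow> orth M N"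
proof -
  obtain P d \<epsilon> where r: "res M P d \<epsilon>" using res_exists assms by metis
  show ?thesis
    using orth_res[OF assms r] G.orth_res[OF infl_fg infl_fg infl_res[OF r]] assms by (simp add: infl_van)
qed

text \<open>The projective module at the new vertex: \<open>p\<close> is the coordinate at \<open>i\<close> and \<open>q\<close> the one at \<open>a\<close>.
  It is also injective, because the arrow from \<open>a\<close> is the only arrow that ends at \<open>i\<close>.\<close>

definition PAm :: "('a \<times> 'k \<times> 'k, 'k \<times> 'k) module" where
  "PAm = \<lparr>carrier = UNIV, mult = (\<lambda>_ _. undefined), one = undefined, zero = (0, 0),
     add = (\<lambda>(p, q) (p', q'). (p + p', q + q')),
     smult = (\<lambda>(a, m, c) (p, q). (p * \<chi> a + q * m, q * c))\<rparr>"

lemma PAm_simps [simp]: "carrier PAm = UNIV" "\<zero>\<^bsub>PAm\<^esub> = (0, 0)"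
  "(p, q) \<oplus>\<^bsub>PAm\<^esub> (p', q') = (p + p', q + q')"
  "(a, m, c) \<odot>\<^bsub>PAm\<^esub> (p, q) = (p * \<chi> a + q * m, q * c)"
  by (auto simp: PAm_def)

lemma G_rmod_PAm: "G.rmod PAm"
  by (rule G.rmodI) (auto simp: chi_add chi_mult algebra_simps)

lemma G_fd_PAm: "G.fd PAm"
proof -
  have "(p, q) \<in> G.kspan PAm {(1, 0), (0, 1)}" for p q
    using G.kspan_step[OF _ G.kspan_step[OF _ G.kspan_zero[of PAm "{(1, 0), (0, 1)}"], of "(0, 1)" q], of "(1, 0)" p]
    by (simp add: G_sc)
  then show ?thesis unfolding G.fd_def using G_rmod_PAm
    by (intro conjI exI[of _ "{(1, 0), (0, 1)}"]) auto
qed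

lemma G_ex_ea:
  assumes "G.rmod Y" "v \<in> carrier Y"
  shows "ex \<odot>\<^bsub>Y\<^esub> (ea \<odot>\<^bsub>Y\<^esub> v) = ex \<odot>\<^bsub>Y\<^esub> v" "ea \<odot>\<^bsub>Y\<^esub> (ex \<odot>\<^bsub>Y\<^esub> v) = \<zero>\<^bsub>Y\<^esub>"
    "ea \<odot>\<^bsub>Y\<^esub> (ea \<odot>\<^bsub>Y\<^esub> v) = ea \<odot>\<^bsub>Y\<^esub> v"
  using G_mult[OF assms(1) R.zero_closed R.zero_closed assms(2)] G_zero[OF assms] by simp_all

lemma G_act_ea:
  assumes "G.rmod Y" "v \<in> carrier Y" "ea \<odot>\<^bsub>Y\<^esub> v = v" "a \<in> carrier A"
  shows "(a, m, c) \<odot>\<^bsub>Y\<^esub> v = G.sc c \<odot>\<^bsub>Y\<^esub> v \<oplus>\<^bsub>Y\<^esub> G.sc m \<odot>\<^bsub>Y\<^esub> (ex \<odot>\<^bsub>Y\<^esub> v)"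
    "(a, m, c) \<odot>\<^bsub>Y\<^esub> (ex \<odot>\<^bsub>Y\<^esub> v) = G.sc (\<chi> a) \<odot>\<^bsub>Y\<^esub> (ex \<odot>\<^bsub>Y\<^esub> v)"
proof -
  note Gm = G_mult[OF assms(1) R.zero_closed _ assms(2)]
  have sx: "G.sc m \<odot>\<^bsub>Y\<^esub> (ex \<odot>\<^bsub>Y\<^esub> v) = (\<zero>\<^bsub>A\<^esub>, m, 0) \<odot>\<^bsub>Y\<^esub> v" for m
    using Gm[of "sc m" 0 m 1 0] by (simp add: G_sc)
  have sv: "G.sc c \<odot>\<^bsub>Y\<^esub> (ea \<odot>\<^bsub>Y\<^esub> v) = (\<zero>\<^bsub>A\<^esub>, 0, c) \<odot>\<^bsub>Y\<^esub> v"
    using Gm[of "sc c" 0 c 0 1] by (simp add: G_sc)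
  have "(a, m, c) \<odot>\<^bsub>Y\<^esub> (ea \<odot>\<^bsub>Y\<^esub> v) = (\<zero>\<^bsub>A\<^esub>, m, c) \<odot>\<^bsub>Y\<^esub> v"
    using Gm[OF assms(4), of m c 0 1] assms(4) by simp
  also have "\<dots> = (\<zero>\<^bsub>A\<^esub>, 0, c) \<odot>\<^bsub>Y\<^esub> v \<oplus>\<^bsub>Y\<^esub> (\<zero>\<^bsub>A\<^esub>, m, 0) \<odot>\<^bsub>Y\<^esub> v"
    using G_add[OF assms(1) R.zero_closed R.zero_closed assms(2), of 0 m c 0] by simp
  finally show "(a, m, c) \<odot>\<^bsub>Y\<^esub> v = G.sc c \<odot>\<^bsub>Y\<^esub> v \<oplus>\<^bsub>Y\<^esub> G.sc m \<odot>\<^bsub>Y\<^esub> (ex \<odot>\<^bsub>Y\<^esub> v)"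
    using sv sx by (simp add: assms(3))
  show "(a, m, c) \<odot>\<^bsub>Y\<^esub> (ex \<odot>\<^bsub>Y\<^esub> v) = G.sc (\<chi> a) \<odot>\<^bsub>Y\<^esub> (ex \<odot>\<^bsub>Y\<^esub> v)"
    unfolding sx using Gm[OF assms(4), of m c 1 0] assms(4) by simp
qed

text \<open>\<open>PAm\<close> is generated by (0, 1), and a homomorphism from it amounts to the
  image v of that generator, which may be any element fixed by \<open>ea\<close>. The converse is
  \<open>PAm_homD\<close>.\<close>

lemma PAm_hom:
  assumes "G.rmod Y" "v \<in> carrier Y" "ea \<odot>\<^bsub>Y\<^esub> v = v"
  shows "G.lin PAm Y (\<lambda>z. G.sc (snd z) \<odot>\<^bsub>Y\<^esub> v \<oplus>\<^bsub>Y\<^esub> G.sc (fst z) \<odot>\<^bsub>Y\<^esub> (ex \<odot>\<^bsub>Y\<^esub> v))" (is "G.lin _ _ ?f")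
proof (rule G.linI)
  note Y = assms(1)
  have w: "ex \<odot>\<^bsub>Y\<^esub> v \<in> carrier Y" using assms by simp
  show "?f x \<in> carrier Y" for x using Y w assms(2) by simp
  show "?f (x \<oplus>\<^bsub>PAm\<^esub> y) = ?f x \<oplus>\<^bsub>Y\<^esub> ?f y" for x y
    using Y w assms(2) by (cases x; cases y) (simp add: G.sc_act_simps(1) G.rmod_ac)
  show "?f (a \<odot>\<^bsub>PAm\<^esub> x) = a \<odot>\<^bsub>Y\<^esub> ?f x" if a: "a \<in> carrier ext_alg" for a x
  proof -
    obtain b m c p q where [simp]: "a = (b, m, c)" "x = (p, q)" by (cases a; cases x) auto
    have b: "b \<in> carrier A" using a by simp
    have "a \<odot>\<^bsub>Y\<^esub> ?f x = G.sc q \<odot>\<^bsub>Y\<^esub> (a \<odot>\<^bsub>Y\<^esub> v) \<oplus>\<^bsub>Y\<^esub> G.sc p \<odot>\<^bsub>Y\<^esub> (a \<odot>\<^bsub>Y\<^esub> (ex \<odot>\<^bsub>Y\<^esub> v))"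
      using G.ract_add[OF Y a, of "G.sc q \<odot>\<^bsub>Y\<^esub> v" "G.sc p \<odot>\<^bsub>Y\<^esub> (ex \<odot>\<^bsub>Y\<^esub> v)"] Y w assms(2)
        G.sc_act_simps(3)[OF Y assms(2) a] G.sc_act_simps(3)[OF Y w a] by simp
    also have "\<dots> = G.sc q \<odot>\<^bsub>Y\<^esub> (G.sc c \<odot>\<^bsub>Y\<^esub> v \<oplus>\<^bsub>Y\<^esub> G.sc m \<odot>\<^bsub>Y\<^esub> (ex \<odot>\<^bsub>Y\<^esub> v)) \<oplus>\<^bsub>Y\<^esub>
        G.sc p \<odot>\<^bsub>Y\<^esub> (G.sc (\<chi> b) \<odot>\<^bsub>Y\<^esub> (ex \<odot>\<^bsub>Y\<^esub> v))"
      using G_act_ea[OF Y assms(2,3) b, of m c] by simp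
    also have "\<dots> = ?f (a \<odot>\<^bsub>PAm\<^esub> x)"
      using Y w assms(2) by (simp add: G.ract_add G.sc_act_simps(2) G.sc_act_simps(1) G.rmod_ac)
    finally show ?thesis by simp
  qed
qed

lemma PAm_homD:
  assumes "G.lin PAm Y f" "G.rmod Y"
  shows "f (p, q) = G.sc q \<odot>\<^bsub>Y\<^esub> f (0, 1) \<oplus>\<^bsub>Y\<^esub> G.sc p \<odot>\<^bsub>Y\<^esub> (ex \<odot>\<^bsub>Y\<^esub> f (0, 1))"
    "ea \<odot>\<^bsub>Y\<^esub> f (0, 1) = f (0, 1)" "f (0, 1) \<in> carrier Y"
proof -
  have x: "ex \<odot>\<^bsub>Y\<^esub> f (0, 1) = f (1, 0)" using G.lin_act[OF assms(1), of ex "(0, 1)"] by simp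
  show "f (p, q) = G.sc q \<odot>\<^bsub>Y\<^esub> f (0, 1) \<oplus>\<^bsub>Y\<^esub> G.sc p \<odot>\<^bsub>Y\<^esub> (ex \<odot>\<^bsub>Y\<^esub> f (0, 1))"
    unfolding x using G.lin_act[OF assms(1), of "G.sc q" "(0, 1)"] G.lin_act[OF assms(1), of "G.sc p" "(1, 0)"]
      G.lin_add[OF assms(1), of "(0, q)" "(p, 0)"] by (simp add: G_sc)
  show "ea \<odot>\<^bsub>Y\<^esub> f (0, 1) = f (0, 1)" using G.lin_act[OF assms(1), of ea "(0, 1)"] by simp
  show "f (0, 1) \<in> carrier Y" using G.lin_closed[OF assms(1)] by simp
qed

text \<open>Lift the image of the generator (0, 1) to some m and replace m by m \<open>ea\<close>,
  so that \<open>PAm_hom\<close> applies.\<close>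

lemma lifts_PAm: "G.lifts PAm"
  unfolding G.lifts_def
proof (intro ballI allI impI)
  fix M N g f
  assume *: "M \<in> fg_modules ext_alg" "N \<in> fg_modules ext_alg" "G.lin M N g" "G.lin PAm N f"
    "carrier N \<subseteq> g ` carrier M"
  have rm: "G.rmod M" "G.rmod N" using * by auto
  note fD = PAm_homD[OF *(4) rm(2)]
  obtain m where m: "m \<in> carrier M" "g m = f (0, 1)" using *(5) fD(3) by force
  let ?m = "ea \<odot>\<^bsub>M\<^esub> m"
  have mc: "?m \<in> carrier M" using m rm by simp
  have gm: "g ?m = f (0, 1)" using G.lin_act[OF *(3), of ea m] m fD(2) by simp
  have "ex \<odot>\<^bsub>M\<^esub> ?m \<in> carrier M" using mc rm by simp
  then have "g (G.sc q \<odot>\<^bsub>M\<^esub> ?m \<oplus>\<^bsub>M\<^esub> G.sc p \<odot>\<^bsub>M\<^esub> (ex \<odot>\<^bsub>M\<^esub> ?m)) = f (p, q)" for p q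
    unfolding fD(1)[of p q] using mc rm gm G.lin_act[OF *(3), of ex ?m]
    by (simp add: G.lin_add[OF *(3)] G.lin_act[OF *(3), of "G.sc _"] del: ext_alg_simps(2))
  then show "\<exists>h. G.lin PAm M h \<and> (\<forall>x\<in>carrier PAm. g (h x) = f x)"
    using PAm_hom[OF rm(1) mc G_ex_ea(3)[OF rm(1) m(1)]] by (intro exI conjI) auto
qed

text \<open>Extend the coordinate of \<open>f\<close> at i to a linear functional l on
  \<open>L\<close>. A map into \<open>PAm\<close> is determined by its coordinate at i, which leads
  to the candidate sending y to (l(y e), l(y ex)).\<close>

lemma inj_PAm: "G.inj_mod PAm"
  unfolding G.inj_mod_def
proof (intro ballI allI impI)
  fix K L g f
  assume *: "K \<in> fg_modules ext_alg" "L \<in> fg_modules ext_alg" "G.lin K L g" "G.lin K PAm f"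
    "\<forall>x\<in>carrier K. g x = \<zero>\<^bsub>L\<^esub> \<longrightarrow> f x = \<zero>\<^bsub>PAm\<^esub>"
  have rm: "G.rmod K" "G.rmod L" using * by auto
  let ?E = "(e, 0, 0) :: 'a \<times> 'k \<times> 'k"
  have E: "?E \<in> carrier ext_alg" "ex \<in> carrier ext_alg" by auto
  have fst_add: "fst (x \<oplus>\<^bsub>PAm\<^esub> y) = fst x + fst y" for x y by (cases x; cases y) simp
  have fst_sc: "fst (G.sc c \<odot>\<^bsub>PAm\<^esub> x) = c * fst x" for c x by (cases x) (simp add: G_sc mult.commute)
  have "G.klin K (carrier K) (\<lambda>x. fst (f x))"
    unfolding G.klin_def using G.lin_add[OF *(4)] G.lin_act[OF *(4), of "G.sc _"] fst_add fst_sc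
    by (simp del: ext_alg_simps)
  then obtain l :: "_ \<Rightarrow> 'k" where l: "G.klin L (carrier L) l" "\<And>x. x \<in> carrier K \<Longrightarrow> l (g x) = fst (f x)"
    using G.klin_factor[OF rm(1) G.fg_fd[OF *(2)] *(3), of "\<lambda>x. fst (f x)"] *(5) by auto
  have la: "l (x \<oplus>\<^bsub>L\<^esub> y) = l x + l y" if "x \<in> carrier L" "y \<in> carrier L" for x y
    using l(1) that unfolding G.klin_def by blast
  have ls: "l (G.sc c \<odot>\<^bsub>L\<^esub> x) = c * l x" if "x \<in> carrier L" for x c
    using l(1) that unfolding G.klin_def by blast
  let ?h = "\<lambda>y. (l (?E \<odot>\<^bsub>L\<^esub> y), l (ex \<odot>\<^bsub>L\<^esub> y))"
  have "G.lin L PAm ?h"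
  proof (rule G.linI)
    show "?h (x \<oplus>\<^bsub>L\<^esub> y) = ?h x \<oplus>\<^bsub>PAm\<^esub> ?h y" if "x \<in> carrier L" "y \<in> carrier L" for x y
      using that rm E by (simp add: G.ract_add la)
    show "?h (a \<odot>\<^bsub>L\<^esub> y) = a \<odot>\<^bsub>PAm\<^esub> ?h y" if a: "a \<in> carrier ext_alg" and y: "y \<in> carrier L" for a y
    proof -
      obtain b m c where ab [simp]: "a = (b, m, c)" by (cases a)
      have b: "b \<in> carrier A" using a by simp
      note Gm = G_mult[OF rm(2) _ _ y]
      have "ex \<odot>\<^bsub>L\<^esub> (a \<odot>\<^bsub>L\<^esub> y) = (\<zero>\<^bsub>A\<^esub>, c, 0) \<odot>\<^bsub>L\<^esub> y" using Gm[OF b R.zero_closed, of 1 0 m c] b by simp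
      also have "\<dots> = G.sc c \<odot>\<^bsub>L\<^esub> (ex \<odot>\<^bsub>L\<^esub> y)" using Gm[OF R.zero_closed, of "sc c" 0 c 1 0] by (simp add: G_sc)
      finally have 1: "ex \<odot>\<^bsub>L\<^esub> (a \<odot>\<^bsub>L\<^esub> y) = G.sc c \<odot>\<^bsub>L\<^esub> (ex \<odot>\<^bsub>L\<^esub> y)" .
      have be: "b \<otimes>\<^bsub>A\<^esub> e = e \<otimes>\<^bsub>A\<^esub> sc (\<chi> b)"
        using mult_e[OF b] scalar_central[OF e_closed] by (simp add: sc_def)
      \<comment> \<open>In \<Gamma> the product of (b, m, c) with (e, 0, 0) is (\<chi>(b) e, m, 0).
        Its two parts match the two contributions to the coordinate of \<open>PAm\<close> at
        i.\<close>
      have "?E \<odot>\<^bsub>L\<^esub> (a \<odot>\<^bsub>L\<^esub> y) = (e \<otimes>\<^bsub>A\<^esub> sc (\<chi> b), m, 0) \<odot>\<^bsub>L\<^esub> y"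
        using Gm[OF b e_closed, of 0 0 m c] b by (simp add: be)
      also have "\<dots> = (e \<otimes>\<^bsub>A\<^esub> sc (\<chi> b), 0, 0) \<odot>\<^bsub>L\<^esub> y \<oplus>\<^bsub>L\<^esub> (\<zero>\<^bsub>A\<^esub>, m, 0) \<odot>\<^bsub>L\<^esub> y"
        using G_add[OF rm(2) _ R.zero_closed y, of "e \<otimes>\<^bsub>A\<^esub> sc (\<chi> b)" 0 m 0 0] by simp
      also have "(e \<otimes>\<^bsub>A\<^esub> sc (\<chi> b), 0, 0) \<odot>\<^bsub>L\<^esub> y = G.sc (\<chi> b) \<odot>\<^bsub>L\<^esub> (?E \<odot>\<^bsub>L\<^esub> y)"
        using Gm[OF e_closed, of "sc (\<chi> b)" 0 "\<chi> b" 0 0] by (simp add: G_sc)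
      also have "(\<zero>\<^bsub>A\<^esub>, m, 0) \<odot>\<^bsub>L\<^esub> y = G.sc m \<odot>\<^bsub>L\<^esub> (ex \<odot>\<^bsub>L\<^esub> y)"
        using Gm[OF R.zero_closed, of "sc m" 0 m 1 0] by (simp add: G_sc)
      finally have 2: "?E \<odot>\<^bsub>L\<^esub> (a \<odot>\<^bsub>L\<^esub> y) = G.sc (\<chi> b) \<odot>\<^bsub>L\<^esub> (?E \<odot>\<^bsub>L\<^esub> y) \<oplus>\<^bsub>L\<^esub> G.sc m \<odot>\<^bsub>L\<^esub> (ex \<odot>\<^bsub>L\<^esub> y)" .
      have c: "?E \<odot>\<^bsub>L\<^esub> y \<in> carrier L" "ex \<odot>\<^bsub>L\<^esub> y \<in> carrier L" using rm y by auto
      show ?thesis unfolding 1 2 using c rm by (simp add: la ls mult.commute)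
    qed
  qed simp
  moreover have "?h (g x) = f x" if x: "x \<in> carrier K" for x
  proof -
    have "?h (g x) = (fst (?E \<odot>\<^bsub>PAm\<^esub> f x), fst (ex \<odot>\<^bsub>PAm\<^esub> f x))"
      using l(2)[of "?E \<odot>\<^bsub>K\<^esub> x"] l(2)[of "ex \<odot>\<^bsub>K\<^esub> x"] G.lin_act[OF *(3) E(1) x] G.lin_act[OF *(3) E(2) x]
        G.lin_act[OF *(4) E(1) x] G.lin_act[OF *(4) E(2) x] x rm E by simp
    then show ?thesis by (cases "f x") simp
  qed
  ultimately show "\<exists>h. G.lin L PAm h \<and> (\<forall>x\<in>carrier K. h (g x) = f x)" by blast
qed

definition PA where "PA = (SOME N. N \<in> fg_modules ext_alg \<and> mod_iso ext_alg PAm N)"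

lemma PA: "PA \<in> fg_modules ext_alg" "mod_iso ext_alg PAm PA"
proof -
  have "\<exists>N. N \<in> fg_modules ext_alg \<and> mod_iso ext_alg PAm N" using G.fd_transport[OF G_fd_PAm] by blast
  from someI_ex[OF this] show "PA \<in> fg_modules ext_alg" "mod_iso ext_alg PAm PA" by (auto simp: PA_def)
qed

lemma PA_rmod [simp]: "G.rmod PA" using PA(1) by simp

lemma PA_projective: "projective_module ext_alg PA"
  using G.lifts_iso[OF lifts_PAm PA(2) G_rmod_PAm PA_rmod] PA(1) by (simp add: G.projective_iff)

lemma PA_inj: "G.inj_mod PA"
  by (rule G.inj_mod_iso[OF inj_PAm PA(2) G_rmod_PAm PA_rmod])

lemma PA_ind: "indecomposable ext_alg PA"
proof (rule G.ind_brick_iso[OF PA G_rmod_PAm])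
  show "carrier PAm \<noteq> {\<zero>\<^bsub>PAm\<^esub>}" by (metis PAm_simps(1,2) UNIV_I prod.inject singletonD zero_neq_one)
  fix f assume f: "G.lin PAm PAm f"
  note fD = PAm_homD[OF f G_rmod_PAm]
  obtain s t where st: "f (0, 1) = (s, t)" by (cases "f (0, 1)")
  \<comment> \<open>The image of the generator is fixed by \<open>ea\<close>, and \<open>ea\<close>
    annihilates the coordinate at i.\<close>
  have "s = 0" using fD(2) by (simp add: st)
  then have "f (p, q) = G.sc t \<odot>\<^bsub>PAm\<^esub> (p, q)" for p q
    unfolding fD(1)[of p q] by (simp add: st G_sc mult.commute)
  then show "\<exists>c. \<forall>x\<in>carrier PAm. f x = G.sc c \<odot>\<^bsub>PAm\<^esub> x" by auto
qed

section \<open>Splitting P_a and S_a off a \<Gamma>-module\<close>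

abbreviation "SA \<equiv> G.Sm"

lemma G_orth_trivial:
  assumes "M \<in> fg_modules ext_alg"
  shows "G.orth PA M" "G.orth M PA" "G.orth M SA"
  using G.orth_projective[OF PA_projective assms] G.orth_injective[OF assms PA(1) PA_inj]
    G.orth_injective[OF assms G.Sm(1) G.Sm_inj] by auto

text \<open>The image of the generator of P_a is fixed by \<open>ea\<close>, and 0 is the only such
  element of \<open>Y\<close>.\<close>

lemma no_hom_PA:
  assumes "G.rmod Y" "lambda_mod Y" shows "G.no_hom PA Y"
proof (rule G.no_hom_iso1[OF _ PA(2) G_rmod_PAm])
  show "G.no_hom PAm Y"
    unfolding G.no_hom_def
  proof (intro allI impI ballI)
    fix f and x :: "'k \<times> 'k" assume f: "G.lin PAm Y f"
    note fD = PAm_homD[OF f assms(1)]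
    have "f (0, 1) = \<zero>\<^bsub>Y\<^esub>" using fD(2,3) assms(2) by (simp add: lambda_mod_def)
    then show "f x = \<zero>\<^bsub>Y\<^esub>" using fD(1)[of "fst x" "snd x"] assms(1) by simp
  qed
qed

text \<open>The hypothesis says that S_a does not embed in \<open>Y\<close>: an element at the
  vertex a that is killed by the new arrow would span a copy of it.\<close>

lemma no_hom_SA:
  assumes "G.rmod Y" "\<And>y. y \<in> carrier Y \<Longrightarrow> ea \<odot>\<^bsub>Y\<^esub> y = y \<Longrightarrow> ex \<odot>\<^bsub>Y\<^esub> y = \<zero>\<^bsub>Y\<^esub> \<Longrightarrow> y = \<zero>\<^bsub>Y\<^esub>"
  shows "G.no_hom SA Y"
proof (rule G.no_hom_iso1[OF _ G.Sm(2)])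
  show "G.no_hom G.charmod Y"
    unfolding G.no_hom_def
  proof (intro allI impI ballI)
    fix f and x :: 'k assume f: "G.lin G.charmod Y f"
    have "ea \<odot>\<^bsub>Y\<^esub> f x = f x" "ex \<odot>\<^bsub>Y\<^esub> f x = f 0"
      using G.lin_act[OF f, of ea x] G.lin_act[OF f, of ex x] by simp_all
    moreover have "f 0 = \<zero>\<^bsub>Y\<^esub>" using G.lin_zero[OF f] assms(1) by simp
    ultimately show "f x = \<zero>\<^bsub>Y\<^esub>" using assms(2) G.lin_closed[OF f, of x] by simp
  qed
qed simp

lemma no_hom_SA_lambda: "G.rmod Y \<Longrightarrow> lambda_mod Y \<Longrightarrow> G.no_hom SA Y"
  by (rule no_hom_SA) (auto simp: lambda_mod_def)

text \<open>In \<open>PAm\<close> the new arrow maps the coordinate at a injectively to the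
  coordinate at i.\<close>

lemma no_hom_SA_PA: "G.no_hom SA PA"
proof -
  obtain i j where ij: "G.lin PAm PA i" "G.lin PA PAm j" "\<And>x. x \<in> carrier PAm \<Longrightarrow> j (i x) = x"
    "\<And>y. y \<in> carrier PA \<Longrightarrow> i (j y) = y"
    using G.mod_isoE[OF PA(2) G_rmod_PAm] by metis
  have "G.no_hom SA PAm" by (rule no_hom_SA[OF G_rmod_PAm]) auto
  moreover have "inj_on j (carrier PA)" by (metis ij(4) inj_onI)
  ultimately show ?thesis using G.no_hom_sub[OF _ ij(2)] G_rmod_PAm by simp
qed

text \<open>The map from P_a that sends its generator to y \<open>ea\<close> is injective, because
  it does not kill the coordinate at i: that is spanned by a vector with image y \<open>ex\<close>.
  Its image splits off since P_a is injective.\<close>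

lemma PA_split:
  assumes "Y \<in> fg_modules ext_alg" "y \<in> carrier Y" "ex \<odot>\<^bsub>Y\<^esub> y \<noteq> \<zero>\<^bsub>Y\<^esub>"
  obtains Y' where "Y' \<in> fg_modules ext_alg" "G.biprod Y Y' PA"
proof -
  have Y: "G.rmod Y" using assms by simp
  let ?v = "ea \<odot>\<^bsub>Y\<^esub> y"
  have v: "?v \<in> carrier Y" "ea \<odot>\<^bsub>Y\<^esub> ?v = ?v" "ex \<odot>\<^bsub>Y\<^esub> ?v = ex \<odot>\<^bsub>Y\<^esub> y"
    using assms(2) Y G_ex_ea[OF Y assms(2)] by auto
  let ?w = "ex \<odot>\<^bsub>Y\<^esub> y"
  have w: "?w \<in> carrier Y" using assms(2) Y by simp
  define f where "f z = G.sc (snd z) \<odot>\<^bsub>Y\<^esub> ?v \<oplus>\<^bsub>Y\<^esub> G.sc (fst z) \<odot>\<^bsub>Y\<^esub> ?w" for z :: "'k \<times> 'k"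
  have f: "G.lin PAm Y f" using PAm_hom[OF Y v(1,2)] unfolding f_def v(3) .
  have sc0: "c = 0" if "G.sc c \<odot>\<^bsub>Y\<^esub> u = \<zero>\<^bsub>Y\<^esub>" "u \<in> carrier Y" "u \<noteq> \<zero>\<^bsub>Y\<^esub>" for c u
  proof (rule ccontr)
    assume "c \<noteq> 0"
    then have "u = G.sc (inverse c) \<odot>\<^bsub>Y\<^esub> (G.sc c \<odot>\<^bsub>Y\<^esub> u)" using that(2) Y by (simp add: G.sc_act_simps(2) del: ext_alg_simps)
    then show False using that Y by simp
  qed
  have "z = (0, 0)" if z: "f z = \<zero>\<^bsub>Y\<^esub>" for z
  proof -
    have "ea \<odot>\<^bsub>Y\<^esub> f z = G.sc (snd z) \<odot>\<^bsub>Y\<^esub> (ea \<odot>\<^bsub>Y\<^esub> ?v) \<oplus>\<^bsub>Y\<^esub> G.sc (fst z) \<odot>\<^bsub>Y\<^esub> (ea \<odot>\<^bsub>Y\<^esub> ?w)"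
      unfolding f_def using v(1) w Y G.sc_act_simps(3)[OF Y v(1), of ea] G.sc_act_simps(3)[OF Y w, of ea]
        G.ract_add[OF Y, of ea] by simp
    also have "\<dots> = G.sc (snd z) \<odot>\<^bsub>Y\<^esub> ?v"
      unfolding v(2) G_ex_ea(2)[OF Y assms(2)] using v(1) Y by simp
    finally have "G.sc (snd z) \<odot>\<^bsub>Y\<^esub> ?v = \<zero>\<^bsub>Y\<^esub>" using z Y by simp
    moreover have "?v \<noteq> \<zero>\<^bsub>Y\<^esub>" using v(3) assms(3) Y by auto
    ultimately have q: "snd z = 0" using sc0 v(1) by blast
    then have "G.sc (fst z) \<odot>\<^bsub>Y\<^esub> ?w = \<zero>\<^bsub>Y\<^esub>" using z v(1) w Y unfolding f_def by (simp add: G_zero)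
    then have "fst z = 0" using sc0 w assms(3) by blast
    then show ?thesis using q by (simp add: prod_eq_iff)
  qed
  then have fi: "inj_on f (carrier PAm)" using G.lin_inj_iff[OF G_rmod_PAm Y f] by simp
  obtain i j where ij: "G.lin PA PAm j" "\<And>y. y \<in> carrier PA \<Longrightarrow> i (j y) = y"
    using G.mod_isoE[OF PA(2) G_rmod_PAm] by metis
  have "inj_on (\<lambda>y. f (j y)) (carrier PA)"
  proof (rule inj_onI)
    fix u v assume "u \<in> carrier PA" "v \<in> carrier PA" "f (j u) = f (j v)"
    moreover from inj_onD[OF fi this(3)] have "j u = j v" by simp
    ultimately show "u = v" using ij(2) by metis
  qed
  then show thesis using G.inj_split[OF PA_inj PA(1) assms(1) G.lin_comp[OF ij(1) f]] that by blast
qed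

text \<open>If the new arrow acts as zero, every nonzero element at the vertex a spans a copy of
  S_a. Together with \<open>PA_split\<close>: a \<Gamma>-module either vanishes at a or has P_a or
  S_a as a summand.\<close>

lemma SA_split:
  assumes "Y \<in> fg_modules ext_alg" "\<And>y. y \<in> carrier Y \<Longrightarrow> ex \<odot>\<^bsub>Y\<^esub> y = \<zero>\<^bsub>Y\<^esub>" "\<not> lambda_mod Y"
  obtains Y' where "Y' \<in> fg_modules ext_alg" "G.biprod Y Y' SA"
proof -
  have Y: "G.rmod Y" using assms by simp
  obtain y where y: "y \<in> carrier Y" "ea \<odot>\<^bsub>Y\<^esub> y \<noteq> \<zero>\<^bsub>Y\<^esub>" using assms(3) by (auto simp: lambda_mod_def)
  let ?v = "ea \<odot>\<^bsub>Y\<^esub> y"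
  have v: "?v \<in> carrier Y" "ea \<odot>\<^bsub>Y\<^esub> ?v = ?v" using y Y G_ex_ea[OF Y y(1)] by auto
  have act: "(b, m, c) \<odot>\<^bsub>Y\<^esub> ?v = G.sc c \<odot>\<^bsub>Y\<^esub> ?v" if "b \<in> carrier A" for b m c
    unfolding G_act_ea(1)[OF Y v that] assms(2)[OF v(1)] using v(1) Y by simp
  have f: "G.lin G.charmod Y (\<lambda>c. G.sc c \<odot>\<^bsub>Y\<^esub> ?v)"
  proof (rule G.charmod_hom[OF Y v(1)])
    fix a :: "'a \<times> 'k \<times> 'k" assume "a \<in> carrier ext_alg"
    then show "a \<odot>\<^bsub>Y\<^esub> ?v = G.sc (case a of (a, m, c) \<Rightarrow> c) \<odot>\<^bsub>Y\<^esub> ?v"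
      using act[of "fst a" "fst (snd a)" "snd (snd a)"] by (cases a) (simp only: ext_alg_simps(1) fst_conv snd_conv split)
  qed
  obtain i j where ij: "G.lin G.charmod SA i" "G.lin SA G.charmod j" "\<And>x. x \<in> carrier G.charmod \<Longrightarrow> j (i x) = x"
    using G.mod_isoE[OF G.Sm(2) G.rmod_charmod] by metis
  have "\<not> G.no_hom SA Y"
  proof
    assume "G.no_hom SA Y"
    from G.no_homD[OF this G.lin_comp[OF ij(2) f] G.lin_closed[OF ij(1), of 1]]
    have "G.sc 1 \<odot>\<^bsub>Y\<^esub> ?v = \<zero>\<^bsub>Y\<^esub>" using ij(3)[of 1] by simp
    then show False using y(2) v(1) Y by (simp add: G_sc G_one)
  qed
  then show thesis using G.Sm_split[OF assms(1)] that by blast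
qed

text \<open>Prolonging a resolution \<open>P\<close> of \<open>S\<^sub>i\<close> by \<open>0 \<rightarrow> S\<^sub>i \<rightarrow> P\<^sub>a \<rightarrow> S\<^sub>a \<rightarrow> 0\<close>
  gives a resolution of \<open>S\<^sub>a\<close>.\<close>

lemma SA_orth:
  assumes Y: "Y \<in> fg_modules A"
  shows "G.orth SA (infl Y) \<longleftrightarrow> no_hom Sm Y \<and> orth Sm Y"
proof -
  have rY: "rmod Y" using Y by simp
  obtain P d \<epsilon> where r: "res Sm P d \<epsilon>" using res_exists Sm(1) by metis
  note r1 = resD[OF r]
  obtain \<sigma> \<sigma>' where \<sigma>: "lin charmod Sm \<sigma>" "lin Sm charmod \<sigma>'" "\<And>x. x \<in> carrier charmod \<Longrightarrow> \<sigma>' (\<sigma> x) = x"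
    "\<And>y. y \<in> carrier Sm \<Longrightarrow> \<sigma> (\<sigma>' y) = y"
    using mod_isoE[OF Sm(2) rmod_charmod] by metis
  obtain \<tau> \<tau>' where \<tau>: "G.lin G.charmod SA \<tau>" "G.lin SA G.charmod \<tau>'"
    "\<And>x. x \<in> carrier G.charmod \<Longrightarrow> \<tau>' (\<tau> x) = x" "\<And>y. y \<in> carrier SA \<Longrightarrow> \<tau> (\<tau>' y) = y"
    using G.mod_isoE[OF G.Sm(2) G.rmod_charmod] by metis
  obtain \<pi> \<pi>' where \<pi>: "G.lin PAm PA \<pi>" "G.lin PA PAm \<pi>'" "\<And>x. x \<in> carrier PAm \<Longrightarrow> \<pi>' (\<pi> x) = x"
    "\<And>y. y \<in> carrier PA \<Longrightarrow> \<pi> (\<pi>' y) = y"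
    using G.mod_isoE[OF PA(2) G_rmod_PAm] by metis
  define R where "R = case_nat PA (\<lambda>n. infl (P n))"
  \<comment> \<open>The first coordinate of \<open>PAm\<close> is the copy of S_i in P_a, the second
    its quotient S_a; \<open>D 0\<close> covers the former and \<open>E\<close> projects onto the
    latter.\<close>
  define D where "D = case_nat (\<lambda>x. \<pi> (\<sigma>' (\<epsilon> x), 0)) d"
  define E where "E = (\<lambda>z. \<tau> (snd (\<pi>' z)))"
  have RD: "R 0 = PA" "R (Suc n) = infl (P n)" "D 0 = (\<lambda>x. \<pi> (\<sigma>' (\<epsilon> x), 0))" "D (Suc n) = d n" for n
    by (auto simp: R_def D_def)
  have \<tau>0: "\<tau> 0 = \<zero>\<^bsub>SA\<^esub>" using G.lin_zero[OF \<tau>(1)] by simp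
  have \<pi>0: "\<pi> (0, 0) = \<zero>\<^bsub>PA\<^esub>" using G.lin_zero[OF \<pi>(1)] G_rmod_PAm by simp
  have \<sigma>0: "\<sigma> 0 = \<zero>\<^bsub>Sm\<^esub>" "\<sigma>' \<zero>\<^bsub>Sm\<^esub> = 0" using lin_zero[OF \<sigma>(1)] lin_zero[OF \<sigma>(2)] by simp_all
  have in1: "G.lin (infl charmod) PAm (\<lambda>x. (x, 0))" by (rule G.linI) auto
  have l0: "G.lin (infl (P 0)) PA (\<lambda>x. \<pi> (\<sigma>' (\<epsilon> x), 0))"
    using G.lin_comp[OF G.lin_comp[OF _ in1] \<pi>(1)] lin_comp[OF r1(2) \<sigma>(2)] G_lin_infl by blast
  have out: "G.lin PAm G.charmod snd" by (rule G.linI) auto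
  have lE: "G.lin PA SA E" unfolding E_def by (rule G.lin_comp[OF G.lin_comp[OF \<pi>(2) out] \<tau>(1)])
  have k0: "\<pi> (\<sigma>' (\<epsilon> x), 0) = \<zero>\<^bsub>PA\<^esub> \<longleftrightarrow> \<epsilon> x = \<zero>\<^bsub>Sm\<^esub>" if x: "x \<in> carrier (P 0)" for x
  proof
    assume "\<pi> (\<sigma>' (\<epsilon> x), 0) = \<zero>\<^bsub>PA\<^esub>"
    then have "\<pi>' (\<pi> (\<sigma>' (\<epsilon> x), 0)) = \<pi>' (\<pi> (0, 0))" using \<pi>0 by simp
    then have "\<sigma>' (\<epsilon> x) = 0" using \<pi>(3) by simp
    then show "\<epsilon> x = \<zero>\<^bsub>Sm\<^esub>" using \<sigma>(4)[OF lin_closed[OF r1(2) x]] \<sigma>0 by simp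
  qed (simp add: \<sigma>0 \<pi>0)
  have kE: "E z = \<zero>\<^bsub>SA\<^esub> \<longleftrightarrow> z \<in> (\<lambda>x. \<pi> (\<sigma>' (\<epsilon> x), 0)) ` carrier (P 0)" if z: "z \<in> carrier PA" for z
  proof
    assume "E z = \<zero>\<^bsub>SA\<^esub>"
    then have "\<tau>' (\<tau> (snd (\<pi>' z))) = \<tau>' (\<tau> 0)" using \<tau>0 by (simp add: E_def)
    then have q: "snd (\<pi>' z) = 0" using \<tau>(3) by simp
    obtain x where x: "x \<in> carrier (P 0)" "\<epsilon> x = \<sigma> (fst (\<pi>' z))"
      using r1(3) lin_closed[OF \<sigma>(1), of "fst (\<pi>' z)"] by force
    have "(\<sigma>' (\<epsilon> x), 0) = \<pi>' z" using x \<sigma>(3) q by (simp add: prod_eq_iff)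
    then have "\<pi> (\<sigma>' (\<epsilon> x), 0) = z" using \<pi>(4)[OF z] by simp
    then show "z \<in> (\<lambda>x. \<pi> (\<sigma>' (\<epsilon> x), 0)) ` carrier (P 0)" using x(1) by blast
  next
    assume "z \<in> (\<lambda>x. \<pi> (\<sigma>' (\<epsilon> x), 0)) ` carrier (P 0)"
    then show "E z = \<zero>\<^bsub>SA\<^esub>" using \<pi>(3) \<tau>0 by (auto simp: E_def)
  qed
  have surjE: "carrier SA \<subseteq> E ` carrier PA"
  proof
    fix y assume y: "y \<in> carrier SA"
    have "E (\<pi> (0, \<tau>' y)) = y" using \<pi>(3) \<tau>(4)[OF y] by (simp add: E_def)
    moreover have "\<pi> (0, \<tau>' y) \<in> carrier PA" using G.lin_closed[OF \<pi>(1)] by simp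
    ultimately show "y \<in> E ` carrier PA" by force
  qed
  have rR: "G.res SA R D E"
    unfolding G.res_def
  proof (intro conjI allI ballI)
    fix n
    show "projective_module ext_alg (R n)"
      using PA_projective infl_projective[OF r1(1)] by (cases n) (simp_all add: RD)
    show "G.lin (R (Suc n)) (R n) (D n)"
      using l0 r1(4) by (cases n) (simp_all add: RD G_lin_infl)
    fix x assume x: "x \<in> carrier (R (Suc n))"
    show "D n x = \<zero>\<^bsub>R n\<^esub> \<longleftrightarrow> x \<in> D (Suc n) ` carrier (R (Suc (Suc n)))"
    proof (cases n)
      case 0
      have xP: "x \<in> carrier (P 0)" using x 0 by (simp add: RD)
      have "D n x = \<zero>\<^bsub>R n\<^esub> \<longleftrightarrow> \<epsilon> x = \<zero>\<^bsub>Sm\<^esub>" using k0[OF xP] 0 by (simp add: RD)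
      then show ?thesis using r1(5)[OF xP] 0 by (simp add: RD)
    next
      case (Suc m)
      have xP: "x \<in> carrier (P (Suc m))" using x Suc by (simp add: RD)
      show ?thesis using r1(6)[OF xP] Suc by (simp add: RD)
    qed
  next
    fix x assume "x \<in> carrier (R 0)"
    then show "E x = \<zero>\<^bsub>SA\<^esub> \<longleftrightarrow> x \<in> D 0 ` carrier (R (Suc 0))" using kE by (simp add: RD)
  qed (use lE surjE in \<open>simp_all add: RD\<close>)
  \<comment> \<open>\<open>R\<close> is \<open>P\<close> shifted by one degree: Ext^(n+2)(S_a, Y)
    vanishes exactly when Ext^(n+1)(S_i, Y) does.\<close>
  have vS: "G.van R D (infl Y) (Suc n) \<longleftrightarrow> van P d Y n" for n
    unfolding G.van_def van_def by (simp add: RD G_lin_infl)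
  \<comment> \<open>Here Ext^1(S_a, Y) is at issue. Cocycles are maps on P 0 that factor through
    S_i, and the only coboundary is zero because Hom(P_a, Y) = 0.\<close>
  have v0: "G.van R D (infl Y) 0 \<longleftrightarrow> no_hom Sm Y"
  proof
    assume v: "G.van R D (infl Y) 0"
    show "no_hom Sm Y"
      unfolding no_hom_def
    proof (intro allI impI ballI)
      fix u s assume u: "lin Sm Y u" and s: "s \<in> carrier Sm"
      have ue: "lin (P 0) Y (\<lambda>x. u (\<epsilon> x))" by (rule lin_comp[OF r1(2) u])
      obtain g where g: "G.lin PA (infl Y) g" "\<And>x. x \<in> carrier (P 0) \<Longrightarrow> u (\<epsilon> x) = g (D 0 x)"
        using G.vanD[OF v, of "\<lambda>x. u (\<epsilon> x)"] ue r1(9) lin_zero[OF u Sm_rmod rY] by (auto simp: RD G_lin_infl)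
      have gz: "g z = \<zero>\<^bsub>Y\<^esub>" if "z \<in> carrier PA" for z
        using G.no_homD[OF no_hom_PA[OF G_rmod_infl[OF rY] lambda_mod_infl[OF rY]] g(1) that] by simp
      obtain x where x: "x \<in> carrier (P 0)" "s = \<epsilon> x" using r1(3) s by auto
      have "D 0 x \<in> carrier PA" using G.lin_closed[OF l0] x by (simp add: RD)
      then show "u s = \<zero>\<^bsub>Y\<^esub>" using g(2)[OF x(1)] gz x by simp
    qed
  next
    assume nh: "no_hom Sm Y"
    show "G.van R D (infl Y) 0"
      unfolding G.van_def
    proof (intro allI impI)
      fix f assume f: "G.lin (R (Suc 0)) (infl Y) f"
        "\<forall>x\<in>carrier (R (Suc (Suc 0))). f (D (Suc 0) x) = \<zero>\<^bsub>infl Y\<^esub>"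
      have f': "lin (P 0) Y f" using f(1) by (simp add: RD G_lin_infl)
      have "f x = \<zero>\<^bsub>Y\<^esub>" if "x \<in> carrier (P 0)" "\<epsilon> x = \<zero>\<^bsub>Sm\<^esub>" for x
        using that f(2) r1(5) by (auto simp: RD)
      then obtain u where u: "lin Sm Y u" "\<And>x. x \<in> carrier (P 0) \<Longrightarrow> u (\<epsilon> x) = f x"
        using lin_factor[OF r1(8) Sm_rmod rY r1(2,3) f'] by metis
      have "f x = \<zero>\<^bsub>Y\<^esub>" if "x \<in> carrier (P 0)" for x
        using u(2)[OF that] no_homD[OF nh u(1) lin_closed[OF r1(2) that]] by simp
      then show "\<exists>g. G.lin (R 0) (infl Y) g \<and> (\<forall>x\<in>carrier (R (Suc 0)). f x = g (D 0 x))"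
        using G.lin_const_zero[OF G_rmod_infl[OF rY], of "R 0"]
        by (intro exI[of _ "\<lambda>_. \<zero>\<^bsub>Y\<^esub>"]) (simp add: RD)
    qed
  qed
  have "G.orth SA (infl Y) \<longleftrightarrow> (\<forall>n. G.van R D (infl Y) n)"
    by (rule G.orth_res[OF G.Sm(1) infl_fg[OF Y] rR])
  also have "\<dots> \<longleftrightarrow> G.van R D (infl Y) 0 \<and> (\<forall>n. G.van R D (infl Y) (Suc n))"
    by (metis nat.exhaust)
  also have "\<dots> \<longleftrightarrow> no_hom Sm Y \<and> orth Sm Y"
    unfolding vS v0 using orth_res[OF Sm(1) Y r] by simp
  finally show ?thesis .
qed

section \<open>Generation and the PWT condition over the extension\<close>

lemma gen_PA_SA: "G.gen PA SA"
proof -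
  obtain \<tau> \<tau>' where \<tau>: "G.lin G.charmod SA \<tau>" "G.lin SA G.charmod \<tau>'"
    "\<And>y. y \<in> carrier SA \<Longrightarrow> \<tau> (\<tau>' y) = y"
    using G.mod_isoE[OF G.Sm(2) G.rmod_charmod] by metis
  obtain \<pi> \<pi>' where \<pi>: "G.lin PAm PA \<pi>" "G.lin PA PAm \<pi>'" "\<And>x. x \<in> carrier PAm \<Longrightarrow> \<pi>' (\<pi> x) = x"
    using G.mod_isoE[OF PA(2) G_rmod_PAm] by metis
  have out: "G.lin PAm G.charmod snd" by (rule G.linI) auto
  show ?thesis
  proof (rule G.gen_surj[OF G.Sm_rmod G.lin_comp[OF G.lin_comp[OF \<pi>(2) out] \<tau>(1)]], rule subsetI)
    fix y assume y: "y \<in> carrier SA"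
    have "\<tau> (snd (\<pi>' (\<pi> (0, \<tau>' y)))) = y" using \<pi>(3) \<tau>(3)[OF y] by simp
    moreover have "\<pi> (0, \<tau>' y) \<in> carrier PA" using G.lin_closed[OF \<pi>(1)] by simp
    ultimately show "y \<in> (\<lambda>x. \<tau> (snd (\<pi>' x))) ` carrier PA" by force
  qed
qed

lemma PA_nonzero: obtains x where "x \<in> carrier PA" "x \<noteq> \<zero>\<^bsub>PA\<^esub>"
  using PA_ind G.nonzeroE[OF PA_rmod] unfolding indecomposable_def by metis

lemma lambda_mod_infl_rep:
  assumes "Y \<in> fg_modules ext_alg" "lambda_mod Y"
  obtains X where "X \<in> fg_modules A" "mod_iso ext_alg Y (infl X)" "mod_iso ext_alg (infl X) Y"
  using lambda_mod_iso[of Y] restr_fg[OF assms(1)] assms G.mod_iso_sym[of Y "infl (restr Y)"]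
  by (metis G.fg_rmod G_rmod_infl fg_rmod)

text \<open>Induction on the dimension of \<open>Y\<close>. Unless \<open>Y\<close> comes from
  \<Lambda>, one of \<open>PA_split\<close> and \<open>SA_split\<close> removes a nonzero summand,
  which \<open>T\<close> generates because it generates P_a; the smaller complement is still
  orthogonal to \<open>T\<close>.\<close>

lemma G_gen_all:
  assumes T: "T \<in> fg_modules ext_alg" "G.gen T PA"
    and infl: "\<And>X. X \<in> fg_modules A \<Longrightarrow> G.orth T (infl X) \<Longrightarrow> G.gen T (infl X)"
    and Y: "Y \<in> fg_modules ext_alg" "G.orth T Y"
  shows "G.gen T Y"
  using Y
proof (induction "G.kdim Y" arbitrary: Y rule: less_induct)
  case less
  have rT: "G.rmod T" and rY: "G.rmod Y" using T less by auto
  have SA: "G.gen T SA" by (rule G.gen_trans[OF rT PA_rmod G.Sm_rmod T(2) gen_PA_SA])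
  have split: "G.gen T Y" if J: "J \<in> fg_modules ext_alg" "G.gen T J" "x \<in> carrier J" "x \<noteq> \<zero>\<^bsub>J\<^esub>"
    and Y': "Y' \<in> fg_modules ext_alg" "G.biprod Y Y' J" for J Y' x
  proof -
    have rm: "G.rmod J" "G.rmod Y'" using that by auto
    have "G.orth T Y'" using G.orth_biprod2[OF T(1) less(2) Y'(1) J(1) Y'(2)] less by simp
    moreover have "G.kdim Y' < G.kdim Y"
      by (rule G.biprod_nonzero_less[OF less(2) Y'(2) rm(2,1) J(3,4)])
    ultimately have "G.gen T Y'" using less(1) Y'(1) by blast
    then show ?thesis using G.gen_biprod[OF rY rm(2,1) Y'(2) _ J(2)] by blast
  qed
  show ?case
  proof (cases "lambda_mod Y")
    case True
    obtain X where X: "X \<in> fg_modules A" "mod_iso ext_alg Y (infl X)" "mod_iso ext_alg (infl X) Y"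
      using lambda_mod_infl_rep[OF less(2) True] by metis
    have rX: "G.rmod (infl X)" using X by (simp add: G_rmod_infl)
    have "G.gen T (infl X)" using infl[OF X(1)] G.orth_iso2[OF X(2) T(1) less(2) infl_fg[OF X(1)]] less by simp
    then show ?thesis using G.gen_trans[OF rT rX rY _ G.gen_iso[OF X(3) rX rY]] by blast
  next
    case False
    show ?thesis
    proof (cases "\<exists>y\<in>carrier Y. ex \<odot>\<^bsub>Y\<^esub> y \<noteq> \<zero>\<^bsub>Y\<^esub>")
      case True
      then obtain Y' where "Y' \<in> fg_modules ext_alg" "G.biprod Y Y' PA" using PA_split[OF less(2)] by metis
      then show ?thesis using split[OF PA(1) T(2)] PA_nonzero by metis
    next
      case no: False
      then obtain Y' where "Y' \<in> fg_modules ext_alg" "G.biprod Y Y' SA" using SA_split[OF less(2) _ False] by metis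
      then show ?thesis using split[OF G.Sm(1) SA] G.Sm_nonzero by metis
    qed
  qed
qed

lemma G_gen_infl:
  assumes "rmod X" "rmod Y" shows "G.gen (infl X) (infl Y) \<longleftrightarrow> gen X Y"
proof -
  have s: "submodule H ext_alg (infl Y) \<longleftrightarrow> submodule H A Y" for H
  proof
    assume *: "submodule H ext_alg (infl Y)"
    show "submodule H A Y" unfolding submodule_iff[OF assms(2)]
    proof (intro conjI ballI)
      show "a \<odot>\<^bsub>Y\<^esub> x \<in> H" if "a \<in> carrier A" "x \<in> H" for a x
        using G.submoduleD(4)[OF * G_rmod_infl[OF assms(2)], of "(a, 0, 0)" x] that by simp
    qed (use * G.submodule_iff[OF G_rmod_infl[OF assms(2)], of H] in simp_all)
  next
    assume *: "submodule H A Y"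
    show "submodule H ext_alg (infl Y)" unfolding G.submodule_iff[OF G_rmod_infl[OF assms(2)]]
    proof (intro conjI ballI)
      show "a \<odot>\<^bsub>infl Y\<^esub> x \<in> H" if "a \<in> carrier ext_alg" "x \<in> H" for a x
        using submoduleD(4)[OF * assms(2), of "fst a" x] that by (cases a) simp
    qed (use * submodule_iff[OF assms(2), of H] in simp_all)
  qed
  show ?thesis unfolding gen_def G.gen_def by (simp add: s G_lin_infl)
qed

text \<open>P_a is projective and injective, so it affects no orthogonality relation; it has no
  nonzero maps to \<Lambda>-modules, so it does not help to generate them. Beyond \<Lambda>-modules,
  \<open>G_gen_all\<close> takes over.\<close>

lemma PWT_extend_PA:
  assumes X: "X \<in> fg_modules A" and T: "T \<in> fg_modules ext_alg" "G.biprod T (infl X) PA"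
  shows "PWT_module ext_alg T \<longleftrightarrow> PWT_module A X"
proof -
  have rm: "rmod X" "G.rmod T" "G.rmod (infl X)" using X T by (auto simp: G_rmod_infl)
  note iX = infl_fg[OF X]
  have orth_infl: "G.orth T (infl Y) \<longleftrightarrow> orth X Y" if "Y \<in> fg_modules A" for Y
    using G.orth_biprod1[OF T(1) iX PA(1) infl_fg[OF that] T(2)] G_orth_trivial infl_orth[OF X that] that by simp
  have self: "G.orth T T \<longleftrightarrow> orth X X"
    using G.orth_biprod2[OF T(1) T(1) iX PA(1) T(2)] G_orth_trivial(2)[OF T(1)] orth_infl[OF X] by simp
  have gX: "G.gen T (infl X)" "G.gen T PA" using G.gen_summand[OF rm(2,3) PA_rmod T(2)] .
  show ?thesis
  proof
    assume P: "PWT_module ext_alg T"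
    have "gen X Y" if Y: "Y \<in> fg_modules A" "orth X Y" for Y
    proof -
      have rY: "rmod Y" using Y by simp
      have "G.gen T (infl Y)" using P orth_infl[OF Y(1)] Y infl_fg[OF Y(1)] by (simp add: G.PWT_module_iff)
      then have "G.gen (infl X) (infl Y)"
        by (rule G.gen_drop_summand[OF rm(2,3) PA_rmod G_rmod_infl[OF rY] T(2)])
          (rule G.no_homD[OF no_hom_PA[OF G_rmod_infl[OF rY] lambda_mod_infl[OF rY]]])
      then show ?thesis using G_gen_infl[OF rm(1) rY] by simp
    qed
    then show "PWT_module A X" using P self X by (simp add: PWT_module_iff G.PWT_module_iff)
  next
    assume P: "PWT_module A X"
    have "G.gen T (infl Y)" if Y: "Y \<in> fg_modules A" "G.orth T (infl Y)" for Y
    proof -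
      have rY: "rmod Y" using Y by simp
      have "gen X Y" using P orth_infl[OF Y(1)] Y by (simp add: PWT_module_iff)
      then have "G.gen (infl X) (infl Y)" using G_gen_infl[OF rm(1) rY] by simp
      then show ?thesis using G.gen_trans[OF rm(2,3) G_rmod_infl[OF rY] gX(1)] by blast
    qed
    then have "G.gen T Y" if "Y \<in> fg_modules ext_alg" "G.orth T Y" for Y
      using G_gen_all[OF T(1) gX(2) _ that] by blast
    then show "PWT_module ext_alg T" using P self T by (simp add: PWT_module_iff G.PWT_module_iff)
  qed
qed

text \<open>By \<open>SA_orth\<close>, the \<Lambda>-modules in T^perp are those of N^perp that
  receive no nonzero map from S_i. Self-orthogonality of \<open>T\<close> requires this of
  \<open>M\<close> itself, which explains the second condition on the right.\<close>

lemma PWT_extend_PA_SA: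
  assumes M: "M \<in> fg_modules A" and N: "N \<in> fg_modules A" "biprod N M Sm"
    and U: "U \<in> fg_modules ext_alg" "G.biprod U PA SA"
    and T: "T \<in> fg_modules ext_alg" "G.biprod T (infl M) U"
  shows "PWT_module ext_alg T \<longleftrightarrow> PWT_module A N \<and> no_hom Sm M"
proof -
  have rm: "rmod M" "rmod N" "G.rmod T" "G.rmod U" "G.rmod (infl M)" using M N T U by (auto simp: G_rmod_infl)
  note iM = infl_fg[OF M]
  have orth_infl: "G.orth T (infl Y) \<longleftrightarrow> orth N Y \<and> no_hom Sm Y" if "Y \<in> fg_modules A" for Y
    using G.orth_biprod1[OF T(1) iM U(1) infl_fg[OF that] T(2)]
      G.orth_biprod1[OF U(1) PA(1) G.Sm(1) infl_fg[OF that] U(2)] G_orth_trivial(1)[OF infl_fg[OF that]]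
      infl_orth[OF M that] SA_orth[OF that] orth_biprod1[OF N(1) M Sm(1) that N(2)] by blast
  have oS: "orth Y Sm" if "Y \<in> fg_modules A" for Y by (rule orth_injective[OF that Sm(1) Sm_inj])
  have self: "G.orth T T \<longleftrightarrow> orth N N \<and> no_hom Sm M"
    using G.orth_biprod2[OF T(1) T(1) iM U(1) T(2)] G.orth_biprod2[OF T(1) U(1) PA(1) G.Sm(1) U(2)]
      G_orth_trivial(2,3)[OF T(1)] orth_infl[OF M] orth_biprod2[OF N(1) N(1) M Sm(1) N(2)] oS[OF N(1)] by blast
  have gM: "G.gen T (infl M)" "G.gen T U" using G.gen_summand[OF rm(3,5,4) T(2)] .
  have gU: "G.gen U PA" "G.gen U SA" using G.gen_summand[OF rm(4) PA_rmod G.Sm_rmod U(2)] .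
  have gPA: "G.gen T PA" by (rule G.gen_trans[OF rm(3,4) PA_rmod gM(2) gU(1)])
  have gN: "gen N M" "gen N Sm" using gen_summand[OF rm(2,1) Sm_rmod N(2)] .
  have nU: "G.no_hom U (infl Y)" if "rmod Y" for Y
    using G.no_hom_biprod1[OF U(2) no_hom_PA no_hom_SA_lambda] G_rmod_infl[OF that] lambda_mod_infl[OF that] by blast
  show ?thesis
  proof
    assume P: "PWT_module ext_alg T"
    have "gen N Y" if "Y \<in> fg_modules A" "orth N Y" for Y
      using that
    proof (induction "kdim Y" arbitrary: Y rule: less_induct)
      case less
      have rY: "rmod Y" using less by simp
      show ?case
      proof (cases "no_hom Sm Y")
        case True
        have "G.gen T (infl Y)"
          using P orth_infl[OF less(2)] less True infl_fg[OF less(2)] by (simp add: G.PWT_module_iff)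
        then have "G.gen (infl M) (infl Y)"
          by (rule G.gen_drop_summand[OF rm(3,5,4) G_rmod_infl[OF rY] T(2)]) (rule G.no_homD[OF nU[OF rY]])
        then have "gen M Y" using G_gen_infl[OF rm(1) rY] by simp
        then show ?thesis using gen_trans[OF rm(2,1) rY gN(1)] by blast
      next
        case False
        \<comment> \<open>Such a \<open>Y\<close> is not orthogonal to \<open>T\<close>, so nothing
          is known about it from \<open>T\<close>. Its summand S_i is generated by \<open>N\<close>,
          and the complement is smaller and still orthogonal to \<open>N\<close>.\<close>
        then obtain Y' where Y': "Y' \<in> fg_modules A" "biprod Y Y' Sm" using Sm_split[OF less(2)] by metis
        have rY': "rmod Y'" using Y' by simp
        have "orth N Y'" using orth_biprod2[OF N(1) less(2) Y'(1) Sm(1) Y'(2)] less by simp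
        moreover have "kdim Y' < kdim Y"
          using biprod_nonzero_less[OF less(2) Y'(2) rY' Sm_rmod] Sm_nonzero by metis
        ultimately have "gen N Y'" using less(1) Y'(1) by blast
        then show ?thesis using gen_biprod[OF rY rY' Sm_rmod Y'(2) _ gN(2)] by blast
      qed
    qed
    then show "PWT_module A N \<and> no_hom Sm M" using P self N by (simp add: PWT_module_iff G.PWT_module_iff)
  next
    assume P: "PWT_module A N \<and> no_hom Sm M"
    have "G.gen T (infl Y)" if Y: "Y \<in> fg_modules A" "G.orth T (infl Y)" for Y
    proof -
      have rY: "rmod Y" using Y by simp
      have "gen N Y" using P orth_infl[OF Y(1)] Y by (simp add: PWT_module_iff)
      moreover have "no_hom Sm Y" using orth_infl[OF Y(1)] Y by simp
      ultimately have "gen M Y"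
        using gen_drop_summand[OF rm(2,1) Sm_rmod rY N(2)] no_homD by metis
      then have "G.gen (infl M) (infl Y)" using G_gen_infl[OF rm(1) rY] by simp
      then show ?thesis using G.gen_trans[OF rm(3,5) G_rmod_infl[OF rY] gM(1)] by blast
    qed
    then have "G.gen T Y" if "Y \<in> fg_modules ext_alg" "G.orth T Y" for Y
      using G_gen_all[OF T(1) gPA _ that] by blast
    then show "PWT_module ext_alg T" using P self T by (simp add: PWT_module_iff G.PWT_module_iff)
  qed
qed

end

subsection \<open>Isomorphism classes\<close>

text \<open>\<open>c\<close> and \<open>c'\<close> assign classes. A map on representatives that
  preserves and reflects equality of classes descends to a bijection onto the classes it
  reaches.\<close>

lemma quotient_map:
  assumes "\<And>x y. x \<in> P \<Longrightarrow> y \<in> P \<Longrightarrow> c x = c y \<longleftrightarrow> c' (F x) = c' (F y)"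
  obtains G where "bij_betw G (c ` P) ((\<lambda>x. c' (F x)) ` P)"
proof
  let ?G = "\<lambda>s. c' (F (SOME x. x \<in> P \<and> c x = s))"
  have G: "?G (c x) = c' (F x)" if "x \<in> P" for x
  proof -
    have "(SOME y. y \<in> P \<and> c y = c x) \<in> P \<and> c (SOME y. y \<in> P \<and> c y = c x) = c x"
      by (rule someI) (use that in simp)
    then show ?thesis using assms that by metis
  qed
  have "?G ` c ` P = (\<lambda>x. c' (F x)) ` P" using G by (simp add: image_image cong: image_cong)
  moreover have "inj_on ?G (c ` P)" using G assms by (auto simp: inj_on_def)
  ultimately show "bij_betw ?G (c ` P) ((\<lambda>x. c' (F x)) ` P)" by (simp add: bij_betw_def)
qed

context fd_algebra
begin

lemma PWT_eq: "PWT A = (\<lambda>T. iso_rel A `` {T}) ` basic_PWT_modules A"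
  by (auto simp: PWT_def quotient_def)

lemma basic_PWT_iff: "T \<in> basic_PWT_modules A \<longleftrightarrow> basic_module A T \<and> PWT_module A T"
  by (simp add: basic_PWT_modules_def)

lemma basic_PWT_iso:
  "T \<in> basic_PWT_modules A \<Longrightarrow> mod_iso A T T' \<Longrightarrow> T' \<in> fg_modules A \<Longrightarrow> T' \<in> basic_PWT_modules A"
  using basic_iso PWT_module_iso by (metis basic_PWT_iff)

end

section \<open>Adding and removing the summand S_i\<close>

context source_algebra
begin

text \<open>Schur's lemma for a one-dimensional module: \<open>f\<close> corresponds to
  multiplication by a nonzero scalar.\<close>

lemma Sm_endo_surj:
  assumes "lin Sm Sm f" "u \<in> carrier Sm" "f u \<noteq> \<zero>\<^bsub>Sm\<^esub>" "y \<in> carrier Sm"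
  obtains x where "x \<in> carrier Sm" "f x = y"
proof -
  obtain i j where ij: "lin charmod Sm i" "lin Sm charmod j" "\<And>x. x \<in> carrier charmod \<Longrightarrow> j (i x) = x"
    "\<And>y. y \<in> carrier Sm \<Longrightarrow> i (j y) = y"
    using mod_isoE[OF Sm(2) rmod_charmod] by metis
  have l: "lin charmod charmod (\<lambda>x. j (f (i x)))" by (rule lin_comp[OF lin_comp[OF ij(1) assms(1)] ij(2)])
  define c where "c = j (f (i 1))"
  have jf: "j (f (i x)) = x * c" for x using charmod_homD(1)[OF l e_closed, of x] by (simp add: c_def mult.commute)
  have "c \<noteq> 0"
  proof
    assume "c = 0"
    then have "j (f u) = 0" using jf[of "j u"] ij(4)[OF assms(2)] by simp
    then have "f u = i 0" using ij(4)[OF lin_closed[OF assms(1,2)]] by simp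
    then show False using assms(3) lin_zero[OF ij(1)] by simp
  qed
  then have "j (f (i (j y / c))) = j y" by (simp add: jf)
  moreover have ic: "i (j y / c) \<in> carrier Sm" using lin_closed[OF ij(1)] by simp
  ultimately have "f (i (j y / c)) = y" using ij(4) lin_closed[OF assms(1) ic] assms(4) by metis
  then show thesis using that ic by blast
qed

text \<open>Nothing is assumed about Hom(S_i, M), so \<open>biprod_cancel\<close> does not apply. As
  q1 i2 = 0, the copy i2 of S_i lies in the copy j2; by \<open>Sm_endo_surj\<close> the two
  coincide, so p1 kills j2 and \<open>bip_cancel\<close> applies to the identity of
  \<open>T\<close>.\<close>

lemma Sm_cancel:
  assumes "biprod T M Sm" "biprod T M' Sm" "no_hom Sm M'" and rm: "rmod T" "rmod M" "rmod M'"
  shows "mod_iso A M M'"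
proof -
  obtain i1 i2 p1 p2 where b: "bip T M Sm i1 i2 p1 p2" using assms biprod_def by blast
  obtain j1 j2 q1 q2 where c: "bip T M' Sm j1 j2 q1 q2" using assms biprod_def by blast
  note bd = bipD[OF b] and cd = bipD[OF c]
  have q1: "q1 (i2 u) = \<zero>\<^bsub>M'\<^esub>" if "u \<in> carrier Sm" for u
    by (rule no_homD[OF assms(3) lin_comp[OF bd(2) cd(3)] that])
  have i2: "j2 (q2 (i2 u)) = i2 u" if u: "u \<in> carrier Sm" for u
    using cd(9)[OF lin_closed[OF bd(2) u]] q1[OF u] lin_zero[OF cd(1)] rm
      lin_closed[OF cd(2) lin_closed[OF cd(4) lin_closed[OF bd(2) u]]] by simp
  have f: "lin Sm Sm (\<lambda>u. q2 (i2 u))" by (rule lin_comp[OF bd(2) cd(4)])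
  obtain u where u: "u \<in> carrier Sm" "u \<noteq> \<zero>\<^bsub>Sm\<^esub>" using Sm_nonzero by metis
  have fu: "q2 (i2 u) \<noteq> \<zero>\<^bsub>Sm\<^esub>"
  proof
    assume "q2 (i2 u) = \<zero>\<^bsub>Sm\<^esub>"
    then have "i2 u = \<zero>\<^bsub>T\<^esub>" using i2[OF u(1)] lin_zero[OF cd(2)] rm by simp
    then show False using bd(7)[OF u(1)] u(2) lin_zero[OF bd(4)] rm by simp
  qed
  have p1: "p1 (j2 y) = \<zero>\<^bsub>M\<^esub>" if y: "y \<in> carrier Sm" for y
  proof -
    obtain x where x: "x \<in> carrier Sm" "q2 (i2 x) = y" using Sm_endo_surj[OF f u(1) fu y] by metis
    then show ?thesis using i2[OF x(1)] bd(8)[OF x(1)] by simp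
  qed
  show ?thesis
    by (rule bip_cancel[OF b c lin_id lin_id _ _ q1 p1 rm(1,1,2,3) Sm_rmod Sm_rmod]) auto
qed

lemma ind_Sm_iso:
  assumes "indecomposable A X" "\<not> no_hom Sm X" shows "mod_iso A X Sm"
proof -
  obtain Y where Y: "Y \<in> fg_modules A" "biprod X Y Sm" using Sm_split[OF ind_fg[OF assms(1)] assms(2)] by metis
  have "carrier Y = {\<zero>\<^bsub>Y\<^esub>}" using ind_biprod[OF assms(1) _ _ Y(2)] Y(1) Sm Sm_nonzero by auto
  then show ?thesis using biprod_zero_iso[OF Y(2)] assms Y by simp
qed

text \<open>Some summand in a basic decomposition of \<open>T\<close> receives a nonzero map from
  S_i, so it is S_i, and then no other summand does. With \<open>T'\<close> the sum of the others,
  \<open>Sm_cancel\<close> identifies the given complement \<open>M\<close> with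
  \<open>T'\<close>.\<close>

lemma basic_summand_Sm:
  assumes "basic_module A T" "biprod T M Sm" "M \<in> fg_modules A"
  shows "no_hom Sm M" "basic_module A M"
proof -
  obtain n :: nat and X where X: "\<And>j. j < n \<Longrightarrow> indecomposable A (X j)" "mod_iso A T (fam {..<n} X)"
    "\<And>j l. j < n \<Longrightarrow> l < n \<Longrightarrow> j \<noteq> l \<Longrightarrow> \<not> mod_iso A (X j) (X l)"
    using basic_moduleE[OF assms(1)] by metis
  have rX: "rmod (X j)" if "j < n" for j using X(1) that by auto
  have rm: "rmod T" "rmod M" "rmod (fam {..<n} X)" using assms rX by (auto intro!: rmod_fam)
  obtain j0 where j0: "j0 < n" "\<not> no_hom Sm (X j0)"
  proof (rule ccontr)
    assume "\<not> thesis"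
    then have "no_hom Sm (fam {..<n} X)" using that by (intro no_hom_fam) auto
    then have "no_hom Sm T" using no_hom_iso2[OF _ mod_iso_sym[OF X(2)]] rm by blast
    then have "no_hom Sm Sm" using no_hom_summand(2)[OF assms(2)] rm by simp
    then show False using not_no_hom_self[OF Sm_ind] by blast
  qed
  have iso0: "mod_iso A (X j0) Sm" by (rule ind_Sm_iso[OF X(1) j0(2)]) (rule j0(1))
  have other: "no_hom Sm (X l)" if l: "l < n" "l \<noteq> j0" for l
  proof (rule ccontr)
    assume "\<not> no_hom Sm (X l)"
    then have "mod_iso A (X l) Sm" using ind_Sm_iso X(1) l by blast
    then have "mod_iso A (X l) (X j0)"
      by (rule mod_iso_trans[OF _ mod_iso_sym[OF iso0]]) (use rX l j0 in simp_all)
    then show False using X(3) l j0 by blast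
  qed
  let ?J = "{..<n} - {j0}"
  have "fd (fam ?J X)" using X(1) by (intro fd_fam) auto
  then obtain T' where T': "T' \<in> fg_modules A" "mod_iso A (fam ?J X) T'" using fd_transport by blast
  have rT': "rmod T'" "rmod (fam ?J X)" using T' rX by (auto intro!: rmod_fam)
  have nT': "no_hom Sm T'" by (rule no_hom_iso2[OF no_hom_fam T'(2) rT'(2,1)]) (use other in auto)
  have "biprod (fam {..<n} X) (X j0) (fam ?J X)" by (rule biprod_fam_remove) (use rX j0 in auto)
  then have "biprod T (X j0) (fam ?J X)" using biprod_iso[OF _ mod_iso_sym[OF X(2)]] rm by blast
  then have "biprod T Sm T'" using biprod_cong[OF _ iso0 T'(2)] rm rX j0 rT' by simp
  then have bT: "biprod T T' Sm" using biprod_swap rm by blast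
  have iM: "mod_iso A M T'" by (rule Sm_cancel[OF assms(2) bT nT' rm(1,2) rT'(1)])
  then have iM': "mod_iso A T' M" using mod_iso_sym rm rT' by blast
  show "no_hom Sm M" using no_hom_iso2[OF nT' iM' rT'(1) rm(2)] .
  have "basic_module A T'"
    by (rule basic_moduleI[of ?J T' X]) (use X T' mod_iso_sym[OF T'(2) rT'(2,1)] in auto)
  then show "basic_module A M" using basic_iso iM' assms(3) by blast
qed

text \<open>The representatives in \<open>RPWT\<close>, expressed with \<open>biprod\<close> and
  \<open>Sm\<close>; \<open>charmod_summand_iff\<close> makes the link.\<close>

definition RPWT_modules where "RPWT_modules = {M \<in> fg_modules A. \<exists>T \<in> basic_PWT_modules A. biprod T M Sm}"

lemma charmod_summand_iff:
  assumes "T \<in> fg_modules A" "M \<in> fg_modules A"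
  shows "mod_iso A T (direct_sum M charmod) \<longleftrightarrow> biprod T M Sm"
proof -
  have rm: "rmod T" "rmod M" using assms by auto
  have "mod_iso A Sm charmod" using mod_iso_sym[OF Sm(2)] by simp
  then have "biprod T M charmod \<longleftrightarrow> biprod T M Sm"
    using biprod_cong[OF _ mod_iso_refl Sm(2)] biprod_cong[OF _ mod_iso_refl, of T M Sm charmod] rm by auto
  then show ?thesis using biprod_iff[OF rm rmod_charmod] by simp
qed

lemma basic_PWT_fg [simp]: "T \<in> basic_PWT_modules A \<Longrightarrow> T \<in> fg_modules A"
  by (simp add: basic_PWT_iff)

lemma RPWT_eq: "RPWT A charmod = (\<lambda>M. iso_rel A `` {M}) ` RPWT_modules"
proof -
  have "{M \<in> fg_modules A. \<exists>T \<in> basic_PWT_modules A. mod_iso A T (direct_sum M charmod)} = RPWT_modules"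
    unfolding RPWT_modules_def using charmod_summand_iff by auto
  then show ?thesis unfolding RPWT_def by (auto simp: quotient_def)
qed

lemma PWT_with_eq: "PWT_with A charmod =
  (\<lambda>T. iso_rel A `` {T}) ` {T \<in> basic_PWT_modules A. \<exists>M \<in> fg_modules A. biprod T M Sm}"
proof -
  have "{T \<in> basic_PWT_modules A. \<exists>M \<in> fg_modules A. mod_iso A T (direct_sum M charmod)} =
    {T \<in> basic_PWT_modules A. \<exists>M \<in> fg_modules A. biprod T M Sm}"
    using charmod_summand_iff by auto
  then show ?thesis unfolding PWT_with_def by (auto simp: quotient_def)
qed

lemma RPWT_modules_no_hom:
  assumes "M \<in> RPWT_modules" shows "no_hom Sm M" "basic_module A M"
proof -
  obtain T where "basic_module A T" "biprod T M Sm" "M \<in> fg_modules A"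
    using assms by (auto simp: RPWT_modules_def basic_PWT_iff)
  then show "no_hom Sm M" "basic_module A M" by (rule basic_summand_Sm)+
qed

text \<open>On representatives the map sends M to M + S_i. It reflects isomorphism by
  \<open>Sm_cancel\<close>, which applies because these M receive no nonzero map from S_i.\<close>

lemma RPWT_PWT_with: "\<exists>h. bij_betw h (RPWT A charmod) (PWT_with A charmod)"
proof -
  let ?c = "\<lambda>M. iso_rel A `` {M}"
  have "\<forall>M. \<exists>N. M \<in> fg_modules A \<longrightarrow> N \<in> fg_modules A \<and> biprod N M Sm"
    using biprod_exists Sm(1) by (metis fg_fd)
  then obtain N where N: "\<And>M. M \<in> fg_modules A \<Longrightarrow> N M \<in> fg_modules A \<and> biprod (N M) M Sm" by metis
  have fgR: "M \<in> fg_modules A" if "M \<in> RPWT_modules" for M using that by (simp add: RPWT_modules_def)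
  have iso: "mod_iso A (N M) T" if "M \<in> fg_modules A" "T \<in> fg_modules A" "biprod T M Sm" for M T
    using biprod_unique[OF _ that(3) mod_iso_refl mod_iso_refl, of "N M"] N[OF that(1)] that by simp
  have 1: "?c M = ?c M' \<longleftrightarrow> ?c (N M) = ?c (N M')" if M: "M \<in> RPWT_modules" "M' \<in> RPWT_modules" for M M'
  proof -
    have fg: "M \<in> fg_modules A" "M' \<in> fg_modules A" "N M \<in> fg_modules A" "N M' \<in> fg_modules A"
      using M fgR N by auto
    then have rm: "rmod M" "rmod M'" "rmod (N M)" "rmod (N M')" by auto
    have "mod_iso A M M' \<longleftrightarrow> mod_iso A (N M) (N M')"
    proof
      assume "mod_iso A M M'"
      then show "mod_iso A (N M) (N M')"
        using biprod_unique[OF _ _ _ mod_iso_refl, of "N M" M Sm "N M'" M'] N fg rm by simp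
    next
      assume "mod_iso A (N M) (N M')"
      then have "biprod (N M') M Sm" using biprod_iso N fg rm by blast
      then show "mod_iso A M M'" using Sm_cancel[OF _ _ RPWT_modules_no_hom(1)[OF M(2)]] N fg rm by blast
    qed
    then show ?thesis using iso_rel_class_eq fg by simp
  qed
  have "(\<lambda>M. ?c (N M)) ` RPWT_modules = PWT_with A charmod"
    unfolding PWT_with_eq
  proof (intro equalityI image_subsetI)
    fix M assume M: "M \<in> RPWT_modules"
    then obtain T where T: "T \<in> basic_PWT_modules A" "biprod T M Sm" by (auto simp: RPWT_modules_def)
    have NM: "N M \<in> fg_modules A" "biprod (N M) M Sm" using N fgR[OF M] by auto
    have "mod_iso A T (N M)" using mod_iso_sym[OF iso[OF fgR[OF M] _ T(2)]] T NM by simp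
    then have "N M \<in> basic_PWT_modules A" using basic_PWT_iso T NM by blast
    then show "?c (N M) \<in> ?c ` {T \<in> basic_PWT_modules A. \<exists>M \<in> fg_modules A. biprod T M Sm}"
      using NM fgR[OF M] by blast
  next
    fix T assume "T \<in> {T \<in> basic_PWT_modules A. \<exists>M \<in> fg_modules A. biprod T M Sm}"
    then obtain M where M: "M \<in> fg_modules A" "biprod T M Sm" "T \<in> basic_PWT_modules A" by blast
    then have "M \<in> RPWT_modules" by (auto simp: RPWT_modules_def)
    moreover have "?c T = ?c (N M)" using iso_rel_class_eq[of "N M" T] iso[OF M(1) _ M(2)] N[OF M(1)] M(3) by simp
    ultimately show "?c T \<in> (\<lambda>M. ?c (N M)) ` RPWT_modules" by blast
  qed
  then show ?thesis unfolding RPWT_eq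
    using quotient_map[where c = ?c and c' = ?c and F = N and P = RPWT_modules] 1 by metis
qed

end

section \<open>The two constructions of basic PWT modules over the extension\<close>

context one_point
begin

lemma infl_fam: "(\<And>j. j \<in> J \<Longrightarrow> rmod (X j)) \<Longrightarrow> mod_iso ext_alg (infl (fam J X)) (fam J (\<lambda>j. infl (X j)))"
  by (rule G.mod_isoI[OF G_rmod_infl[OF rmod_fam], of _ _ _ "\<lambda>x. x" "\<lambda>x. x"])
    (auto simp: G.lin_def direct_sum_family_def infl_def)

lemma lambda_mod_sub:
  assumes "lambda_mod Y" "G.lin Z Y i" "inj_on i (carrier Z)" "G.rmod Y" "G.rmod Z"
  shows "lambda_mod Z"
  unfolding lambda_mod_def
proof
  fix z assume z: "z \<in> carrier Z"
  have "i (ea \<odot>\<^bsub>Z\<^esub> z) = \<zero>\<^bsub>Y\<^esub>"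
    using G.lin_act[OF assms(2) _ z, of ea] assms(1) G.lin_closed[OF assms(2) z] by (simp add: lambda_mod_def)
  then show "ea \<odot>\<^bsub>Z\<^esub> z = \<zero>\<^bsub>Z\<^esub>"
    using G.lin_inj_iff[OF assms(5,4,2)] assms(3,5) z by simp
qed

lemma lambda_mod_summand:
  assumes "G.biprod D M N" "lambda_mod D" "G.rmod D" "G.rmod M" "G.rmod N"
  shows "lambda_mod M" "lambda_mod N"
proof -
  obtain i1 i2 p1 p2 where b: "G.bip D M N i1 i2 p1 p2" using assms G.biprod_def by blast
  note bd = G.bipD[OF b]
  have "inj_on i1 (carrier M)" "inj_on i2 (carrier N)" using bd(5,7) by (metis inj_onI)+
  then show "lambda_mod M" "lambda_mod N"
    using lambda_mod_sub[OF assms(2) bd(1)] lambda_mod_sub[OF assms(2) bd(2)] assms by blast+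
qed

lemma lambda_mod_transfer:
  assumes "lambda_mod Y" "mod_iso ext_alg Y Z" "G.rmod Y" "G.rmod Z" shows "lambda_mod Z"
proof -
  obtain i j where ij: "G.lin Y Z i" "G.lin Z Y j" "\<And>y. y \<in> carrier Z \<Longrightarrow> i (j y) = y"
    using G.mod_isoE[OF assms(2,3)] by metis
  have "inj_on j (carrier Z)" using ij(3) by (metis inj_onI)
  then show ?thesis using lambda_mod_sub[OF assms(1) ij(2)] assms by blast
qed

lemma lambda_mod_fam:
  assumes "\<And>j. j \<in> J \<Longrightarrow> lambda_mod (X j)" shows "lambda_mod (fam J X)"
  using assms by (auto simp: lambda_mod_def direct_sum_family_def PiE_iff restrict_def)

text \<open>A summand of a module vanishing at a vanishes there too, so every decomposition of
  \<open>infl X\<close> over \<Gamma> comes from one of \<open>X\<close> over \<Lambda>.\<close>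

lemma infl_ind:
  assumes X: "X \<in> fg_modules A"
  shows "indecomposable ext_alg (infl X) \<longleftrightarrow> indecomposable A X"
proof
  have rX: "rmod X" using X by simp
  note GX = G_rmod_infl[OF rX]
  assume i: "indecomposable ext_alg (infl X)"
  show "indecomposable A X"
    unfolding indecomposable_def
  proof (intro conjI ballI impI X)
    show "carrier X \<noteq> {\<zero>\<^bsub>X\<^esub>}" using G.ind_nonzero[OF i] by simp
    fix U V assume UV: "U \<in> fg_modules A" "V \<in> fg_modules A" "mod_iso A X (direct_sum U V)"
    then have "biprod X U V" using biprod_iff[OF rX fg_rmod[OF UV(1)] fg_rmod[OF UV(2)]] by blast
    then have "G.biprod (infl X) (infl U) (infl V)" by (simp add: infl_biprod)
    then have "carrier (infl U) = {\<zero>\<^bsub>infl U\<^esub>} \<or> carrier (infl V) = {\<zero>\<^bsub>infl V\<^esub>}"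
      using G.ind_biprod[OF i] infl_fg UV by (metis G.fg_fd)
    then show "carrier U = {\<zero>\<^bsub>U\<^esub>} \<or> carrier V = {\<zero>\<^bsub>V\<^esub>}" by simp
  qed
next
  have rX: "rmod X" using X by simp
  note GX = G_rmod_infl[OF rX]
  assume i: "indecomposable A X"
  show "indecomposable ext_alg (infl X)"
    unfolding indecomposable_def
  proof (intro conjI ballI impI infl_fg X)
    show "carrier (infl X) \<noteq> {\<zero>\<^bsub>infl X\<^esub>}" using ind_nonzero[OF i] by simp
    fix U V assume UV: "U \<in> fg_modules ext_alg" "V \<in> fg_modules ext_alg" "mod_iso ext_alg (infl X) (direct_sum U V)"
    have rm: "G.rmod U" "G.rmod V" using UV by auto
    have b: "G.biprod (infl X) U V" using GX rm UV(3) by (simp add: G.biprod_iff)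
    note l = lambda_mod_summand[OF b lambda_mod_infl[OF rX] GX rm]
    have fg: "restr U \<in> fg_modules A" "restr V \<in> fg_modules A" using restr_fg UV by auto
    have "G.biprod (infl X) (infl (restr U)) (infl (restr V))"
      by (rule G.biprod_cong[OF b lambda_mod_iso[OF rm(1) l(1)] lambda_mod_iso[OF rm(2) l(2)] GX rm])
        (use fg in \<open>auto simp: G_rmod_infl\<close>)
    then have "biprod X (restr U) (restr V)" by (simp add: infl_biprod)
    then have "carrier (restr U) = {\<zero>\<^bsub>restr U\<^esub>} \<or> carrier (restr V) = {\<zero>\<^bsub>restr V\<^esub>}"
      using ind_biprod[OF i] fg by (metis fg_fd)
    then show "carrier U = {\<zero>\<^bsub>U\<^esub>} \<or> carrier V = {\<zero>\<^bsub>V\<^esub>}"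
      using lambda_mod_restr[OF rm(1) l(1)] lambda_mod_restr[OF rm(2) l(2)] by (simp add: restr_simps(2))
  qed
qed

text \<open>A decomposition over \<Lambda> is inflated summand by summand. Conversely the summands
  of \<open>infl X\<close> vanish at a, so \<open>restr\<close> returns them to \<Lambda>.\<close>

lemma infl_basic:
  assumes X: "X \<in> fg_modules A"
  shows "basic_module ext_alg (infl X) \<longleftrightarrow> basic_module A X"
proof
  have rX: "rmod X" using X by simp
  note GX = G_rmod_infl[OF rX]
  {
    assume "basic_module A X"
    then obtain n :: nat and Z where Z: "\<And>j. j < n \<Longrightarrow> indecomposable A (Z j)" "mod_iso A X (fam {..<n} Z)"
      "\<And>j l. j < n \<Longrightarrow> l < n \<Longrightarrow> j \<noteq> l \<Longrightarrow> \<not> mod_iso A (Z j) (Z l)"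
      using basic_moduleE by metis
    have rZ: "rmod (Z j)" if "j < n" for j using Z(1) that by auto
    have rF: "rmod (fam {..<n} Z)" using rZ by (auto intro!: rmod_fam)
    have i: "mod_iso ext_alg (infl X) (infl (fam {..<n} Z))" using infl_iso[OF rX, of "fam {..<n} Z"] Z(2) by blast
    have "mod_iso ext_alg (infl X) (fam {..<n} (\<lambda>j. infl (Z j)))"
      by (rule G.mod_iso_trans[OF i infl_fam GX G_rmod_infl[OF rF]]) (use rZ in simp)
    then show "basic_module ext_alg (infl X)"
      using Z rZ X by (intro G.basic_moduleI[of "{..<n}"]) (auto simp: infl_ind infl_iso[symmetric])
  }
  assume "basic_module ext_alg (infl X)"
  then obtain n :: nat and Z where Z: "\<And>j. j < n \<Longrightarrow> indecomposable ext_alg (Z j)"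
    "mod_iso ext_alg (infl X) (fam {..<n} Z)"
    "\<And>j l. j < n \<Longrightarrow> l < n \<Longrightarrow> j \<noteq> l \<Longrightarrow> \<not> mod_iso ext_alg (Z j) (Z l)"
    using G.basic_moduleE by metis
  have rZ: "G.rmod (Z j)" if "j < n" for j using Z(1) that by auto
  have rF: "G.rmod (fam {..<n} Z)" using rZ by (auto intro!: G.rmod_fam)
  have lF: "lambda_mod (fam {..<n} Z)" by (rule lambda_mod_transfer[OF lambda_mod_infl[OF rX] Z(2) GX rF])
  have lZ: "lambda_mod (Z j)" if j: "j < n" for j
    by (rule lambda_mod_summand(1)[OF G.biprod_fam_remove lF rF]) (use rZ j in \<open>auto intro!: G.rmod_fam\<close>)
  have fgZ: "restr (Z j) \<in> fg_modules A" if "j < n" for j using restr_fg Z(1) that by simp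
  have iZ: "mod_iso ext_alg (Z j) (infl (restr (Z j)))" if "j < n" for j
    by (rule lambda_mod_iso[OF rZ lZ]) (use that in auto)
  have rrZ: "rmod (restr (Z j))" "G.rmod (infl (restr (Z j)))" if "j < n" for j
    using fgZ[OF that] by (auto simp: G_rmod_infl)
  have rF': "rmod (fam {..<n} (\<lambda>j. restr (Z j)))" using rrZ by (auto intro!: rmod_fam)
  have rF'': "G.rmod (fam {..<n} (\<lambda>j. infl (restr (Z j))))" using rrZ by (auto intro!: G.rmod_fam)
  have "mod_iso ext_alg (fam {..<n} Z) (fam {..<n} (\<lambda>j. infl (restr (Z j))))"
    by (rule G.mod_iso_fam[of id]) (use iZ rZ rrZ in auto)
  then have 1: "mod_iso ext_alg (infl X) (fam {..<n} (\<lambda>j. infl (restr (Z j))))"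
    using G.mod_iso_trans[OF Z(2) _ GX rF] by blast
  have "mod_iso ext_alg (infl (fam {..<n} (\<lambda>j. restr (Z j)))) (fam {..<n} (\<lambda>j. infl (restr (Z j))))"
    by (rule infl_fam) (use rrZ in simp)
  then have "mod_iso ext_alg (infl X) (infl (fam {..<n} (\<lambda>j. restr (Z j))))"
    using G.mod_iso_trans[OF 1 G.mod_iso_sym[OF _ G_rmod_infl[OF rF'] rF''] GX rF''] by blast
  then have iX: "mod_iso A X (fam {..<n} (\<lambda>j. restr (Z j)))" by (simp add: infl_iso[OF rX])
  have "\<not> mod_iso A (restr (Z j)) (restr (Z l))" if jl: "j < n" "l < n" "j \<noteq> l" for j l
  proof
    assume "mod_iso A (restr (Z j)) (restr (Z l))"
    then have "mod_iso ext_alg (infl (restr (Z j))) (infl (restr (Z l)))" using rrZ jl by (simp add: infl_iso)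
    then have "mod_iso ext_alg (Z j) (infl (restr (Z l)))"
      using G.mod_iso_trans[OF iZ[OF jl(1)]] rZ rrZ jl by blast
    then have "mod_iso ext_alg (Z j) (Z l)"
      using G.mod_iso_trans[OF _ G.mod_iso_sym[OF iZ[OF jl(2)]]] rZ rrZ jl by blast
    then show False using Z(3) jl by blast
  qed
  moreover have "indecomposable A (restr (Z j))" if "j < n" for j
    using G.ind_iso[OF Z(1) iZ infl_fg[OF fgZ]] infl_ind[OF fgZ] that by blast
  ultimately show "basic_module A X"
    using X iX by (intro basic_moduleI[of "{..<n}"]) auto
qed

definition PA_SA where "PA_SA = (SOME U. U \<in> fg_modules ext_alg \<and> G.biprod U PA SA)"

lemma PA_SA: "PA_SA \<in> fg_modules ext_alg" "G.biprod PA_SA PA SA"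
proof -
  have "\<exists>U. U \<in> fg_modules ext_alg \<and> G.biprod U PA SA"
    using G.biprod_exists[OF G.fg_fd[OF PA(1)] G.fg_fd[OF G.Sm(1)]] by blast
  from someI_ex[OF this] show "PA_SA \<in> fg_modules ext_alg" "G.biprod PA_SA PA SA" by (auto simp: PA_SA_def)
qed

lemma PA_SA_rmod [simp]: "G.rmod PA_SA" using PA_SA(1) by simp

lemma no_hom_PA_SA: "rmod Y \<Longrightarrow> G.no_hom PA_SA (infl Y)"
  using G.no_hom_biprod1[OF PA_SA(2) no_hom_PA no_hom_SA_lambda] G_rmod_infl lambda_mod_infl by blast

text \<open>Chosen copies of X + P_a and M + P_a + S_a inside \<open>fg_modules\<close>;
  \<open>biprod\<close> determines them up to isomorphism only.\<close>

definition add_PA where "add_PA X = (SOME T. T \<in> fg_modules ext_alg \<and> G.biprod T (infl X) PA)"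
definition add_PA_SA where "add_PA_SA M = (SOME T. T \<in> fg_modules ext_alg \<and> G.biprod T (infl M) PA_SA)"

lemma add_PA: assumes "X \<in> fg_modules A" shows "add_PA X \<in> fg_modules ext_alg" "G.biprod (add_PA X) (infl X) PA"
proof -
  have "\<exists>T. T \<in> fg_modules ext_alg \<and> G.biprod T (infl X) PA"
    using G.biprod_exists[OF G.fg_fd[OF infl_fg[OF assms]] G.fg_fd[OF PA(1)]] by blast
  from someI_ex[OF this] show "add_PA X \<in> fg_modules ext_alg" "G.biprod (add_PA X) (infl X) PA" by (auto simp: add_PA_def)
qed

lemma add_PA_SA: assumes "X \<in> fg_modules A" shows "add_PA_SA X \<in> fg_modules ext_alg" "G.biprod (add_PA_SA X) (infl X) PA_SA"
proof -
  have "\<exists>T. T \<in> fg_modules ext_alg \<and> G.biprod T (infl X) PA_SA"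
    using G.biprod_exists[OF G.fg_fd[OF infl_fg[OF assms]] G.fg_fd[OF PA_SA(1)]] by blast
  from someI_ex[OF this] show "add_PA_SA X \<in> fg_modules ext_alg" "G.biprod (add_PA_SA X) (infl X) PA_SA" by (auto simp: add_PA_SA_def)
qed

text \<open>Supplies what \<open>quotient_map\<close> asks of both constructions. From left to right
  the summand \<open>V\<close> is cancelled, having no nonzero map to an inflated module.\<close>

lemma G_biprod_infl_iso:
  assumes "X \<in> fg_modules A" "X' \<in> fg_modules A" "T \<in> fg_modules ext_alg" "T' \<in> fg_modules ext_alg"
    "V \<in> fg_modules ext_alg" "G.biprod T (infl X) V" "G.biprod T' (infl X') V"
    and nh: "\<And>Y :: ('a, nat \<Rightarrow> 'k) module. rmod Y \<Longrightarrow> G.no_hom V (infl Y)"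
  shows "mod_iso ext_alg T T' \<longleftrightarrow> mod_iso A X X'"
proof -
  have rm: "rmod X" "rmod X'" "G.rmod T" "G.rmod T'" "G.rmod V" "G.rmod (infl X)" "G.rmod (infl X')"
    using assms by (auto simp: G_rmod_infl)
  show ?thesis
  proof
    assume "mod_iso ext_alg T T'"
    then have "mod_iso ext_alg (infl X) (infl X')"
      using G.biprod_cancel[OF assms(6,7) _ nh[OF rm(2)] nh[OF rm(1)]] rm by blast
    then show "mod_iso A X X'" using rm by (simp add: infl_iso)
  next
    assume "mod_iso A X X'"
    then have "mod_iso ext_alg (infl X) (infl X')" using rm by (simp add: infl_iso)
    then show "mod_iso ext_alg T T'"
      by (rule G.biprod_unique[OF assms(6,7) _ G.mod_iso_refl[OF rm(5)] rm(3,4,6,5,7,5)])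
  qed
qed

lemma add_PA_basic_PWT:
  assumes "X \<in> basic_PWT_modules A" shows "add_PA X \<in> basic_PWT_modules ext_alg"
proof -
  have X: "X \<in> fg_modules A" "basic_module A X" "PWT_module A X" using assms by (auto simp: basic_PWT_iff)
  have rX: "rmod X" using X by simp
  note E = add_PA[OF X(1)]
  have "PWT_module ext_alg (add_PA X)" using PWT_extend_PA[OF X(1) E] X by simp
  moreover have "basic_module ext_alg (add_PA X)"
    by (rule G.basic_add[OF _ PA_ind E no_hom_PA[OF G_rmod_infl[OF rX] lambda_mod_infl[OF rX]]])
      (use X infl_basic in simp)
  ultimately show ?thesis by (simp add: G.basic_PWT_iff)
qed

lemma add_PA_SA_basic_PWT:
  assumes "M \<in> RPWT_modules" shows "add_PA_SA M \<in> basic_PWT_modules ext_alg"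
proof -
  obtain N where M: "M \<in> fg_modules A" and N: "N \<in> basic_PWT_modules A" "biprod N M Sm"
    using assms by (auto simp: RPWT_modules_def)
  have rM: "rmod M" using M by simp
  note E = add_PA_SA[OF M]
  note nh = RPWT_modules_no_hom[OF assms]
  have "PWT_module ext_alg (add_PA_SA M)"
    using PWT_extend_PA_SA[OF M _ N(2) PA_SA E] N nh by (simp add: basic_PWT_iff)
  moreover have "basic_module ext_alg (add_PA_SA M)"
  proof -
    \<comment> \<open>\<open>basic_add\<close> wants no map from the new summand into what is
      already there. Hence P_a is added first and S_a second: Hom(S_a, P_a) = 0, while P_a maps onto
      S_a.\<close>
    note D = add_PA[OF M]
    have rD: "G.rmod (add_PA M)" using D by simp
    have bD: "basic_module ext_alg (add_PA M)"
      by (rule G.basic_add[OF _ PA_ind D no_hom_PA[OF G_rmod_infl[OF rM] lambda_mod_infl[OF rM]]])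
        (use M nh infl_basic in simp)
    obtain T where T: "T \<in> fg_modules ext_alg" "G.biprod T (add_PA M) SA"
      using G.biprod_exists[OF G.fg_fd[OF D(1)] G.fg_fd[OF G.Sm(1)]] by blast
    have rT: "G.rmod T" using T by simp
    have "G.no_hom SA (add_PA M)"
      by (rule G.no_hom_biprod2[OF D(2) no_hom_SA_lambda no_hom_SA_PA rD])
        (use rM in \<open>auto simp: G_rmod_infl lambda_mod_infl\<close>)
    then have bT: "basic_module ext_alg T" by (rule G.basic_add[OF bD G.Sm_ind T])
    have "G.biprod T (infl M) PA_SA"
      by (rule G.biprod_assoc[OF T(2) D(2) PA_SA(2) rT rD G.Sm_rmod G_rmod_infl[OF rM] PA_rmod PA_SA_rmod])
    then have "mod_iso ext_alg T (add_PA_SA M)"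
      using G_biprod_infl_iso[OF M M T(1) E(1) PA_SA(1) _ E(2) no_hom_PA_SA] mod_iso_refl[OF rM] by simp
    then show ?thesis using G.basic_iso bT E(1) by blast
  qed
  ultimately show ?thesis by (simp add: G.basic_PWT_iff)
qed

text \<open>Hom(S_a, -) separates the two kinds: it vanishes on X + P_a but not on a module with
  summand S_a.\<close>

lemma add_PA_not_iso:
  assumes "X \<in> fg_modules A" "M \<in> fg_modules A" shows "\<not> mod_iso ext_alg (add_PA X) (add_PA_SA M)"
proof
  assume i: "mod_iso ext_alg (add_PA X) (add_PA_SA M)"
  note add_PA = add_PA[OF assms(1)] and add_PA_SA = add_PA_SA[OF assms(2)]
  have rm: "rmod X" "rmod M" "G.rmod (add_PA X)" "G.rmod (add_PA_SA M)" "G.rmod (infl X)" "G.rmod (infl M)"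
    using assms add_PA add_PA_SA by (auto simp: G_rmod_infl)
  have "G.no_hom SA (add_PA X)"
    by (rule G.no_hom_biprod2[OF add_PA(2) no_hom_SA_lambda no_hom_SA_PA rm(3)]) (use rm in \<open>auto simp: lambda_mod_infl\<close>)
  then have "G.no_hom SA (add_PA_SA M)" using G.no_hom_iso2[OF _ i rm(3,4)] by blast
  then have "G.no_hom SA PA_SA" using G.no_hom_summand(2)[OF add_PA_SA(2)] rm by simp
  then have "G.no_hom SA SA" using G.no_hom_summand(2)[OF PA_SA(2)] by simp
  then show False using G.not_no_hom_self[OF G.Sm_ind] by blast
qed

section \<open>Every basic PWT module over the extension arises from one of the two
  constructions\<close>

definition ex_kills where "ex_kills Y \<longleftrightarrow> (\<forall>y\<in>carrier Y. ex \<odot>\<^bsub>Y\<^esub> y = \<zero>\<^bsub>Y\<^esub>)"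

text \<open>The elements killed by the new arrow form a submodule, and homomorphisms preserve it.
  Since the arrow acts nontrivially on P_a, a module that generates P_a cannot be killed by
  it.\<close>

lemma ex_kills_gen:
  assumes "G.rmod T" "G.rmod Y" "G.gen T Y" "ex_kills T" shows "ex_kills Y"
proof -
  have "submodule {y \<in> carrier Y. ex \<odot>\<^bsub>Y\<^esub> y = \<zero>\<^bsub>Y\<^esub>} ext_alg Y"
    unfolding G.submodule_iff[OF assms(2)]
  proof (intro conjI ballI)
    fix a y assume a: "a \<in> carrier ext_alg" and y: "y \<in> {y \<in> carrier Y. ex \<odot>\<^bsub>Y\<^esub> y = \<zero>\<^bsub>Y\<^esub>}"
    obtain b m c where b: "a = (b, m, c)" "b \<in> carrier A" using a by (cases a) auto
    have "ex \<odot>\<^bsub>Y\<^esub> (a \<odot>\<^bsub>Y\<^esub> y) = (\<zero>\<^bsub>A\<^esub>, c, 0) \<odot>\<^bsub>Y\<^esub> y"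
      using G_mult[OF assms(2) b(2) R.zero_closed, of y 1 0 m c] y b by simp
    also have "\<dots> = G.sc c \<odot>\<^bsub>Y\<^esub> (ex \<odot>\<^bsub>Y\<^esub> y)"
      using G_mult[OF assms(2) R.zero_closed, of "sc c" y 0 c 1 0] y by (simp add: G_sc)
    also have "\<dots> = \<zero>\<^bsub>Y\<^esub>" using y assms(2) by simp
    finally show "a \<odot>\<^bsub>Y\<^esub> y \<in> {y \<in> carrier Y. ex \<odot>\<^bsub>Y\<^esub> y = \<zero>\<^bsub>Y\<^esub>}" using y a assms(2) by simp
  qed (use assms(2) in \<open>auto simp: G.ract_add\<close>)
  moreover have "f ` carrier T \<subseteq> {y \<in> carrier Y. ex \<odot>\<^bsub>Y\<^esub> y = \<zero>\<^bsub>Y\<^esub>}" if f: "G.lin T Y f" for f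
    using assms(1,2,4) G.lin_closed[OF f] G.lin_act[OF f, of ex] G.lin_zero[OF f] by (auto simp: ex_kills_def)
  ultimately have "{y \<in> carrier Y. ex \<odot>\<^bsub>Y\<^esub> y = \<zero>\<^bsub>Y\<^esub>} = carrier Y" using assms(3) unfolding G.gen_def by blast
  then show ?thesis unfolding ex_kills_def by blast
qed

lemma ex_not_kills_PA: "\<not> ex_kills PA"
proof
  assume k: "ex_kills PA"
  obtain i j where ij: "G.lin PAm PA i" "G.lin PA PAm j" "\<And>x. x \<in> carrier PAm \<Longrightarrow> j (i x) = x"
    using G.mod_isoE[OF PA(2) G_rmod_PAm] by metis
  have "i (1, 0) = \<zero>\<^bsub>PA\<^esub>"
    using k G.lin_act[OF ij(1), of ex "(0, 1)"] G.lin_closed[OF ij(1), of "(0, 1)"] by (simp add: ex_kills_def)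
  then have "j (i (1, 0)) = (0, 0)" using G.lin_zero[OF ij(2)] G_rmod_PAm by simp
  then show False using ij(3)[of "(1, 0)"] by simp
qed

lemma ex_kills_fam:
  assumes "\<And>j. j \<in> J \<Longrightarrow> ex_kills (X j)" shows "ex_kills (fam J X)"
  using assms by (auto simp: ex_kills_def direct_sum_family_def PiE_iff restrict_def)

lemma ind_PA_iso:
  assumes "indecomposable ext_alg X" "\<not> ex_kills X" shows "mod_iso ext_alg X PA"
proof -
  obtain Y where Y: "Y \<in> fg_modules ext_alg" "G.biprod X Y PA"
    using PA_split[OF G.ind_fg[OF assms(1)]] assms(2) unfolding ex_kills_def by metis
  have "carrier Y = {\<zero>\<^bsub>Y\<^esub>}"
    using G.ind_biprod[OF assms(1) _ _ Y(2)] Y(1) PA(1) PA_nonzero by auto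
  then show ?thesis using G.biprod_zero_iso[OF Y(2)] assms Y by simp
qed

lemma ind_SA_iso:
  assumes "indecomposable ext_alg X" "ex_kills X" "\<not> lambda_mod X" shows "mod_iso ext_alg X SA"
proof -
  obtain Y where Y: "Y \<in> fg_modules ext_alg" "G.biprod X Y SA"
    using SA_split[OF G.ind_fg[OF assms(1)] _ assms(3)] assms(2) unfolding ex_kills_def by metis
  have "carrier Y = {\<zero>\<^bsub>Y\<^esub>}"
    using G.ind_biprod[OF assms(1) _ _ Y(2)] Y(1) G.Sm(1) G.Sm_nonzero by auto
  then show ?thesis using G.biprod_zero_iso[OF Y(2)] assms Y by simp
qed

text \<open>By the splitting lemmas each indecomposable summand of \<open>T\<close> is P_a, S_a or a
  \<Lambda>-module. P_a occurs, and neither P_a nor S_a occurs twice, so the cases are the absence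
  and the presence of S_a.\<close>

lemma basic_PWT_cases:
  assumes T: "T \<in> basic_PWT_modules ext_alg"
  shows "(\<exists>X\<in>basic_PWT_modules A. mod_iso ext_alg T (add_PA X)) \<or> (\<exists>M\<in>RPWT_modules. mod_iso ext_alg T (add_PA_SA M))"
proof -
  have T': "T \<in> fg_modules ext_alg" "basic_module ext_alg T" "PWT_module ext_alg T"
    using T by (auto simp: G.basic_PWT_iff)
  obtain n :: nat and X where X: "\<And>j. j < n \<Longrightarrow> indecomposable ext_alg (X j)" "mod_iso ext_alg T (fam {..<n} X)"
    "\<And>j l. j < n \<Longrightarrow> l < n \<Longrightarrow> j \<noteq> l \<Longrightarrow> \<not> mod_iso ext_alg (X j) (X l)"
    using G.basic_moduleE[OF T'(2)] by metis
  have rX: "G.rmod (X j)" if "j < n" for j using X(1) that by auto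
  have rT: "G.rmod T" using T' by simp
  have rF: "G.rmod (fam J X)" if "J \<subseteq> {..<n}" for J using rX that by (auto intro!: G.rmod_fam)
  have unique: "j = l" if "mod_iso ext_alg (X j) V" "mod_iso ext_alg (X l) V" "j < n" "l < n" "G.rmod V"
    for j l and V :: "('a \<times> 'k \<times> 'k, nat \<Rightarrow> 'k) module"
  proof (rule ccontr)
    assume "j \<noteq> l"
    moreover have "mod_iso ext_alg (X j) (X l)"
      using G.mod_iso_trans[OF that(1) G.mod_iso_sym[OF that(2)]] rX that by blast
    ultimately show False using X(3) that by blast
  qed
  \<comment> \<open>P_a is injective and so belongs to T^perp; hence \<open>T\<close> generates it,
    which forces P_a to be a summand.\<close>
  have "G.gen T PA" using T'(3) PA(1) G_orth_trivial(2)[OF T'(1)] by (simp add: G.PWT_module_iff)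
  then have nk: "\<not> ex_kills T" using ex_kills_gen[OF rT PA_rmod] ex_not_kills_PA by blast
  obtain j0 where j0: "j0 < n" "\<not> ex_kills (X j0)"
  proof (rule ccontr)
    assume "\<not> thesis"
    then have "ex_kills (fam {..<n} X)" using that by (intro ex_kills_fam) auto
    then have "ex_kills T"
      using ex_kills_gen[OF rF rT G.gen_iso[OF G.mod_iso_sym[OF X(2)]]] rF rT by simp
    then show False using nk by simp
  qed
  have i0: "mod_iso ext_alg (X j0) PA" by (rule ind_PA_iso[OF X(1)[OF j0(1)] j0(2)])
  let ?J = "{..<n} - {j0}"
  have k: "ex_kills (X l)" if l: "l \<in> ?J" for l
  proof (rule ccontr)
    assume "\<not> ex_kills (X l)"
    then have "mod_iso ext_alg (X l) PA" using ind_PA_iso[OF X(1)] l by simp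
    then have "l = j0" by (rule unique[OF _ i0]) (use l j0 in auto)
    then show False using l by simp
  qed
  have b0: "G.biprod (fam {..<n} X) (X j0) (fam ?J X)" by (rule G.biprod_fam_remove) (use rX j0 in auto)
  have bT: "G.biprod T (X j0) (fam ?J X)"
    using G.biprod_iso[OF b0 G.mod_iso_sym[OF X(2) rT]] rF by simp
  \<comment> \<open>A partial sum of summands vanishing at a is the inflation of a basic
    \<Lambda>-module; used for all summands but P_a, or all but P_a and S_a.\<close>
  have basicJ: "\<exists>Z. Z \<in> fg_modules A \<and> mod_iso ext_alg (fam J X) (infl Z) \<and> basic_module A Z"
    if J: "J \<subseteq> {..<n}" "\<And>l. l \<in> J \<Longrightarrow> lambda_mod (X l)" for J
  proof -
    have fJ: "finite J" using J finite_subset by blast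
    have "G.fd (fam J X)" using X(1) J by (intro G.fd_fam fJ) auto
    then obtain V where V: "V \<in> fg_modules ext_alg" "mod_iso ext_alg (fam J X) V" using G.fd_transport by blast
    have rV: "G.rmod V" using V by simp
    have "lambda_mod V"
      by (rule lambda_mod_transfer[OF lambda_mod_fam V(2) rF rV]) (use J in auto)
    then obtain Z where Z: "Z \<in> fg_modules A" "mod_iso ext_alg V (infl Z)" "mod_iso ext_alg (infl Z) V"
      using lambda_mod_infl_rep[OF V(1)] by metis
    have i: "mod_iso ext_alg (fam J X) (infl Z)" using G.mod_iso_trans[OF V(2) Z(2)] rF J rV by blast
    have rZ: "G.rmod (infl Z)" using Z by (simp add: G_rmod_infl)
    have "basic_module ext_alg (infl Z)"
      by (rule G.basic_moduleI[OF fJ infl_fg[OF Z(1)], of X])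
        (use X J G.mod_iso_sym[OF i rF rZ] in \<open>auto simp: subset_iff\<close>)
    then show ?thesis using i Z infl_basic by blast
  qed
  show ?thesis
  proof (cases "\<forall>l\<in>?J. lambda_mod (X l)")
    case True
    then obtain Z where Z: "Z \<in> fg_modules A" "mod_iso ext_alg (fam ?J X) (infl Z)" "basic_module A Z"
      using basicJ[of ?J] by blast
    have rZ: "rmod Z" "G.rmod (infl Z)" using Z by (auto simp: G_rmod_infl)
    have "G.biprod T PA (infl Z)"
      using G.biprod_cong[OF bT i0 Z(2) rT] rX j0 rF rZ by simp
    then have b: "G.biprod T (infl Z) PA" using G.biprod_swap rT by blast
    have "PWT_module A Z" using PWT_extend_PA[OF Z(1) T'(1) b] T' by simp
    then have "Z \<in> basic_PWT_modules A" using Z by (simp add: basic_PWT_iff)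
    moreover have "mod_iso ext_alg T (add_PA Z)"
      using G_biprod_infl_iso[OF Z(1,1) T'(1) add_PA(1)[OF Z(1)] PA(1) b add_PA(2)[OF Z(1)]]
        no_hom_PA G_rmod_infl lambda_mod_infl mod_iso_refl[OF rZ(1)] by blast
    ultimately show ?thesis by blast
  next
    case False
    then obtain l0 where l0: "l0 \<in> ?J" "\<not> lambda_mod (X l0)" by blast
    have i1: "mod_iso ext_alg (X l0) SA" using ind_SA_iso[OF X(1) k l0(2)] l0 by simp
    let ?K = "?J - {l0}"
    have "lambda_mod (X l)" if l: "l \<in> ?K" for l
    proof (rule ccontr)
      assume "\<not> lambda_mod (X l)"
      then have "mod_iso ext_alg (X l) SA" using ind_SA_iso[OF X(1) k] l by simp
      then have "l = l0" by (rule unique[OF _ i1]) (use l l0 in auto)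
      then show False using l by simp
    qed
    then obtain M where M: "M \<in> fg_modules A" "mod_iso ext_alg (fam ?K X) (infl M)" "basic_module A M"
      using basicJ[of ?K] by blast
    have rM: "rmod M" "G.rmod (infl M)" using M by (auto simp: G_rmod_infl)
    have "G.biprod (fam ?J X) (X l0) (fam ?K X)" by (rule G.biprod_fam_remove) (use rX l0 in auto)
    then have b1: "G.biprod (fam ?J X) SA (infl M)"
      by (rule G.biprod_cong[OF _ i1 M(2)]) (use rX l0 rM in \<open>auto intro!: rF\<close>)
    have b2: "G.biprod T (fam ?J X) PA"
      using G.biprod_swap[OF G.biprod_cong[OF bT i0 G.mod_iso_refl] rT] rX j0 rF rT by simp
    have b3: "G.biprod (fam ?J X) (infl M) SA" using G.biprod_swap[OF b1] rF by simp
    \<comment> \<open>P_a was split off before S_a, so \<open>T\<close> is (M + S_a) + P_a, and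
      \<open>biprod_assoc\<close> wants the summands of \<open>PA_SA\<close> in this order.\<close>
    have b4: "G.biprod PA_SA SA PA" using G.biprod_swap[OF PA_SA(2)] by simp
    have b: "G.biprod T (infl M) PA_SA"
      by (rule G.biprod_assoc[OF b2 b3 b4 rT rF PA_rmod rM(2) G.Sm_rmod PA_SA_rmod]) auto
    obtain N where N: "N \<in> fg_modules A" "biprod N M Sm"
      using biprod_exists[OF fg_fd[OF M(1)] fg_fd[OF Sm(1)]] by blast
    have P: "PWT_module A N" "no_hom Sm M" using PWT_extend_PA_SA[OF M(1) N PA_SA T'(1) b] T' by auto
    have "basic_module A N" by (rule basic_add[OF M(3) Sm_ind N P(2)])
    then have "M \<in> RPWT_modules" using M N P by (auto simp: RPWT_modules_def basic_PWT_iff)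
    moreover have "mod_iso ext_alg T (add_PA_SA M)"
      using G_biprod_infl_iso[OF M(1,1) T'(1) add_PA_SA(1)[OF M(1)] PA_SA(1) b add_PA_SA(2)[OF M(1)] no_hom_PA_SA]
        mod_iso_refl[OF rM(1)] by simp
    ultimately show ?thesis by blast
  qed
qed

theorem PWT_ext_alg:
  assumes "representation_finite A"
  shows "(\<exists>f. bij_betw f (PWT ext_alg) (Sum_Type.Plus (PWT A) (RPWT A charmod))) \<and> finite (PWT ext_alg) \<and>
    card (PWT ext_alg) = card (PWT A) + card (RPWT A charmod) \<and>
    card (PWT A) + card (RPWT A charmod) = card (PWT A) + card (PWT_with A charmod)"
proof -
  let ?c = "\<lambda>X. iso_rel A `` {X}" and ?d = "\<lambda>T. iso_rel ext_alg `` {T}"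
  let ?P = "basic_PWT_modules A"
  have Rfg: "M \<in> fg_modules A" if "M \<in> RPWT_modules" for M using that by (simp add: RPWT_modules_def)
  have 1: "?c X = ?c X' \<longleftrightarrow> ?d (add_PA X) = ?d (add_PA X')" if "X \<in> ?P" "X' \<in> ?P" for X X'
  proof -
    have fg: "X \<in> fg_modules A" "X' \<in> fg_modules A" using that by auto
    have "mod_iso ext_alg (add_PA X) (add_PA X') \<longleftrightarrow> mod_iso A X X'"
      by (rule G_biprod_infl_iso[OF fg add_PA(1)[OF fg(1)] add_PA(1)[OF fg(2)] PA(1) add_PA(2)[OF fg(1)] add_PA(2)[OF fg(2)]])
        (rule no_hom_PA[OF G_rmod_infl lambda_mod_infl])
    then show ?thesis using iso_rel_class_eq[OF fg] G.iso_rel_class_eq[OF add_PA(1)[OF fg(1)] add_PA(1)[OF fg(2)]] by simp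
  qed
  have 2: "?c X = ?c X' \<longleftrightarrow> ?d (add_PA_SA X) = ?d (add_PA_SA X')" if "X \<in> RPWT_modules" "X' \<in> RPWT_modules" for X X'
  proof -
    have fg: "X \<in> fg_modules A" "X' \<in> fg_modules A" using that Rfg by auto
    have "mod_iso ext_alg (add_PA_SA X) (add_PA_SA X') \<longleftrightarrow> mod_iso A X X'"
      by (rule G_biprod_infl_iso[OF fg add_PA_SA(1)[OF fg(1)] add_PA_SA(1)[OF fg(2)] PA_SA(1) add_PA_SA(2)[OF fg(1)] add_PA_SA(2)[OF fg(2)]])
        (rule no_hom_PA_SA)
    then show ?thesis using iso_rel_class_eq[OF fg] G.iso_rel_class_eq[OF add_PA_SA(1)[OF fg(1)] add_PA_SA(1)[OF fg(2)]] by simp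
  qed
  let ?I1 = "(\<lambda>X. ?d (add_PA X)) ` ?P" and ?I2 = "(\<lambda>M. ?d (add_PA_SA M)) ` RPWT_modules"
  obtain G1 where "bij_betw G1 (?c ` ?P) ?I1"
    using quotient_map[where c = ?c and c' = ?d and F = add_PA and P = ?P] 1 by metis
  then have G1: "bij_betw G1 (PWT A) ?I1" by (simp add: PWT_eq)
  obtain G2 where "bij_betw G2 (?c ` RPWT_modules) ?I2"
    using quotient_map[where c = ?c and c' = ?d and F = add_PA_SA and P = RPWT_modules] 2 by metis
  then have G2: "bij_betw G2 (RPWT A charmod) ?I2" by (simp add: RPWT_eq)
  have disj: "?I1 \<inter> ?I2 = {}"
  proof -
    have "?d (add_PA X) \<noteq> ?d (add_PA_SA M)" if "X \<in> ?P" "M \<in> RPWT_modules" for X M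
      using that add_PA_not_iso[of X M] G.iso_rel_class_eq[OF add_PA(1) add_PA_SA(1), of X M] Rfg by simp
    then show ?thesis by blast
  qed
  have cover: "?I1 \<union> ?I2 = PWT ext_alg"
  proof (intro equalityI subsetI)
    fix t assume "t \<in> ?I1 \<union> ?I2"
    then show "t \<in> PWT ext_alg" unfolding G.PWT_eq using add_PA_basic_PWT add_PA_SA_basic_PWT by blast
  next
    fix t assume "t \<in> PWT ext_alg"
    then obtain T where T: "T \<in> basic_PWT_modules ext_alg" "t = ?d T" unfolding G.PWT_eq by blast
    have fT: "T \<in> fg_modules ext_alg" using T by simp
    show "t \<in> ?I1 \<union> ?I2"
      using basic_PWT_cases[OF T(1)]
    proof (elim disjE bexE)
      fix X assume "X \<in> ?P" "mod_iso ext_alg T (add_PA X)"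
      then show ?thesis using T(2) G.iso_rel_class_eq[OF fT add_PA(1)] basic_PWT_fg by blast
    next
      fix M assume "M \<in> RPWT_modules" "mod_iso ext_alg T (add_PA_SA M)"
      then show ?thesis using T(2) G.iso_rel_class_eq[OF fT add_PA_SA(1)] Rfg by blast
    qed
  qed
  have g: "bij_betw (case_sum G1 G2) (Sum_Type.Plus (PWT A) (RPWT A charmod)) (PWT ext_alg)"
    unfolding bij_betw_def
  proof
    show "inj_on (case_sum G1 G2) (Sum_Type.Plus (PWT A) (RPWT A charmod))"
    proof (rule inj_onI)
      fix s t assume s: "s \<in> Sum_Type.Plus (PWT A) (RPWT A charmod)"
        and t: "t \<in> Sum_Type.Plus (PWT A) (RPWT A charmod)" and eq: "case_sum G1 G2 s = case_sum G1 G2 t"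
      have G12: "G1 a \<noteq> G2 b" if "a \<in> PWT A" "b \<in> RPWT A charmod" for a b
        using bij_betw_apply[OF G1 that(1)] bij_betw_apply[OF G2 that(2)] disj by (metis IntI empty_iff)
      show "s = t"
        using s t
      proof (elim PlusE)
        fix a b assume ab: "s = Inl a" "t = Inl b" "a \<in> PWT A" "b \<in> PWT A"
        then show ?thesis using eq inj_onD[OF bij_betw_imp_inj_on[OF G1], of a b] by simp
      next
        fix a b assume ab: "s = Inr a" "t = Inr b" "a \<in> RPWT A charmod" "b \<in> RPWT A charmod"
        then show ?thesis using eq inj_onD[OF bij_betw_imp_inj_on[OF G2], of a b] by simp
      next
        fix a b assume "s = Inl a" "t = Inr b" "a \<in> PWT A" "b \<in> RPWT A charmod"
        then show ?thesis using eq G12 by simp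
      next
        fix a b assume "s = Inr a" "t = Inl b" "a \<in> RPWT A charmod" "b \<in> PWT A"
        then show ?thesis using eq G12 by (metis sum.case)
      qed
    qed
    show "case_sum G1 G2 ` (Sum_Type.Plus (PWT A) (RPWT A charmod)) = PWT ext_alg"
      using bij_betw_imp_surj_on[OF G1] bij_betw_imp_surj_on[OF G2]
      unfolding cover[symmetric] Plus_def image_Un image_image by simp
  qed
  have fin: "finite (PWT A)" using finite_PWT[OF assms] .
  obtain h where h: "bij_betw h (RPWT A charmod) (PWT_with A charmod)" using RPWT_PWT_with by blast
  \<comment> \<open>Counting needs finiteness, as \<open>card\<close> of an infinite set is 0.
    \<open>RPWT\<close> is finite because it is in bijection with a subset of the finite set
    PWT(\<Lambda>).\<close>
  have "PWT_with A charmod \<subseteq> PWT A" unfolding PWT_with_eq PWT_eq by blast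
  then have "finite (PWT_with A charmod)" using fin finite_subset by blast
  then have fin2: "finite (RPWT A charmod)" using bij_betw_finite[OF h] by simp
  have "finite (PWT ext_alg)" using bij_betw_finite[OF g] fin fin2 by simp
  moreover have "card (PWT ext_alg) = card (PWT A) + card (RPWT A charmod)"
    using bij_betw_same_card[OF g] card_Plus[OF fin fin2] by simp
  ultimately show ?thesis using bij_betw_inv_into[OF g] bij_betw_same_card[OF h] by auto
qed

end

subsection \<open>Bound quiver algebras\<close>

locale bound_quiver =
  fixes Q :: "('v, 'e) pre_digraph" and I :: "(('v, 'e) path \<Rightarrow> 'k::field) set" and i :: 'v
  assumes fin: "fin_digraph Q" and adm: "admissible_ideal Q I" and source: "source_point Q i"
begin

sublocale Q: fin_digraph Q by (rule fin)

abbreviation kQ :: "('k, ('v, 'e) path \<Rightarrow> 'k) module" where "kQ \<equiv> path_algebra Q"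

sublocale I: ideal I kQ
  using adm by (simp add: admissible_ideal_def)

lemma kQ_simps:
  "f \<in> carrier kQ \<longleftrightarrow> finite {w. f w \<noteq> 0} \<and> {w. f w \<noteq> 0} \<subseteq> paths Q"
  "\<zero>\<^bsub>kQ\<^esub> = (\<lambda>_. 0)" "f \<oplus>\<^bsub>kQ\<^esub> g = (\<lambda>w. f w + g w)" "c \<odot>\<^bsub>kQ\<^esub> f = (\<lambda>w. c * f w)"
  "\<one>\<^bsub>kQ\<^esub> = (\<lambda>(u, p). if u \<in> verts Q \<and> p = [] then 1 else 0)"
  "(f \<otimes>\<^bsub>kQ\<^esub> g) (u, p) = (\<Sum>j\<le>length p. f (u, take j p) * g (Q.awlast u (take j p), drop j p))"
  by (auto simp: path_algebra_def)

lemma kQ_smult_closed: "f \<in> carrier kQ \<Longrightarrow> c \<odot>\<^bsub>kQ\<^esub> f \<in> carrier kQ"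
  by (cases "c = 0") (auto simp: kQ_simps)

lemma kQ_smult_one:
  assumes "f \<in> carrier kQ"
  shows "(c \<odot>\<^bsub>kQ\<^esub> \<one>\<^bsub>kQ\<^esub>) \<otimes>\<^bsub>kQ\<^esub> f = c \<odot>\<^bsub>kQ\<^esub> f" "f \<otimes>\<^bsub>kQ\<^esub> (c \<odot>\<^bsub>kQ\<^esub> \<one>\<^bsub>kQ\<^esub>) = c \<odot>\<^bsub>kQ\<^esub> f"
proof -
  have l: "((c \<odot>\<^bsub>kQ\<^esub> \<one>\<^bsub>kQ\<^esub>) \<otimes>\<^bsub>kQ\<^esub> f) w = c * (\<one>\<^bsub>kQ\<^esub> \<otimes>\<^bsub>kQ\<^esub> f) w"
    and r: "(f \<otimes>\<^bsub>kQ\<^esub> (c \<odot>\<^bsub>kQ\<^esub> \<one>\<^bsub>kQ\<^esub>)) w = c * (f \<otimes>\<^bsub>kQ\<^esub> \<one>\<^bsub>kQ\<^esub>) w" for w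
    by (cases w; simp add: kQ_simps(4,6) sum_distrib_left mult.assoc mult.left_commute)+
  show "(c \<odot>\<^bsub>kQ\<^esub> \<one>\<^bsub>kQ\<^esub>) \<otimes>\<^bsub>kQ\<^esub> f = c \<odot>\<^bsub>kQ\<^esub> f" "f \<otimes>\<^bsub>kQ\<^esub> (c \<odot>\<^bsub>kQ\<^esub> \<one>\<^bsub>kQ\<^esub>) = c \<odot>\<^bsub>kQ\<^esub> f"
    using l r assms by (auto simp: kQ_simps(4) fun_eq_iff)
qed

lemma I_carrier: "f \<in> I \<Longrightarrow> f \<in> carrier kQ"
  using I.a_subset by blast

text \<open>A ring ideal is a subspace here, since c f is the product of c 1 with f.\<close>

lemma I_smult: "f \<in> I \<Longrightarrow> c \<odot>\<^bsub>kQ\<^esub> f \<in> I"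
  using I.I_l_closed[of f "c \<odot>\<^bsub>kQ\<^esub> \<one>\<^bsub>kQ\<^esub>"] kQ_smult_one(1) I_carrier kQ_smult_closed by simp

lemma I_length: "f \<in> I \<Longrightarrow> length p < 2 \<Longrightarrow> f (u, p) = 0"
  using adm unfolding admissible_ideal_def arrow_ideal_power_def by force

abbreviation Lam where "Lam \<equiv> bound_quiver_algebra Q I"

lemma Lam_simps:
  "carrier Lam = carrier (kQ Quot I)" "\<one>\<^bsub>Lam\<^esub> = \<one>\<^bsub>kQ Quot I\<^esub>" "\<zero>\<^bsub>Lam\<^esub> = \<zero>\<^bsub>kQ Quot I\<^esub>"
  "X \<oplus>\<^bsub>Lam\<^esub> Y = X \<oplus>\<^bsub>kQ Quot I\<^esub> Y" "X \<otimes>\<^bsub>Lam\<^esub> Y = X \<otimes>\<^bsub>kQ Quot I\<^esub> Y"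
  "c \<odot>\<^bsub>Lam\<^esub> X = I <+>\<^bsub>kQ\<^esub> (\<lambda>f. c \<odot>\<^bsub>kQ\<^esub> f) ` X"
  by (simp_all add: bound_quiver_algebra_def Let_def ring.defs module.defs)

abbreviation cl where "cl f \<equiv> I +>\<^bsub>kQ\<^esub> f"

lemma cl_eq_iff:
  assumes "f \<in> carrier kQ" "g \<in> carrier kQ" shows "cl f = cl g \<longleftrightarrow> f \<ominus>\<^bsub>kQ\<^esub> g \<in> I"
  using I.quotient_eq_iff_same_a_r_cos[OF I.ideal_axioms assms] by simp

lemma I_zero: "\<zero>\<^bsub>kQ\<^esub> \<in> I"
  by (rule additive_subgroup.zero_closed[OF ideal.axioms(1)[OF I.ideal_axioms]])

lemma cl_smult:
  assumes "f \<in> carrier kQ" shows "c \<odot>\<^bsub>Lam\<^esub> cl f = cl (c \<odot>\<^bsub>kQ\<^esub> f)"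
proof -
  have "g \<in> I <+>\<^bsub>kQ\<^esub> (\<lambda>f. c \<odot>\<^bsub>kQ\<^esub> f) ` cl f \<longleftrightarrow> g \<in> cl (c \<odot>\<^bsub>kQ\<^esub> f)" for g
  proof
    assume "g \<in> I <+>\<^bsub>kQ\<^esub> (\<lambda>f. c \<odot>\<^bsub>kQ\<^esub> f) ` cl f"
    then obtain h h' where h: "h \<in> I" "h' \<in> I" "g = h \<oplus>\<^bsub>kQ\<^esub> c \<odot>\<^bsub>kQ\<^esub> (h' \<oplus>\<^bsub>kQ\<^esub> f)"
      unfolding set_add_def' a_r_coset_def' by auto
    then have "g = (h \<oplus>\<^bsub>kQ\<^esub> c \<odot>\<^bsub>kQ\<^esub> h') \<oplus>\<^bsub>kQ\<^esub> c \<odot>\<^bsub>kQ\<^esub> f"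
      by (simp add: kQ_simps(3,4) distrib_left add.assoc)
    then show "g \<in> cl (c \<odot>\<^bsub>kQ\<^esub> f)" unfolding a_r_coset_def' using I_smult h by auto
  next
    assume "g \<in> cl (c \<odot>\<^bsub>kQ\<^esub> f)"
    then obtain h where h: "h \<in> I" "g = h \<oplus>\<^bsub>kQ\<^esub> c \<odot>\<^bsub>kQ\<^esub> f" unfolding a_r_coset_def' by auto
    have "f \<in> cl f" unfolding a_r_coset_def' using I_zero by (force simp: kQ_simps(2,3))
    then show "g \<in> I <+>\<^bsub>kQ\<^esub> (\<lambda>f. c \<odot>\<^bsub>kQ\<^esub> f) ` cl f" unfolding set_add_def' using h by auto
  qed
  then show ?thesis unfolding Lam_simps by blast
qed

lemma Lam_cl:
  "X \<in> carrier Lam \<longleftrightarrow> (\<exists>f\<in>carrier kQ. X = cl f)"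
  "\<one>\<^bsub>Lam\<^esub> = cl \<one>\<^bsub>kQ\<^esub>" "\<zero>\<^bsub>Lam\<^esub> = cl \<zero>\<^bsub>kQ\<^esub>"
  "f \<in> carrier kQ \<Longrightarrow> g \<in> carrier kQ \<Longrightarrow> cl f \<oplus>\<^bsub>Lam\<^esub> cl g = cl (f \<oplus>\<^bsub>kQ\<^esub> g)"
  "f \<in> carrier kQ \<Longrightarrow> g \<in> carrier kQ \<Longrightarrow> cl f \<otimes>\<^bsub>Lam\<^esub> cl g = cl (f \<otimes>\<^bsub>kQ\<^esub> g)"
proof -
  show "X \<in> carrier Lam \<longleftrightarrow> (\<exists>f\<in>carrier kQ. X = cl f)"
    by (auto simp: Lam_simps FactRing_def A_RCOSETS_def')
  show "\<one>\<^bsub>Lam\<^esub> = cl \<one>\<^bsub>kQ\<^esub>" by (simp add: Lam_simps FactRing_def)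
  have "cl \<zero>\<^bsub>kQ\<^esub> = I" by (simp add: I.a_subset)
  then show "\<zero>\<^bsub>Lam\<^esub> = cl \<zero>\<^bsub>kQ\<^esub>" by (simp add: Lam_simps FactRing_def)
  show "cl f \<oplus>\<^bsub>Lam\<^esub> cl g = cl (f \<oplus>\<^bsub>kQ\<^esub> g)" if "f \<in> carrier kQ" "g \<in> carrier kQ" for f g
    using that by (simp add: Lam_simps FactRing_def I.a_rcos_sum)
  show "cl f \<otimes>\<^bsub>Lam\<^esub> cl g = cl (f \<otimes>\<^bsub>kQ\<^esub> g)" if "f \<in> carrier kQ" "g \<in> carrier kQ" for f g
    using that by (simp add: Lam_simps FactRing_def I.rcoset_mult_add)
qed

lemma ring_Lam: "ring Lam"
proof -
  interpret R: ring "kQ Quot I" by (rule I.quotient_is_ring)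
  show ?thesis
  proof (rule ringI)
    show "abelian_group Lam"
      by (rule abelian_groupI) (auto simp: Lam_simps R.a_ac intro: R.add.l_inv_ex)
    show "monoid Lam" by (rule monoidI) (auto simp: Lam_simps R.m_assoc)
  qed (auto simp: Lam_simps R.l_distr R.r_distr)
qed

text \<open>The expression by which \<open>simple_at\<close> lets a coset act; \<open>chi_cl\<close>
  evaluates it, elements of \<open>I\<close> having no coefficient at paths shorter than 2.\<close>

definition chi where "chi X = the_elem ((\<lambda>f. f (i, [])) ` X)"

lemma chi_cl: assumes "f \<in> carrier kQ" shows "chi (cl f) = f (i, [])"
proof -
  have "(\<lambda>f. f (i, [])) ` cl f = {f (i, [])}"
  proof (intro equalityI subsetI)
    fix x assume "x \<in> (\<lambda>f. f (i, [])) ` cl f"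
    then obtain h where "h \<in> I" "x = (h \<oplus>\<^bsub>kQ\<^esub> f) (i, [])" unfolding a_r_coset_def' by auto
    then show "x \<in> {f (i, [])}" using I_length[of h "[]" i] by (simp add: kQ_simps(3))
  next
    fix x assume x: "x \<in> {f (i, [])}"
    have "\<zero>\<^bsub>kQ\<^esub> \<oplus>\<^bsub>kQ\<^esub> f \<in> cl f" unfolding a_r_coset_def' using I_zero by blast
    then show "x \<in> (\<lambda>f. f (i, [])) ` cl f" using x by (auto simp: kQ_simps(2,3) image_iff)
  qed
  then show ?thesis by (simp add: chi_def)
qed

definition triv :: "('v, 'e) path \<Rightarrow> 'k" where "triv = (\<lambda>w. if w = (i, []) then 1 else 0)"

lemma i_verts: "i \<in> verts Q"
  using source by (simp add: source_point_def)

lemma triv_carrier: "triv \<in> carrier kQ"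
  using i_verts by (auto simp: kQ_simps triv_def paths_def Q.awalk_def intro!: exI[of _ i])

text \<open>In the product formula only the cut at the end of the path survives, and only for a path
  that ends at i. As i is a source, that path is trivial.\<close>

lemma mult_triv:
  assumes f: "f \<in> carrier kQ" shows "f \<otimes>\<^bsub>kQ\<^esub> triv = f (i, []) \<odot>\<^bsub>kQ\<^esub> triv"
proof
  fix w :: "('v, 'e) path"
  obtain u p where w: "w = (u, p)" by (cases w)
  have "(f \<otimes>\<^bsub>kQ\<^esub> triv) (u, p) = (\<Sum>j\<le>length p. if j = length p then f (u, p) * triv (Q.awlast u p, []) else 0)"
    unfolding kQ_simps(6) by (rule sum.cong) (auto simp: triv_def)
  also have "\<dots> = f (u, p) * triv (Q.awlast u p, [])" by simp
  also have "\<dots> = f (i, []) * triv (u, p)"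
  proof (cases "f (u, p) = 0 \<or> Q.awlast u p \<noteq> i")
    case True
    then show ?thesis by (auto simp: triv_def)
  next
    case False
    then have "(u, p) \<in> paths Q" using f by (auto simp: kQ_simps)
    then obtain v where "Q.awalk u p v" by (auto simp: paths_def)
    then have v: "Q.awalk u p i" using False Q.awalkE' by metis
    \<comment> \<open>The last arrow of a nonempty path to i would end at i.\<close>
    have "p = []"
    proof (cases p rule: rev_cases)
      case (snoc q x)
      then have "x \<in> in_arcs Q i" using v by (auto simp: Q.awalk_simps)
      then show ?thesis using source unfolding source_point_def by blast
    qed
    then show ?thesis using False by (auto simp: triv_def)
  qed
  finally show "(f \<otimes>\<^bsub>kQ\<^esub> triv) w = (f (i, []) \<odot>\<^bsub>kQ\<^esub> triv) w" by (simp add: w kQ_simps(4))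
qed

lemma source_algebra_Lam: "source_algebra Lam (cl triv) chi"
proof (intro source_algebra.intro fd_algebra.intro ralg.intro ring_Lam fd_algebra_axioms.intro
    source_algebra_axioms.intro)
  have sm: "c \<odot>\<^bsub>Lam\<^esub> \<one>\<^bsub>Lam\<^esub> = cl (c \<odot>\<^bsub>kQ\<^esub> \<one>\<^bsub>kQ\<^esub>)" for c
    by (simp add: Lam_cl(2) cl_smult)
  note smc = kQ_smult_closed[OF I.one_closed]
  note mul = kQ_smult_one
  {
    fix a c assume "a \<in> carrier Lam"
    then obtain f where f: "f \<in> carrier kQ" "a = cl f" by (auto simp: Lam_cl(1))
    show "c \<odot>\<^bsub>Lam\<^esub> a = (c \<odot>\<^bsub>Lam\<^esub> \<one>\<^bsub>Lam\<^esub>) \<otimes>\<^bsub>Lam\<^esub> a"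
      "(c \<odot>\<^bsub>Lam\<^esub> \<one>\<^bsub>Lam\<^esub>) \<otimes>\<^bsub>Lam\<^esub> a = a \<otimes>\<^bsub>Lam\<^esub> (c \<odot>\<^bsub>Lam\<^esub> \<one>\<^bsub>Lam\<^esub>)"
      unfolding sm f(2) using f(1) smc by (simp_all add: Lam_cl(5) cl_smult mul)
  }
  show "c \<odot>\<^bsub>Lam\<^esub> \<one>\<^bsub>Lam\<^esub> \<in> carrier Lam" for c unfolding sm Lam_cl(1) using smc by blast
  show "(c + d) \<odot>\<^bsub>Lam\<^esub> \<one>\<^bsub>Lam\<^esub> = c \<odot>\<^bsub>Lam\<^esub> \<one>\<^bsub>Lam\<^esub> \<oplus>\<^bsub>Lam\<^esub> d \<odot>\<^bsub>Lam\<^esub> \<one>\<^bsub>Lam\<^esub>" for c d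
  proof -
    have "(c + d) \<odot>\<^bsub>kQ\<^esub> \<one>\<^bsub>kQ\<^esub> = c \<odot>\<^bsub>kQ\<^esub> \<one>\<^bsub>kQ\<^esub> \<oplus>\<^bsub>kQ\<^esub> d \<odot>\<^bsub>kQ\<^esub> \<one>\<^bsub>kQ\<^esub>"
      unfolding kQ_simps(3,4) by (simp add: distrib_right)
    then show ?thesis unfolding sm using Lam_cl(4)[OF smc smc] by simp
  qed
  show "(c * d) \<odot>\<^bsub>Lam\<^esub> \<one>\<^bsub>Lam\<^esub> = (c \<odot>\<^bsub>Lam\<^esub> \<one>\<^bsub>Lam\<^esub>) \<otimes>\<^bsub>Lam\<^esub> (d \<odot>\<^bsub>Lam\<^esub> \<one>\<^bsub>Lam\<^esub>)" for c d
  proof -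
    have "(c * d) \<odot>\<^bsub>kQ\<^esub> \<one>\<^bsub>kQ\<^esub> = c \<odot>\<^bsub>kQ\<^esub> (d \<odot>\<^bsub>kQ\<^esub> \<one>\<^bsub>kQ\<^esub>)"
      unfolding kQ_simps(4) by (simp add: mult.assoc)
    then show ?thesis unfolding sm using Lam_cl(5)[OF smc smc] mul(1)[OF smc] by simp
  qed
  show "1 \<odot>\<^bsub>Lam\<^esub> \<one>\<^bsub>Lam\<^esub> = \<one>\<^bsub>Lam\<^esub>"
  proof -
    have "1 \<odot>\<^bsub>kQ\<^esub> \<one>\<^bsub>kQ\<^esub> = \<one>\<^bsub>kQ\<^esub>" by (simp add: kQ_simps(4))
    then show ?thesis unfolding sm unfolding Lam_cl(2) by simp
  qed
  show "cl triv \<in> carrier Lam" using triv_carrier Lam_cl(1) by blast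
  {
    fix a b assume "a \<in> carrier Lam" "b \<in> carrier Lam"
    then obtain f g where fg: "f \<in> carrier kQ" "a = cl f" "g \<in> carrier kQ" "b = cl g" by (auto simp: Lam_cl(1))
    show "chi (a \<oplus>\<^bsub>Lam\<^esub> b) = chi a + chi b"
      using fg Lam_cl(4)[OF fg(1,3)] chi_cl[OF fg(1)] chi_cl[OF fg(3)] chi_cl[OF I.add.m_closed[OF fg(1,3)]]
      by (simp add: kQ_simps(3))
    show "chi (a \<otimes>\<^bsub>Lam\<^esub> b) = chi a * chi b"
      using fg Lam_cl(5)[OF fg(1,3)] chi_cl[OF fg(1)] chi_cl[OF fg(3)] chi_cl[OF I.m_closed[OF fg(1,3)]]
      by (simp add: kQ_simps(6))
  }
  show "chi (c \<odot>\<^bsub>Lam\<^esub> \<one>\<^bsub>Lam\<^esub>) = c" for c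
    unfolding sm using chi_cl[OF smc] i_verts by (simp add: kQ_simps(4,5))
  show "chi (cl triv) = 1" using chi_cl[OF triv_carrier] by (simp add: triv_def)
  show "a \<otimes>\<^bsub>Lam\<^esub> cl triv = (chi a \<odot>\<^bsub>Lam\<^esub> \<one>\<^bsub>Lam\<^esub>) \<otimes>\<^bsub>Lam\<^esub> cl triv" if a: "a \<in> carrier Lam" for a
  proof -
    obtain f where f: "f \<in> carrier kQ" "a = cl f" using a by (auto simp: Lam_cl(1))
    show ?thesis
      unfolding sm f(2) chi_cl[OF f(1)] Lam_cl(5)[OF f(1) triv_carrier] Lam_cl(5)[OF smc triv_carrier]
        mul(1)[OF triv_carrier] mult_triv[OF f(1)] ..
  qed
  show "\<exists>B. finite B \<and> B \<subseteq> carrier Lam \<and>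
      (\<forall>H. H \<subseteq> carrier Lam \<and> \<zero>\<^bsub>Lam\<^esub> \<in> H \<and> (\<forall>x\<in>H. \<forall>y\<in>H. x \<oplus>\<^bsub>Lam\<^esub> y \<in> H) \<and>
         (\<forall>c. \<forall>x\<in>H. c \<odot>\<^bsub>Lam\<^esub> x \<in> H) \<and> B \<subseteq> H \<longrightarrow> H = carrier Lam)"
  proof -
    obtain m where m: "arrow_ideal_power Q m \<subseteq> I" using adm by (auto simp: admissible_ideal_def)
    define sg where "sg w = (\<lambda>w'. if w' = w then 1 else 0 :: 'k)" for w :: "('v, 'e) path"
    have sgc: "sg w \<in> carrier kQ" if "w \<in> paths Q" for w using that by (auto simp: kQ_simps(1) sg_def)
    \<comment> \<open>Paths of length at least \<open>m\<close> lie in \<open>I\<close>, so the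
      classes of the shorter ones span, and a finite quiver has finitely many of these.\<close>
    let ?W = "{w \<in> paths Q. length (snd w) < m}"
    have "?W \<subseteq> verts Q \<times> {p. set p \<subseteq> arcs Q \<and> length p \<le> m}"
      by (auto simp: paths_def Q.awalk_def)
    then have "finite ?W" using finite_lists_length_le[OF Q.finite_arcs] Q.finite_verts finite_subset by blast
    then have finW: "finite ((\<lambda>w. cl (sg w)) ` ?W)" by simp
    have subW: "(\<lambda>w. cl (sg w)) ` ?W \<subseteq> carrier Lam" using sgc Lam_cl(1) by auto
    have spanW: "H = carrier Lam" if H: "H \<subseteq> carrier Lam \<and> \<zero>\<^bsub>Lam\<^esub> \<in> H \<and>
        (\<forall>x\<in>H. \<forall>y\<in>H. x \<oplus>\<^bsub>Lam\<^esub> y \<in> H) \<and> (\<forall>c. \<forall>x\<in>H. c \<odot>\<^bsub>Lam\<^esub> x \<in> H) \<and> (\<lambda>w. cl (sg w)) ` ?W \<subseteq> H" for H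
    proof -
      have Ha: "x \<oplus>\<^bsub>Lam\<^esub> y \<in> H" if "x \<in> H" "y \<in> H" for x y using H that by blast
      have Hs: "c \<odot>\<^bsub>Lam\<^esub> x \<in> H" if "x \<in> H" for x c using H that by blast
      have sgH: "cl (sg w) \<in> H" if w: "w \<in> paths Q" for w
      proof (cases "length (snd w) < m")
        case True
        then show ?thesis using H w by blast
      next
        case False
        then have "sg w \<in> arrow_ideal_power Q m"
          using sgc[OF w] by (auto simp: arrow_ideal_power_def sg_def split: if_splits)
        then have "sg w \<in> I" using m by blast
        then have "sg w \<ominus>\<^bsub>kQ\<^esub> \<zero>\<^bsub>kQ\<^esub> \<in> I" using sgc[OF w] by (simp add: a_minus_def)
        then have "cl (sg w) = \<zero>\<^bsub>Lam\<^esub>" unfolding Lam_cl(3) using cl_eq_iff sgc[OF w] by simp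
        then show ?thesis using H by simp
      qed
      \<comment> \<open>Induction on a finite set containing the support of f: one path is removed
        by setting its coefficient to 0.\<close>
      have "cl f \<in> H" if "finite S" "f \<in> carrier kQ" "{w. f w \<noteq> 0} \<subseteq> S" for S f
        using that
      proof (induction S arbitrary: f)
        case empty
        then have "f = \<zero>\<^bsub>kQ\<^esub>" by (auto simp: kQ_simps(2))
        then show ?case using H Lam_cl(3) by simp
      next
        case (insert w S)
        let ?f = "f(w := 0)"
        have sub: "{v. ?f v \<noteq> 0} \<subseteq> {v. f v \<noteq> 0}" by auto
        have fc: "finite {v. f v \<noteq> 0}" "{v. f v \<noteq> 0} \<subseteq> paths Q"
          using insert.prems(1) by (auto simp: kQ_simps(1))
        have f': "?f \<in> carrier kQ" unfolding kQ_simps(1) using finite_subset[OF sub fc(1)] sub fc(2) by blast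
        have "{v. ?f v \<noteq> 0} \<subseteq> S" using insert.prems(2) by auto
        then have IH: "cl ?f \<in> H" using insert.IH f' by blast
        show ?case
        proof (cases "f w = 0")
          case True
          then have "?f = f" by (auto simp: fun_eq_iff)
          then show ?thesis using IH by (simp only:)
        next
          case False
          then have w: "w \<in> paths Q" using fc(2) by blast
          have "f = f w \<odot>\<^bsub>kQ\<^esub> sg w \<oplus>\<^bsub>kQ\<^esub> ?f" unfolding kQ_simps(3,4) by (auto simp: sg_def fun_eq_iff)
          then have eq: "cl f = f w \<odot>\<^bsub>Lam\<^esub> cl (sg w) \<oplus>\<^bsub>Lam\<^esub> cl ?f"
            using cl_smult[OF sgc[OF w]] Lam_cl(4)[OF kQ_smult_closed[OF sgc[OF w]] f'] by metis
          show ?thesis by (rule ssubst[OF eq, of "\<lambda>x. x \<in> H"]) (rule Ha[OF Hs[OF sgH[OF w]] IH])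
        qed
      qed
      then have "carrier Lam \<subseteq> H" by (auto simp: Lam_cl(1) kQ_simps(1))
      then show ?thesis using H by blast
    qed
    show ?thesis
      by (intro exI[of _ "(\<lambda>w. cl (sg w)) ` ?W"] conjI[OF finW] conjI[OF subW] allI impI) (rule spanW)
  qed
qed

end

theorem theoremC:
  fixes Q :: "('v, 'e) pre_digraph"
    and I :: "(('v, 'e) path \<Rightarrow> 'k::alg_closed_field) set"
    and i :: 'v
    and \<Lambda> :: "('k, (('v, 'e) path \<Rightarrow> 'k) set) module"
    and \<Gamma> :: "('k, (('v, 'e) path \<Rightarrow> 'k) set \<times> 'k \<times> 'k) module"
    and S :: "((('v, 'e) path \<Rightarrow> 'k) set, 'k) module"
  assumes "fin_digraph Q" and "admissible_ideal Q I"
    and "\<Lambda> = bound_quiver_algebra Q I"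
    and "representation_finite \<Lambda>"
    and "source_point Q i"
    and "S = simple_at i"
    and "\<Gamma> = one_point_extension \<Lambda> S"
  shows "(\<exists>f. bij_betw f (PWT \<Gamma>) (PWT \<Lambda> <+> RPWT \<Lambda> S)) \<and>
    finite (PWT \<Gamma>) \<and>
    card (PWT \<Gamma>) = card (PWT \<Lambda>) + card (RPWT \<Lambda> S) \<and>
    card (PWT \<Lambda>) + card (RPWT \<Lambda> S) = card (PWT \<Lambda>) + card (PWT_with \<Lambda> S)"
proof -
  interpret b: bound_quiver Q I i by (rule bound_quiver.intro[OF assms(1,2,5)])
  interpret o: source_algebra b.Lam "b.cl b.triv" b.chi by (rule b.source_algebra_Lam)
  interpret o: one_point b.Lam "b.cl b.triv" b.chi ..
  \<comment> \<open>An equality of records, not just an isomorphism, so the classes for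
    \<open>S\<close> and for \<open>charmod\<close> are literally the same.\<close>
  have S: "S = o.charmod"
    unfolding assms(6) o.charmod_def simple_at_def b.chi_def ..
  have \<Gamma>: "\<Gamma> = o.ext_alg" by (simp add: assms(3,7) S o.ext_alg_def)
  have \<Lambda>: "\<Lambda> = b.Lam" by (rule assms(3))
  show ?thesis using o.PWT_ext_alg assms(4) unfolding \<Gamma> \<Lambda> S by blast
qed

end
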